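(* Let $X$ be a complex Banach space. The Bohr transform $\mathcal{B}$, which sends $F\in H_\infty(B_{c_0},X)$ to the Dirichlet series $\sum_n a_nn^{-s}$ with $a_n=c_\alpha(F)$ for $n=\mathfrak{p}^\alpha$, $\alpha\in\mathbb{N}_0^{(\mathbb{N})}$, defines an isometry of $H_\infty(B_{c_0},X)$ onto $\mathcal{H}_\infty^+(X)$. Moreover, if $D=\sum_n a_nn^{-s}=\mathcal{B}(F)$, then $F(\mathfrak{p}^{-s})=\sum_n a_nn^{-s}$ whenever $\operatorname{Re}(s)>0$, where $\mathfrak{p}^{-s}=(\mathfrak{p}_1^{-s},\mathfrak{p}_2^{-s},\dots)$.
   Context: $\mathbb{N}_0=\mathbb{N}\cup\{0\}$; $\mathbb{Z}^{(\mathbb{N})}$ (resp. $\mathbb{N}_0^{(\mathbb{N})}$) is the set of eventually zero sequences of integers (resp. of elements of $\mathbb{N}_0$). $\mathfrak{p}=(\mathfrak{p}_1<\mathfrak{p}_2<\dots)$ is the sequence of primes and $\mathfrak{p}^\alpha=\prod_j\mathfrak{p}_j^{\alpha_j}$, so every $n\in\mathbb{N}$ equals $\mathfrak{p}^\alpha$ for a unique $\alpha\in\mathbb{N}_0^{(\mathbb{N})}$. $\mathbb{T}^{\mathbb{N}}$ is the infinite-dimensional torus with normalized Haar measure $d\omega$; $L_\infty(\mathbb{T}^{\mathbb{N}},X)$ is the space of essentially bounded (strongly) measurable functions. For $\alpha\in\mathbb{Z}^{(\mathbb{N})}$ put $\omega^\alpha=\prod_j\omega_j^{\alpha_j}$ and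 $\widehat f(\alpha)=\int_{\mathbb{T}^{\mathbb{N}}}f(\omega)\omega^{-\alpha}\,d\omega$. $H_\infty(\mathbb{T}^{\mathbb{N}},X)$ is the closed subspace of those $f\in L_\infty(\mathbb{T}^{\mathbb{N}},X)$ with $\widehat f(\alpha)=0$ for all $\alpha\in\mathbb{Z}^{(\mathbb{N})}\setminus\mathbb{N}_0^{(\mathbb{N})}$. A Dirichlet series in $X$ is a formal series $D=\sum_n a_n n^{-s}$ with $a_n\in X$, identified with its coefficient sequence. $\mathcal{H}_\infty(X)$ is the space of Dirichlet series $D=\sum_n a_nn^{-s}$ for which there is a (unique) $f\in H_\infty(\mathbb{T}^{\mathbb{N}},X)$ with $\widehat f(\alpha)=a_{\mathfrak{p}^\alpha}$ for all $\alpha\in\mathbb{N}_0^{(\mathbb{N})}$, with norm $\|D\|_{\mathcal{H}_\infty(X)}=\|f\|_\infty$. For $\varepsilon>0$, $D_\varepsilon=\sum_n \frac{a_n}{n^\varepsilon}n^{-s}$. $\mathcal{H}_\infty^+(X)$ is the space of Dirichlet series $D$ in $X$ such that $D_\varepsilon\in\mathcal{H}_\infty(X)$ for every $\varepsilon>0$ and $\|D\|_{\mathcal{H}_\infty^+(X)}:=\sup_{\varepsilon>0}\|D_\varepsilon\|_{\mathcal{H}_\infty(X)}<\infty$. $B_{c_0}$ is the open unit ball of the complex Banach space $c_0$ of null sequences, and $H_\infty(B_{c_0},X)$ is the Banach space of bounded holomorphic functions $F:B_{c_0}\to X$ with the supremum norm. For such $F$ and $m\in\mathbb{N}$ let $F_m(z)=F(z_1,\dots,z_m,0,0,\dots)$,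 $z\in\mathbb{D}^m$. The monomial coefficients $(c_\alpha(F))_{\alpha\in\mathbb{N}_0^{(\mathbb{N})}}$ in $X$ are determined by $F_m(z)=\sum_{\alpha\in\mathbb{N}_0^m}c_\alpha(F)z^\alpha$ for all $z\in\mathbb{D}^m$, $m\in\mathbb{N}$ ($\mathbb{N}_0^m$ is viewed in $\mathbb{N}_0^{(\mathbb{N})}$ by appending zeros). *)

theory Defs
  imports
    "HOL-Probability.Essential_Supremum"
    "HOL-Probability.Probability"
    "HOL-Library.Infinite_Set"
    "HOL-Library.Poly_Mapping"
    "HOL-Computational_Algebra.Primes"
begin

section \<open>Complex Banach spaces\<close>

class complex_normed_vector = real_normed_vector +
  fixes scaleC :: "complex \<Rightarrow> 'a \<Rightarrow> 'a"  (infixr \<open>*\<^sub>C\<close> 75)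
  assumes scaleC_add_right: "a *\<^sub>C (x + y) = a *\<^sub>C x + a *\<^sub>C y"
    and scaleC_add_left: "(a + b) *\<^sub>C x = a *\<^sub>C x + b *\<^sub>C x"
    and scaleC_scaleC: "a *\<^sub>C b *\<^sub>C x = (a * b) *\<^sub>C x"
    and scaleC_one: "1 *\<^sub>C x = x"
    and scaleR_scaleC: "r *\<^sub>R x = complex_of_real r *\<^sub>C x"
    and norm_scaleC: "norm (a *\<^sub>C x) = cmod a * norm x"

class complex_banach = complex_normed_vector + complete_space

subclass (in complex_banach) banach ..

instantiation complex :: complex_banach
begin

definition scaleC_complex :: "complex \<Rightarrow> complex \<Rightarrow> complex"
  where "scaleC_complex a x = a * x"

instance
  by standard (auto simp: scaleC_complex_def algebra_simps norm_mult scaleR_conv_of_real)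

end


section \<open>The complex Banach space of null sequences\<close>

typedef c0 = "{x :: nat \<Rightarrow> complex. x \<longlonglongrightarrow> 0}"
  morphisms c0_nth Abs_c0
  by (rule exI[of _ "\<lambda>_. 0"]) simp

setup_lifting type_definition_c0

lemma c0_nth_tendsto: "c0_nth x \<longlonglongrightarrow> 0"
  using c0_nth[of x] by simp

lemma c0_eqI: "(\<And>j. c0_nth x j = c0_nth y j) \<Longrightarrow> x = y"
  by (simp add: c0_nth_inject[symmetric] fun_eq_iff)

lemma c0_bdd_above: "bdd_above (range (\<lambda>j. cmod (c0_nth x j)))"
proof -
  have "Bseq (c0_nth x)"
    using c0_nth_tendsto[of x] convergentI convergent_imp_Bseq by blast
  then show ?thesis
    by (auto simp: Bseq_def bdd_above_def)
qed

instantiation c0 :: real_vector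
begin

lift_definition zero_c0 :: c0 is "\<lambda>_. 0" by simp

lift_definition plus_c0 :: "c0 \<Rightarrow> c0 \<Rightarrow> c0" is "\<lambda>x y j. x j + y j"
  by (rule tendsto_add_zero)

lift_definition uminus_c0 :: "c0 \<Rightarrow> c0" is "\<lambda>x j. - x j"
  using tendsto_minus by fastforce

lift_definition minus_c0 :: "c0 \<Rightarrow> c0 \<Rightarrow> c0" is "\<lambda>x y j. x j - y j"
  using tendsto_diff by fastforce

lift_definition scaleR_c0 :: "real \<Rightarrow> c0 \<Rightarrow> c0" is "\<lambda>r x j. r *\<^sub>R x j"
  using tendsto_scaleR[OF tendsto_const] by fastforce

instance
proof
  fix x y z :: c0 and r s :: real
  show "x + y + z = x + (y + z)" by transfer (simp add: algebra_simps)
  show "x + y = y + x" by transfer (simp add: algebra_simps)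
  show "0 + x = x" by transfer simp
  show "- x + x = 0" by transfer simp
  show "x - y = x + - y" by transfer simp
  show "r *\<^sub>R (x + y) = r *\<^sub>R x + r *\<^sub>R y" by transfer (simp add: algebra_simps)
  show "(r + s) *\<^sub>R x = r *\<^sub>R x + s *\<^sub>R x" by transfer (simp add: algebra_simps)
  show "r *\<^sub>R s *\<^sub>R x = (r * s) *\<^sub>R x" by transfer simp
  show "1 *\<^sub>R x = x" by transfer simp
qed

end

instantiation c0 :: complex_normed_vector
begin

lift_definition scaleC_c0 :: "complex \<Rightarrow> c0 \<Rightarrow> c0" is "\<lambda>a x j. a * x j"
  by (rule tendsto_mult_right_zero)

lift_definition norm_c0 :: "c0 \<Rightarrow> real" is "\<lambda>x. SUP j. cmod (x j)" .

definition dist_c0 :: "c0 \<Rightarrow> c0 \<Rightarrow> real"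
  where "dist_c0 x y = norm (x - y)"

definition sgn_c0 :: "c0 \<Rightarrow> c0"
  where "sgn_c0 x = x /\<^sub>R norm x"

definition uniformity_c0 :: "(c0 \<times> c0) filter"
  where "uniformity_c0 = (INF e\<in>{0<..}. principal {(x, y). dist x y < e})"

definition open_c0 :: "c0 set \<Rightarrow> bool"
  where "open_c0 U \<longleftrightarrow> (\<forall>x\<in>U. \<forall>\<^sub>F (x', y) in uniformity. x' = x \<longrightarrow> y \<in> U)"

lemma cmod_c0_nth_le: "cmod (c0_nth x j) \<le> norm x"
  unfolding norm_c0.rep_eq by (rule cSUP_upper[OF UNIV_I c0_bdd_above])

lemma norm_c0_le: "(\<And>j. cmod (c0_nth x j) \<le> B) \<Longrightarrow> norm x \<le> B"
  unfolding norm_c0.rep_eq by (rule cSUP_least) auto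

lemma norm_scaleC_c0: "norm (a *\<^sub>C x :: c0) = cmod a * norm x"
proof (cases "a = 0")
  case True
  then show ?thesis by (simp add: norm_c0.rep_eq scaleC_c0.rep_eq)
next
  case False
  show ?thesis
  proof (rule antisym)
    show "norm (a *\<^sub>C x) \<le> cmod a * norm x"
      by (rule norm_c0_le) (simp add: scaleC_c0.rep_eq norm_mult mult_left_mono cmod_c0_nth_le)
    have "norm x \<le> norm (a *\<^sub>C x) / cmod a"
    proof (rule norm_c0_le)
      fix j
      show "cmod (c0_nth x j) \<le> norm (a *\<^sub>C x) / cmod a"
        using cmod_c0_nth_le[of "a *\<^sub>C x" j] False
        by (simp add: scaleC_c0.rep_eq norm_mult field_simps)
    qed
    then show "cmod a * norm x \<le> norm (a *\<^sub>C x)"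
      using False by (simp add: field_simps)
  qed
qed

lemma scaleR_scaleC_c0: "r *\<^sub>R (x :: c0) = complex_of_real r *\<^sub>C x"
  by (rule c0_eqI) (simp add: scaleR_c0.rep_eq scaleC_c0.rep_eq scaleR_conv_of_real)

instance
proof
  fix x y :: c0 and a b :: complex and r :: real
  show "a *\<^sub>C (x + y) = a *\<^sub>C x + a *\<^sub>C y" by transfer (simp add: algebra_simps)
  show "(a + b) *\<^sub>C x = a *\<^sub>C x + b *\<^sub>C x" by transfer (simp add: algebra_simps)
  show "a *\<^sub>C b *\<^sub>C x = (a * b) *\<^sub>C x" by transfer (simp add: algebra_simps)
  show "1 *\<^sub>C x = x" by transfer simp
  show "r *\<^sub>R x = complex_of_real r *\<^sub>C x" by (rule scaleR_scaleC_c0)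
  show "norm (a *\<^sub>C x) = cmod a * norm x" by (rule norm_scaleC_c0)
  show "norm (r *\<^sub>R x) = \<bar>r\<bar> * norm x" by (simp add: scaleR_scaleC_c0 norm_scaleC_c0)
  show "dist x y = norm (x - y)" by (rule dist_c0_def)
  show "sgn x = x /\<^sub>R norm x" by (rule sgn_c0_def)
  show "uniformity = (INF e\<in>{0<..}. principal {(x :: c0, y). dist x y < e})"
    by (rule uniformity_c0_def)
  show "open U \<longleftrightarrow> (\<forall>x\<in>U. \<forall>\<^sub>F (x', y) in uniformity. x' = x \<longrightarrow> y \<in> U)" for U :: "c0 set"
    by (rule open_c0_def)
  show "norm x = 0 \<longleftrightarrow> x = 0"
  proof
    assume "norm x = 0"
    then have "c0_nth x j = 0" for j
      using cmod_c0_nth_le[of x j] by simp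
    then show "x = 0" by (intro c0_eqI) (simp add: zero_c0.rep_eq)
  qed (simp add: norm_c0.rep_eq zero_c0.rep_eq)
  show "norm (x + y) \<le> norm x + norm y"
    by (rule norm_c0_le, unfold plus_c0.rep_eq,
        rule order_trans[OF norm_triangle_ineq add_mono[OF cmod_c0_nth_le cmod_c0_nth_le]])
qed

end

instance c0 :: complex_banach
proof
  fix X :: "nat \<Rightarrow> c0"
  assume X: "Cauchy X"
  have cau: "\<exists>N. \<forall>m\<ge>N. \<forall>n\<ge>N. \<forall>j. cmod (c0_nth (X m) j - c0_nth (X n) j) < e" if "e > 0" for e
  proof -
    obtain N where N: "\<And>m n. m \<ge> N \<Longrightarrow> n \<ge> N \<Longrightarrow> norm (X m - X n) < e"
      using X \<open>e > 0\<close> unfolding Cauchy_iff by blast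
    have "cmod (c0_nth (X m) j - c0_nth (X n) j) < e" if "m \<ge> N" "n \<ge> N" for m n j
      using cmod_c0_nth_le[of "X m - X n" j] N[OF that] by (simp add: minus_c0.rep_eq)
    then show ?thesis by blast
  qed
  have "Cauchy (\<lambda>n. c0_nth (X n) j)" for j
    unfolding Cauchy_iff using cau by blast
  then have "\<exists>l. (\<lambda>n. c0_nth (X n) j) \<longlonglongrightarrow> l" for j
    using Cauchy_convergent_iff convergent_def by blast
  then obtain l where l: "\<And>j. (\<lambda>n. c0_nth (X n) j) \<longlonglongrightarrow> l j"
    by metis
  have unif: "\<exists>N. \<forall>n\<ge>N. \<forall>j. cmod (c0_nth (X n) j - l j) \<le> e" if e: "e > 0" for e
  proof -
    obtain N where N: "\<forall>m\<ge>N. \<forall>n\<ge>N. \<forall>j. cmod (c0_nth (X m) j - c0_nth (X n) j) < e"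
      using cau[OF e] by blast
    have "cmod (c0_nth (X n) j - l j) \<le> e" if "n \<ge> N" for n j
    proof (rule LIMSEQ_le_const2)
      show "(\<lambda>m. cmod (c0_nth (X n) j - c0_nth (X m) j)) \<longlonglongrightarrow> cmod (c0_nth (X n) j - l j)"
        by (intro tendsto_intros l)
      show "\<exists>M. \<forall>m\<ge>M. cmod (c0_nth (X n) j - c0_nth (X m) j) \<le> e"
        using N that by (meson less_imp_le)
    qed
    then show ?thesis by blast
  qed
  have "l \<longlonglongrightarrow> 0"
  proof (rule LIMSEQ_I)
    fix e :: real assume e: "e > 0"
    obtain N where N: "\<And>n j. n \<ge> N \<Longrightarrow> cmod (c0_nth (X n) j - l j) \<le> e / 2"
      using unif[of "e / 2"] e by auto
    obtain J where J: "\<And>j. j \<ge> J \<Longrightarrow> cmod (c0_nth (X N) j) < e / 2"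
      using LIMSEQ_D[OF c0_nth_tendsto[of "X N"], of "e / 2"] e by auto
    have "cmod (l j) < e" if "j \<ge> J" for j
      using N[of N j] J[OF that] norm_triangle_sub[of "l j" "c0_nth (X N) j"]
      by (simp add: norm_minus_commute)
    then show "\<exists>J. \<forall>j\<ge>J. norm (l j - 0) < e" by auto
  qed
  then have nth_l: "c0_nth (Abs_c0 l) = l" by (simp add: Abs_c0_inverse)
  have "X \<longlonglongrightarrow> Abs_c0 l"
  proof (rule LIMSEQ_I)
    fix e :: real assume e: "e > 0"
    obtain N where N: "\<And>n j. n \<ge> N \<Longrightarrow> cmod (c0_nth (X n) j - l j) \<le> e / 2"
      using unif[of "e / 2"] e by auto
    have "norm (X n - Abs_c0 l) \<le> e / 2" if "n \<ge> N" for n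
      using N[OF that] by (intro norm_c0_le) (simp add: minus_c0.rep_eq nth_l)
    then show "\<exists>N. \<forall>n\<ge>N. norm (X n - Abs_c0 l) < e"
      using e by (intro exI[of _ N]) fastforce
  qed
  then show "convergent X" by (rule convergentI)
qed


section \<open>Bounded holomorphic functions on the unit ball of \<open>c0\<close>\<close>

definition holomorphic_at :: "('a::complex_normed_vector \<Rightarrow> 'b::complex_normed_vector) \<Rightarrow> 'a \<Rightarrow> bool"
  where "holomorphic_at F z \<longleftrightarrow>
    (\<exists>F'. (F has_derivative F') (at z) \<and> (\<forall>a h. F' (a *\<^sub>C h) = a *\<^sub>C F' h))"

text \<open>Functions are total in HOL; only the values on the open unit ball matter.\<close>

definition Hinf_ball :: "(c0 \<Rightarrow> 'x::complex_banach) set"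
  where "Hinf_ball = {F. (\<forall>z\<in>ball 0 1. holomorphic_at F z) \<and> bounded (F ` ball 0 1)}"

definition norm_Hinf_ball :: "(c0 \<Rightarrow> 'x::complex_banach) \<Rightarrow> real"
  where "norm_Hinf_ball F = (SUP z\<in>ball 0 1. norm (F z))"

text \<open>
  Coordinates are numbered from \<open>0\<close>. The type \<open>nat \<Rightarrow>\<^sub>0 nat\<close> of finitely supported functions
  consists of the eventually zero sequences in \<open>\<nat>\<^sub>0\<close>, and the multi-indices of length \<open>m\<close>
  are those supported in \<open>{..<m}\<close>.
\<close>

definition multi_power :: "(nat \<Rightarrow> 'a::comm_monoid_mult) \<Rightarrow> (nat \<Rightarrow>\<^sub>0 nat) \<Rightarrow> 'a"
  where "multi_power z \<alpha> = (\<Prod>j\<in>Poly_Mapping.keys \<alpha>. z j ^ Poly_Mapping.lookup \<alpha> j)"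

definition section_at :: "(c0 \<Rightarrow> 'x) \<Rightarrow> nat \<Rightarrow> (nat \<Rightarrow> complex) \<Rightarrow> 'x"
  where "section_at F m z = F (Abs_c0 (\<lambda>j. if j < m then z j else 0))"

definition monomial_coeff :: "(c0 \<Rightarrow> 'x::complex_banach) \<Rightarrow> (nat \<Rightarrow>\<^sub>0 nat) \<Rightarrow> 'x"
  where "monomial_coeff F = (THE c. \<forall>m z. (\<forall>j<m. cmod (z j) < 1) \<longrightarrow>
    ((\<lambda>\<alpha>. multi_power z \<alpha> *\<^sub>C c \<alpha>) has_sum section_at F m z)
      {\<alpha>. Poly_Mapping.keys \<alpha> \<subseteq> {..<m}})"


section \<open>The Bochner integral in arbitrary Banach spaces\<close>

text \<open>
  The Bochner integral of the library is restricted to second-countable target types. The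
  following is the same construction without that restriction, with Borel measurability
  strengthened to strong measurability.
\<close>

definition strongly_measurable :: "'a measure \<Rightarrow> ('a \<Rightarrow> 'x::real_normed_vector) \<Rightarrow> bool"
  where "strongly_measurable M f \<longleftrightarrow>
    (\<exists>s. (\<forall>i. simple_function M (s i)) \<and> (\<forall>x\<in>space M. (\<lambda>i. s i x) \<longlonglongrightarrow> f x))"

definition has_strong_integral :: "'a measure \<Rightarrow> ('a \<Rightarrow> 'x::real_normed_vector) \<Rightarrow> 'x \<Rightarrow> bool"
  where "has_strong_integral M f I \<longleftrightarrow> strongly_measurable M f \<and>
    (\<exists>s. (\<forall>i. Bochner_Integration.simple_bochner_integrable M (s i)) \<and>
      (\<lambda>i. \<integral>\<^sup>+x. ennreal (norm (f x - s i x)) \<partial>M) \<longlonglongrightarrow> 0 \<and>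
      (\<lambda>i. Bochner_Integration.simple_bochner_integral M (s i)) \<longlonglongrightarrow> I)"

definition strong_integral :: "'a measure \<Rightarrow> ('a \<Rightarrow> 'x::real_normed_vector) \<Rightarrow> 'x"
  where "strong_integral M f = (THE I. has_strong_integral M f I)"


section \<open>Hardy space on the infinite-dimensional torus\<close>

definition circle_measure :: "complex measure"
  where "circle_measure =
    distr (uniform_measure lborel {0..1::real}) (restrict_space borel (sphere 0 1))
      (\<lambda>t. cis (2 * pi * t))"

definition torus_measure :: "(nat \<Rightarrow> complex) measure"
  where "torus_measure = PiM UNIV (\<lambda>_. circle_measure)"

text \<open>Elements of \<open>L\<^sub>\<infinity>\<close> are handled through representatives; no quotient is taken.\<close>

definition Linf_torus :: "((nat \<Rightarrow> complex) \<Rightarrow> 'x::complex_banach) set"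
  where "Linf_torus = {f. strongly_measurable torus_measure f \<and>
    esssup torus_measure (\<lambda>\<omega>. ereal (norm (f \<omega>))) < \<infinity>}"

definition norm_Linf_torus :: "((nat \<Rightarrow> complex) \<Rightarrow> 'x::complex_banach) \<Rightarrow> real"
  where "norm_Linf_torus f = real_of_ereal (esssup torus_measure (\<lambda>\<omega>. ereal (norm (f \<omega>))))"

definition multi_powi :: "(nat \<Rightarrow> complex) \<Rightarrow> (nat \<Rightarrow>\<^sub>0 int) \<Rightarrow> complex"
  where "multi_powi \<omega> \<alpha> = (\<Prod>j\<in>Poly_Mapping.keys \<alpha>. \<omega> j powi Poly_Mapping.lookup \<alpha> j)"

definition fourier_coeff :: "((nat \<Rightarrow> complex) \<Rightarrow> 'x::complex_banach) \<Rightarrow> (nat \<Rightarrow>\<^sub>0 int) \<Rightarrow> 'x"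
  where "fourier_coeff f \<alpha> = strong_integral torus_measure (\<lambda>\<omega>. multi_powi \<omega> (- \<alpha>) *\<^sub>C f \<omega>)"

definition Hinf_torus :: "((nat \<Rightarrow> complex) \<Rightarrow> 'x::complex_banach) set"
  where "Hinf_torus = {f \<in> Linf_torus.
    \<forall>\<alpha>. (\<exists>j. Poly_Mapping.lookup \<alpha> j < 0) \<longrightarrow> fourier_coeff f \<alpha> = 0}"


section \<open>Hardy spaces of Dirichlet series\<close>

text \<open>The prime sequence, starting with \<open>nth_prime 0 = 2\<close>.\<close>

definition nth_prime :: "nat \<Rightarrow> nat"
  where "nth_prime = enumerate {p. prime p}"

text \<open>
  A Dirichlet series is identified with its coefficient sequence \<open>a\<close>; the meaningless entry
  \<open>a 0\<close> is normalised to \<open>0\<close>.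
\<close>

definition dirichlet_series :: "(nat \<Rightarrow> 'x::zero) set"
  where "dirichlet_series = {a. a 0 = 0}"

definition represents_dirichlet :: "((nat \<Rightarrow> complex) \<Rightarrow> 'x::complex_banach) \<Rightarrow> (nat \<Rightarrow> 'x) \<Rightarrow> bool"
  where "represents_dirichlet f a \<longleftrightarrow> f \<in> Hinf_torus \<and>
    (\<forall>\<alpha>. fourier_coeff f (Poly_Mapping.map int \<alpha>) = a (multi_power nth_prime \<alpha>))"

definition Hinf_dirichlet :: "(nat \<Rightarrow> 'x::complex_banach) set"
  where "Hinf_dirichlet = {a \<in> dirichlet_series. \<exists>f. represents_dirichlet f a}"

text \<open>The representing function is unique up to null sets, so its norm is determined by \<open>a\<close>.\<close>

definition norm_Hinf_dirichlet :: "(nat \<Rightarrow> 'x::complex_banach) \<Rightarrow> real"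
  where "norm_Hinf_dirichlet a = (THE r. \<exists>f. represents_dirichlet f a \<and> r = norm_Linf_torus f)"

definition horizontal_translate :: "real \<Rightarrow> (nat \<Rightarrow> 'x::complex_banach) \<Rightarrow> nat \<Rightarrow> 'x"
  where "horizontal_translate \<epsilon> a = (\<lambda>n. (1 / real n powr \<epsilon>) *\<^sub>R a n)"

definition Hinf_plus :: "(nat \<Rightarrow> 'x::complex_banach) set"
  where "Hinf_plus = {a \<in> dirichlet_series. (\<forall>\<epsilon>>0. horizontal_translate \<epsilon> a \<in> Hinf_dirichlet) \<and>
    bdd_above ((\<lambda>\<epsilon>. norm_Hinf_dirichlet (horizontal_translate \<epsilon> a)) ` {0<..})}"

definition norm_Hinf_plus :: "(nat \<Rightarrow> 'x::complex_banach) \<Rightarrow> real"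
  where "norm_Hinf_plus a = (SUP \<epsilon>\<in>{0<..}. norm_Hinf_dirichlet (horizontal_translate \<epsilon> a))"


section \<open>The Bohr transform\<close>

definition bohr_transform :: "(c0 \<Rightarrow> 'x::complex_banach) \<Rightarrow> nat \<Rightarrow> 'x"
  where "bohr_transform F n =
    (if n = 0 then 0 else monomial_coeff F (THE \<alpha>. multi_power nth_prime \<alpha> = n))"

definition prime_point :: "complex \<Rightarrow> c0"
  where "prime_point s = Abs_c0 (\<lambda>j. of_nat (nth_prime j) powr (- s))"

end

theory Submission
  imports Defs "HOL-Complex_Analysis.Great_Picard"
begin

text \<open>
  A function \<open>F\<close> on the ball and its Dirichlet series carry the same family of coefficients
  \<open>c \<alpha> = a n\<close>, where \<open>n\<close> is the product of the prime powers with exponents \<open>\<alpha>\<close>. The infinite torus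
  mediates between them.

  From the ball to Dirichlet series. For \<open>\<epsilon> > 0\<close> let \<open>r j\<close> be the \<open>-\<epsilon>\<close>-th power of the \<open>j\<close>-th prime.
  This is a null sequence bounded away from \<open>1\<close>, so \<open>\<omega> \<mapsto> F (r j * \<omega> j)\<close> is a bounded function on
  the torus, and its Fourier coefficients are \<open>r\<^sup>\<alpha> * c \<alpha> = n powr (- \<epsilon>) * a n\<close>
  (\<open>fourier_coeff_torus_lift\<close>). It therefore represents the translate by \<open>\<epsilon>\<close> of the Dirichlet series, and
  its norm is at most that of \<open>F\<close> (\<open>bohr_transform_Hinf_plus\<close>). That the norm of a Dirichlet
  series does not depend on the representing function is the uniqueness theorem for Fourier
  coefficients (\<open>Linf_torus_eq_if_fourier_eq\<close>).

  From Dirichlet series to the ball. If \<open>f\<close> on the torus has no Fourier coefficients at indices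
  with a negative entry, then the power series in \<open>m\<close> variables with the Fourier coefficients of
  \<open>f\<close> is the average of \<open>f\<close> against a product of \<open>m\<close> Poisson kernels, hence at most
  \<open>\<parallel>f\<parallel>\<close> on the polydisk (\<open>polydisc_sum_le_norm_Linf\<close>). Applied to the translates, with \<open>\<epsilon>\<close>
  tending to \<open>0\<close>, this bounds the power series with coefficients \<open>a n\<close> on all finite-dimensional
  polydisks by the norm of the Dirichlet series (\<open>Hinf_plus_bounds\<close>). By the Schwarz lemma the
  bounds force these power series to converge on the ball of null sequences as the number of variables grows,
  and the limit is holomorphic (\<open>Hinf_ball_of_coefficients\<close>). This gives surjectivity, and applied to the
  Dirichlet series of a given \<open>F\<close> the same bounds give the missing norm inequality.

  Convergence. In \<open>m\<close> variables the monomial series converges absolutely, so at the point with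
  coordinates \<open>p powr (- s)\<close> it may be summed in the order of \<open>n\<close>. To let \<open>m\<close> grow, its tails are
  estimated independently of \<open>m\<close>: on the imaginary axis the partial sums up to \<open>N\<close> are of order
  \<open>ln N\<close> (\<open>smooth_partial_sum_bound\<close>), because a kernel with trapezoidal cosine transform and
  \<open>L\<^sub>1\<close>-norm of order \<open>ln N\<close> separates the frequencies up to \<open>ln N\<close> from those beyond
  \<open>ln (N + 1)\<close>; summation by parts then makes the tails at \<open>s\<close> of order \<open>N powr (- \<sigma> / 2)\<close>,
  where \<open>\<sigma> > 0\<close> is the real part of \<open>s\<close> (\<open>bohr_series_sums\<close>).

  Vector values are reduced to complex values throughout by functionals of norm at most \<open>1\<close>, of
  which there are enough to recover every norm (\<open>norming_functional\<close>).
\<close>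

section \<open>Norming functionals\<close>

definition sublinear :: "('a::real_vector \<Rightarrow> real) \<Rightarrow> bool"
  where "sublinear p \<longleftrightarrow> (\<forall>x y. p (x + y) \<le> p x + p y) \<and> (\<forall>t>0. \<forall>x. p (t *\<^sub>R x) \<le> t * p x)"

lemma sublinear_add: "sublinear p \<Longrightarrow> p (x + y) \<le> p x + p y"
  and sublinear_scale_le: "sublinear p \<Longrightarrow> t > 0 \<Longrightarrow> p (t *\<^sub>R x) \<le> t * p x"
  by (auto simp: sublinear_def)

lemma sublinear_zero: "sublinear p \<Longrightarrow> p 0 = 0"
  using sublinear_add[of p 0 0] sublinear_scale_le[of p "1/2" 0] by simp

lemma sublinear_scale:
  assumes "sublinear p" "t \<ge> 0"
  shows "p (t *\<^sub>R x) = t * p x"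
proof (cases "t = 0")
  case True
  then show ?thesis using sublinear_zero[OF assms(1)] by simp
next
  case False
  then have t: "t > 0" using assms by simp
  have "p x = p ((1/t) *\<^sub>R (t *\<^sub>R x))" using t by simp
  also have "\<dots> \<le> (1/t) * p (t *\<^sub>R x)"
    by (rule sublinear_scale_le[OF assms(1)]) (use t in simp)
  finally have "t * p x \<le> p (t *\<^sub>R x)" using t by (simp add: field_simps)
  with sublinear_scale_le[OF assms(1) t, of x] show ?thesis by simp
qed

lemma sublinear_ge_minus: "sublinear p \<Longrightarrow> - p (- x) \<le> p x"
  using sublinear_add[of p x "- x"] sublinear_zero[of p] by simp

text \<open>
  The cheapest way to reach \<open>x\<close> when steps in the direction \<open>- y\<close> are credited at the fixed
  price \<open>- p y\<close>: \<open>q x\<close> is the infimum over \<open>t\<close> of the right-hand side. It is finite because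
  \<open>t * p y \<le> p (x + t *\<^sub>R y) + p (- x)\<close>, and sublinear because the amounts \<open>t\<close> add up under addition
  and scale under scaling.
\<close>

lemma sublinear_tilt:
  fixes p :: "'a::real_vector \<Rightarrow> real"
  assumes p: "sublinear p"
  obtains q where "sublinear q" "\<And>x. q x \<le> p x" "\<And>x t. t \<ge> 0 \<Longrightarrow> q x \<le> p (x + t *\<^sub>R y) - t * p y"
proof -
  define q where "q x = (INF t\<in>{0..}. p (x + t *\<^sub>R y) - t * p y)" for x
  have lb: "- p (- x) \<le> p (x + t *\<^sub>R y) - t * p y" if "t \<ge> 0" for x t
    using sublinear_add[OF p, of "x + t *\<^sub>R y" "- x"] sublinear_scale[OF p that, of y] by simp
  have bdd: "bdd_below ((\<lambda>t. p (x + t *\<^sub>R y) - t * p y) ` {0..})" for x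
    using lb by (auto simp: bdd_below_def)
  have le: "q x \<le> p (x + t *\<^sub>R y) - t * p y" if "t \<ge> 0" for x t
    unfolding q_def by (rule cINF_lower[OF bdd]) (use that in simp)
  have ge: "z \<le> q x" if "\<And>t. t \<ge> 0 \<Longrightarrow> z \<le> p (x + t *\<^sub>R y) - t * p y" for z x
    unfolding q_def by (rule cINF_greatest) (use that in auto)
  have "sublinear q"
    unfolding sublinear_def
  proof safe
    fix x x'
    have "q (x + x') - (p (x' + t' *\<^sub>R y) - t' * p y) \<le> q x" if t': "t' \<ge> 0" for t'
    proof (rule ge)
      fix t :: real assume t: "t \<ge> 0"
      have "q (x + x') \<le> p ((x + t *\<^sub>R y) + (x' + t' *\<^sub>R y)) - (t + t') * p y"
        using le[of "t + t'" "x + x'"] t t' by (simp add: algebra_simps)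
      also have "\<dots> \<le> p (x + t *\<^sub>R y) + p (x' + t' *\<^sub>R y) - (t + t') * p y"
        using sublinear_add[OF p] by simp
      finally show "q (x + x') - (p (x' + t' *\<^sub>R y) - t' * p y) \<le> p (x + t *\<^sub>R y) - t * p y"
        by (simp add: algebra_simps)
    qed
    then have "q (x + x') - q x \<le> q x'"
      by (intro ge) (simp add: algebra_simps)
    then show "q (x + x') \<le> q x + q x'" by simp
  next
    fix s :: real and x assume s: "s > 0"
    have "q (s *\<^sub>R x) / s \<le> q x"
    proof (rule ge)
      fix t :: real assume t: "t \<ge> 0"
      have "q (s *\<^sub>R x) \<le> p (s *\<^sub>R (x + t *\<^sub>R y)) - (s * t) * p y"
        using le[of "s * t" "s *\<^sub>R x"] s t by (simp add: algebra_simps)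
      also have "\<dots> = s * (p (x + t *\<^sub>R y) - t * p y)"
        using sublinear_scale[OF p, of s "x + t *\<^sub>R y"] s by (simp add: algebra_simps)
      finally show "q (s *\<^sub>R x) / s \<le> p (x + t *\<^sub>R y) - t * p y"
        using s by (simp add: field_simps)
    qed
    then show "q (s *\<^sub>R x) \<le> s * q x" using s by (simp add: field_simps)
  qed
  moreover have "q x \<le> p x" for x using le[of 0 x] by simp
  ultimately show ?thesis using that le by blast
qed

text \<open>
  Zorn's lemma. A chain has its pointwise infimum as a lower bound: the values at \<open>x\<close> stay above
  \<open>- p0 (- x)\<close>, and the infimum is sublinear because any two members of a chain are comparable.
\<close>

lemma minimal_sublinear_below:
  fixes p0 :: "'a::real_vector \<Rightarrow> real"
  assumes p0: "sublinear p0"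
  obtains p where "sublinear p" "\<And>x. p x \<le> p0 x"
    "\<And>q x. sublinear q \<Longrightarrow> (\<And>x. q x \<le> p x) \<Longrightarrow> q x = p x"
proof -
  define A where "A = {p. sublinear p \<and> (\<forall>x. p x \<le> p0 x)}"
  define P :: "('a \<Rightarrow> real) \<Rightarrow> ('a \<Rightarrow> real) \<Rightarrow> bool" where "P p q \<longleftrightarrow> (\<forall>x. q x \<le> p x)" for p q
  have po: "partial_order_on A (relation_of P A)"
    by (rule partial_order_on_relation_ofI) (auto simp: P_def fun_eq_iff intro: order_trans antisym)
  have "\<exists>u\<in>A. \<forall>a\<in>C. P a u" if C: "C \<in> Chains (relation_of P A)" for C
  proof (cases "C = {}")
    case True
    then show ?thesis using p0 by (auto simp: A_def)
  next
    case False
    have CA: "C \<subseteq> A" using C by (auto simp: Chains_def relation_of_def)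
    have tot: "P p q \<or> P q p" if "p \<in> C" "q \<in> C" for p q
      using C that by (auto simp: Chains_def relation_of_def)
    define u where "u x = (INF p\<in>C. p x)" for x
    have bdd: "bdd_below ((\<lambda>p. p x) ` C)" for x
    proof (rule bdd_belowI2)
      fix p assume "p \<in> C"
      then have "sublinear p" "p (- x) \<le> p0 (- x)" using CA by (auto simp: A_def)
      then show "- p0 (- x) \<le> p x" using sublinear_ge_minus[of p x] by simp
    qed
    have le: "u x \<le> p x" if "p \<in> C" for p x
      unfolding u_def by (rule cINF_lower[OF bdd that])
    have ge: "z \<le> u x" if "\<And>p. p \<in> C \<Longrightarrow> z \<le> p x" for z x
      unfolding u_def by (rule cINF_greatest) (use that False in auto)
    have "sublinear u"
      unfolding sublinear_def
    proof safe
      fix x y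
      have "u (x + y) - q y \<le> u x" if q: "q \<in> C" for q
      proof (rule ge)
        fix p assume p: "p \<in> C"
        obtain r where r: "r \<in> C" "r x \<le> p x" "r y \<le> q y"
          using tot[OF p q] p q by (auto simp: P_def)
        have "u (x + y) \<le> r (x + y)" using le r by blast
        also have "\<dots> \<le> r x + r y" using r CA by (auto simp: A_def intro: sublinear_add)
        finally show "u (x + y) - q y \<le> p x" using r by simp
      qed
      then have "u (x + y) - u x \<le> u y" by (intro ge) (simp add: algebra_simps)
      then show "u (x + y) \<le> u x + u y" by simp
    next
      fix t :: real and x assume t: "t > 0"
      have "u (t *\<^sub>R x) / t \<le> u x"
      proof (rule ge)
        fix p assume p: "p \<in> C"
        have "u (t *\<^sub>R x) \<le> p (t *\<^sub>R x)" using le p by blast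
        also have "\<dots> \<le> t * p x" using p CA t by (auto simp: A_def intro: sublinear_scale_le)
        finally show "u (t *\<^sub>R x) / t \<le> p x" using t by (simp add: field_simps)
      qed
      then show "u (t *\<^sub>R x) \<le> t * u x" using t by (simp add: field_simps)
    qed
    moreover have "u x \<le> p0 x" for x
    proof -
      obtain p where "p \<in> C" using False by blast
      then show ?thesis using le[of p x] CA by (auto simp: A_def intro: order_trans)
    qed
    ultimately show ?thesis using le by (auto simp: A_def P_def intro!: bexI[of _ u])
  qed
  from predicate_Zorn[OF po this] obtain p where p: "p \<in> A" "\<And>a. a \<in> A \<Longrightarrow> P p a \<Longrightarrow> a = p"
    by blast
  show ?thesis
  proof (rule that)
    show "sublinear p" "\<And>x. p x \<le> p0 x" using p by (auto simp: A_def)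
    fix q x assume q: "sublinear q" "\<And>x. q x \<le> p x"
    then have "q \<in> A" using p(1) by (auto simp: A_def intro: order_trans)
    then show "q x = p x" using p(2)[of q] q by (auto simp: P_def)
  qed
qed

text \<open>
  Tilting cannot lower a minimal sublinear functional, so \<open>p x \<le> p (x + y) - p y\<close>. Together with
  sublinearity this makes it additive.
\<close>

lemma linear_below_sublinear:
  fixes p0 :: "'a::real_vector \<Rightarrow> real"
  assumes "sublinear p0"
  obtains f where "linear f" "\<And>x. f x \<le> p0 x"
proof -
  obtain p where p: "sublinear p" "\<And>x. p x \<le> p0 x"
      "\<And>q x. sublinear q \<Longrightarrow> (\<And>x. q x \<le> p x) \<Longrightarrow> q x = p x"
    using minimal_sublinear_below[OF assms] by metis
  have ge: "p x \<le> p (x + t *\<^sub>R y) - t * p y" if "t \<ge> 0" for x y t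
  proof -
    obtain q where q: "sublinear q" "\<And>x. q x \<le> p x" 
        "\<And>x t. t \<ge> 0 \<Longrightarrow> q x \<le> p (x + t *\<^sub>R y) - t * p y"
      using sublinear_tilt[OF p(1), of y] by blast
    then show ?thesis using p(3)[of q x] q(3)[OF that, of x] by simp
  qed
  have add: "p (x + y) = p x + p y" for x y
    using ge[of 1 x y] sublinear_add[OF p(1), of x y] by simp
  have neg: "p (- x) = - p x" for x
    using add[of x "- x"] sublinear_zero[OF p(1)] by simp
  have "p (t *\<^sub>R x) = t * p x" for t x
    using sublinear_scale[OF p(1), of t x] sublinear_scale[OF p(1), of "- t" x] neg[of "t *\<^sub>R x"]
    by (cases "t \<ge> 0") auto
  then have "linear p" by (intro linearI) (simp_all add: add)
  then show ?thesis using that p(2) by blast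
qed

lemma sublinear_norm: "sublinear (norm :: 'a::real_normed_vector \<Rightarrow> real)"
  by (simp add: sublinear_def norm_triangle_ineq)

text \<open>
  The norm tilted in the direction \<open>x0\<close> is at most \<open>- norm x0\<close> at \<open>- x0\<close>, so every linear functional
  below it reaches \<open>norm x0\<close> at \<open>x0\<close>.
\<close>

lemma real_norming_functional:
  fixes x0 :: "'a::real_normed_vector"
  obtains f where "linear f" "\<And>x. f x \<le> norm x" "f x0 = norm x0"
proof -
  obtain q where q: "sublinear q" "\<And>x. q x \<le> norm (x :: 'a)"
      "\<And>x t. t \<ge> 0 \<Longrightarrow> q x \<le> norm (x + t *\<^sub>R x0) - t * norm x0"
    using sublinear_tilt[OF sublinear_norm, of x0] by blast
  obtain f where f: "linear f" "\<And>x. f x \<le> q x" using linear_below_sublinear[OF q(1)] by blast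
  have "- f x0 \<le> - norm x0"
    using f(2)[of "- x0"] q(3)[of 1 "- x0"] linear_neg[OF f(1), of x0] by simp
  moreover have "f x0 \<le> norm x0" using f(2) q(2) order_trans by blast
  ultimately show ?thesis using that f q(2) order_trans by (metis antisym neg_le_iff_le)
qed

definition contractive_functional :: "('x::complex_normed_vector \<Rightarrow> complex) \<Rightarrow> bool"
  where "contractive_functional \<phi> \<longleftrightarrow> (\<forall>x y. \<phi> (x + y) = \<phi> x + \<phi> y) \<and>
    (\<forall>a x. \<phi> (a *\<^sub>C x) = a * \<phi> x) \<and> (\<forall>x. cmod (\<phi> x) \<le> norm x)"

lemma
  assumes "contractive_functional \<phi>"
  shows functional_add: "\<phi> (x + y) = \<phi> x + \<phi> y"
    and functional_scaleC: "\<phi> (a *\<^sub>C x) = a * \<phi> x"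
    and functional_contractive: "cmod (\<phi> x) \<le> norm x"
  using assms by (auto simp: contractive_functional_def)

lemma functional_bounded_linear:
  assumes "contractive_functional \<phi>"
  shows "bounded_linear \<phi>"
  using functional_contractive[OF assms]
  by (intro bounded_linear_intro[of _ 1])
    (simp_all add: functional_add[OF assms] functional_scaleC[OF assms] scaleR_scaleC[where 'a='a] scaleR_conv_of_real)

lemmas functional_sum = bounded_linear.linear[OF functional_bounded_linear, THEN linear_sum]
lemmas functional_diff = bounded_linear.linear[OF functional_bounded_linear, THEN linear_diff]
lemmas functional_zero = bounded_linear.linear[OF functional_bounded_linear, THEN linear_0]
lemmas functional_scaleR = bounded_linear.linear[OF functional_bounded_linear, THEN linear_scale]

text \<open>
  The complexification \<open>f x - \<i> f (\<i> x)\<close> of a real functional \<open>f\<close>. It is contractive because a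
  rotation of \<open>x\<close> makes its value real, and real values are values of \<open>f\<close>.
\<close>

lemma norming_functional:
  fixes x0 :: "'x::complex_normed_vector"
  obtains \<phi> where "contractive_functional \<phi>" "\<phi> x0 = of_real (norm x0)"
proof -
  obtain f where f: "linear f" "\<And>x. f x \<le> norm x" "f x0 = norm (x0 :: 'x)"
    using real_norming_functional by blast
  define \<phi> where "\<phi> x = Complex (f x) (- f (\<i> *\<^sub>C x))" for x
  have ii: "\<i> *\<^sub>C \<i> *\<^sub>C x = - x" for x :: 'x
  proof -
    have "\<i> *\<^sub>C \<i> *\<^sub>C x = complex_of_real (- 1) *\<^sub>C x" by (simp add: scaleC_scaleC)
    also have "\<dots> = - x" by (simp only: scaleR_scaleC[symmetric]) simp
    finally show ?thesis .
  qed
  have add: "\<phi> (x + y) = \<phi> x + \<phi> y" for x y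
    by (simp add: \<phi>_def scaleC_add_right linear_add[OF f(1)] complex_eq_iff)
  have real: "\<phi> (complex_of_real r *\<^sub>C x) = complex_of_real r * \<phi> x" for r x
  proof -
    have "\<i> *\<^sub>C complex_of_real r *\<^sub>C x = r *\<^sub>R (\<i> *\<^sub>C x)"
      by (simp add: scaleR_scaleC scaleC_scaleC mult.commute)
    then show ?thesis
      by (simp add: \<phi>_def complex_eq_iff linear_scale[OF f(1)] flip: scaleR_scaleC)
  qed
  have imag: "\<phi> (\<i> *\<^sub>C x) = \<i> * \<phi> x" for x
    by (simp add: \<phi>_def ii linear_neg[OF f(1)] complex_eq_iff)
  have scale: "\<phi> (a *\<^sub>C x) = a * \<phi> x" for a x
  proof -
    have "a *\<^sub>C x = complex_of_real (Re a) *\<^sub>C x + \<i> *\<^sub>C complex_of_real (Im a) *\<^sub>C x"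
      by (simp add: scaleC_scaleC complex_eq_iff flip: scaleC_add_left)
        (simp flip: complex_eq)
    then show ?thesis by (simp add: add real imag complex_eq_iff)
  qed
  have contr: "cmod (\<phi> x) \<le> norm x" for x
  proof (cases "\<phi> x = 0")
    case False
    define a where "a = cnj (\<phi> x) / cmod (\<phi> x)"
    have "a * \<phi> x = cmod (\<phi> x)"
      using False complex_norm_square[of "\<phi> x"] by (simp add: a_def power2_eq_square field_simps)
    then have "cmod (\<phi> x) = Re (\<phi> (a *\<^sub>C x))" by (simp add: scale)
    also have "\<dots> = f (a *\<^sub>C x)" by (simp add: \<phi>_def)
    also have "\<dots> \<le> norm (a *\<^sub>C x)" by (rule f(2))
    also have "\<dots> = norm x" using False by (simp add: norm_scaleC a_def norm_divide)
    finally show ?thesis .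
  qed simp
  have cf: "contractive_functional \<phi>"
    unfolding contractive_functional_def using add scale contr by blast
  have "Re (\<phi> x0) = norm x0" by (simp add: \<phi>_def f(3))
  moreover have "(Re (\<phi> x0))\<^sup>2 + (Im (\<phi> x0))\<^sup>2 \<le> (norm x0)\<^sup>2"
    using contr[of x0] by (metis cmod_power2 norm_ge_zero power_mono)
  ultimately have "\<phi> x0 = of_real (norm x0)" by (simp add: complex_eq_iff)
  then show ?thesis using that cf by blast
qed

text \<open>
  This rule and the next turn a claim about vectors into claims about complex numbers.
\<close>

lemma functional_eqI:
  fixes x y :: "'x::complex_normed_vector"
  assumes "\<And>\<phi>. contractive_functional \<phi> \<Longrightarrow> \<phi> x = \<phi> y"
  shows "x = y"
proof -
  obtain \<phi> where \<phi>: "contractive_functional \<phi>" "\<phi> (x - y) = of_real (norm (x - y))"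
    using norming_functional by blast
  then show ?thesis using assms[OF \<phi>(1)] by (simp add: functional_diff)
qed

lemma functional_norm_leI:
  fixes x :: "'x::complex_normed_vector"
  assumes "\<And>\<phi>. contractive_functional \<phi> \<Longrightarrow> cmod (\<phi> x) \<le> B"
  shows "norm x \<le> B"
proof -
  obtain \<phi> where \<phi>: "contractive_functional \<phi>" "\<phi> x = of_real (norm x)"
    using norming_functional by blast
  then show ?thesis using assms[OF \<phi>(1)] by simp
qed

section \<open>Vector-valued holomorphic functions on the unit disk\<close>

text \<open>
  Orthogonality of the characters of the cyclic group of order \<open>K\<close>.
\<close>

lemma root_of_unity_sum:
  fixes l n K :: nat
  assumes "l < K" "n < K"
  shows "(\<Sum>j<K. cis (2 * pi * real j / real K) ^ l * cnj (cis (2 * pi * real j / real K)) ^ n)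
    = (if l = n then of_nat K else 0)"
proof -
  define w where "w = cis (2 * pi * (real l - real n) / real K)"
  have t: "cis (2 * pi * real j / real K) ^ l * cnj (cis (2 * pi * real j / real K)) ^ n = w ^ j" for j
    unfolding w_def cis_cnj Complex.DeMoivre cis_mult
    by (rule arg_cong[where f = cis]) (simp add: diff_divide_distrib algebra_simps)
  have K: "K > 0" using assms by simp
  show ?thesis
  proof (cases "l = n")
    case True
    then have "w = 1" by (simp add: w_def)
    then show ?thesis using True by (simp add: t[unfolded True])
  next
    case False
    have "w \<noteq> 1"
    proof
      assume "w = 1"
      then have "cos (2 * pi * (real l - real n) / real K) = 1"
        by (simp add: w_def complex_eq_iff)
      then obtain i :: int where "2 * pi * (real l - real n) / real K = of_int i * 2 * pi"
        by (auto simp: cos_one_2pi_int)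
      then have "(2 * pi) * (real l - real n) = (2 * pi) * (of_int i * real K)"
        using K by (simp add: field_simps)
      then have "real l - real n = of_int i * real K" by (subst (asm) mult_cancel_left) simp
      then have "int l - int n = i * int K"
        by (metis of_int_diff of_int_eq_iff of_int_mult of_int_of_nat_eq)
      then have "int K dvd int l - int n" by simp
      moreover have "int l - int n \<noteq> 0" "\<bar>int l - int n\<bar> < int K" using False assms by auto
      ultimately show False by (metis dvd_imp_le_int not_le abs_of_nat)
    qed
    moreover have "w ^ K = cis (2 * pi * (of_int (int l - int n)))"
      unfolding w_def Complex.DeMoivre using K by simp
    then have "w ^ K = 1" by (simp only: cis_multiple_2pi Ints_of_int)
    ultimately have "(\<Sum>j<K. w ^ j) = 0" using geometric_sum[of w K] by simp
    then show ?thesis using False by (simp add: t)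
  qed
qed

text \<open>
  The Cauchy integral for the \<open>n\<close>-th Taylor coefficient over the circle of radius \<open>1/2\<close>, replaced by its
  Riemann sum with \<open>K\<close> equidistant points. As a finite combination of values of \<open>g\<close> it commutes with
  functionals and preserves holomorphic dependence on parameters.
\<close>

definition circle_average :: "nat \<Rightarrow> nat \<Rightarrow> (complex \<Rightarrow> 'x::complex_normed_vector) \<Rightarrow> 'x"
  where "circle_average K n g = (\<Sum>j<K.
    (2 ^ n * cnj (cis (2 * pi * real j / real K)) ^ n / of_nat K) *\<^sub>C g (cis (2 * pi * real j / real K) / 2))"

text \<open>
  Sampling at \<open>K\<close> points does not distinguish exponents that agree modulo \<open>K\<close>. Among the exponents
  below \<open>K\<close> only \<open>n\<close> itself contributes, and each exponent \<open>l \<ge> K\<close> contributes at most \<open>M * 2 ^ n / 2 ^ l\<close>.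
\<close>

lemma circle_average_scalar_approx:
  fixes g :: "complex \<Rightarrow> complex"
  assumes g: "\<And>z. cmod z < 1 \<Longrightarrow> (\<lambda>l. a l * z ^ l) sums g z"
    and a: "\<And>l. cmod (a l) \<le> M" and K: "n < K"
  shows "cmod (circle_average K n g - a n) \<le> 2 * M * 2 ^ n * (1/2) ^ K"
proof -
  define w where "w j = cis (2 * pi * real j / real K)" for j
  define t where "t l = (\<Sum>j<K. (2 ^ n * cnj (w j) ^ n / of_nat K) * (a l * (w j / 2) ^ l))" for l
  have K0: "K > 0" using K by simp
  have "(\<lambda>l. (2 ^ n * cnj (w j) ^ n / of_nat K) * (a l * (w j / 2) ^ l)) sums
      ((2 ^ n * cnj (w j) ^ n / of_nat K) * g (w j / 2))" for j
    by (intro sums_mult g) (simp add: w_def norm_divide)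
  then have t_sums: "t sums circle_average K n g"
    unfolding circle_average_def scaleC_complex_def w_def[symmetric] t_def[abs_def]
    by (intro sums_sum)
  have t_eq: "t l = a l * 2 ^ n / 2 ^ l / of_nat K * (\<Sum>j<K. w j ^ l * cnj (w j) ^ n)" for l
    unfolding t_def sum_distrib_left by (intro sum.cong refl) (simp add: field_simps)
  have t_small: "t l = (if l = n then a n else 0)" if "l < K" for l
    unfolding t_eq w_def root_of_unity_sum[OF that K] using K0 by auto
  have M: "M \<ge> 0" using a[of 0] norm_ge_zero order_trans by blast
  have t_le: "cmod (t l) \<le> M * 2 ^ n * (1/2) ^ l" for l
  proof -
    have "cmod (\<Sum>j<K. w j ^ l * cnj (w j) ^ n) \<le> (\<Sum>j<K. 1)"
      by (rule sum_norm_le) (simp add: norm_mult norm_power w_def)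
    then have "cmod (\<Sum>j<K. w j ^ l * cnj (w j) ^ n) \<le> of_nat K" by simp
    moreover have "cmod (a l * 2 ^ n / 2 ^ l / of_nat K) \<le> M * 2 ^ n * (1/2) ^ l / of_nat K"
      using a[of l] K0 by (simp add: norm_mult norm_divide norm_power field_simps)
    ultimately have "cmod (t l) \<le> (M * 2 ^ n * (1/2) ^ l / of_nat K) * of_nat K"
      unfolding t_eq norm_mult using M by (intro mult_mono) auto
    then show ?thesis using K0 by simp
  qed
  have "(\<lambda>l. t (l + K)) sums (circle_average K n g - (\<Sum>l<K. t l))"
    using t_sums by (simp add: sums_iff_shift)
  moreover have "(\<Sum>l<K. t l) = (\<Sum>l<K. if l = n then a n else 0)"
    by (intro sum.cong refl) (simp add: t_small)
  then have "(\<Sum>l<K. t l) = a n"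
    using K by simp
  ultimately have s: "(\<lambda>l. t (l + K)) sums (circle_average K n g - a n)" by simp
  have geo: "(\<lambda>l. M * 2 ^ n * (1/2) ^ K * (1/2) ^ l) sums (M * 2 ^ n * (1/2) ^ K * (1 / (1 - 1/2)))"
    by (intro sums_mult geometric_sums) simp
  have "cmod (suminf (\<lambda>l. t (l + K))) \<le> suminf (\<lambda>l. M * 2 ^ n * (1/2) ^ K * (1/2) ^ l)"
  proof (rule norm_suminf_le)
    show "cmod (t (l + K)) \<le> M * 2 ^ n * (1/2) ^ K * (1/2) ^ l" for l
      using t_le[of "l + K"] by (simp add: power_add field_simps)
  qed (rule sums_summable[OF geo])
  then show ?thesis using sums_unique[OF s] sums_unique[OF geo] by simp
qed

lemma functional_circle_average:
  assumes "contractive_functional \<phi>"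
  shows "\<phi> (circle_average K n g) = circle_average K n (\<lambda>z. \<phi> (g z))"
  unfolding circle_average_def
  by (simp add: functional_sum[OF assms] functional_scaleC[OF assms] scaleC_complex_def)

definition disk_series :: "(nat \<Rightarrow> 'x::complex_normed_vector) \<Rightarrow> (complex \<Rightarrow> 'x) \<Rightarrow> bool"
  where "disk_series c g \<longleftrightarrow> (\<forall>z. cmod z < 1 \<longrightarrow> (\<lambda>n. z ^ n *\<^sub>C c n) sums g z)"

lemma functional_sums:
  assumes "contractive_functional \<phi>" "f sums s"
  shows "(\<lambda>n. \<phi> (f n)) sums \<phi> s"
  by (rule bounded_linear.sums[OF functional_bounded_linear[OF assms(1)] assms(2)])

lemma circle_average_approx:
  fixes g :: "complex \<Rightarrow> 'x::complex_normed_vector"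
  assumes g: "disk_series c g" and c: "\<And>l. norm (c l) \<le> M" and K: "n < K"
  shows "norm (circle_average K n g - c n) \<le> 2 * M * 2 ^ n * (1/2) ^ K"
proof (rule functional_norm_leI)
  fix \<phi> :: "'x \<Rightarrow> complex" assume \<phi>: "contractive_functional \<phi>"
  have "cmod (circle_average K n (\<lambda>z. \<phi> (g z)) - \<phi> (c n)) \<le> 2 * M * 2 ^ n * (1/2) ^ K"
  proof (rule circle_average_scalar_approx[OF _ _ K])
    fix z :: complex assume "cmod z < 1"
    then have "(\<lambda>l. \<phi> (z ^ l *\<^sub>C c l)) sums \<phi> (g z)"
      using g by (intro functional_sums[OF \<phi>]) (simp add: disk_series_def)
    then show "(\<lambda>l. \<phi> (c l) * z ^ l) sums \<phi> (g z)"
      by (simp add: functional_scaleC[OF \<phi>] mult.commute)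
  next
    show "cmod (\<phi> (c l)) \<le> M" for l
      using functional_contractive[OF \<phi>] c order_trans by blast
  qed
  then show "cmod (\<phi> (circle_average K n g - c n)) \<le> 2 * M * 2 ^ n * (1/2) ^ K"
    by (simp add: functional_diff[OF \<phi>] functional_circle_average[OF \<phi>])
qed

lemma half_power_tendsto: "(\<lambda>K. C * (1/2) ^ K) \<longlonglongrightarrow> (0::real)"
  using tendsto_mult[OF tendsto_const LIMSEQ_power_zero[of "1/2::real"], of C] by simp

lemma circle_average_tendsto:
  fixes g :: "complex \<Rightarrow> 'x::complex_normed_vector"
  assumes g: "disk_series c g" and c: "\<And>l. norm (c l) \<le> M"
  shows "(\<lambda>K. circle_average K n g) \<longlonglongrightarrow> c n"
proof (subst LIM_zero_iff[symmetric], rule Lim_null_comparison)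
  show "\<forall>\<^sub>F K in sequentially. norm (circle_average K n g - c n) \<le> 2 * M * 2 ^ n * (1/2) ^ K"
    using circle_average_approx[OF assms] eventually_gt_at_top by (rule eventually_mono[rotated])
qed (rule half_power_tendsto)

text \<open>
  Tested against functionals, holomorphy is inherited by bounded pointwise limits. Bounded functions
  of this kind nevertheless are norm-convergent power series (\<open>weakly_holomorphic_expansion\<close>).
\<close>

definition weakly_holomorphic :: "(complex \<Rightarrow> 'x::complex_normed_vector) \<Rightarrow> bool"
  where "weakly_holomorphic g \<longleftrightarrow>
    (\<forall>\<phi>. contractive_functional \<phi> \<longrightarrow> (\<lambda>z. \<phi> (g z)) holomorphic_on ball 0 1)"

text \<open>
  Cauchy's inequality on the circles of radius \<open>r < 1\<close>, with \<open>r\<close> tending to \<open>1\<close>.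
\<close>

lemma bounded_holomorphic_expansion:
  assumes f: "f holomorphic_on ball 0 1" and M: "\<And>z. cmod z < 1 \<Longrightarrow> cmod (f z) \<le> M"
  obtains a where "\<And>l. cmod (a l) \<le> M" "\<And>z. cmod z < 1 \<Longrightarrow> (\<lambda>l. a l * z ^ l) sums f z"
proof
  fix l
  have *: "cmod ((deriv ^^ l) f 0 / fact l) * r ^ l \<le> M" if r: "0 < r" "r < 1" for r
  proof -
    have "cmod ((deriv ^^ l) f 0) \<le> fact l * M / r ^ l"
    proof (rule Cauchy_inequality)
      show "f holomorphic_on ball 0 r" using f r by (elim holomorphic_on_subset) auto
      show "continuous_on (cball 0 r) f"
        using holomorphic_on_imp_continuous_on[OF f] r by (elim continuous_on_subset) auto
      show "cmod (f x) \<le> M" if "cmod (0 - x) = r" for x using M that r by simp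
    qed (rule r)
    then show ?thesis using r by (simp add: norm_divide field_simps)
  qed
  have "((\<lambda>r. cmod ((deriv ^^ l) f 0 / fact l) * r ^ l) \<longlongrightarrow> cmod ((deriv ^^ l) f 0 / fact l) * 1 ^ l) (at_left 1)"
    by (intro tendsto_intros)
  moreover have "\<forall>\<^sub>F r in at_left 1. cmod ((deriv ^^ l) f 0 / fact l) * r ^ l \<le> M"
    using * by (intro eventually_at_leftI[of 0]) auto
  ultimately show "cmod ((deriv ^^ l) f 0 / fact l) \<le> M"
    using tendsto_upperbound[OF _ _ trivial_limit_at_left_real] by fastforce
next
  fix z :: complex assume "cmod z < 1"
  then show "(\<lambda>l. (deriv ^^ l) f 0 / fact l * z ^ l) sums f z"
    using holomorphic_power_series[OF f, of z] by simp
qed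

lemma norm_summable_scaleC_powers:
  fixes c :: "nat \<Rightarrow> 'x::complex_banach"
  assumes "\<And>l. norm (c l) \<le> M" "cmod z < 1"
  shows "summable (\<lambda>l. norm (z ^ l *\<^sub>C c l))"
proof (rule summable_comparison_test')
  show "summable (\<lambda>l. M * cmod z ^ l)"
    using assms by (intro summable_mult summable_geometric) simp
  show "norm (norm (z ^ l *\<^sub>C c l)) \<le> M * cmod z ^ l" if "l \<ge> 0" for l
    using assms(1)[of l] by (simp add: norm_scaleC norm_power mult.commute mult_right_mono)
qed

text \<open>
  After applying a contractive functional, the circle averages of \<open>g\<close> approach a Taylor coefficient at a
  rate that depends on \<open>M\<close> and \<open>n\<close> only. Since the rate is the same for all functionals, the circle averages
  of \<open>g\<close> itself form a Cauchy sequence, and their limits are the coefficients.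
\<close>

lemma weakly_holomorphic_expansion:
  fixes g :: "complex \<Rightarrow> 'x::complex_banach"
  assumes g: "weakly_holomorphic g" and M: "\<And>z. cmod z < 1 \<Longrightarrow> norm (g z) \<le> M"
  obtains c where "\<And>l. norm (c l) \<le> M" "disk_series c g"
proof -
  have ex: "\<exists>a. (\<forall>l. cmod (a l) \<le> M) \<and> (\<forall>z. cmod z < 1 \<longrightarrow> (\<lambda>l. a l * z ^ l) sums \<phi> (g z))"
    if \<phi>: "contractive_functional \<phi>" for \<phi>
  proof -
    have "(\<lambda>z. \<phi> (g z)) holomorphic_on ball 0 1" using g \<phi> by (simp add: weakly_holomorphic_def)
    moreover have "cmod (\<phi> (g z)) \<le> M" if "cmod z < 1" for z
      using functional_contractive[OF \<phi>] M[OF that] order_trans by blast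
    ultimately obtain a where "\<forall>l. cmod (a l) \<le> M" "\<forall>z. cmod z < 1 \<longrightarrow> (\<lambda>l. a l * z ^ l) sums \<phi> (g z)"
      using bounded_holomorphic_expansion[of "\<lambda>z. \<phi> (g z)" M] by metis
    then show ?thesis by blast
  qed
  have dist: "norm (circle_average K n g - circle_average L n g) \<le> 4 * M * 2 ^ n * (1/2) ^ N"
    if N: "n < N" "N \<le> K" "N \<le> L" for n N K L
  proof (rule functional_norm_leI)
    fix \<phi> :: "'x \<Rightarrow> complex" assume \<phi>: "contractive_functional \<phi>"
    obtain a where a: "\<And>l. cmod (a l) \<le> M" "\<And>z. cmod z < 1 \<Longrightarrow> (\<lambda>l. a l * z ^ l) sums \<phi> (g z)"
      using ex[OF \<phi>] by blast
    have M0: "M \<ge> 0" using a(1)[of 0] norm_ge_zero order_trans by blast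
    have "cmod (circle_average J n (\<lambda>z. \<phi> (g z)) - a n) \<le> 2 * M * 2 ^ n * (1/2) ^ N" if "N \<le> J" for J
    proof -
      have "cmod (circle_average J n (\<lambda>z. \<phi> (g z)) - a n) \<le> 2 * M * 2 ^ n * (1/2) ^ J"
        by (rule circle_average_scalar_approx[OF a(2) a(1)]) (use that N in auto)
      also have "\<dots> \<le> 2 * M * 2 ^ n * (1/2) ^ N"
        using M0 that by (intro mult_left_mono power_decreasing) auto
      finally show ?thesis .
    qed
    from norm_triangle_ineq4[of "circle_average K n (\<lambda>z. \<phi> (g z)) - a n"
        "circle_average L n (\<lambda>z. \<phi> (g z)) - a n"] this[OF N(2)] this[OF N(3)]
    show "cmod (\<phi> (circle_average K n g - circle_average L n g)) \<le> 4 * M * 2 ^ n * (1/2) ^ N"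
      unfolding functional_diff[OF \<phi>] functional_circle_average[OF \<phi>] by simp
  qed
  have "Cauchy (\<lambda>K. circle_average K n g)" for n
  proof (rule metric_CauchyI)
    fix e :: real assume e: "e > 0"
    from LIMSEQ_D[OF half_power_tendsto[of "4 * M * 2 ^ n"] e]
    obtain N0 where N0: "\<And>N. N \<ge> N0 \<Longrightarrow> 4 * M * 2 ^ n * (1/2) ^ N < e" by fastforce
    define N where "N = max N0 (Suc n)"
    have "dist (circle_average K n g) (circle_average L n g) < e" if "K \<ge> N" "L \<ge> N" for K L
      using dist[of n N K L] that N0[of N] unfolding dist_norm
      by (rule_tac order_le_less_trans) (auto simp: N_def)
    then show "\<exists>N. \<forall>K\<ge>N. \<forall>L\<ge>N. dist (circle_average K n g) (circle_average L n g) < e" by blast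
  qed
  then have "\<forall>n. \<exists>l. (\<lambda>K. circle_average K n g) \<longlonglongrightarrow> l"
    using Cauchy_convergent_iff convergent_def by blast
  then obtain c where c: "\<And>n. (\<lambda>K. circle_average K n g) \<longlonglongrightarrow> c n" by metis
  have a_eq: "a n = \<phi> (c n)" if \<phi>: "contractive_functional \<phi>" and a: "\<And>l. cmod (a l) \<le> M"
      "\<And>z. cmod z < 1 \<Longrightarrow> (\<lambda>l. a l * z ^ l) sums \<phi> (g z)" for \<phi> a n
  proof (rule LIMSEQ_unique)
    show "(\<lambda>K. circle_average K n (\<lambda>z. \<phi> (g z))) \<longlonglongrightarrow> \<phi> (c n)"
      using bounded_linear.tendsto[OF functional_bounded_linear[OF \<phi>] c[of n]]
      by (simp add: functional_circle_average[OF \<phi>])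
    show "(\<lambda>K. circle_average K n (\<lambda>z. \<phi> (g z))) \<longlonglongrightarrow> a n"
      by (rule circle_average_tendsto[OF _ a(1)])
        (use a(2) in \<open>simp add: disk_series_def scaleC_complex_def mult.commute\<close>)
  qed
  have c_le: "norm (c n) \<le> M" for n
  proof (rule functional_norm_leI)
    fix \<phi> :: "'x \<Rightarrow> complex" assume \<phi>: "contractive_functional \<phi>"
    then show "cmod (\<phi> (c n)) \<le> M" using ex[OF \<phi>] a_eq[OF \<phi>] by metis
  qed
  have "disk_series c g"
    unfolding disk_series_def
  proof safe
    fix z :: complex assume z: "cmod z < 1"
    have "summable (\<lambda>n. z ^ n *\<^sub>C c n)"
      by (rule summable_norm_cancel[OF norm_summable_scaleC_powers[OF c_le z]])
    then obtain S where S: "(\<lambda>n. z ^ n *\<^sub>C c n) sums S" by (auto simp: summable_def)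
    have "S = g z"
    proof (rule functional_eqI)
      fix \<phi> :: "'x \<Rightarrow> complex" assume \<phi>: "contractive_functional \<phi>"
      obtain a where a: "\<And>l. cmod (a l) \<le> M" "\<And>z. cmod z < 1 \<Longrightarrow> (\<lambda>l. a l * z ^ l) sums \<phi> (g z)"
        using ex[OF \<phi>] by blast
      show "\<phi> S = \<phi> (g z)"
        using functional_sums[OF \<phi> S] a(2)[OF z] a_eq[OF \<phi> a] sums_unique2
        by (simp add: functional_scaleC[OF \<phi>] mult.commute)
    qed
    with S show "(\<lambda>n. z ^ n *\<^sub>C c n) sums g z" by simp
  qed
  with c_le show ?thesis using that by blast
qed

text \<open>
  By Montel's theorem a subsequence converges to a holomorphic function, which must be the pointwise
  limit.
\<close>

lemma weakly_holomorphic_limit: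
  fixes g :: "complex \<Rightarrow> 'x::complex_normed_vector"
  assumes wh: "\<And>k. weakly_holomorphic (f k)"
    and M: "\<And>k z. cmod z < 1 \<Longrightarrow> norm (f k z) \<le> M"
    and lim: "\<And>z. cmod z < 1 \<Longrightarrow> (\<lambda>k. f k z) \<longlonglongrightarrow> g z"
  shows "weakly_holomorphic g"
  unfolding weakly_holomorphic_def
proof safe
  fix \<phi> :: "'x \<Rightarrow> complex" assume \<phi>: "contractive_functional \<phi>"
  define \<H> where "\<H> = range (\<lambda>k z. \<phi> (f k z))"
  obtain h r where h: "h holomorphic_on ball 0 1" "strict_mono (r :: nat \<Rightarrow> nat)"
    "\<And>x. x \<in> ball 0 1 \<Longrightarrow> ((\<lambda>n. \<phi> (f (r n) x)) \<longlongrightarrow> h x) sequentially"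
  proof (rule Montel[of "ball 0 1" \<H> "\<lambda>k z. \<phi> (f k z)"])
    show "\<And>h. h \<in> \<H> \<Longrightarrow> h holomorphic_on ball 0 1"
      using wh \<phi> by (auto simp: \<H>_def weakly_holomorphic_def)
    show "\<exists>B. \<forall>h\<in>\<H>. \<forall>z\<in>K. norm (h z) \<le> B" if "compact K" "K \<subseteq> ball 0 1" for K
      using that functional_contractive[OF \<phi>] order_trans[OF functional_contractive[OF \<phi>] M]
      by (intro exI[of _ M]) (auto simp: \<H>_def subset_iff)
  qed (auto simp: \<H>_def)
  have "h z = \<phi> (g z)" if "z \<in> ball 0 1" for z
  proof (rule LIMSEQ_unique[OF h(3)[OF that]])
    have "(\<lambda>k. \<phi> (f k z)) \<longlonglongrightarrow> \<phi> (g z)"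
      by (rule bounded_linear.tendsto[OF functional_bounded_linear[OF \<phi>] lim]) (use that in simp)
    then show "(\<lambda>n. \<phi> (f (r n) z)) \<longlonglongrightarrow> \<phi> (g z)"
      using LIMSEQ_subseq_LIMSEQ[OF _ h(2), of "\<lambda>k. \<phi> (f k z)"] by (simp add: o_def)
  qed
  then show "(\<lambda>z. \<phi> (g z)) holomorphic_on ball 0 1"
    by (rule holomorphic_transform[OF h(1)])
qed

lemma weakly_holomorphic_sum:
  assumes "\<And>i. i \<in> I \<Longrightarrow> weakly_holomorphic (f i)"
  shows "weakly_holomorphic (\<lambda>z. \<Sum>i\<in>I. f i z)"
  using assms unfolding weakly_holomorphic_def by (auto simp: functional_sum intro!: holomorphic_intros)

lemma weakly_holomorphic_scaleC:
  assumes "a holomorphic_on ball 0 1" "weakly_holomorphic g"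
  shows "weakly_holomorphic (\<lambda>z. a z *\<^sub>C g z)"
  using assms unfolding weakly_holomorphic_def by (auto simp: functional_scaleC intro!: holomorphic_intros)

lemma weakly_holomorphic_const: "weakly_holomorphic (\<lambda>z. x)"
  by (simp add: weakly_holomorphic_def)

lemma weakly_holomorphic_if_holomorphic_at:
  fixes g :: "complex \<Rightarrow> 'x::complex_normed_vector"
  assumes "\<And>z. cmod z < 1 \<Longrightarrow> holomorphic_at g z"
  shows "weakly_holomorphic g"
  unfolding weakly_holomorphic_def
proof safe
  fix \<phi> :: "'x \<Rightarrow> complex" assume \<phi>: "contractive_functional \<phi>"
  show "(\<lambda>z. \<phi> (g z)) holomorphic_on ball 0 1"
  proof (rule holomorphic_onI)
    fix z :: complex assume "z \<in> ball 0 1"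
    then obtain g' where g': "(g has_derivative g') (at z)" "\<And>a h. g' (a *\<^sub>C h) = a *\<^sub>C g' h"
      using assms[of z] by (auto simp: holomorphic_at_def)
    have "((\<lambda>z. \<phi> (g z)) has_derivative (\<lambda>h. \<phi> (g' h))) (at z)"
      by (rule bounded_linear.has_derivative[OF functional_bounded_linear[OF \<phi>] g'(1)])
    moreover have "(\<lambda>h. \<phi> (g' h)) = (*) (\<phi> (g' 1))"
    proof
      fix h
      have "g' h = h *\<^sub>C g' 1" using g'(2)[of h 1] by (simp add: scaleC_complex_def)
      then show "\<phi> (g' h) = \<phi> (g' 1) * h" by (simp add: functional_scaleC[OF \<phi>])
    qed
    ultimately have "((\<lambda>z. \<phi> (g z)) has_field_derivative \<phi> (g' 1)) (at z)"
      by (simp add: has_field_derivative_def)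
    then show "(\<lambda>z. \<phi> (g z)) field_differentiable at z within ball 0 1"
      using field_differentiable_at_within field_differentiable_def by blast
  qed
qed

section \<open>Power series on polydisks\<close>

definition multi_indices :: "nat \<Rightarrow> (nat \<Rightarrow>\<^sub>0 nat) set"
  where "multi_indices m = {\<alpha>. Poly_Mapping.keys \<alpha> \<subseteq> {..<m}}"

lemma multi_power_eq_prod:
  assumes "finite S" "Poly_Mapping.keys \<alpha> \<subseteq> S"
  shows "multi_power z \<alpha> = (\<Prod>j\<in>S. z j ^ Poly_Mapping.lookup \<alpha> j)"
  unfolding multi_power_def using assms
  by (intro prod.mono_neutral_left) (auto simp: in_keys_iff)

lemma multi_power_add: "multi_power z (\<alpha> + \<beta>) = multi_power z \<alpha> * multi_power z \<beta>"
proof -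
  let ?S = "Poly_Mapping.keys \<alpha> \<union> Poly_Mapping.keys \<beta>"
  have "multi_power z (\<alpha> + \<beta>) = (\<Prod>j\<in>?S. z j ^ Poly_Mapping.lookup (\<alpha> + \<beta>) j)"
    by (rule multi_power_eq_prod) (use keys_add[of \<alpha> \<beta>] in auto)
  also have "\<dots> = (\<Prod>j\<in>?S. z j ^ Poly_Mapping.lookup \<alpha> j) * (\<Prod>j\<in>?S. z j ^ Poly_Mapping.lookup \<beta> j)"
    by (simp add: lookup_add power_add prod.distrib)
  also have "\<dots> = multi_power z \<alpha> * multi_power z \<beta>"
    by (simp flip: multi_power_eq_prod)
  finally show ?thesis .
qed

lemma multi_power_single: "multi_power z (Poly_Mapping.single j n) = z j ^ n"
  using multi_power_eq_prod[of "{j}" "Poly_Mapping.single j n" z] by simp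

lemma multi_power_zero [simp]: "multi_power z 0 = 1"
  by (simp add: multi_power_def)

lemma multi_power_mult: "multi_power (\<lambda>j. x j * y j) \<alpha> = multi_power x \<alpha> * multi_power y \<alpha>"
  by (simp add: multi_power_def power_mult_distrib prod.distrib)

lemma norm_multi_power: "cmod (multi_power z \<alpha>) = multi_power (\<lambda>j. cmod (z j)) \<alpha>"
  by (simp add: multi_power_def norm_power flip: prod_norm)

lemma multi_power_cong:
  assumes "\<alpha> \<in> multi_indices m" "\<And>j. j < m \<Longrightarrow> z j = z' j"
  shows "multi_power z \<alpha> = multi_power z' \<alpha>"
  unfolding multi_power_def using assms by (intro prod.cong) (auto simp: multi_indices_def)

lemma multi_power_nonneg: "(\<And>j. r j \<ge> (0::real)) \<Longrightarrow> multi_power r \<alpha> \<ge> 0"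
  by (simp add: multi_power_def prod_nonneg)

lemma multi_indices_mono: "m \<le> m' \<Longrightarrow> multi_indices m \<subseteq> multi_indices m'"
  by (auto simp: multi_indices_def)

lemma multi_indices_0: "multi_indices 0 = {0}"
  by (auto simp: multi_indices_def)

lemma ex_multi_indices: "\<exists>m. \<alpha> \<in> multi_indices m"
proof -
  have "finite (Poly_Mapping.keys \<alpha>)" by simp
  then obtain m where "\<And>j. j \<in> Poly_Mapping.keys \<alpha> \<Longrightarrow> j < m"
    by (auto simp: finite_nat_set_iff_bounded)
  then show ?thesis by (auto simp: multi_indices_def)
qed

text \<open>
  Splitting off the last exponent is the step of every induction on the number of variables.
\<close>

lemma multi_indices_Suc_bij:
  "bij_betw (\<lambda>(n, \<alpha>). \<alpha> + Poly_Mapping.single m n) (UNIV \<times> multi_indices m) (multi_indices (Suc m))"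
proof (rule bij_betw_byWitness[where f' = "\<lambda>\<beta>. (Poly_Mapping.lookup \<beta> m, Poly_Mapping.update m 0 \<beta>)"])
  have z: "Poly_Mapping.lookup \<alpha> m = 0" if "\<alpha> \<in> multi_indices m" for \<alpha>
    using that by (auto simp: multi_indices_def in_keys_iff)
  show "\<forall>a\<in>UNIV \<times> multi_indices m.
      (\<lambda>\<beta>. (Poly_Mapping.lookup \<beta> m, Poly_Mapping.update m 0 \<beta>))
       ((\<lambda>(n, \<alpha>). \<alpha> + Poly_Mapping.single m n) a) = a"
    by (auto simp: lookup_add z lookup_update lookup_single when_def intro!: poly_mapping_eqI)
  show "\<forall>\<beta>\<in>multi_indices (Suc m).
      (\<lambda>(n, \<alpha>). \<alpha> + Poly_Mapping.single m n) (Poly_Mapping.lookup \<beta> m, Poly_Mapping.update m 0 \<beta>) = \<beta>"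
    by (auto simp: lookup_add lookup_update lookup_single when_def intro!: poly_mapping_eqI)
  show "(\<lambda>(n, \<alpha>). \<alpha> + Poly_Mapping.single m n) ` (UNIV \<times> multi_indices m) \<subseteq> multi_indices (Suc m)"
    by (auto simp: multi_indices_def in_keys_iff lookup_add lookup_single when_def subset_iff less_Suc_eq
        split: if_splits)
  show "(\<lambda>\<beta>. (Poly_Mapping.lookup \<beta> m, Poly_Mapping.update m 0 \<beta>)) ` multi_indices (Suc m)
      \<subseteq> UNIV \<times> multi_indices m"
  proof safe
    fix \<beta> assume \<beta>: "\<beta> \<in> multi_indices (Suc m)"
    have "j < m" if "j \<in> Poly_Mapping.keys (Poly_Mapping.update m 0 \<beta>)" for j
    proof -
      have "j \<noteq> m" "j \<in> Poly_Mapping.keys \<beta>"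
        using that by (auto simp: in_keys_iff lookup_update split: if_splits)
      then show ?thesis using \<beta> by (auto simp: multi_indices_def less_Suc_eq)
    qed
    then show "Poly_Mapping.update m 0 \<beta> \<in> multi_indices m" by (auto simp: multi_indices_def)
  qed simp
qed

text \<open>
  A product of \<open>m\<close> geometric series.
\<close>

lemma multi_power_summable:
  fixes r :: "nat \<Rightarrow> real"
  assumes "\<And>j. j < m \<Longrightarrow> 0 \<le> r j" "\<And>j. j < m \<Longrightarrow> r j < 1"
  shows "multi_power r summable_on multi_indices m"
  using assms
proof (induction m)
  case 0
  then show ?case by (simp add: multi_indices_0)
next
  case (Suc m)
  have IH: "multi_power r summable_on multi_indices m" using Suc by simp
  have nn: "multi_power r \<alpha> \<ge> 0" if "\<alpha> \<in> multi_indices m" for \<alpha>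
    using that Suc.prems(1) by (force simp: multi_power_def multi_indices_def intro!: prod_nonneg)
  have "(\<lambda>(n, \<alpha>). r m ^ n * multi_power r \<alpha>) summable_on (UNIV \<times> multi_indices m)"
  proof (rule summable_on_SigmaI)
    show "((\<lambda>\<alpha>. (\<lambda>(n, \<alpha>). r m ^ n * multi_power r \<alpha>) (n, \<alpha>)) has_sum
        (r m ^ n * infsum (multi_power r) (multi_indices m))) (multi_indices m)" for n
      using has_sum_cmult_right[OF has_sum_infsum[OF IH]] by simp
    have "(\<lambda>n. r m ^ n) summable_on UNIV"
      using Suc.prems by (intro norm_summable_imp_summable_on) (simp add: summable_geometric norm_power)
    then show "(\<lambda>n. r m ^ n * infsum (multi_power r) (multi_indices m)) summable_on UNIV"
      by (rule summable_on_cmult_left)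
  qed (use nn Suc.prems in auto)
  then have "(\<lambda>p. multi_power r ((\<lambda>(n, \<alpha>). \<alpha> + Poly_Mapping.single m n) p))
      summable_on (UNIV \<times> multi_indices m)"
    by (simp add: case_prod_unfold multi_power_add multi_power_single mult.commute)
  then show ?case by (simp only: summable_on_reindex_bij_betw[OF multi_indices_Suc_bij])
qed

lemma multi_power_series_abs_summable:
  fixes c :: "_ \<Rightarrow> 'x::complex_banach"
  assumes "\<And>\<alpha>. \<alpha> \<in> multi_indices m \<Longrightarrow> norm (c \<alpha>) \<le> M" "\<And>j. j < m \<Longrightarrow> cmod (z j) < 1"
  shows "(\<lambda>\<alpha>. norm (multi_power z \<alpha> *\<^sub>C c \<alpha>)) summable_on multi_indices m"
proof (rule Infinite_Sum.abs_summable_on_comparison_test')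
  show "(\<lambda>\<alpha>. multi_power (\<lambda>j. cmod (z j)) \<alpha> * M) summable_on multi_indices m"
    by (intro summable_on_cmult_left multi_power_summable) (use assms in auto)
  show "norm (multi_power z \<alpha> *\<^sub>C c \<alpha>) \<le> multi_power (\<lambda>j. cmod (z j)) \<alpha> * M"
    if "\<alpha> \<in> multi_indices m" for \<alpha>
    using assms(1)[OF that] by (simp add: norm_scaleC norm_multi_power mult_left_mono multi_power_nonneg)
qed

lemma bounded_bilinear_scaleC: "bounded_bilinear (\<lambda>a (x::'x::complex_normed_vector). a *\<^sub>C x)"
proof
  show "(r *\<^sub>R a) *\<^sub>C x = r *\<^sub>R a *\<^sub>C x" for r a and x :: 'x
    unfolding scaleR_scaleC[where 'a = 'x] scaleC_scaleC scaleR_conv_of_real ..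
  show "a *\<^sub>C r *\<^sub>R x = r *\<^sub>R a *\<^sub>C x" for r a and x :: 'x
    unfolding scaleR_scaleC scaleC_scaleC by (simp only: mult.commute)
  show "\<exists>K. \<forall>a (x::'x). norm (a *\<^sub>C x) \<le> norm a * norm x * K"
    by (intro exI[of _ 1]) (simp add: norm_scaleC)
qed (rule scaleC_add_left scaleC_add_right)+

lemmas bounded_linear_scaleC_right = bounded_bilinear.bounded_linear_right[OF bounded_bilinear_scaleC]
lemmas bounded_linear_scaleC_left = bounded_bilinear.bounded_linear_left[OF bounded_bilinear_scaleC]

lemma circle_average_bound:
  assumes "\<And>z. cmod z < 1 \<Longrightarrow> norm (g z) \<le> M"
  shows "norm (circle_average K n g) \<le> 2 ^ n * M"
proof (cases "K = 0")
  case True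
  then show ?thesis using order_trans[OF norm_ge_zero assms[of 0]] by (simp add: circle_average_def)
next
  case False
  have "norm (circle_average K n g) \<le> (\<Sum>j<K. 2 ^ n / real K * M)"
    unfolding circle_average_def
  proof (rule sum_norm_le)
    fix j
    have "norm (g (cis (2 * pi * real j / real K) / 2)) \<le> M"
      by (rule assms) (simp add: norm_divide)
    then show "norm ((2 ^ n * cnj (cis (2 * pi * real j / real K)) ^ n / of_nat K) *\<^sub>C
        g (cis (2 * pi * real j / real K) / 2)) \<le> 2 ^ n / real K * M"
      by (simp add: norm_scaleC norm_mult norm_divide norm_power divide_right_mono mult_left_mono)
  qed
  then show ?thesis using False by simp
qed

text \<open>
  Induction on the number of variables. For fixed values of the other variables, \<open>g\<close> is a power series
  in the last one. The coefficients of this series are limits of circle averages in the last variable, hence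
  again separately holomorphic in the others and bounded by \<open>M\<close>, and the induction hypothesis expands them. The
  common bound \<open>M\<close> makes the resulting multiple series absolutely convergent, so that it may be
  summed over the last exponent at the end.
\<close>

lemma polydisc_expansion:
  fixes g :: "(nat \<Rightarrow> complex) \<Rightarrow> 'x::complex_banach"
  assumes "\<And>z j. (\<And>i. i < m \<Longrightarrow> cmod (z i) < 1) \<Longrightarrow> j < m \<Longrightarrow> weakly_holomorphic (\<lambda>w. g (z(j := w)))"
    and "\<And>z. (\<And>i. i < m \<Longrightarrow> cmod (z i) < 1) \<Longrightarrow> norm (g z) \<le> M"
    and "\<And>z z'. (\<And>i. i < m \<Longrightarrow> z i = z' i) \<Longrightarrow> g z = g z'"
  shows "\<exists>c. (\<forall>\<alpha>\<in>multi_indices m. norm (c \<alpha>) \<le> M) \<and>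
    (\<forall>z. (\<forall>i<m. cmod (z i) < 1) \<longrightarrow>
      ((\<lambda>\<alpha>. multi_power z \<alpha> *\<^sub>C c \<alpha>) has_sum g z) (multi_indices m))"
  using assms
proof (induction m arbitrary: g)
  case 0
  have "norm (g (\<lambda>_. 0)) \<le> M" by (rule 0(2)) simp
  moreover have "((\<lambda>\<alpha>. multi_power z \<alpha> *\<^sub>C g (\<lambda>_. 0)) has_sum g z) (multi_indices 0)" for z
  proof -
    have "g z = g (\<lambda>_. 0)" by (rule 0(3)) simp
    then show ?thesis
      using has_sum_finite[of "{0}" "\<lambda>\<alpha>. multi_power z \<alpha> *\<^sub>C g (\<lambda>_. 0)"]
      by (simp add: multi_indices_0 scaleC_one)
  qed
  ultimately show ?case by (intro exI[of _ "\<lambda>_. g (\<lambda>_. 0)"]) simp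
next
  case (Suc m)
  note hol = Suc.prems(1) and bnd = Suc.prems(2) and dep = Suc.prems(3)
  \<comment> \<open>the \<open>n\<close>-th coefficient of \<open>g\<close> as a function of the last variable\<close>
  define C where "C n z = lim (\<lambda>K. circle_average K n (\<lambda>w. g (z(m := w))))" for n z
  have C: "norm (C n z) \<le> M" "disk_series (\<lambda>n. C n z) (\<lambda>w. g (z(m := w)))"
      "(\<lambda>K. circle_average K n (\<lambda>w. g (z(m := w)))) \<longlonglongrightarrow> C n z"
    if z: "\<And>i. i < m \<Longrightarrow> cmod (z i) < 1" for n z
  proof -
    have "weakly_holomorphic (\<lambda>w. g ((z(m := 0))(m := w)))"
      by (rule hol) (use z in \<open>auto simp: less_Suc_eq\<close>)
    then have wh: "weakly_holomorphic (\<lambda>w. g (z(m := w)))" by simp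
    have "norm (g (z(m := w))) \<le> M" if "cmod w < 1" for w
      by (rule bnd) (use z that in \<open>auto simp: less_Suc_eq\<close>)
    from weakly_holomorphic_expansion[OF wh this] obtain c
      where c: "\<And>l. norm (c l) \<le> M" "disk_series c (\<lambda>w. g (z(m := w)))" by blast
    note lim = circle_average_tendsto[OF c(2,1)]
    have "c = (\<lambda>n. C n z)" unfolding C_def using limI[OF lim] by auto
    with c lim show "norm (C n z) \<le> M" "disk_series (\<lambda>n. C n z) (\<lambda>w. g (z(m := w)))"
      "(\<lambda>K. circle_average K n (\<lambda>w. g (z(m := w)))) \<longlonglongrightarrow> C n z" by auto
  qed
  have "\<exists>c. (\<forall>\<alpha>\<in>multi_indices m. norm (c \<alpha>) \<le> M) \<and>
    (\<forall>z. (\<forall>i<m. cmod (z i) < 1) \<longrightarrow>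
      ((\<lambda>\<alpha>. multi_power z \<alpha> *\<^sub>C c \<alpha>) has_sum C n z) (multi_indices m))" for n
  proof (rule Suc.IH)
    fix z :: "nat \<Rightarrow> complex" and j
    assume z: "\<And>i. i < m \<Longrightarrow> cmod (z i) < 1" and j: "j < m"
    have zj: "cmod ((z(j := w)) i) < 1" if "cmod w < 1" "i < m" for w i
      using that z by simp
    show "weakly_holomorphic (\<lambda>w. C n (z(j := w)))"
    proof (rule weakly_holomorphic_limit)
      show "(\<lambda>K. circle_average K n (\<lambda>w'. g (z(j := w, m := w')))) \<longlonglongrightarrow> C n (z(j := w))"
        if "cmod w < 1" for w by (rule C(3)) (use zj that in blast)
      show "norm (circle_average K n (\<lambda>w'. g (z(j := w, m := w')))) \<le> 2 ^ n * M" if "cmod w < 1" for w K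
        by (rule circle_average_bound, rule bnd) (use z that in \<open>auto simp: less_Suc_eq\<close>)
      show "weakly_holomorphic (\<lambda>w. circle_average K n (\<lambda>w'. g (z(j := w, m := w'))))" for K
        unfolding circle_average_def
      proof (intro weakly_holomorphic_sum weakly_holomorphic_scaleC holomorphic_on_const)
        fix i
        let ?a = "cis (2 * pi * real i / real K) / 2"
        have "weakly_holomorphic (\<lambda>w. g ((z(m := ?a))(j := w)))"
          by (rule hol) (use z j in \<open>auto simp: less_Suc_eq norm_divide\<close>)
        moreover have "(z(m := ?a))(j := w) = z(j := w, m := ?a)" for w using j by auto
        ultimately show "weakly_holomorphic (\<lambda>w. g (z(j := w, m := ?a)))" by simp
      qed
    qed
  next
    show "norm (C n z) \<le> M" if "\<And>i. i < m \<Longrightarrow> cmod (z i) < 1" for z using C(1)[OF that] .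
  next
    fix z z' :: "nat \<Rightarrow> complex" assume "\<And>i. i < m \<Longrightarrow> z i = z' i"
    then have "g (z(m := w)) = g (z'(m := w))" for w by (intro dep) (auto simp: less_Suc_eq)
    then show "C n z = C n z'" by (simp add: C_def)
  qed
  then obtain c where c: "\<And>n \<alpha>. \<alpha> \<in> multi_indices m \<Longrightarrow> norm (c n \<alpha>) \<le> M"
    "\<And>n z. (\<And>i. i < m \<Longrightarrow> cmod (z i) < 1) \<Longrightarrow>
      ((\<lambda>\<alpha>. multi_power z \<alpha> *\<^sub>C c n \<alpha>) has_sum C n z) (multi_indices m)" by metis
  define d where "d \<beta> = c (Poly_Mapping.lookup \<beta> m) (Poly_Mapping.update m 0 \<beta>)" for \<beta>
  have d_add: "d (\<alpha> + Poly_Mapping.single m n) = c n \<alpha>" if "\<alpha> \<in> multi_indices m" for \<alpha> n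
  proof -
    have l: "Poly_Mapping.lookup \<alpha> m = 0" using that by (auto simp: multi_indices_def in_keys_iff)
    then have "Poly_Mapping.update m 0 (\<alpha> + Poly_Mapping.single m n) = \<alpha>"
      by (auto simp: lookup_add lookup_update lookup_single when_def intro!: poly_mapping_eqI)
    then show ?thesis using l by (simp add: d_def lookup_add)
  qed
  have d_le: "norm (d \<beta>) \<le> M" if "\<beta> \<in> multi_indices (Suc m)" for \<beta>
  proof -
    have "\<beta> \<in> (\<lambda>(n, \<alpha>). \<alpha> + Poly_Mapping.single m n) ` (UNIV \<times> multi_indices m)"
      using that by (simp only: bij_betw_imp_surj_on[OF multi_indices_Suc_bij])
    then obtain n \<alpha> where "\<alpha> \<in> multi_indices m" "\<beta> = \<alpha> + Poly_Mapping.single m n"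
      by auto
    then show ?thesis using d_add c(1) by simp
  qed
  have "((\<lambda>\<beta>. multi_power z \<beta> *\<^sub>C d \<beta>) has_sum g z) (multi_indices (Suc m))"
    if z: "\<And>i. i < Suc m \<Longrightarrow> cmod (z i) < 1" for z
  proof -
    let ?f = "\<lambda>\<beta>. multi_power z \<beta> *\<^sub>C d \<beta>"
    have "?f summable_on multi_indices (Suc m)"
      by (rule abs_summable_summable[OF multi_power_series_abs_summable]) (use d_le z in auto)
    then obtain S where S: "(?f has_sum S) (multi_indices (Suc m))" by (auto simp: summable_on_def)
    have S': "((\<lambda>p. ?f ((\<lambda>(n, \<alpha>). \<alpha> + Poly_Mapping.single m n) p)) has_sum S) (UNIV \<times> multi_indices m)"
      by (rule has_sum_reindex_bij_betw[OF multi_indices_Suc_bij, where f = ?f and S = S, THEN iffD2, OF S])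
    have "((\<lambda>n. z m ^ n *\<^sub>C C n z) has_sum S) UNIV"
    proof (rule has_sum_SigmaD[OF S'])
      fix n
      have "((\<lambda>\<alpha>. z m ^ n *\<^sub>C multi_power z \<alpha> *\<^sub>C c n \<alpha>) has_sum z m ^ n *\<^sub>C C n z) (multi_indices m)"
        by (rule has_sum_bounded_linear[OF bounded_linear_scaleC_right c(2)]) (use z in auto)
      then show "((\<lambda>\<alpha>. ?f ((\<lambda>(n, \<alpha>). \<alpha> + Poly_Mapping.single m n) (n, \<alpha>))) has_sum z m ^ n *\<^sub>C C n z)
          (multi_indices m)"
        by (rule has_sum_cong[THEN iffD1, rotated])
          (simp add: d_add multi_power_add multi_power_single scaleC_scaleC mult.commute)
    qed
    then have "(\<lambda>n. z m ^ n *\<^sub>C C n z) sums S" by (rule has_sum_imp_sums)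
    moreover have "(\<lambda>n. z m ^ n *\<^sub>C C n z) sums g (z(m := z m))"
    proof -
      have "disk_series (\<lambda>n. C n z) (\<lambda>w. g (z(m := w)))" by (rule C(2)) (use z in auto)
      then show ?thesis unfolding disk_series_def using z[of m] by blast
    qed
    ultimately have "S = g z" by (metis fun_upd_triv sums_unique2)
    then show ?thesis using S by simp
  qed
  with d_le show ?case by blast
qed

section \<open>Sections of functions on the ball of null sequences\<close>

definition truncate_c0 :: "nat \<Rightarrow> (nat \<Rightarrow> complex) \<Rightarrow> c0"
  where "truncate_c0 m z = Abs_c0 (\<lambda>j. if j < m then z j else 0)"

lemma c0_nth_Abs: "x \<longlonglongrightarrow> 0 \<Longrightarrow> c0_nth (Abs_c0 x) = x"
  by (simp add: Abs_c0_inverse)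

lemma c0_nth_truncate: "c0_nth (truncate_c0 m z) j = (if j < m then z j else 0)"
proof -
  have "(\<lambda>j. if j < m then z j else 0) \<longlonglongrightarrow> 0"
    by (rule tendsto_eventually) (rule eventually_mono[OF eventually_ge_at_top[of m]], simp)
  then show ?thesis by (simp add: truncate_c0_def c0_nth_Abs)
qed

lemma section_at_truncate: "section_at F m z = F (truncate_c0 m z)"
  by (simp add: section_at_def truncate_c0_def)

text \<open>
  The supremum stays below \<open>1\<close> because only finitely many coordinates are nonzero.
\<close>

lemma norm_truncate_less:
  assumes "\<And>j. j < m \<Longrightarrow> cmod (z j) < 1"
  shows "norm (truncate_c0 m z) < 1"
proof -
  define q where "q = Max (insert 0 ((\<lambda>j. cmod (z j)) ` {..<m}))"
  have "norm (truncate_c0 m z) \<le> q"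
    by (rule norm_c0_le) (auto simp: c0_nth_truncate q_def)
  also have "q < 1" using assms by (auto simp: q_def)
  finally show ?thesis .
qed

lemma holomorphic_along_line:
  assumes F: "\<And>z. z \<in> ball 0 1 \<Longrightarrow> holomorphic_at F z"
    and zh: "\<And>w. cmod w < 1 \<Longrightarrow> norm (z + w *\<^sub>C h) < 1"
  shows "weakly_holomorphic (\<lambda>w. F (z + w *\<^sub>C h))"
proof (rule weakly_holomorphic_if_holomorphic_at)
  fix w :: complex assume w: "cmod w < 1"
  obtain F' where F': "(F has_derivative F') (at (z + w *\<^sub>C h))" "\<And>a k. F' (a *\<^sub>C k) = a *\<^sub>C F' k"
    using F[of "z + w *\<^sub>C h"] zh[OF w] by (auto simp: holomorphic_at_def)
  have "((\<lambda>w. z + w *\<^sub>C h) has_derivative (\<lambda>k. k *\<^sub>C h)) (at w)"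
    by (auto intro!: derivative_eq_intros bounded_linear.has_derivative[OF bounded_linear_scaleC_left])
  from diff_chain_at[OF this F'(1)]
  have "((\<lambda>w. F (z + w *\<^sub>C h)) has_derivative (\<lambda>k. F' (k *\<^sub>C h))) (at w)"
    by (simp add: o_def)
  then show "holomorphic_at (\<lambda>w. F (z + w *\<^sub>C h)) w"
    unfolding holomorphic_at_def
    by (intro exI[of _ "\<lambda>k. F' (k *\<^sub>C h)"] conjI)
      (simp_all add: F'(2) scaleC_complex_def scaleC_scaleC[symmetric])
qed

text \<open>
  Varying one coordinate of a truncated sequence moves it along a complex line, so sections are
  separately holomorphic.
\<close>

lemma Hinf_ball_section_expansion:
  assumes F: "F \<in> Hinf_ball" and M: "\<And>z. norm z < 1 \<Longrightarrow> norm (F z) \<le> M"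
  shows "\<exists>c. (\<forall>\<alpha>\<in>multi_indices m. norm (c \<alpha>) \<le> M) \<and>
    (\<forall>z. (\<forall>i<m. cmod (z i) < 1) \<longrightarrow>
      ((\<lambda>\<alpha>. multi_power z \<alpha> *\<^sub>C c \<alpha>) has_sum section_at F m z) (multi_indices m))"
proof (rule polydisc_expansion)
  fix z :: "nat \<Rightarrow> complex" and j
  assume z: "\<And>i. i < m \<Longrightarrow> cmod (z i) < 1" and j: "j < m"
  let ?e = "truncate_c0 m (\<lambda>i. if i = j then 1 else 0)"
  have eq: "truncate_c0 m (z(j := w)) = truncate_c0 m (z(j := 0)) + w *\<^sub>C ?e" for w
    by (rule c0_eqI) (simp add: c0_nth_truncate plus_c0.rep_eq scaleC_c0.rep_eq)
  have "weakly_holomorphic (\<lambda>w. F (truncate_c0 m (z(j := 0)) + w *\<^sub>C ?e))"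
  proof (rule holomorphic_along_line)
    show "holomorphic_at F x" if "x \<in> ball 0 1" for x using F that unfolding Hinf_ball_def by blast
    show "norm (truncate_c0 m (z(j := 0)) + w *\<^sub>C ?e) < 1" if "cmod w < 1" for w
      unfolding eq[symmetric] by (rule norm_truncate_less) (use z that in auto)
  qed
  then show "weakly_holomorphic (\<lambda>w. section_at F m (z(j := w)))"
    by (simp only: section_at_truncate flip: eq)
next
  show "norm (section_at F m z) \<le> M" if "\<And>i. i < m \<Longrightarrow> cmod (z i) < 1" for z
    unfolding section_at_truncate by (rule M[OF norm_truncate_less[OF that]])
  show "section_at F m z = section_at F m z'" if "\<And>i. i < m \<Longrightarrow> z i = z' i" for z z'
  proof -
    have "truncate_c0 m z = truncate_c0 m z'" by (rule c0_eqI) (simp only: c0_nth_truncate that cong: if_cong)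
    then show ?thesis by (simp add: section_at_truncate)
  qed
qed

section \<open>Holomorphy from holomorphy along lines\<close>

lemma disk_series_tail:
  fixes c :: "nat \<Rightarrow> 'x::complex_banach"
  assumes g: "disk_series c g" and c: "\<And>l. norm (c l) \<le> M" and w: "cmod w \<le> 1/2"
  shows "norm (g w - (\<Sum>n<N. w ^ n *\<^sub>C c n)) \<le> 2 * M * cmod w ^ N"
proof -
  have M: "M \<ge> 0" using c[of 0] norm_ge_zero order_trans by blast
  have s: "(\<lambda>n. w ^ (n + N) *\<^sub>C c (n + N)) sums (g w - (\<Sum>n<N. w ^ n *\<^sub>C c n))"
    using g w unfolding disk_series_def by (intro sums_split_initial_segment) auto
  have geo: "(\<lambda>n. M * cmod w ^ N * (1/2) ^ n) sums (M * cmod w ^ N * (1 / (1 - 1/2)))"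
    by (intro sums_mult geometric_sums) simp
  have "norm (suminf (\<lambda>n. w ^ (n + N) *\<^sub>C c (n + N))) \<le> suminf (\<lambda>n. M * cmod w ^ N * (1/2) ^ n)"
  proof (rule norm_suminf_le)
    fix n
    have "norm (w ^ (n + N) *\<^sub>C c (n + N)) = (cmod w ^ n * cmod w ^ N) * norm (c (n + N))"
      by (simp add: norm_scaleC norm_mult norm_power power_add)
    also have "\<dots> \<le> ((1/2) ^ n * cmod w ^ N) * M"
      using w c M by (intro mult_mono power_mono) auto
    finally show "norm (w ^ (n + N) *\<^sub>C c (n + N)) \<le> M * cmod w ^ N * (1/2) ^ n"
      by (simp add: mult_ac)
  qed (rule sums_summable[OF geo])
  then show ?thesis using sums_unique[OF s] sums_unique[OF geo] by simp
qed

text \<open>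
  Remainders of the power series after one and after two terms. The first estimate is a form of the
  Schwarz lemma; in the second, \<open>l\<close> is the derivative at \<open>0\<close>.
\<close>

lemma weakly_holomorphic_Schwarz:
  fixes g :: "complex \<Rightarrow> 'x::complex_banach"
  assumes g: "weakly_holomorphic g" "\<And>z. cmod z < 1 \<Longrightarrow> norm (g z) \<le> M"
  obtains l where "\<And>w. cmod w \<le> 1/2 \<Longrightarrow> norm (g w - g 0) \<le> 2 * M * cmod w"
    "\<And>w. cmod w \<le> 1/2 \<Longrightarrow> norm (g w - g 0 - w *\<^sub>C l) \<le> 2 * M * cmod w ^ 2"
proof -
  obtain c where c: "\<And>l. norm (c l) \<le> M" "disk_series c g"
    using weakly_holomorphic_expansion[OF g] by blast
  have "g 0 = c 0"
    using disk_series_tail[OF c(2,1), of 0 1] by (simp add: scaleC_one)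
  then show ?thesis
    using that[of "c 1"] disk_series_tail[OF c(2,1), of _ 1] disk_series_tail[OF c(2,1), of _ 2]
    by (simp add: scaleC_one numeral_2_eq_2 diff_diff_eq)
qed

text \<open>
  Applied to the difference of two first-order approximations with quadratic errors, this shows that
  they agree.
\<close>

lemma norm_le_quadratic_imp_zero:
  fixes l :: "'x::real_normed_vector"
  assumes "\<delta> > 0" and le: "\<And>t. 0 < t \<Longrightarrow> t \<le> \<delta> \<Longrightarrow> t * norm l \<le> C * t ^ 2"
  shows "l = 0"
proof -
  have "((\<lambda>t. C * t) \<longlongrightarrow> C * 0) (at_right 0)" by (intro tendsto_intros)
  moreover have "\<forall>\<^sub>F t in at_right 0. norm l \<le> C * t"
    unfolding eventually_at_right_field
  proof (intro exI[of _ \<delta>] conjI allI impI)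
    fix t assume "0 < t" "t < \<delta>"
    then show "norm l \<le> C * t" using le[of t] by (simp add: power2_eq_square)
  qed (rule assms(1))
  ultimately have "norm l \<le> C * 0" by (rule tendsto_lowerbound) simp
  then show ?thesis by simp
qed

text \<open>
  The condition on \<open>z\<close> and \<open>h\<close> keeps the whole disk \<open>z + w h\<close> inside the unit ball. Like weak holomorphy on
  the disk, this property survives bounded pointwise limits.
\<close>

definition line_holomorphic :: "(c0 \<Rightarrow> 'x::complex_banach) \<Rightarrow> bool"
  where "line_holomorphic F \<longleftrightarrow>
    (\<forall>z h. norm z + norm h < 1 \<longrightarrow> weakly_holomorphic (\<lambda>w. F (z + w *\<^sub>C h)))"

lemma scaleC_zero_left [simp]: "0 *\<^sub>C (x :: 'x::complex_normed_vector) = 0"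
  using scaleC_add_left[of 0 0 x] by simp

lemma scaleC_zero_right [simp]: "a *\<^sub>C (0 :: 'x::complex_normed_vector) = 0"
  using scaleC_add_right[of a 0 0] by simp

lemma scaleC_diff_right: "a *\<^sub>C (x - y) = a *\<^sub>C x - a *\<^sub>C (y :: 'x::complex_normed_vector)"
  using scaleC_add_right[of a "x - y" y] by (simp add: algebra_simps)

lemma norm_scaleC_add_less:
  fixes z h :: "'x::complex_normed_vector"
  assumes "norm z + norm h < 1" "cmod w < 1"
  shows "norm (z + w *\<^sub>C h) < 1"
proof -
  have "norm (z + w *\<^sub>C h) \<le> norm z + cmod w * norm h"
    using norm_triangle_ineq[of z "w *\<^sub>C h"] by (simp add: norm_scaleC)
  also have "\<dots> \<le> norm z + 1 * norm h"
    using assms by (intro add_left_mono mult_right_mono) auto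
  finally show ?thesis using assms by simp
qed

lemma line_holomorphic_Lipschitz:
  assumes F: "line_holomorphic F" and M: "\<And>z. norm z < 1 \<Longrightarrow> norm (F z) \<le> M"
    and z: "norm z + norm h < 1" and w: "cmod w \<le> 1/2"
  shows "norm (F (z + w *\<^sub>C h) - F z) \<le> 2 * M * cmod w"
proof -
  have wh: "weakly_holomorphic (\<lambda>w. F (z + w *\<^sub>C h))"
    using F z by (simp add: line_holomorphic_def)
  have "norm (F (z + w *\<^sub>C h)) \<le> M" if "cmod w < 1" for w
    by (intro M norm_scaleC_add_less z that)
  from weakly_holomorphic_Schwarz[OF wh this] show ?thesis using w by (metis scaleC_zero_left add_0_right)
qed

text \<open>
  The Schwarz estimate for the multiple of \<open>h\<close> of length \<open>\<rho>\<close>. After rescaling, the error depends on the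
  increment \<open>w h\<close> through its norm alone, which is what Frechet differentiability asks for.
\<close>

lemma line_holomorphic_derivative:
  assumes F: "line_holomorphic F" and M: "\<And>z. norm z < 1 \<Longrightarrow> norm (F z) \<le> M"
    and \<rho>: "\<rho> > 0" "norm z + \<rho> < 1"
  obtains l where "\<And>w. cmod w * norm h \<le> \<rho> / 2 \<Longrightarrow>
    norm (F (z + w *\<^sub>C h) - F z - w *\<^sub>C l) \<le> 2 * M / \<rho> ^ 2 * (cmod w * norm h) ^ 2"
proof (cases "h = 0")
  case True
  then show ?thesis using that[of 0] by simp
next
  case False
  define s where "s = \<rho> / norm h"
  have s: "s > 0" using False \<rho> by (simp add: s_def)
  define u where "u = complex_of_real s *\<^sub>C h"
  have u: "norm u = \<rho>" using False \<rho> by (simp add: u_def norm_scaleC s_def norm_divide)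
  have wh: "weakly_holomorphic (\<lambda>w. F (z + w *\<^sub>C u))"
    using F \<rho> u by (simp add: line_holomorphic_def)
  have bd: "norm (F (z + w *\<^sub>C u)) \<le> M" if "cmod w < 1" for w
    by (intro M norm_scaleC_add_less that) (use \<rho> u in simp)
  obtain l where l: "\<And>w. cmod w \<le> 1/2 \<Longrightarrow>
      norm (F (z + w *\<^sub>C u) - F (z + 0 *\<^sub>C u) - w *\<^sub>C l) \<le> 2 * M * cmod w ^ 2"
    using weakly_holomorphic_Schwarz[OF wh bd] by metis
  show ?thesis
  proof (rule that[of "complex_of_real (1 / s) *\<^sub>C l"])
    fix w assume w: "cmod w * norm h \<le> \<rho> / 2"
    have "cmod (w / s) = cmod w * norm h / \<rho>" using \<rho> by (simp add: norm_divide norm_mult s_def)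
    moreover have "(w / s) *\<^sub>C u = w *\<^sub>C h" using s by (simp add: u_def scaleC_scaleC)
    moreover have "w *\<^sub>C complex_of_real (1 / s) *\<^sub>C l = (w / s) *\<^sub>C l" by (simp add: scaleC_scaleC)
    moreover have "cmod w * norm h / \<rho> \<le> 1/2" using w \<rho> by (simp add: field_simps)
    ultimately show "norm (F (z + w *\<^sub>C h) - F z - w *\<^sub>C complex_of_real (1 / s) *\<^sub>C l)
        \<le> 2 * M / \<rho> ^ 2 * (cmod w * norm h) ^ 2"
      using l[of "w / s"] by (simp add: power_divide)
  qed
qed

text \<open>
  The Schwarz estimate used twice. In the direction \<open>h\<close> it shows that \<open>F (z + w h + v k) - F (z + v k)\<close> is
  at most \<open>2 M \<bar>w\<bar>\<close> for all \<open>v\<close>; applied to this function of \<open>v\<close>, it shows that the values at \<open>v = w\<close> and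
  \<open>v = 0\<close> differ by a quantity of second order.
\<close>

lemma line_holomorphic_second_difference:
  assumes F: "line_holomorphic F" and M: "\<And>z. norm z < 1 \<Longrightarrow> norm (F z) \<le> M"
    and zhk: "norm z + norm h + norm k < 1" and w: "cmod w \<le> 1/2"
  shows "norm (F (z + w *\<^sub>C h + w *\<^sub>C k) - F (z + w *\<^sub>C k) - (F (z + w *\<^sub>C h) - F z)) \<le> 4 * M * cmod w ^ 2"
proof -
  define g where "g v = F (z + w *\<^sub>C h + v *\<^sub>C k) - F (z + v *\<^sub>C k)" for v
  have zw: "norm (z + w *\<^sub>C h) + norm k < 1"
  proof -
    have "norm (z + w *\<^sub>C h) \<le> norm z + cmod w * norm h"
      using norm_triangle_ineq[of z "w *\<^sub>C h"] by (simp add: norm_scaleC)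
    also have "\<dots> \<le> norm z + 1 * norm h"
      using w by (intro add_left_mono mult_right_mono) auto
    finally show ?thesis using zhk by simp
  qed
  have "weakly_holomorphic (\<lambda>v. F (z + w *\<^sub>C h + v *\<^sub>C k))" "weakly_holomorphic (\<lambda>v. F (z + v *\<^sub>C k))"
    using F zw order_le_less_trans[OF _ zhk, of "norm z + norm k"] unfolding line_holomorphic_def by auto
  then have wh: "weakly_holomorphic g"
    unfolding weakly_holomorphic_def g_def by (auto simp: functional_diff intro!: holomorphic_intros)
  have "norm (g v) \<le> 2 * M * cmod w" if v: "cmod v < 1" for v
  proof -
    have "norm (z + v *\<^sub>C k) \<le> norm z + cmod v * norm k"
      using norm_triangle_ineq[of z "v *\<^sub>C k"] by (simp add: norm_scaleC)
    also have "\<dots> \<le> norm z + 1 * norm k"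
      using v by (intro add_left_mono mult_right_mono) auto
    finally have "norm (z + v *\<^sub>C k) + norm h < 1" using zhk by simp
    from line_holomorphic_Lipschitz[OF F M this w] show ?thesis
      by (simp add: g_def algebra_simps)
  qed
  from weakly_holomorphic_Schwarz[OF wh this]
  have "norm (g w - g 0) \<le> 2 * (2 * M * cmod w) * cmod w" using w by metis
  then show ?thesis by (simp add: g_def power2_eq_square mult_ac)
qed

text \<open>
  Directional derivatives exist with a quadratic error that is uniform in the direction. They are
  homogeneous because first-order approximations are unique, additive because second differences are of second
  order, and bounded because \<open>F\<close> is. Hence they form the Frechet derivative.
\<close>

lemma line_holomorphic_imp_holomorphic_at:
  assumes F: "line_holomorphic F" and M: "\<And>z. norm z < 1 \<Longrightarrow> norm (F z) \<le> M" and z: "norm z < 1"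
  shows "holomorphic_at F z"
proof -
  define \<rho> where "\<rho> = (1 - norm z) / 2"
  have \<rho>: "\<rho> > 0" "norm z + \<rho> < 1" using z by (auto simp: \<rho>_def field_simps)
  define C where "C = 2 * M / \<rho> ^ 2"
  have M0: "M \<ge> 0" using order_trans[OF norm_ge_zero M[of 0]] by simp
  then have C0: "C \<ge> 0" by (simp add: C_def)
  have "\<exists>l. \<forall>w. cmod w * norm h \<le> \<rho> / 2 \<longrightarrow>
      norm (F (z + w *\<^sub>C h) - F z - w *\<^sub>C l) \<le> C * (cmod w * norm h) ^ 2" for h
    using line_holomorphic_derivative[OF F M \<rho>, of h] unfolding C_def by metis
  then obtain L where L: "\<And>h w. cmod w * norm h \<le> \<rho> / 2 \<Longrightarrow>
      norm (F (z + w *\<^sub>C h) - F z - w *\<^sub>C L h) \<le> C * (cmod w * norm h) ^ 2" by metis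
  have scale: "L (a *\<^sub>C h) = a *\<^sub>C L h" for a h
  proof -
    define q where "q = 1 + norm (a *\<^sub>C h)"
    have q: "q \<ge> 1" by (simp add: q_def)
    have "L (a *\<^sub>C h) - a *\<^sub>C L h = 0"
    proof (rule norm_le_quadratic_imp_zero)
      show "\<rho> / 2 / q > 0" using q \<rho> by simp
      fix t :: real assume t: "0 < t" "t \<le> \<rho> / 2 / q"
      have small: "t * norm (a *\<^sub>C h) \<le> \<rho> / 2"
      proof -
        have "t * norm (a *\<^sub>C h) \<le> t * q" using t by (simp add: q_def)
        also have "t * q \<le> \<rho> / 2" using t q by (simp add: field_simps)
        finally show ?thesis .
      qed
      let ?x = "F (z + complex_of_real t *\<^sub>C a *\<^sub>C h) - F z"
      have 1: "norm (?x - complex_of_real t *\<^sub>C L (a *\<^sub>C h)) \<le> C * (t * norm (a *\<^sub>C h)) ^ 2"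
        using L[of "complex_of_real t" "a *\<^sub>C h"] small t by simp
      have 2: "norm (?x - complex_of_real t *\<^sub>C a *\<^sub>C L h) \<le> C * (t * norm (a *\<^sub>C h)) ^ 2"
        using L[of "complex_of_real t * a" h] small t
        by (simp add: scaleC_scaleC norm_mult norm_scaleC mult_ac)
      have "t * norm (L (a *\<^sub>C h) - a *\<^sub>C L h) = norm (complex_of_real t *\<^sub>C (L (a *\<^sub>C h) - a *\<^sub>C L h))"
        using t by (simp add: norm_scaleC)
      also have "\<dots> = norm ((?x - complex_of_real t *\<^sub>C a *\<^sub>C L h) - (?x - complex_of_real t *\<^sub>C L (a *\<^sub>C h)))"
        by (simp add: scaleC_diff_right)
      also have "\<dots> \<le> C * (t * norm (a *\<^sub>C h)) ^ 2 + C * (t * norm (a *\<^sub>C h)) ^ 2"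
        by (rule order_trans[OF norm_triangle_ineq4 add_mono[OF 2 1]])
      also have "\<dots> = (2 * C * norm (a *\<^sub>C h) ^ 2) * t ^ 2" by (simp add: power_mult_distrib)
      finally show "t * norm (L (a *\<^sub>C h) - a *\<^sub>C L h) \<le> (2 * C * norm (a *\<^sub>C h) ^ 2) * t ^ 2" .
    qed
    then show ?thesis by simp
  qed
  have add: "L (h + k) = L h + L k" for h k
  proof -
    define q where "q = 1 + norm h + norm k"
    have q: "q \<ge> 1" "norm h \<le> q" "norm k \<le> q" "norm (h + k) \<le> q"
      using norm_triangle_ineq[of h k] by (auto simp: q_def)
    \<comment> \<open>rescale so that the two increments fit into the ball around \<open>z\<close>\<close>
    define s where "s = \<rho> / q"
    have s: "s > 0" using \<rho> q by (simp add: s_def)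
    have sn: "norm (complex_of_real s *\<^sub>C x) = s * norm x" for x :: c0 using s by (simp add: norm_scaleC)
    have shk: "norm z + norm (complex_of_real s *\<^sub>C h) + norm (complex_of_real s *\<^sub>C k) < 1"
    proof -
      have "s * (norm h + norm k) \<le> s * q" using s by (simp add: q_def)
      also have "\<dots> = \<rho>" using q by (simp add: s_def)
      finally show ?thesis unfolding sn using \<rho> by (simp add: algebra_simps)
    qed
    have "L (h + k) - L h - L k = 0"
    proof (rule norm_le_quadratic_imp_zero)
      show "s / 2 > 0" using s by simp
      fix t :: real assume t: "0 < t" "t \<le> s / 2"
      let ?t = "complex_of_real t"
      have small: "t * norm x \<le> \<rho> / 2" if "norm x \<le> q" for x :: c0
      proof -
        have "t * norm x \<le> (s / 2) * q" using t that q s by (intro mult_mono) auto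
        then show ?thesis using q by (simp add: s_def)
      qed
      have e: "norm (F (z + ?t *\<^sub>C x) - F z - ?t *\<^sub>C L x) \<le> C * q ^ 2 * t ^ 2" if x: "norm x \<le> q" for x
      proof -
        have "norm (F (z + ?t *\<^sub>C x) - F z - ?t *\<^sub>C L x) \<le> C * (t * norm x) ^ 2"
          using L[of ?t x] small[OF x] t by simp
        also have "\<dots> \<le> C * (t * q) ^ 2"
          using C0 t x by (intro mult_left_mono power_mono) auto
        finally show ?thesis by (simp add: power_mult_distrib mult_ac)
      qed
      define A where "A = F (z + ?t *\<^sub>C (h + k)) - F z - ?t *\<^sub>C L (h + k)"
      define B1 where "B1 = F (z + ?t *\<^sub>C h) - F z - ?t *\<^sub>C L h"
      define B2 where "B2 = F (z + ?t *\<^sub>C k) - F z - ?t *\<^sub>C L k"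
      define D where "D = F (z + ?t *\<^sub>C h + ?t *\<^sub>C k) - F (z + ?t *\<^sub>C k) - (F (z + ?t *\<^sub>C h) - F z)"
      have D: "norm D \<le> 4 * M / s ^ 2 * t ^ 2"
      proof -
        have "complex_of_real (t / s) *\<^sub>C complex_of_real s *\<^sub>C x = ?t *\<^sub>C x" for x :: c0
          using s by (simp add: scaleC_scaleC)
        moreover have "cmod (complex_of_real (t / s)) = t / s" "t / s \<le> 1 / 2"
          using s t by (auto simp: field_simps norm_divide)
        ultimately show ?thesis
          using line_holomorphic_second_difference[OF F M shk, of "complex_of_real (t / s)"]
          by (simp add: D_def power_divide)
      qed
      have "?t *\<^sub>C (L (h + k) - L h - L k) = (D - A) + (B1 + B2)"
        by (simp add: A_def B1_def B2_def D_def scaleC_diff_right scaleC_add_right algebra_simps)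
      then have "t * norm (L (h + k) - L h - L k) = norm ((D - A) + (B1 + B2))"
        using t by (metis abs_of_pos norm_of_real norm_scaleC)
      also have "\<dots> \<le> (norm D + norm A) + (norm B1 + norm B2)"
        by (intro order_trans[OF norm_triangle_ineq] add_mono norm_triangle_ineq norm_triangle_ineq4)
      also have "\<dots> \<le> (4 * M / s ^ 2 * t ^ 2 + C * q ^ 2 * t ^ 2) + (C * q ^ 2 * t ^ 2 + C * q ^ 2 * t ^ 2)"
        using D e q unfolding A_def B1_def B2_def by (intro add_mono) auto
      also have "\<dots> = (4 * M / s ^ 2 + 3 * (C * q ^ 2)) * t ^ 2" by (simp add: algebra_simps)
      finally show "t * norm (L (h + k) - L h - L k) \<le> (4 * M / s ^ 2 + 3 * (C * q ^ 2)) * t ^ 2" .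
    qed
    then show ?thesis by (simp add: algebra_simps)
  qed
  have bound: "norm (L h) \<le> norm h * ((2 * M + C * (\<rho> / 2) ^ 2) * (2 / \<rho>))" for h
  proof (cases "h = 0")
    case True
    have "L 0 = 0" using add[of 0 0] by simp
    then show ?thesis using True by simp
  next
    case False
    define t where "t = \<rho> / (2 * norm h)"
    have t: "t > 0" "t * norm h = \<rho> / 2" using False \<rho> by (auto simp: t_def)
    let ?t = "complex_of_real t"
    have e: "norm (F (z + ?t *\<^sub>C h) - F z - ?t *\<^sub>C L h) \<le> C * (\<rho> / 2) ^ 2"
      using L[of ?t h] t by simp
    have "norm (z + ?t *\<^sub>C h) < 1"
      using norm_triangle_ineq[of z "?t *\<^sub>C h"] t \<rho> by (simp add: norm_scaleC)
    then have f: "norm (F (z + ?t *\<^sub>C h) - F z) \<le> 2 * M"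
      using norm_triangle_ineq4[of "F (z + ?t *\<^sub>C h)" "F z"] M[OF z] M[of "z + ?t *\<^sub>C h"] by simp
    have "t * norm (L h) = norm ((F (z + ?t *\<^sub>C h) - F z) - (F (z + ?t *\<^sub>C h) - F z - ?t *\<^sub>C L h))"
      using t by (simp add: norm_scaleC)
    also have "\<dots> \<le> 2 * M + C * (\<rho> / 2) ^ 2"
      by (rule order_trans[OF norm_triangle_ineq4 add_mono[OF f e]])
    finally have "norm (L h) \<le> (2 * M + C * (\<rho> / 2) ^ 2) / t" using t by (simp add: field_simps)
    then show ?thesis using False by (simp add: t_def mult_ac)
  qed
  have "bounded_linear L"
    by (rule bounded_linear_intro[OF add _ bound]) (simp add: scaleR_scaleC scale)
  then have "(F has_derivative L) (at z)"
  proof (rule has_derivativeI_sandwich[of "\<rho> / 2", rotated])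
    show "\<rho> / 2 > 0" using \<rho> by simp
    show "norm (F y - F z - L (y - z)) / norm (y - z) \<le> C * norm (y - z)"
      if "y \<noteq> z" "dist y z < \<rho> / 2" for y
    proof -
      have "norm (F (z + 1 *\<^sub>C (y - z)) - F z - 1 *\<^sub>C L (y - z)) \<le> C * (cmod 1 * norm (y - z)) ^ 2"
        by (rule L) (use that in \<open>simp add: dist_norm\<close>)
      then show ?thesis using that by (simp add: scaleC_one divide_simps power2_eq_square)
    qed
    show "((\<lambda>y. C * norm (y - z)) \<longlongrightarrow> 0) (at z)"
      by (rule tendsto_eq_intros | simp)+
  qed
  then show ?thesis unfolding holomorphic_at_def using scale by blast
qed

section \<open>Functions on the ball from bounded power series\<close>

text \<open>
  Replaces unordered summation over a countable set by the limit of a sequence of finite sums, to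
  which Montel's theorem and dominated convergence apply.
\<close>

lemma finite_exhaustion:
  assumes "countable A"
  obtains E :: "nat \<Rightarrow> 'a set" where "\<And>k. finite (E k)" "\<And>k. E k \<subseteq> A"
    "filterlim E (finite_subsets_at_top A) sequentially"
proof (cases "A = {}")
  case True
  show ?thesis
    by (rule that[of "\<lambda>_. {}"]) (auto simp: True filterlim_finite_subsets_at_top)
next
  case False
  define E where "E k = from_nat_into A ` {..<k}" for k :: nat
  show ?thesis
  proof (rule that[of E])
    show "finite (E k)" "E k \<subseteq> A" for k
      using from_nat_into[OF False] by (auto simp: E_def)
    show "filterlim E (finite_subsets_at_top A) sequentially"
      unfolding filterlim_finite_subsets_at_top
    proof safe
      fix B assume B: "finite B" "B \<subseteq> A"
      have "\<forall>x\<in>B. \<exists>n. from_nat_into A n = x"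
        using B from_nat_into_surj[OF assms] by blast
      then obtain n where n: "\<And>x. x \<in> B \<Longrightarrow> from_nat_into A (n x) = x" by metis
      obtain N where N: "\<And>x. x \<in> B \<Longrightarrow> n x < N"
        using B(1) finite_nat_set_iff_bounded[of "n ` B"] by auto
      have "B \<subseteq> E k" if "k \<ge> N" for k
      proof
        fix x assume x: "x \<in> B"
        then show "x \<in> E k" using n[OF x] N[OF x] that unfolding E_def by (intro image_eqI[of _ _ "n x"]) auto
      qed
      then have "\<forall>\<^sub>F k in sequentially. B \<subseteq> E k" by (auto simp: eventually_sequentially)
      then show "\<forall>\<^sub>F k in sequentially. finite (E k) \<and> B \<subseteq> E k \<and> E k \<subseteq> A"
        by (rule eventually_mono) (use from_nat_into[OF False] in \<open>auto simp: E_def\<close>)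
    qed
  qed
qed

lemma countable_multi_indices: "countable (multi_indices m)"
proof (induction m)
  case 0
  then show ?case by (simp add: multi_indices_0)
next
  case (Suc m)
  then have "countable ((UNIV :: nat set) \<times> multi_indices m)" by (intro countable_SIGMA) auto
  then have "countable ((\<lambda>(n, \<alpha>). \<alpha> + Poly_Mapping.single m n) ` (UNIV \<times> multi_indices m))"
    by (rule countable_image)
  then show ?case by (simp only: bij_betw_imp_surj_on[OF multi_indices_Suc_bij])
qed

lemma has_sum_along:
  assumes "(f has_sum S) A" "filterlim E (finite_subsets_at_top A) sequentially"
  shows "(\<lambda>k. sum f (E k)) \<longlonglongrightarrow> S"
  using filterlim_compose[OF assms(1)[unfolded has_sum_def] assms(2)] .

definition polydisc_sum :: "((nat \<Rightarrow>\<^sub>0 nat) \<Rightarrow> 'x::complex_banach) \<Rightarrow> nat \<Rightarrow> (nat \<Rightarrow> complex) \<Rightarrow> 'x"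
  where "polydisc_sum c m z = infsum (\<lambda>\<alpha>. multi_power z \<alpha> *\<^sub>C c \<alpha>) (multi_indices m)"

lemma polydisc_sum_has_sum:
  assumes "\<And>\<alpha>. norm (c \<alpha>) \<le> M" "\<And>j. j < m \<Longrightarrow> cmod (z j) < 1"
  shows "((\<lambda>\<alpha>. multi_power z \<alpha> *\<^sub>C c \<alpha>) has_sum polydisc_sum c m z) (multi_indices m)"
  unfolding polydisc_sum_def
  by (intro has_sum_infsum abs_summable_summable[OF multi_power_series_abs_summable[where M = M]])
    (use assms in auto)

lemma polydisc_sum_cong:
  assumes "\<And>j. j < m \<Longrightarrow> z j = z' j"
  shows "polydisc_sum c m z = polydisc_sum c m z'"
  unfolding polydisc_sum_def
proof (rule infsum_cong)
  fix \<alpha> assume "\<alpha> \<in> multi_indices m"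
  then have "multi_power z \<alpha> = multi_power z' \<alpha>" by (rule multi_power_cong) (rule assms)
  then show "multi_power z \<alpha> *\<^sub>C c \<alpha> = multi_power z' \<alpha> *\<^sub>C c \<alpha>" by simp
qed

lemma polydisc_sum_restrict:
  assumes "m \<le> m'" "\<And>j. m \<le> j \<Longrightarrow> j < m' \<Longrightarrow> z j = 0"
  shows "polydisc_sum c m' z = polydisc_sum c m z"
  unfolding polydisc_sum_def
proof (rule infsum_cong_neutral)
  fix \<alpha> assume "\<alpha> \<in> multi_indices m' - multi_indices m"
  then obtain j where j: "j \<in> Poly_Mapping.keys \<alpha>" "m \<le> j" "j < m'"
    by (force simp: multi_indices_def)
  then have "z j ^ Poly_Mapping.lookup \<alpha> j = 0" using assms(2) by (simp add: in_keys_iff)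
  then have "multi_power z \<alpha> = 0" using j unfolding multi_power_def by (intro prod_zero) auto
  then show "multi_power z \<alpha> *\<^sub>C c \<alpha> = 0" by simp
qed (use multi_indices_mono[OF assms(1)] in auto)

text \<open>
  Partial sums are polynomials in \<open>w\<close>. They are dominated by the absolutely convergent series at the
  point with coordinates \<open>\<bar>z j\<bar> + \<bar>h j\<bar> < 1\<close>, so their limit is weakly holomorphic.
\<close>

lemma polydisc_sum_along_line:
  assumes c: "\<And>\<alpha>. norm (c \<alpha>) \<le> M" and zh: "norm z + norm h < 1"
  shows "weakly_holomorphic (\<lambda>w. polydisc_sum c m (c0_nth (z + w *\<^sub>C h)))"
proof -
  obtain E where E: "\<And>k. finite (E k)" "\<And>k. E k \<subseteq> multi_indices m"
    "filterlim E (finite_subsets_at_top (multi_indices m)) sequentially"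
    using finite_exhaustion[OF countable_multi_indices] by blast
  define q where "q j = cmod (c0_nth z j) + cmod (c0_nth h j)" for j
  have q: "0 \<le> q j" "q j < 1" for j
    using cmod_c0_nth_le[of z j] cmod_c0_nth_le[of h j] zh by (auto simp: q_def)
  have nth: "c0_nth (z + w *\<^sub>C h) j = c0_nth z j + w * c0_nth h j" for w j
    by (simp add: plus_c0.rep_eq scaleC_c0.rep_eq)
  have nth_le: "cmod (c0_nth (z + w *\<^sub>C h) j) \<le> q j" if w: "cmod w < 1" for w j
  proof -
    have "cmod (c0_nth z j + w * c0_nth h j) \<le> cmod (c0_nth z j) + cmod w * cmod (c0_nth h j)"
      by (metis norm_mult norm_triangle_ineq)
    also have "\<dots> \<le> cmod (c0_nth z j) + 1 * cmod (c0_nth h j)"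
      using w by (intro add_left_mono mult_right_mono) auto
    finally show ?thesis by (simp add: q_def nth)
  qed
  define B where "B = infsum (\<lambda>\<alpha>. multi_power q \<alpha> * M) (multi_indices m)"
  have sB: "(\<lambda>\<alpha>. multi_power q \<alpha> * M) summable_on multi_indices m"
    by (intro summable_on_cmult_left multi_power_summable) (use q in auto)
  have M0: "M \<ge> 0" using c[of 0] norm_ge_zero order_trans by blast
  show ?thesis
  proof (rule weakly_holomorphic_limit)
    show "weakly_holomorphic (\<lambda>w. \<Sum>\<alpha>\<in>E k. multi_power (c0_nth (z + w *\<^sub>C h)) \<alpha> *\<^sub>C c \<alpha>)" for k
      unfolding multi_power_def nth
      by (intro weakly_holomorphic_sum weakly_holomorphic_scaleC weakly_holomorphic_const holomorphic_intros)
    fix w :: complex assume w: "cmod w < 1"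
    show "norm (\<Sum>\<alpha>\<in>E k. multi_power (c0_nth (z + w *\<^sub>C h)) \<alpha> *\<^sub>C c \<alpha>) \<le> B" for k
    proof -
      have "norm (\<Sum>\<alpha>\<in>E k. multi_power (c0_nth (z + w *\<^sub>C h)) \<alpha> *\<^sub>C c \<alpha>) \<le> (\<Sum>\<alpha>\<in>E k. multi_power q \<alpha> * M)"
      proof (rule sum_norm_le)
        fix \<alpha>
        have "cmod (multi_power (c0_nth (z + w *\<^sub>C h)) \<alpha>) \<le> multi_power q \<alpha>"
          unfolding norm_multi_power unfolding multi_power_def
          using nth_le[OF w] by (intro prod_mono conjI power_mono) auto
        then show "norm (multi_power (c0_nth (z + w *\<^sub>C h)) \<alpha> *\<^sub>C c \<alpha>) \<le> multi_power q \<alpha> * M"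
          unfolding norm_scaleC using c M0 multi_power_nonneg[of q \<alpha>] q by (intro mult_mono) auto
      qed
      also have "\<dots> \<le> B"
        unfolding B_def by (rule finite_sum_le_infsum[OF sB E(1,2)]) (use M0 q multi_power_nonneg in auto)
      finally show ?thesis .
    qed
    have "((\<lambda>\<alpha>. multi_power (c0_nth (z + w *\<^sub>C h)) \<alpha> *\<^sub>C c \<alpha>) has_sum
        polydisc_sum c m (c0_nth (z + w *\<^sub>C h))) (multi_indices m)"
      by (rule polydisc_sum_has_sum[OF c]) (use nth_le[OF w] q le_less_trans in blast)
    then show "(\<lambda>k. \<Sum>\<alpha>\<in>E k. multi_power (c0_nth (z + w *\<^sub>C h)) \<alpha> *\<^sub>C c \<alpha>)
        \<longlonglongrightarrow> polydisc_sum c m (c0_nth (z + w *\<^sub>C h))"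
      by (rule has_sum_along[OF _ E(3)])
  qed
qed

text \<open>
  Let all coordinates of \<open>x\<close> from the \<open>m\<close>-th on have modulus at most \<open>\<delta>\<close>. The truncations of \<open>x\<close> at \<open>m\<close> and
  at \<open>m' \<ge> m\<close> then have distance at most \<open>\<delta>\<close>, so their difference may be stretched by the factor \<open>d / \<delta>\<close>
  without leaving the ball. On the resulting disk the sum in \<open>m'\<close> variables is bounded by \<open>M\<close>, and by
  the Schwarz estimate its values at \<open>0\<close> and at \<open>\<delta> / d\<close>, which are the two sums in question, differ by at most
  \<open>2 M \<delta> / d\<close>. As \<open>x\<close> is a null sequence, \<open>\<delta>\<close> is small for large \<open>m\<close>.
\<close>

lemma polydisc_sums_Cauchy:
  assumes c: "\<And>\<alpha>. norm (c \<alpha>) \<le> M"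
    and M: "\<And>m z. (\<And>j. j < m \<Longrightarrow> cmod (z j) < 1) \<Longrightarrow> norm (polydisc_sum c m z) \<le> M"
    and x: "norm x < 1"
  shows "Cauchy (\<lambda>m. polydisc_sum c m (c0_nth x))"
proof -
  have M0: "M \<ge> 0" using c[of 0] norm_ge_zero order_trans by blast
  have xj: "cmod (c0_nth x j) < 1" for j using cmod_c0_nth_le[of x j] x by simp
  define d where "d = (1 - norm x) / 2"
  have d: "d > 0" "norm x + d < 1" using x by (auto simp: d_def field_simps)
  have step: "norm (polydisc_sum c m' (c0_nth x) - polydisc_sum c m (c0_nth x)) \<le> 2 * M * (\<delta> / d)"
    if mm: "m \<le> m'" and \<delta>: "0 < \<delta>" "\<delta> \<le> d / 2" "\<And>j. j \<ge> m \<Longrightarrow> cmod (c0_nth x j) \<le> \<delta>" for m m' \<delta>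
  proof -
    define z where "z = truncate_c0 m (c0_nth x)"
    define h where "h = complex_of_real (d / \<delta>) *\<^sub>C (truncate_c0 m' (c0_nth x) - z)"
    have "norm (truncate_c0 m' (c0_nth x) - z) \<le> \<delta>"
      by (rule norm_c0_le) (use \<delta> mm in \<open>auto simp: z_def minus_c0.rep_eq c0_nth_truncate\<close>)
    then have "norm h \<le> (d / \<delta>) * \<delta>"
      unfolding h_def norm_scaleC using d \<delta> by (intro mult_mono) (auto simp: norm_divide)
    then have h: "norm h \<le> d" using \<delta> by simp
    have "norm z \<le> norm x"
      by (rule norm_c0_le) (auto simp: z_def c0_nth_truncate intro: cmod_c0_nth_le)
    then have zh: "norm z + norm h < 1" using h d by simp
    have wh: "weakly_holomorphic (\<lambda>w. polydisc_sum c m' (c0_nth (z + w *\<^sub>C h)))"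
      by (rule polydisc_sum_along_line[OF c zh])
    have "norm (polydisc_sum c m' (c0_nth (z + w *\<^sub>C h))) \<le> M" if "cmod w < 1" for w
      by (rule M) (use cmod_c0_nth_le norm_scaleC_add_less[OF zh that] le_less_trans in blast)
    from weakly_holomorphic_Schwarz[OF wh this]
    have S: "norm (polydisc_sum c m' (c0_nth (z + w *\<^sub>C h)) - polydisc_sum c m' (c0_nth (z + 0 *\<^sub>C h)))
        \<le> 2 * M * cmod w" if "cmod w \<le> 1/2" for w using that by metis
    let ?w = "complex_of_real (\<delta> / d)"
    have "z + ?w *\<^sub>C h = truncate_c0 m' (c0_nth x)"
      using \<delta> d by (simp add: h_def scaleC_scaleC scaleC_one)
    then have "polydisc_sum c m' (c0_nth (z + ?w *\<^sub>C h)) = polydisc_sum c m' (c0_nth x)"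
      by (intro polydisc_sum_cong) (simp add: c0_nth_truncate)
    moreover have "polydisc_sum c m' (c0_nth z) = polydisc_sum c m (c0_nth z)"
      by (rule polydisc_sum_restrict[OF mm]) (simp add: z_def c0_nth_truncate)
    moreover have "polydisc_sum c m (c0_nth z) = polydisc_sum c m (c0_nth x)"
      by (rule polydisc_sum_cong) (simp add: z_def c0_nth_truncate)
    moreover have "cmod ?w = \<delta> / d" using \<delta> d by (simp add: norm_divide)
    moreover have "\<delta> / d \<le> 1/2" using \<delta> d by (simp add: field_simps)
    ultimately show ?thesis using S[of ?w] by simp
  qed
  show ?thesis
  proof (rule metric_CauchyI)
    fix e :: real assume e: "e > 0"
    define \<delta> where "\<delta> = min (d / 2) (e * d / (8 * (M + 1)))"
    have \<delta>: "\<delta> > 0" using d e M0 by (simp add: \<delta>_def)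
    have \<delta>2: "\<delta> \<le> d / 2" unfolding \<delta>_def by (rule min.cobounded1)
    have "\<delta> * (8 * (M + 1)) \<le> e * d"
      using M0 by (simp add: \<delta>_def flip: pos_le_divide_eq)
    then have "2 * M * (\<delta> / d) * 4 \<le> e" using d \<delta> M0 by (simp add: field_simps)
    then have small: "2 * M * (\<delta> / d) < e / 2" using e by simp
    obtain N where N: "\<And>j. j \<ge> N \<Longrightarrow> cmod (c0_nth x j) < \<delta>"
      using LIMSEQ_D[OF c0_nth_tendsto[of x] \<delta>] by auto
    have "dist (polydisc_sum c m (c0_nth x)) (polydisc_sum c N (c0_nth x)) < e / 2" if "m \<ge> N" for m
      using step[OF that \<delta> \<delta>2] N small by (auto simp: dist_norm less_imp_le intro: le_less_trans)
    then show "\<exists>N. \<forall>m\<ge>N. \<forall>n\<ge>N. dist (polydisc_sum c m (c0_nth x)) (polydisc_sum c n (c0_nth x)) < e"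
      by (metis dist_triangle_half_l)
  qed
qed

text \<open>
  The pointwise limit of the sums in \<open>m\<close> variables inherits their bound and their holomorphy along
  lines, and the latter implies holomorphy.
\<close>

lemma Hinf_ball_of_coefficients:
  assumes c: "\<And>\<alpha>. norm (c \<alpha>) \<le> M"
    and M: "\<And>m z. (\<And>j. j < m \<Longrightarrow> cmod (z j) < 1) \<Longrightarrow> norm (polydisc_sum c m z) \<le> M"
  obtains F where "F \<in> Hinf_ball" "\<And>m z. section_at F m z = polydisc_sum c m z"
proof -
  define F where "F x = lim (\<lambda>m. polydisc_sum c m (c0_nth x))" for x
  have lim: "(\<lambda>m. polydisc_sum c m (c0_nth x)) \<longlonglongrightarrow> F x" if "norm x < 1" for x
  proof -
    have "Cauchy (\<lambda>m. polydisc_sum c m (c0_nth x))"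
    proof (rule polydisc_sums_Cauchy[where c = c and M = M])
      show "norm (polydisc_sum c m z) \<le> M" if "\<And>j. j < m \<Longrightarrow> cmod (z j) < 1" for m z
        by (rule M) (rule that)
    qed (use c that in auto)
    then have "convergent (\<lambda>m. polydisc_sum c m (c0_nth x))" by (rule Cauchy_convergent)
    then show ?thesis unfolding F_def by (rule convergent_LIMSEQ_iff[THEN iffD1])
  qed
  have bd: "norm (polydisc_sum c m (c0_nth x)) \<le> M" if "norm x < 1" for m x
    by (rule M, rule le_less_trans[OF cmod_c0_nth_le that])
  have F_le: "norm (F x) \<le> M" if "norm x < 1" for x
    using tendsto_norm[OF lim[OF that]] by (rule LIMSEQ_le_const2) (use bd[OF that] in blast)
  have "line_holomorphic F"
    unfolding line_holomorphic_def
  proof safe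
    fix z h :: c0 assume zh: "norm z + norm h < 1"
    show "weakly_holomorphic (\<lambda>w. F (z + w *\<^sub>C h))"
      by (rule weakly_holomorphic_limit[where f = "\<lambda>m w. polydisc_sum c m (c0_nth (z + w *\<^sub>C h))" and M = M])
        (use polydisc_sum_along_line[OF c zh] bd lim norm_scaleC_add_less[OF zh] in auto)
  qed
  then have "F \<in> Hinf_ball"
    unfolding Hinf_ball_def bounded_iff
    by (auto intro!: exI[of _ M] line_holomorphic_imp_holomorphic_at F_le)
  moreover have "section_at F m z = polydisc_sum c m z" for m z
  proof -
    have "polydisc_sum c m' (c0_nth (truncate_c0 m z)) = polydisc_sum c m z" if "m' \<ge> m" for m'
    proof -
      have "polydisc_sum c m' (c0_nth (truncate_c0 m z)) = polydisc_sum c m (c0_nth (truncate_c0 m z))"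
        by (rule polydisc_sum_restrict[OF that]) (simp add: c0_nth_truncate)
      also have "\<dots> = polydisc_sum c m z"
        by (rule polydisc_sum_cong) (simp add: c0_nth_truncate)
      finally show ?thesis .
    qed
    then have "(\<lambda>m'. polydisc_sum c m' (c0_nth (truncate_c0 m z))) \<longlonglongrightarrow> polydisc_sum c m z"
      by (intro tendsto_eventually) (auto simp: eventually_sequentially)
    then show ?thesis unfolding section_at_truncate F_def by (rule limI)
  qed
  ultimately show ?thesis using that by blast
qed

section \<open>Strong integrals of bounded functions\<close>

lemma functional_continuous: "contractive_functional \<phi> \<Longrightarrow> f \<longlonglongrightarrow> l \<Longrightarrow> (\<lambda>i. \<phi> (f i)) \<longlonglongrightarrow> \<phi> l"
  using bounded_linear.tendsto[OF functional_bounded_linear] by blast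

lemma strongly_measurable_functional:
  assumes f: "strongly_measurable M f" and \<phi>: "contractive_functional \<phi>"
  shows "(\<lambda>x. \<phi> (f x)) \<in> borel_measurable M"
proof -
  obtain s where s: "\<And>i. simple_function M (s i)" "\<And>x. x \<in> space M \<Longrightarrow> (\<lambda>i. s i x) \<longlonglongrightarrow> f x"
    using f by (auto simp: strongly_measurable_def)
  show ?thesis
  proof (rule borel_measurable_LIMSEQ_metric)
    show "(\<lambda>x. \<phi> (s i x)) \<in> borel_measurable M" for i
      by (rule borel_measurable_simple_function, rule simple_function_compose1[OF s(1)])
    show "(\<lambda>i. \<phi> (s i x)) \<longlonglongrightarrow> \<phi> (f x)" if "x \<in> space M" for x
      by (rule functional_continuous[OF \<phi> s(2)[OF that]])
  qed
qed

lemma strongly_measurable_norm: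
  fixes f :: "'a \<Rightarrow> 'x::real_normed_vector"
  assumes f: "strongly_measurable M f"
  shows "(\<lambda>x. norm (f x)) \<in> borel_measurable M"
proof -
  obtain s where s: "\<And>i. simple_function M (s i)" "\<And>x. x \<in> space M \<Longrightarrow> (\<lambda>i. s i x) \<longlonglongrightarrow> f x"
    using f by (auto simp: strongly_measurable_def)
  show ?thesis
  proof (rule borel_measurable_LIMSEQ_metric)
    show "(\<lambda>x. norm (s i x)) \<in> borel_measurable M" for i
      by (rule borel_measurable_simple_function, rule simple_function_compose1[OF s(1)])
    show "(\<lambda>i. norm (s i x)) \<longlonglongrightarrow> norm (f x)" if "x \<in> space M" for x
      by (rule tendsto_norm[OF s(2)[OF that]])
  qed
qed

lemma strongly_measurable_simple: "simple_function M f \<Longrightarrow> strongly_measurable M f"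
  unfolding strongly_measurable_def by (intro exI[of _ "\<lambda>_. f"]) auto

lemma strongly_measurable_diff:
  fixes f g :: "'a \<Rightarrow> 'x::real_normed_vector"
  assumes f: "strongly_measurable M f" and g: "strongly_measurable M g"
  shows "strongly_measurable M (\<lambda>x. f x - g x)"
proof -
  obtain s where s: "\<And>i. simple_function M (s i)" "\<And>x. x \<in> space M \<Longrightarrow> (\<lambda>i. s i x) \<longlonglongrightarrow> f x"
    using f by (auto simp: strongly_measurable_def)
  obtain t where t: "\<And>i. simple_function M (t i)" "\<And>x. x \<in> space M \<Longrightarrow> (\<lambda>i. t i x) \<longlonglongrightarrow> g x"
    using g by (auto simp: strongly_measurable_def)
  show ?thesis
    unfolding strongly_measurable_def
  proof (intro exI[of _ "\<lambda>i x. s i x - t i x"] conjI allI ballI)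
    show "simple_function M (\<lambda>x. s i x - t i x)" for i
      by (rule simple_function_compose2[OF s(1) t(1), of "\<lambda>a b. a - b"])
    show "(\<lambda>i. s i x - t i x) \<longlonglongrightarrow> f x - g x" if "x \<in> space M" for x
      by (intro tendsto_diff s t that)
  qed
qed

lemma strongly_measurable_scaleC:
  fixes f :: "'a \<Rightarrow> 'x::complex_normed_vector"
  assumes a: "a \<in> borel_measurable M" and f: "strongly_measurable M f"
  shows "strongly_measurable M (\<lambda>x. a x *\<^sub>C f x)"
proof -
  obtain s where s: "\<And>i. simple_function M (s i)" "\<And>x. x \<in> space M \<Longrightarrow> (\<lambda>i. s i x) \<longlonglongrightarrow> f x"
    using f by (auto simp: strongly_measurable_def)
  obtain t where t: "\<And>i. simple_function M (t i)" "\<And>x. x \<in> space M \<Longrightarrow> (\<lambda>i. t i x) \<longlonglongrightarrow> a x"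
    using borel_measurable_implies_sequence_metric[OF a, of 0] by metis
  show ?thesis
    unfolding strongly_measurable_def
  proof (intro exI[of _ "\<lambda>i x. t i x *\<^sub>C s i x"] conjI allI ballI)
    show "simple_function M (\<lambda>x. t i x *\<^sub>C s i x)" for i
      by (rule simple_function_compose2[OF t(1) s(1), of "\<lambda>a b. a *\<^sub>C b"])
    show "(\<lambda>i. t i x *\<^sub>C s i x) \<longlonglongrightarrow> a x *\<^sub>C f x" if "x \<in> space M" for x
      by (rule bounded_bilinear.tendsto[OF bounded_bilinear_scaleC t(2)[OF that] s(2)[OF that]])
  qed
qed

text \<open>
  A contractive functional maps simple functions that approximate in mean to such functions again.
\<close>

lemma has_strong_integral_functional:
  fixes f :: "'a \<Rightarrow> 'x::complex_normed_vector"
  assumes f: "has_strong_integral M f I" and \<phi>: "contractive_functional \<phi>"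
  shows "has_bochner_integral M (\<lambda>x. \<phi> (f x)) (\<phi> I)"
proof -
  obtain s where sm: "strongly_measurable M f" and s: "\<And>i. Bochner_Integration.simple_bochner_integrable M (s i)"
    "(\<lambda>i. \<integral>\<^sup>+x. ennreal (norm (f x - s i x)) \<partial>M) \<longlonglongrightarrow> 0"
    "(\<lambda>i. Bochner_Integration.simple_bochner_integral M (s i)) \<longlonglongrightarrow> I"
    using f by (auto simp: has_strong_integral_def)
  show ?thesis
  proof (rule has_bochner_integral.intros)
    show "(\<lambda>x. \<phi> (f x)) \<in> borel_measurable M" by (rule strongly_measurable_functional[OF sm \<phi>])
    show "Bochner_Integration.simple_bochner_integrable M (\<lambda>x. \<phi> (s i x))" for i
      by (rule simple_bochner_integrable_compose2[of "\<lambda>x y. \<phi> x", OF _ s(1) s(1)])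
        (simp add: functional_zero[OF \<phi>])
    show "(\<lambda>i. \<integral>\<^sup>+x. ennreal (norm (\<phi> (f x) - \<phi> (s i x))) \<partial>M) \<longlonglongrightarrow> 0"
    proof (rule tendsto_sandwich[OF _ _ tendsto_const s(2)])
      show "\<forall>\<^sub>F i in sequentially. (\<integral>\<^sup>+x. ennreal (norm (\<phi> (f x) - \<phi> (s i x))) \<partial>M)
          \<le> (\<integral>\<^sup>+x. ennreal (norm (f x - s i x)) \<partial>M)"
        by (intro always_eventually allI nn_integral_mono ennreal_leI)
          (metis functional_diff[OF \<phi>] functional_contractive[OF \<phi>])
    qed auto
    have "Bochner_Integration.simple_bochner_integral M (\<lambda>x. \<phi> (s i x)) = \<phi> (Bochner_Integration.simple_bochner_integral M (s i))" for i
      by (rule simple_bochner_integral_linear[OF bounded_linear.linear[OF functional_bounded_linear[OF \<phi>]] s(1)])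
    then show "(\<lambda>i. Bochner_Integration.simple_bochner_integral M (\<lambda>x. \<phi> (s i x))) \<longlonglongrightarrow> \<phi> I"
      using functional_continuous[OF \<phi> s(3)] by simp
  qed
qed

lemma has_strong_integral_unique:
  fixes f :: "'a \<Rightarrow> 'x::complex_normed_vector"
  assumes "has_strong_integral M f I" "has_strong_integral M f J"
  shows "I = J"
proof (rule functional_eqI)
  fix \<phi> :: "'x \<Rightarrow> complex" assume \<phi>: "contractive_functional \<phi>"
  show "\<phi> I = \<phi> J"
    using has_strong_integral_functional[OF assms(1) \<phi>] has_strong_integral_functional[OF assms(2) \<phi>]
    by (rule has_bochner_integral_eq)
qed

lemma simple_bochner_integral_dist_le:
  fixes s t :: "'a \<Rightarrow> 'x::real_normed_vector"
  assumes s: "Bochner_Integration.simple_bochner_integrable M s" and t: "Bochner_Integration.simple_bochner_integrable M t"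
    and f: "strongly_measurable M f"
  shows "ennreal (norm (Bochner_Integration.simple_bochner_integral M s - Bochner_Integration.simple_bochner_integral M t))
    \<le> (\<integral>\<^sup>+x. ennreal (norm (f x - s x)) \<partial>M) + (\<integral>\<^sup>+x. ennreal (norm (f x - t x)) \<partial>M)"
proof -
  have st: "Bochner_Integration.simple_bochner_integrable M (\<lambda>x. s x - t x)"
    by (rule simple_bochner_integrable_compose2[of "\<lambda>x y. x - y", OF _ s t]) simp
  have nst: "Bochner_Integration.simple_bochner_integrable M (\<lambda>x. norm (s x - t x))"
    by (rule simple_bochner_integrable_compose2[of "\<lambda>x y. norm x", OF _ st st]) simp
  have sm: "strongly_measurable M s" "strongly_measurable M t"
    using s t by (auto elim!: simple_bochner_integrable.cases intro: strongly_measurable_simple)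
  have "norm (Bochner_Integration.simple_bochner_integral M s - Bochner_Integration.simple_bochner_integral M t)
      \<le> Bochner_Integration.simple_bochner_integral M (\<lambda>x. norm (s x - t x))"
    using simple_bochner_integral_norm_bound[OF st] by (simp add: simple_bochner_integral_diff[OF s t])
  then have "ennreal (norm (Bochner_Integration.simple_bochner_integral M s - Bochner_Integration.simple_bochner_integral M t))
      \<le> ennreal (Bochner_Integration.simple_bochner_integral M (\<lambda>x. norm (s x - t x)))"
    by (rule ennreal_leI)
  also have "\<dots> = (\<integral>\<^sup>+x. ennreal (norm (s x - t x)) \<partial>M)"
    by (rule simple_bochner_integral_eq_nn_integral[OF nst]) simp
  also have "\<dots> \<le> (\<integral>\<^sup>+x. ennreal (norm (f x - s x)) + ennreal (norm (f x - t x)) \<partial>M)"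
  proof (rule nn_integral_mono)
    fix x
    have "norm (s x - t x) \<le> norm (f x - s x) + norm (f x - t x)"
      using norm_triangle_ineq4[of "f x - t x" "f x - s x"] by simp
    then show "ennreal (norm (s x - t x)) \<le> ennreal (norm (f x - s x)) + ennreal (norm (f x - t x))"
      by (simp flip: ennreal_plus add: ennreal_leI)
  qed
  also have "\<dots> = (\<integral>\<^sup>+x. ennreal (norm (f x - s x)) \<partial>M) + (\<integral>\<^sup>+x. ennreal (norm (f x - t x)) \<partial>M)"
    using measurable_compose[OF strongly_measurable_norm[OF strongly_measurable_diff[OF f sm(1)]] measurable_ennreal]
      measurable_compose[OF strongly_measurable_norm[OF strongly_measurable_diff[OF f sm(2)]] measurable_ennreal]
    by (rule nn_integral_add)
  finally show ?thesis .
qed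

text \<open>
  Simple functions that converge to \<open>f\<close> pointwise may be unbounded. Cutting them off at the height \<open>\<bar>B\<bar> + 1\<close>
  does not affect the limit where \<open>norm (f x) \<le> B\<close>, and makes dominated convergence applicable.
\<close>

lemma (in prob_space) simple_approximation_in_mean:
  fixes f :: "'a \<Rightarrow> 'x::real_normed_vector"
  assumes f: "strongly_measurable M f" and B: "AE x in M. norm (f x) \<le> B"
  obtains s where "\<And>i. Bochner_Integration.simple_bochner_integrable M (s i)"
    "(\<lambda>i. \<integral>\<^sup>+x. ennreal (norm (f x - s i x)) \<partial>M) \<longlonglongrightarrow> 0"
proof -
  obtain t where t: "\<And>i. simple_function M (t i)" "\<And>x. x \<in> space M \<Longrightarrow> (\<lambda>i. t i x) \<longlonglongrightarrow> f x"
    using f by (auto simp: strongly_measurable_def)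
  define cut where "cut y = (if norm y \<le> \<bar>B\<bar> + 1 then y else 0)" for y :: 'x
  define s where "s i x = cut (t i x)" for i x
  have ss: "simple_function M (s i)" for i
    unfolding s_def by (rule simple_function_compose1[OF t(1)])
  have s_le: "norm (s i x) \<le> \<bar>B\<bar> + 1" for i x by (simp add: s_def cut_def)
  have lim: "(\<lambda>i. s i x) \<longlonglongrightarrow> f x" if x: "x \<in> space M" "norm (f x) \<le> B" for x
  proof -
    have "(\<lambda>i. norm (t i x)) \<longlonglongrightarrow> norm (f x)" by (rule tendsto_norm[OF t(2)[OF x(1)]])
    then have "\<forall>\<^sub>F i in sequentially. norm (t i x) < \<bar>B\<bar> + 1"
      by (rule order_tendstoD) (use x in auto)
    then have "\<forall>\<^sub>F i in sequentially. t i x = s i x"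
      by (rule eventually_mono) (simp add: s_def cut_def)
    then show ?thesis using t(2)[OF x(1)] by (rule Lim_transform_eventually[rotated])
  qed
  show ?thesis
  proof (rule that[of s])
    show "Bochner_Integration.simple_bochner_integrable M (s i)" for i
      using ss by (intro simple_bochner_integrable.intros) auto
    have m: "(\<lambda>x. norm (f x - s i x)) \<in> borel_measurable M" for i
      by (rule strongly_measurable_norm[OF strongly_measurable_diff[OF f strongly_measurable_simple[OF ss]]])
    have "(\<lambda>i. \<integral>\<^sup>+x. ennreal (norm (0 - norm (f x - s i x))) \<partial>M) \<longlonglongrightarrow> 0"
    proof (rule nn_integral_dominated_convergence_norm[where w = "\<lambda>_. 2 * \<bar>B\<bar> + 1"])
      show "(\<lambda>x. norm (f x - s i x)) \<in> borel_measurable M" for i by (rule m)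
      show "AE x in M. norm (norm (f x - s j x)) \<le> 2 * \<bar>B\<bar> + 1" for j
        using B
      proof (rule AE_mp, intro AE_I2 impI)
        fix x assume "norm (f x) \<le> B"
        then show "norm (norm (f x - s j x)) \<le> 2 * \<bar>B\<bar> + 1"
          using norm_triangle_ineq4[of "f x" "s j x"] s_le[of j x] by simp
      qed
      show "(\<integral>\<^sup>+x. ennreal (2 * \<bar>B\<bar> + 1) \<partial>M) < \<infinity>" by (simp add: emeasure_space_1)
      show "AE x in M. (\<lambda>i. norm (f x - s i x)) \<longlonglongrightarrow> 0"
        using B
      proof (rule AE_mp, intro AE_I2 impI)
        fix x assume "x \<in> space M" "norm (f x) \<le> B"
        from tendsto_norm[OF tendsto_diff[OF tendsto_const lim[OF this], of "f x"]]
        show "(\<lambda>i. norm (f x - s i x)) \<longlonglongrightarrow> 0" by simp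
      qed
    qed auto
    then show "(\<lambda>i. \<integral>\<^sup>+x. ennreal (norm (f x - s i x)) \<partial>M) \<longlonglongrightarrow> 0" by simp
  qed
qed

text \<open>
  The integrals of simple functions that approximate \<open>f\<close> in mean form a Cauchy sequence, so the strong
  integral exists. By this rule it is accessible through scalar integrals.
\<close>

lemma (in prob_space) strong_integral_functional:
  fixes f :: "'a \<Rightarrow> 'x::complex_banach"
  assumes f: "strongly_measurable M f" and B: "AE x in M. norm (f x) \<le> B"
    and \<phi>: "contractive_functional \<phi>"
  shows "\<phi> (strong_integral M f) = (\<integral>x. \<phi> (f x) \<partial>M)"
proof -
  obtain s where s: "\<And>i. Bochner_Integration.simple_bochner_integrable M (s i)"
    "(\<lambda>i. \<integral>\<^sup>+x. ennreal (norm (f x - s i x)) \<partial>M) \<longlonglongrightarrow> 0"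
    using simple_approximation_in_mean[OF f B] by metis
  have "Cauchy (\<lambda>i. Bochner_Integration.simple_bochner_integral M (s i))"
  proof (rule metric_CauchyI)
    fix e :: real assume e: "e > 0"
    then have "\<forall>\<^sub>F i in sequentially. (\<integral>\<^sup>+x. ennreal (norm (f x - s i x)) \<partial>M) < ennreal (e / 2)"
      by (intro order_tendstoD(2)[OF s(2)]) (use e in simp)
    then obtain N where N: "\<And>i. i \<ge> N \<Longrightarrow> (\<integral>\<^sup>+x. ennreal (norm (f x - s i x)) \<partial>M) < ennreal (e / 2)"
      by (auto simp: eventually_sequentially)
    have "dist (Bochner_Integration.simple_bochner_integral M (s i)) (Bochner_Integration.simple_bochner_integral M (s j)) < e"
      if "i \<ge> N" "j \<ge> N" for i j
    proof -
      have "ennreal (norm (Bochner_Integration.simple_bochner_integral M (s i) - Bochner_Integration.simple_bochner_integral M (s j)))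
          \<le> (\<integral>\<^sup>+x. ennreal (norm (f x - s i x)) \<partial>M) + (\<integral>\<^sup>+x. ennreal (norm (f x - s j x)) \<partial>M)"
        by (rule simple_bochner_integral_dist_le[OF s(1) s(1) f])
      also have "\<dots> < ennreal (e / 2) + ennreal (e / 2)"
        by (intro add_strict_mono N that)
      also have "\<dots> = ennreal e" using e by (simp flip: ennreal_plus)
      finally show ?thesis using e by (simp add: dist_norm ennreal_less_iff)
    qed
    then show "\<exists>N. \<forall>i\<ge>N. \<forall>j\<ge>N. dist (Bochner_Integration.simple_bochner_integral M (s i)) (Bochner_Integration.simple_bochner_integral M (s j)) < e"
      by blast
  qed
  then obtain I where "(\<lambda>i. Bochner_Integration.simple_bochner_integral M (s i)) \<longlonglongrightarrow> I"
    using Cauchy_convergent_iff convergent_def by blast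
  then have I: "has_strong_integral M f I"
    unfolding has_strong_integral_def using f s by blast
  then have "strong_integral M f = I"
    unfolding strong_integral_def by (intro the_equality) (auto dest: has_strong_integral_unique)
  then show ?thesis
    using has_strong_integral_functional[OF I \<phi>] by (simp add: has_bochner_integral_integral_eq)
qed

section \<open>Integration over the torus\<close>

lemma measurable_cis [measurable]: "cis \<in> borel_measurable borel"
  by (intro borel_measurable_continuous_onI continuous_intros)

lemma circle_param_measurable:
  "(\<lambda>t. cis (2 * pi * t)) \<in> measurable (uniform_measure lborel {0..1::real}) (restrict_space borel (sphere 0 1))"
  by (rule measurable_restrict_space2) (auto simp: uniform_measure_def)

lemma prob_space_circle: "prob_space circle_measure"
  unfolding circle_measure_def
  by (intro prob_space.prob_space_distr[OF prob_space_uniform_measure] circle_param_measurable) auto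

lemma space_circle: "space circle_measure = sphere 0 1"
  by (simp add: circle_measure_def space_restrict_space)

lemma sets_circle: "sets circle_measure = sets (restrict_space borel (sphere 0 1))"
  by (simp add: circle_measure_def)

lemma circle_character_integral: "(\<integral>w. w powi n \<partial>circle_measure) = (if n = 0 then 1 else 0)"
proof -
  have meas: "(\<lambda>w::complex. w powi n) \<in> borel_measurable (restrict_space borel (sphere 0 1))"
    by (cases "n \<ge> 0") (auto simp: power_int_def intro!: measurable_restrict_space1)
  have "(\<integral>w. w powi n \<partial>circle_measure) = (\<integral>t. cis (2 * pi * t) powi n \<partial>uniform_measure lborel {0..1::real})"
    unfolding circle_measure_def by (rule integral_distr[OF circle_param_measurable meas])
  also have "\<dots> = (\<integral>t. indicator {0..1} t *\<^sub>R (cis (2 * pi * t) powi n) \<partial>lborel)"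
  proof -
    have u: "uniform_measure lborel {0..1::real} = density lborel (\<lambda>t. ennreal (indicator {0..1} t))"
      by (simp add: uniform_measure_def divide_ennreal_def ennreal_indicator)
    show ?thesis
      unfolding u by (rule integral_density) (auto simp: power_int_def)
  qed
  also have "\<dots> = (\<integral>t. indicator {0..1} t *\<^sub>R cis (2 * pi * of_int n * t) \<partial>lborel)"
    by (intro Bochner_Integration.integral_cong refl) (simp add: cis_power_int mult_ac)
  also have "\<dots> = (if n = 0 then 1 else 0)"
  proof (cases "n = 0")
    case True
    then show ?thesis by (simp add: complex_eq_iff)
  next
    case False
    define F where "F t = cis (2 * pi * of_int n * t) / (2 * pi * of_int n * \<i>)" for t
    have "(\<integral>t. indicator {0..1} t *\<^sub>R cis (2 * pi * of_int n * t) \<partial>lborel) = F 1 - F 0"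
    proof (rule integral_FTC_Icc)
      show "(F has_vector_derivative cis (2 * pi * of_int n * t)) (at t within {0..1})" for t
      proof -
        have "((\<lambda>t. cis (2 * pi * of_int n * t)) has_vector_derivative
            (2 * pi * of_int n) *\<^sub>R (\<i> * cis (2 * pi * of_int n * t))) (at t within {0..1})"
          by (auto intro!: derivative_eq_intros simp: has_vector_derivative_def)
        from has_vector_derivative_divide[OF this, of "2 * pi * of_int n * \<i>"]
        show ?thesis using False unfolding F_def by (simp add: scaleR_conv_of_real)
      qed
      show "continuous_on {0..1} (\<lambda>t. cis (2 * pi * of_int n * t))" by (intro continuous_intros)
    qed simp
    moreover have "cis (2 * pi * of_int n) = 1" by (rule cis_multiple_2pi) simp
    then have "F 1 - F 0 = 0" by (simp add: F_def)
    ultimately show ?thesis using False by simp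
  qed
  finally show ?thesis .
qed

interpretation torus: product_prob_space "\<lambda>_::nat. circle_measure" UNIV
proof -
  interpret prob_space circle_measure by (rule prob_space_circle)
  show "product_prob_space (\<lambda>_::nat. circle_measure)" by unfold_locales
qed

lemma prob_space_torus: "prob_space torus_measure"
  unfolding torus_measure_def by (rule torus.prob_space_axioms)

interpretation T: prob_space torus_measure
  by (rule prob_space_torus)

lemma space_torus: "\<omega> \<in> space torus_measure \<longleftrightarrow> (\<forall>j. cmod (\<omega> j) = 1)"
  by (auto simp: torus_measure_def space_PiM space_circle PiE_def Pi_def)

lemma measurable_coordinate_circle: "(\<lambda>\<omega>. \<omega> j) \<in> measurable torus_measure circle_measure"
  unfolding torus_measure_def by measurable

lemma measurable_coordinate [measurable]: "(\<lambda>\<omega>. \<omega> j) \<in> borel_measurable torus_measure"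
proof -
  have "(\<lambda>w. w) \<in> measurable circle_measure borel"
    unfolding measurable_cong_sets[OF sets_circle refl] by (rule measurable_restrict_space1) simp
  from measurable_compose[OF measurable_coordinate_circle this] show ?thesis .
qed

lemma measurable_multi_powi [measurable]: "(\<lambda>\<omega>. multi_powi \<omega> \<alpha>) \<in> borel_measurable torus_measure"
  unfolding multi_powi_def power_int_def by measurable

text \<open>
  The integrand depends on the coordinates in \<open>J\<close> alone, so the integral is one over a finite product
  of circles.
\<close>

lemma torus_product_integral:
  fixes f :: "nat \<Rightarrow> complex \<Rightarrow> complex"
  assumes J: "finite J" and f: "\<And>j. j \<in> J \<Longrightarrow> integrable circle_measure (f j)"
  shows "(\<integral>\<omega>. (\<Prod>j\<in>J. f j (\<omega> j)) \<partial>torus_measure) = (\<Prod>j\<in>J. \<integral>w. f j w \<partial>circle_measure)"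
proof -
  have m: "(\<lambda>\<omega>. restrict \<omega> J) \<in> measurable (PiM UNIV (\<lambda>_. circle_measure)) (PiM J (\<lambda>_. circle_measure))"
    by (rule measurable_restrict_subset) simp
  have "(\<integral>\<omega>. (\<Prod>j\<in>J. f j (\<omega> j)) \<partial>torus_measure) = (\<integral>\<omega>. (\<Prod>j\<in>J. f j (restrict \<omega> J j)) \<partial>torus_measure)"
    by (intro Bochner_Integration.integral_cong prod.cong refl) simp
  also have "\<dots> = (\<integral>x. (\<Prod>j\<in>J. f j (x j)) \<partial>distr (PiM UNIV (\<lambda>_. circle_measure)) (PiM J (\<lambda>_. circle_measure)) (\<lambda>\<omega>. restrict \<omega> J))"
    unfolding torus_measure_def
  proof (rule integral_distr[symmetric, OF m])
    show "(\<lambda>x. \<Prod>j\<in>J. f j (x j)) \<in> borel_measurable (PiM J (\<lambda>_. circle_measure))"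
    proof (rule borel_measurable_prod)
      fix j assume j: "j \<in> J"
      have "f j \<in> borel_measurable circle_measure" using f[OF j] by (rule borel_measurable_integrable)
      from measurable_compose[OF measurable_component_singleton[OF j, of "\<lambda>_. circle_measure"] this]
      show "(\<lambda>x. f j (x j)) \<in> borel_measurable (PiM J (\<lambda>_. circle_measure))" .
    qed
  qed
  also have "\<dots> = (\<integral>x. (\<Prod>j\<in>J. f j (x j)) \<partial>PiM J (\<lambda>_. circle_measure))"
    by (subst torus.distr_PiM_restrict_finite[OF J]) auto
  also have "\<dots> = (\<Prod>j\<in>J. \<integral>w. f j w \<partial>circle_measure)"
    by (rule torus.product_integral_prod[OF J f])
  finally show ?thesis .
qed

lemma torus_character_integral: "(\<integral>\<omega>. multi_powi \<omega> \<alpha> \<partial>torus_measure) = (if \<alpha> = 0 then 1 else 0)"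
proof -
  have int: "integrable circle_measure (\<lambda>w. w powi n)" for n
  proof (rule finite_measure.integrable_const_bound[where B = 1])
    show "finite_measure circle_measure" using prob_space_circle by (simp add: prob_space_def)
    show "AE w in circle_measure. norm (w powi n) \<le> 1"
      by (intro AE_I2) (simp add: space_circle norm_power_int)
    show "(\<lambda>w. w powi n) \<in> borel_measurable circle_measure"
      unfolding measurable_cong_sets[OF sets_circle refl]
      by (cases "n \<ge> 0") (auto simp: power_int_def intro!: measurable_restrict_space1)
  qed
  have "(\<integral>\<omega>. multi_powi \<omega> \<alpha> \<partial>torus_measure)
      = (\<Prod>j\<in>Poly_Mapping.keys \<alpha>. if Poly_Mapping.lookup \<alpha> j = 0 then 1 else 0)"
    unfolding multi_powi_def by (subst torus_product_integral) (simp_all add: int circle_character_integral)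
  also have "\<dots> = (if \<alpha> = 0 then 1 else 0)"
  proof (cases "\<alpha> = 0")
    case False
    then obtain j where "j \<in> Poly_Mapping.keys \<alpha>" by fastforce
    then have "(\<Prod>j\<in>Poly_Mapping.keys \<alpha>. if Poly_Mapping.lookup \<alpha> j = 0 then 1 else 0) = (0 :: complex)"
      by (intro prod_zero) (auto simp: in_keys_iff intro!: bexI[of _ j])
    then show ?thesis using False by simp
  qed simp
  finally show ?thesis .
qed

lemma multi_powi_eq_prod:
  assumes "finite S" "Poly_Mapping.keys \<alpha> \<subseteq> S"
  shows "multi_powi \<omega> \<alpha> = (\<Prod>j\<in>S. \<omega> j powi Poly_Mapping.lookup \<alpha> j)"
  unfolding multi_powi_def using assms
  by (intro prod.mono_neutral_left) (auto simp: in_keys_iff)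

lemma multi_powi_single: "multi_powi \<omega> (Poly_Mapping.single j n) = \<omega> j powi n"
  using multi_powi_eq_prod[of "{j}" "Poly_Mapping.single j n" \<omega>] by simp

lemma multi_powi_add:
  assumes "\<And>j. \<omega> j \<noteq> 0"
  shows "multi_powi \<omega> (\<alpha> + \<beta>) = multi_powi \<omega> \<alpha> * multi_powi \<omega> \<beta>"
proof -
  let ?S = "Poly_Mapping.keys \<alpha> \<union> Poly_Mapping.keys \<beta>"
  have "multi_powi \<omega> (\<alpha> + \<beta>) = (\<Prod>j\<in>?S. \<omega> j powi Poly_Mapping.lookup (\<alpha> + \<beta>) j)"
    by (rule multi_powi_eq_prod) (use keys_add[of \<alpha> \<beta>] in auto)
  also have "\<dots> = (\<Prod>j\<in>?S. \<omega> j powi Poly_Mapping.lookup \<alpha> j) * (\<Prod>j\<in>?S. \<omega> j powi Poly_Mapping.lookup \<beta> j)"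
    using assms by (simp add: lookup_add power_int_add prod.distrib)
  also have "\<dots> = multi_powi \<omega> \<alpha> * multi_powi \<omega> \<beta>"
    by (simp flip: multi_powi_eq_prod)
  finally show ?thesis .
qed

lemma norm_multi_powi: "\<omega> \<in> space torus_measure \<Longrightarrow> cmod (multi_powi \<omega> \<alpha>) = 1"
  by (simp add: multi_powi_def space_torus norm_power_int flip: prod_norm)

lemma torus_nonzero: "\<omega> \<in> space torus_measure \<Longrightarrow> \<omega> j \<noteq> 0"
  by (metis norm_zero space_torus zero_neq_one)

lemma lookup_map_int: "Poly_Mapping.lookup (Poly_Mapping.map int \<beta>) j = int (Poly_Mapping.lookup \<beta> j)"
  by (simp add: Poly_Mapping.map.rep_eq when_def)

lemma map_int_inject: "Poly_Mapping.map int \<alpha> = Poly_Mapping.map int \<beta> \<longleftrightarrow> \<alpha> = \<beta>"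
  by (auto simp: poly_mapping_eq_iff fun_eq_iff lookup_map_int)

lemma multi_powi_map_int: "multi_powi \<omega> (Poly_Mapping.map int \<beta>) = multi_power \<omega> \<beta>"
proof -
  have "Poly_Mapping.keys (Poly_Mapping.map int \<beta>) = Poly_Mapping.keys \<beta>"
    by (auto simp: in_keys_iff lookup_map_int)
  then show ?thesis by (simp add: multi_powi_def multi_power_def lookup_map_int)
qed

lemma nonneg_index_is_map_int:
  assumes "\<And>j. Poly_Mapping.lookup \<alpha> j \<ge> (0::int)"
  shows "\<alpha> = Poly_Mapping.map int (Poly_Mapping.map nat \<alpha>)"
proof (rule poly_mapping_eqI)
  fix k
  show "Poly_Mapping.lookup \<alpha> k = Poly_Mapping.lookup (Poly_Mapping.map int (Poly_Mapping.map nat \<alpha>)) k"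
    using assms[of k] by (simp add: lookup_map_int Poly_Mapping.map.rep_eq when_def)
qed

section \<open>Fourier coefficients of bounded functions\<close>

text \<open>
  The torus has positive measure, so an essential supremum of norms is nonnegative and its real part
  is meaningful as soon as it is bounded above.
\<close>

lemma Linf_torusI:
  assumes f: "strongly_measurable torus_measure f" and B: "AE \<omega> in torus_measure. norm (f \<omega>) \<le> B"
  shows "f \<in> Linf_torus" "norm_Linf_torus f \<le> B"
proof -
  have [measurable]: "(\<lambda>\<omega>. norm (f \<omega>)) \<in> borel_measurable torus_measure" by (rule strongly_measurable_norm[OF f])
  have le: "esssup torus_measure (\<lambda>\<omega>. ereal (norm (f \<omega>))) \<le> ereal B"
    by (rule esssup_I) (use B in auto)
  then show "f \<in> Linf_torus" using f by (auto simp: Linf_torus_def)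
  have "ereal 0 \<le> esssup torus_measure (\<lambda>\<omega>. ereal (norm (f \<omega>)))"
  proof -
    have "esssup torus_measure (\<lambda>\<omega>. ereal 0) \<le> esssup torus_measure (\<lambda>\<omega>. ereal (norm (f \<omega>)))"
      by (rule esssup_mono) auto
    then show ?thesis by (subst (asm) esssup_const) (auto simp: T.emeasure_space_1)
  qed
  with le show "norm_Linf_torus f \<le> B"
    unfolding norm_Linf_torus_def by (cases "esssup torus_measure (\<lambda>\<omega>. ereal (norm (f \<omega>)))") auto
qed

lemma Linf_torusD:
  assumes "f \<in> Linf_torus"
  shows "strongly_measurable torus_measure f" "AE \<omega> in torus_measure. norm (f \<omega>) \<le> norm_Linf_torus f"
proof -
  show f: "strongly_measurable torus_measure f" using assms by (simp add: Linf_torus_def)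
  have [measurable]: "(\<lambda>\<omega>. norm (f \<omega>)) \<in> borel_measurable torus_measure" by (rule strongly_measurable_norm[OF f])
  let ?e = "esssup torus_measure (\<lambda>\<omega>. ereal (norm (f \<omega>)))"
  have ae: "AE \<omega> in torus_measure. ereal (norm (f \<omega>)) \<le> ?e" by (rule esssup_AE)
  have fin: "?e < \<infinity>" using assms by (simp add: Linf_torus_def)
  have "ereal 0 \<le> ?e"
  proof -
    have "esssup torus_measure (\<lambda>\<omega>. ereal 0) \<le> ?e" by (rule esssup_mono) auto
    then show ?thesis by (subst (asm) esssup_const) (auto simp: T.emeasure_space_1)
  qed
  with fin have "?e = ereal (norm_Linf_torus f)" unfolding norm_Linf_torus_def by (cases ?e) auto
  with ae show "AE \<omega> in torus_measure. norm (f \<omega>) \<le> norm_Linf_torus f" by simp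
qed

lemma fourier_coeff_functional:
  fixes f :: "(nat \<Rightarrow> complex) \<Rightarrow> 'x::complex_banach"
  assumes f: "f \<in> Linf_torus" and \<phi>: "contractive_functional \<phi>"
  shows "\<phi> (fourier_coeff f \<alpha>) = (\<integral>\<omega>. multi_powi \<omega> (- \<alpha>) * \<phi> (f \<omega>) \<partial>torus_measure)"
proof -
  have "\<phi> (fourier_coeff f \<alpha>) = (\<integral>\<omega>. \<phi> (multi_powi \<omega> (- \<alpha>) *\<^sub>C f \<omega>) \<partial>torus_measure)"
    unfolding fourier_coeff_def
  proof (rule T.strong_integral_functional[OF _ _ \<phi>])
    show "strongly_measurable torus_measure (\<lambda>\<omega>. multi_powi \<omega> (- \<alpha>) *\<^sub>C f \<omega>)"
      by (intro strongly_measurable_scaleC measurable_multi_powi Linf_torusD(1) f)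
    show "AE \<omega> in torus_measure. norm (multi_powi \<omega> (- \<alpha>) *\<^sub>C f \<omega>) \<le> norm_Linf_torus f"
      using Linf_torusD(2)[OF f] by (rule AE_mp) (intro AE_I2, simp add: norm_scaleC norm_multi_powi)
  qed
  then show ?thesis by (simp add: functional_scaleC[OF \<phi>])
qed

lemma Linf_functional_integrable:
  assumes f: "f \<in> Linf_torus" and \<phi>: "contractive_functional \<phi>"
    and g: "g \<in> borel_measurable torus_measure" "\<And>\<omega>. \<omega> \<in> space torus_measure \<Longrightarrow> cmod (g \<omega>) \<le> C"
  shows "integrable torus_measure (\<lambda>\<omega>. g \<omega> * \<phi> (f \<omega>))"
proof (rule T.integrable_const_bound)
  have [measurable]: "(\<lambda>\<omega>. \<phi> (f \<omega>)) \<in> borel_measurable torus_measure"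
    by (rule strongly_measurable_functional[OF Linf_torusD(1)[OF f] \<phi>])
  show "(\<lambda>\<omega>. g \<omega> * \<phi> (f \<omega>)) \<in> borel_measurable torus_measure"
    using g(1) by measurable
  show "AE \<omega> in torus_measure. norm (g \<omega> * \<phi> (f \<omega>)) \<le> C * norm_Linf_torus f"
    using Linf_torusD(2)[OF f]
  proof (rule AE_mp, intro AE_I2 impI)
    fix \<omega> assume "\<omega> \<in> space torus_measure" "norm (f \<omega>) \<le> norm_Linf_torus f"
    then show "norm (g \<omega> * \<phi> (f \<omega>)) \<le> C * norm_Linf_torus f"
      unfolding norm_mult using g(2)[of \<omega>] functional_contractive[OF \<phi>, of "f \<omega>"]
      by (intro mult_mono) (auto intro: order_trans[OF norm_ge_zero])
  qed
qed

lemma norm_fourier_coeff_le: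
  fixes f :: "(nat \<Rightarrow> complex) \<Rightarrow> 'x::complex_banach"
  assumes f: "f \<in> Linf_torus"
  shows "norm (fourier_coeff f \<alpha>) \<le> norm_Linf_torus f"
proof (rule functional_norm_leI)
  fix \<phi> :: "'x \<Rightarrow> complex" assume \<phi>: "contractive_functional \<phi>"
  have int: "integrable torus_measure (\<lambda>\<omega>. multi_powi \<omega> (- \<alpha>) * \<phi> (f \<omega>))"
    by (rule Linf_functional_integrable[OF f \<phi>, where C = 1]) (auto simp: norm_multi_powi)
  have "cmod (\<integral>\<omega>. multi_powi \<omega> (- \<alpha>) * \<phi> (f \<omega>) \<partial>torus_measure)
      \<le> (\<integral>\<omega>. cmod (multi_powi \<omega> (- \<alpha>) * \<phi> (f \<omega>)) \<partial>torus_measure)"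
    by (rule integral_norm_bound)
  also have "\<dots> \<le> (\<integral>\<omega>. norm_Linf_torus f \<partial>torus_measure)"
  proof (rule integral_mono_AE[OF integrable_norm[OF int]])
    show "AE \<omega> in torus_measure. cmod (multi_powi \<omega> (- \<alpha>) * \<phi> (f \<omega>)) \<le> norm_Linf_torus f"
      using Linf_torusD(2)[OF f]
      by (rule AE_mp) (intro AE_I2, use functional_contractive[OF \<phi>] order_trans in \<open>auto simp: norm_mult norm_multi_powi\<close>)
  qed simp
  also have "\<dots> = norm_Linf_torus f" by (simp add: T.prob_space)
  finally show "cmod (\<phi> (fourier_coeff f \<alpha>)) \<le> norm_Linf_torus f"
    by (simp add: fourier_coeff_functional[OF f \<phi>])
qed

section \<open>Functions are determined by their Fourier coefficients\<close>

lemma unimodular_cnj: "cmod w = 1 \<Longrightarrow> cnj w = inverse w"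
proof -
  assume "cmod w = 1"
  then have "w * cnj w = 1" using complex_norm_square[of w] by simp
  then show "cnj w = inverse w" by (rule inverse_unique[symmetric])
qed

text \<open>
  The functions on the unit circle that arise from trigonometric polynomials by repeated bounded
  pointwise limits. A bounded function on the torus that is orthogonal to all characters is also orthogonal to
  products of such functions of single coordinates, by dominated convergence.
\<close>

inductive trigonometric_closure :: "(complex \<Rightarrow> complex) \<Rightarrow> bool" where
  character: "trigonometric_closure (\<lambda>w. w powi n)"
| add: "trigonometric_closure f \<Longrightarrow> trigonometric_closure g \<Longrightarrow> trigonometric_closure (\<lambda>w. f w + g w)"
| scale: "trigonometric_closure f \<Longrightarrow> trigonometric_closure (\<lambda>w. c * f w)"
| limit: "(\<And>k. trigonometric_closure (f k)) \<Longrightarrow> (\<And>k w. cmod w = 1 \<Longrightarrow> cmod (f k w) \<le> B) \<Longrightarrow>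
    (\<And>w. cmod w = 1 \<Longrightarrow> (\<lambda>k. f k w) \<longlonglongrightarrow> g w) \<Longrightarrow> trigonometric_closure g"

lemma trigonometric_closure_const: "trigonometric_closure (\<lambda>w. c)"
  using trigonometric_closure.scale[OF trigonometric_closure.character[of 0], of c] by simp

lemma trigonometric_closure_sum:
  "(\<And>i. i \<in> I \<Longrightarrow> trigonometric_closure (f i)) \<Longrightarrow> trigonometric_closure (\<lambda>w. \<Sum>i\<in>I. f i w)"
  by (induction I rule: infinite_finite_induct) (auto intro: trigonometric_closure_const trigonometric_closure.add)

lemma trigonometric_closure_bounded:
  assumes "trigonometric_closure f"
  obtains B where "\<And>w. cmod w = 1 \<Longrightarrow> cmod (f w) \<le> B"
  using assms
proof (induction arbitrary: thesis)
  case (character n)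
  show ?case by (rule character[of 1]) (simp add: norm_power_int)
next
  case (add f g)
  obtain B where B: "\<And>w. cmod w = 1 \<Longrightarrow> cmod (f w) \<le> B" using add.IH(1) by blast
  obtain B' where B': "\<And>w. cmod w = 1 \<Longrightarrow> cmod (g w) \<le> B'" using add.IH(2) by blast
  show ?case by (rule add.prems[of "B + B'"]) (intro norm_triangle_le add_mono B B')
next
  case (scale f c)
  obtain B where B: "\<And>w. cmod w = 1 \<Longrightarrow> cmod (f w) \<le> B" using scale.IH by blast
  show ?case by (rule scale.prems[of "cmod c * B"]) (simp add: norm_mult B mult_left_mono)
next
  case (limit f B g)
  show ?case
  proof (rule limit.prems[of B])
    fix w :: complex assume w: "cmod w = 1"
    show "cmod (g w) \<le> B"
      by (rule LIMSEQ_le_const2[OF tendsto_norm[OF limit.hyps(3)[OF w]]]) (use limit.hyps(2)[OF w] in blast)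
  qed
qed

lemma trigonometric_closure_cong:
  assumes "trigonometric_closure f" "\<And>w. cmod w = 1 \<Longrightarrow> f w = g w"
  shows "trigonometric_closure g"
proof -
  obtain B where B: "\<And>w. cmod w = 1 \<Longrightarrow> cmod (f w) \<le> B"
    using trigonometric_closure_bounded[OF assms(1)] by blast
  show ?thesis
    by (rule trigonometric_closure.limit[of "\<lambda>_. f"]) (use assms B in auto)
qed

lemma trigonometric_closure_measurable:
  assumes "trigonometric_closure f"
  shows "f \<in> borel_measurable circle_measure"
  using assms
proof induction
  case (character n)
  show ?case
    unfolding measurable_cong_sets[OF sets_circle refl]
    by (cases "n \<ge> 0") (auto simp: power_int_def intro!: measurable_restrict_space1)
next
  case (limit f B g)
  show ?case
    by (rule borel_measurable_LIMSEQ_metric[OF limit.IH]) (use limit.hyps(3) in \<open>simp add: space_circle\<close>)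
qed auto

lemma trigonometric_closure_character_mult:
  assumes "trigonometric_closure f"
  shows "trigonometric_closure (\<lambda>w. w powi n * f w)"
  using assms
proof induction
  case (character k)
  show ?case
    by (rule trigonometric_closure_cong[OF trigonometric_closure.character[of "n + k"]])
      (subst power_int_add; force)
next
  case (add f g)
  then show ?case by (simp add: distrib_left trigonometric_closure.add)
next
  case (scale f c)
  show ?case using trigonometric_closure.scale[OF scale.IH, of c] by (simp add: mult_ac)
next
  case (limit f B g)
  show ?case
  proof (rule trigonometric_closure.limit[OF limit.IH])
    show "cmod (w powi n * f k w) \<le> B" if "cmod w = 1" for k w
      using limit.hyps(2)[OF that] that by (simp add: norm_mult norm_power_int)
    show "(\<lambda>k. w powi n * f k w) \<longlonglongrightarrow> w powi n * g w" if "cmod w = 1" for w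
      by (intro tendsto_mult tendsto_const limit.hyps(3) that)
  qed
qed

lemma trigonometric_closure_mult:
  assumes "trigonometric_closure f" "trigonometric_closure g"
  shows "trigonometric_closure (\<lambda>w. f w * g w)"
  using assms(1)
proof induction
  case (character n)
  show ?case by (rule trigonometric_closure_character_mult[OF assms(2)])
next
  case (add f f')
  then show ?case by (simp add: distrib_right trigonometric_closure.add)
next
  case (scale f c)
  show ?case using trigonometric_closure.scale[OF scale.IH, of c] by (simp add: mult_ac)
next
  case (limit f B h)
  obtain C where C: "\<And>w. cmod w = 1 \<Longrightarrow> cmod (g w) \<le> C"
    using trigonometric_closure_bounded[OF assms(2)] by blast
  show ?case
  proof (rule trigonometric_closure.limit[OF limit.IH])
    show "cmod (f k w * g w) \<le> B * C" if "cmod w = 1" for k w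
      unfolding norm_mult using limit.hyps(2)[OF that] C[OF that]
      by (intro mult_mono) (auto intro: order_trans[OF norm_ge_zero])
    show "(\<lambda>k. f k w * g w) \<longlonglongrightarrow> h w * g w" if "cmod w = 1" for w
      by (intro tendsto_mult tendsto_const limit.hyps(3) that)
  qed
qed

text \<open>
  Real-linear functionals are combinations of \<open>w\<close> and its conjugate, and on the circle the conjugate
  is \<open>w powi (-1)\<close>.
\<close>

lemma trigonometric_closure_polynomial:
  fixes p :: "complex \<Rightarrow> real"
  assumes "real_polynomial_function p"
  shows "trigonometric_closure (\<lambda>w. of_real (p w))"
  using assms
proof induction
  case (linear f)
  have f: "f w = Re w * f 1 + Im w * f \<i>" for w
  proof -
    have "w = Re w *\<^sub>R 1 + Im w *\<^sub>R \<i>" by (simp add: complex_eq_iff)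
    then have "f w = f (Re w *\<^sub>R 1 + Im w *\<^sub>R \<i>)" by simp
    also have "\<dots> = Re w * f 1 + Im w * f \<i>"
      using linear_add[OF bounded_linear.linear[OF linear]] linear_scale[OF bounded_linear.linear[OF linear]]
      by simp
    finally show ?thesis .
  qed
  let ?a = "(of_real (f 1) - \<i> * of_real (f \<i>)) / 2" and ?b = "(of_real (f 1) + \<i> * of_real (f \<i>)) / 2"
  have "trigonometric_closure (\<lambda>w. ?a * w powi 1 + ?b * w powi (-1))"
    by (intro trigonometric_closure.intros)
  then show ?case
  proof (rule trigonometric_closure_cong)
    fix w :: complex assume w: "cmod w = 1"
    have pw: "w powi (-1) = cnj w" by (simp add: unimodular_cnj[OF w] power_int_minus)
    then show "?a * w powi 1 + ?b * w powi (-1) = of_real (f w)"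
      unfolding pw f[of w] power_int_1_right by (simp add: complex_eq_iff field_simps)
  qed
next
  case (const c)
  show ?case by (rule trigonometric_closure_const)
next
  case (add f g)
  then show ?case by (simp add: trigonometric_closure.add)
next
  case (mult f g)
  then show ?case by (simp add: trigonometric_closure_mult)
qed

text \<open>
  The Weierstrass approximation theorem.
\<close>

lemma trigonometric_closure_continuous:
  fixes f :: "complex \<Rightarrow> real"
  assumes f: "continuous_on (sphere 0 1) f"
  shows "trigonometric_closure (\<lambda>w. of_real (f w))"
proof -
  have "\<exists>p. real_polynomial_function p \<and> (\<forall>w\<in>sphere 0 1. \<bar>f w - p w\<bar> < 1 / Suc k)" for k
    by (rule Stone_Weierstrass_real_polynomial_function[OF compact_sphere f, of "1 / Suc k"]) auto
  then obtain p where p: "\<And>k. real_polynomial_function (p k)"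
    "\<And>k w. cmod w = 1 \<Longrightarrow> \<bar>f w - p k w\<bar> < 1 / Suc k" by (metis mem_sphere_0)
  have "bounded (f ` sphere 0 1)"
    by (intro compact_imp_bounded compact_continuous_image f compact_sphere)
  then obtain B where "\<forall>x\<in>f ` sphere 0 1. norm x \<le> B" unfolding bounded_iff ..
  then have B: "\<bar>f w\<bar> \<le> B" if "cmod w = 1" for w using that by simp
  show ?thesis
  proof (rule trigonometric_closure.limit[where f = "\<lambda>k w. of_real (p k w)"])
    show "trigonometric_closure (\<lambda>w. of_real (p k w))" for k
      by (rule trigonometric_closure_polynomial[OF p(1)])
    show "cmod (of_real (p k w)) \<le> B + 1" if "cmod w = 1" for k w
    proof -
      have "1 / real (Suc k) \<le> 1" by simp
      then show ?thesis using p(2)[OF that, of k] B[OF that] unfolding norm_of_real by linarith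
    qed
    show "(\<lambda>k. complex_of_real (p k w)) \<longlonglongrightarrow> of_real (f w)" if "cmod w = 1" for w
    proof (intro tendsto_of_real, subst LIM_zero_iff[symmetric], rule Lim_null_comparison)
      show "\<forall>\<^sub>F k in sequentially. norm (p k w - f w) \<le> 1 / Suc k"
        using p(2)[OF that] by (intro always_eventually allI) (simp add: abs_minus_commute less_imp_le)
      show "(\<lambda>k. 1 / real (Suc k)) \<longlonglongrightarrow> 0" by (rule LIMSEQ_Suc[OF lim_1_over_n])
    qed
  qed
qed

text \<open>
  The continuous functions \<open>max 0 (1 - k * infdist w C)\<close> decrease to the indicator of \<open>C\<close>.
\<close>

lemma trigonometric_closure_indicator_closed:
  fixes C :: "complex set"
  assumes C: "closed C"
  shows "trigonometric_closure (indicator C)"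
proof (cases "C = {}")
  case True
  then show ?thesis by (intro trigonometric_closure_cong[OF trigonometric_closure_const[of 0]]) simp
next
  case False
  define f where "f k w = max 0 (1 - real k * infdist w C)" for k w
  show ?thesis
  proof (rule trigonometric_closure.limit[where f = "\<lambda>k w. of_real (f k w)"])
    show "trigonometric_closure (\<lambda>w. of_real (f k w))" for k
      unfolding f_def by (intro trigonometric_closure_continuous continuous_intros)
    show "cmod (of_real (f k w)) \<le> 1" for k w
      using infdist_nonneg[of w C] by (simp add: f_def)
    show "(\<lambda>k. complex_of_real (f k w)) \<longlonglongrightarrow> indicator C w" for w
    proof (cases "w \<in> C")
      case True
      then show ?thesis by (simp add: f_def)
    next
      case w: False
      then have pos: "infdist w C > 0"
        using in_closed_iff_infdist_zero[OF C False, of w] infdist_nonneg[of w C] by (auto simp: less_le)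
      then have "\<forall>\<^sub>F k in sequentially. real k * infdist w C \<ge> 1"
      proof -
        obtain N :: nat where N: "1 / infdist w C \<le> real N" using real_arch_simple by blast
        have "real k * infdist w C \<ge> 1" if "k \<ge> N" for k
        proof -
          have "1 / infdist w C \<le> real k" using N that by linarith
          then show ?thesis using pos by (simp add: field_simps)
        qed
        then show ?thesis by (auto simp: eventually_sequentially)
      qed
      then have "\<forall>\<^sub>F k in sequentially. complex_of_real (f k w) = 0"
        by (rule eventually_mono) (simp add: f_def)
      then show ?thesis using w by (simp add: tendsto_eventually)
    qed
  qed
qed

text \<open>
  Closed sets are stable under intersection, so Dynkin's theorem extends the previous lemma to all
  Borel sets.
\<close>

lemma trigonometric_closure_indicator:
  assumes "A \<in> sets (borel :: complex measure)"
  shows "trigonometric_closure (indicator A)"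
proof -
  have "Int_stable (Collect closed :: complex set set)" by (auto simp: Int_stable_def)
  moreover have "(Collect closed :: complex set set) \<subseteq> Pow UNIV" by simp
  moreover have "A \<in> sigma_sets UNIV (Collect closed)"
    using assms unfolding borel_eq_closed by simp
  ultimately show ?thesis
  proof (induction rule: sigma_sets_induct_disjoint)
    case (basic C)
    then show ?case by (simp add: trigonometric_closure_indicator_closed)
  next
    case empty
    show ?case by (rule trigonometric_closure_cong[OF trigonometric_closure_const[of 0]]) simp
  next
    case (compl A)
    have "trigonometric_closure (\<lambda>w. 1 + (-1) * indicator A w)"
      by (intro trigonometric_closure.add trigonometric_closure_const trigonometric_closure.scale compl)
    then show ?case by (rule trigonometric_closure_cong) (auto simp: indicator_def)
  next
    case (union A)
    have e: "(\<Sum>i<k. indicator (A i) w) = (indicator (\<Union>i<k. A i) w :: complex)" for k w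
      using union(1) by (intro indicator_UN_disjoint[symmetric]) (auto simp: disjoint_family_on_def)
    show ?case
    proof (rule trigonometric_closure.limit[where f = "\<lambda>k w. \<Sum>i<k. indicator (A i) w"])
      show "trigonometric_closure (\<lambda>w. \<Sum>i<k. indicator (A i) w)" for k
        by (intro trigonometric_closure_sum union)
      show "cmod (\<Sum>i<k. indicator (A i) w) \<le> 1" for k w
        unfolding e by (simp add: indicator_def)
      show "(\<lambda>k. \<Sum>i<k. indicator (A i) w) \<longlonglongrightarrow> (indicator (\<Union>i. A i) w :: complex)" for w
        unfolding e by (rule LIMSEQ_indicator_UN)
    qed
  qed
qed

text \<open>
  Induction on \<open>J\<close>. For the new coordinate \<open>k\<close>, consider the functions \<open>v\<close> for which the integral with
  the additional factor \<open>v (\<omega> k)\<close> vanishes for every character. They include the characters of this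
  coordinate, which merely shift \<open>\<alpha>\<close>, and are closed under sums, multiples and bounded limits.
\<close>

lemma annihilates_characters_products:
  fixes h :: "(nat \<Rightarrow> complex) \<Rightarrow> complex"
  assumes h: "h \<in> borel_measurable torus_measure" "AE \<omega> in torus_measure. cmod (h \<omega>) \<le> C"
    and zero: "\<And>\<alpha>. (\<integral>\<omega>. multi_powi \<omega> \<alpha> * h \<omega> \<partial>torus_measure) = 0"
    and J: "finite J" "\<And>j. j \<in> J \<Longrightarrow> trigonometric_closure (u j)"
  shows "(\<integral>\<omega>. multi_powi \<omega> \<alpha> * (\<Prod>j\<in>J. u j (\<omega> j)) * h \<omega> \<partial>torus_measure) = 0"
proof -
  have meas: "(\<lambda>\<omega>. v (\<omega> j)) \<in> borel_measurable torus_measure" if "trigonometric_closure v" for v j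
    by (rule measurable_compose[OF measurable_coordinate_circle trigonometric_closure_measurable[OF that]])
  show ?thesis
    using J
  proof (induction J arbitrary: \<alpha>)
    case empty
    then show ?case using zero by simp
  next
    case (insert k J)
    have mP: "(\<lambda>\<omega>. \<Prod>j\<in>J. u j (\<omega> j)) \<in> borel_measurable torus_measure"
      by (intro borel_measurable_prod meas insert.prems) auto
    have "\<exists>B. \<forall>w. cmod w = 1 \<longrightarrow> cmod (u j w) \<le> B" if "j \<in> J" for j
      using trigonometric_closure_bounded[OF insert.prems[of j]] that by blast
    then obtain B where B: "\<And>j w. j \<in> J \<Longrightarrow> cmod w = 1 \<Longrightarrow> cmod (u j w) \<le> B j" by metis
    have P_le: "cmod (\<Prod>j\<in>J. u j (\<omega> j)) \<le> (\<Prod>j\<in>J. B j)" if "\<omega> \<in> space torus_measure" for \<omega>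
      unfolding prod_norm[symmetric] using that by (intro prod_mono) (auto simp: space_torus intro: B)
    have C0: "C \<ge> 0"
    proof -
      have "AE \<omega> in torus_measure. 0 \<le> C"
        using h(2) by eventually_elim (rule order_trans[OF norm_ge_zero])
      then show ?thesis by simp
    qed
    have dom: "AE \<omega> in torus_measure. cmod (multi_powi \<omega> \<beta> * (v (\<omega> k) * (\<Prod>j\<in>J. u j (\<omega> j))) * h \<omega>) \<le> D * (\<Prod>j\<in>J. B j) * C"
      if D: "\<And>w. cmod w = 1 \<Longrightarrow> cmod (v w) \<le> D" for v D \<beta>
      using h(2)
    proof (rule AE_mp, intro AE_I2 impI)
      fix \<omega> assume w: "\<omega> \<in> space torus_measure" and hC: "cmod (h \<omega>) \<le> C"
      have D0: "D \<ge> 0" using D[of 1] order_trans[OF norm_ge_zero] by simp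
      have P0: "(\<Prod>j\<in>J. B j) \<ge> 0" using P_le[OF w] order_trans[OF norm_ge_zero] by blast
      show "cmod (multi_powi \<omega> \<beta> * (v (\<omega> k) * (\<Prod>j\<in>J. u j (\<omega> j))) * h \<omega>) \<le> D * (\<Prod>j\<in>J. B j) * C"
        unfolding norm_mult norm_multi_powi[OF w] mult_1
        using D P_le[OF w] hC D0 P0 w by (intro mult_mono) (auto simp: space_torus)
    qed
    have int: "integrable torus_measure (\<lambda>\<omega>. multi_powi \<omega> \<beta> * (v (\<omega> k) * (\<Prod>j\<in>J. u j (\<omega> j))) * h \<omega>)"
      if v: "trigonometric_closure v" for v \<beta>
    proof -
      obtain D where D: "\<And>w. cmod w = 1 \<Longrightarrow> cmod (v w) \<le> D" using trigonometric_closure_bounded[OF v] by blast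
      have "AE \<omega> in torus_measure. cmod (multi_powi \<omega> \<beta> * (v (\<omega> k) * (\<Prod>j\<in>J. u j (\<omega> j))) * h \<omega>) \<le> D * (\<Prod>j\<in>J. B j) * C"
        by (rule dom) (rule D)
      then show ?thesis
        by (rule T.integrable_const_bound)
          (intro borel_measurable_times measurable_multi_powi meas[OF v] mP h(1))
    qed
    have "(\<integral>\<omega>. multi_powi \<omega> \<beta> * (v (\<omega> k) * (\<Prod>j\<in>J. u j (\<omega> j))) * h \<omega> \<partial>torus_measure) = 0"
      if "trigonometric_closure v" for v \<beta>
      using that
    proof (induction)
      case (character n)
      have "(\<integral>\<omega>. multi_powi \<omega> \<beta> * (\<omega> k powi n * (\<Prod>j\<in>J. u j (\<omega> j))) * h \<omega> \<partial>torus_measure)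
        = (\<integral>\<omega>. multi_powi \<omega> (\<beta> + Poly_Mapping.single k n) * (\<Prod>j\<in>J. u j (\<omega> j)) * h \<omega> \<partial>torus_measure)"
      proof (intro Bochner_Integration.integral_cong refl)
        fix \<omega> assume "\<omega> \<in> space torus_measure"
        then have nz: "\<omega> j \<noteq> 0" for j by (rule torus_nonzero)
        show "multi_powi \<omega> \<beta> * (\<omega> k powi n * (\<Prod>j\<in>J. u j (\<omega> j))) * h \<omega>
            = multi_powi \<omega> (\<beta> + Poly_Mapping.single k n) * (\<Prod>j\<in>J. u j (\<omega> j)) * h \<omega>"
          by (simp add: multi_powi_add[OF nz] multi_powi_single)
      qed
      also have "\<dots> = 0" by (rule insert.IH) (use insert.prems in auto)
      finally show ?case .
    next
      case (add f g)
      then show ?case using Bochner_Integration.integral_add[OF int[OF add.hyps(1)] int[OF add.hyps(2)], of \<beta> \<beta>]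
        by (simp add: algebra_simps)
    next
      case (scale f c)
      then show ?case using integral_mult_right_zero[of torus_measure c "\<lambda>\<omega>. multi_powi \<omega> \<beta> * (f (\<omega> k) * (\<Prod>j\<in>J. u j (\<omega> j))) * h \<omega>"]
        by (simp add: mult_ac)
    next
      case (limit f D g)
      have g: "trigonometric_closure g" by (rule trigonometric_closure.limit[OF limit.hyps])
      have "(\<lambda>i. \<integral>\<omega>. multi_powi \<omega> \<beta> * (f i (\<omega> k) * (\<Prod>j\<in>J. u j (\<omega> j))) * h \<omega> \<partial>torus_measure)
        \<longlonglongrightarrow> (\<integral>\<omega>. multi_powi \<omega> \<beta> * (g (\<omega> k) * (\<Prod>j\<in>J. u j (\<omega> j))) * h \<omega> \<partial>torus_measure)"
      proof (rule integral_dominated_convergence[where w = "\<lambda>_. D * (\<Prod>j\<in>J. B j) * C"])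
        show "AE \<omega> in torus_measure. (\<lambda>i. multi_powi \<omega> \<beta> * (f i (\<omega> k) * (\<Prod>j\<in>J. u j (\<omega> j))) * h \<omega>)
            \<longlonglongrightarrow> multi_powi \<omega> \<beta> * (g (\<omega> k) * (\<Prod>j\<in>J. u j (\<omega> j))) * h \<omega>"
          by (intro AE_I2 tendsto_intros limit.hyps(3)) (simp add: space_torus)
        show "AE \<omega> in torus_measure. cmod (multi_powi \<omega> \<beta> * (f i (\<omega> k) * (\<Prod>j\<in>J. u j (\<omega> j))) * h \<omega>)
            \<le> D * (\<Prod>j\<in>J. B j) * C" for i
          by (rule dom[OF limit.hyps(2)])
      qed (use int[OF g] int[OF limit.hyps(1)] in \<open>auto intro: borel_measurable_integrable\<close>)
      then have "(\<lambda>i::nat. 0) \<longlonglongrightarrow> (\<integral>\<omega>. multi_powi \<omega> \<beta> * (g (\<omega> k) * (\<Prod>j\<in>J. u j (\<omega> j))) * h \<omega> \<partial>torus_measure)"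
        by (simp only: limit.IH)
      then show ?case by (simp only: LIMSEQ_const_iff)
    qed
    from this[of "u k" \<alpha>] show ?case
      using insert.prems insert.hyps by simp
  qed
qed

text \<open>
  Cylinder sets are products of indicators of single coordinates and generate the product
  \<open>\<sigma>\<close>-algebra; Dynkin's theorem does the rest.
\<close>

lemma annihilates_characters_set_integral:
  fixes h :: "(nat \<Rightarrow> complex) \<Rightarrow> complex"
  assumes h: "h \<in> borel_measurable torus_measure" "AE \<omega> in torus_measure. cmod (h \<omega>) \<le> C"
    and zero: "\<And>\<alpha>. (\<integral>\<omega>. multi_powi \<omega> \<alpha> * h \<omega> \<partial>torus_measure) = 0"
    and A: "A \<in> sets torus_measure"
  shows "(\<integral>\<omega>. indicator A \<omega> * h \<omega> \<partial>torus_measure) = 0"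
proof -
  have int: "integrable torus_measure (\<lambda>\<omega>. indicator A \<omega> * h \<omega>)" if "A \<in> sets torus_measure" for A
  proof (rule T.integrable_const_bound[where B = C])
    show "AE \<omega> in torus_measure. cmod (indicator A \<omega> * h \<omega>) \<le> C"
      using h(2) by (rule AE_mp) (auto intro!: AE_I2 simp: norm_mult indicator_def intro: order_trans[OF norm_ge_zero])
    show "(\<lambda>\<omega>. indicator A \<omega> * h \<omega>) \<in> borel_measurable torus_measure"
      using h(1) that by measurable
  qed
  have sets: "sets torus_measure = sigma_sets (space torus_measure) (prod_algebra UNIV (\<lambda>_::nat. circle_measure))"
    by (simp add: torus_measure_def sets_PiM space_PiM)
  have sub: "prod_algebra UNIV (\<lambda>_::nat. circle_measure) \<subseteq> Pow (space torus_measure)"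
    using prod_algebra_sets_into_space[of UNIV "\<lambda>_::nat. circle_measure"] by (simp add: torus_measure_def space_PiM)
  show ?thesis
    using Int_stable_prod_algebra[of UNIV "\<lambda>_::nat. circle_measure"] sub A[unfolded sets]
  proof (induction rule: sigma_sets_induct_disjoint)
    case (basic A)
    then obtain J E where A: "A = prod_emb UNIV (\<lambda>_. circle_measure) J (\<Pi>\<^sub>E j\<in>J. E j)"
      and J: "finite J" "\<And>j. j \<in> J \<Longrightarrow> E j \<in> sets circle_measure"
      by (auto elim!: prod_algebraE)
    have "\<exists>B. B \<in> sets borel \<and> E j = sphere 0 1 \<inter> B" if "j \<in> J" for j
      using J(2)[OF that] by (auto simp: sets_circle sets_restrict_space)
    then obtain B where B: "\<And>j. j \<in> J \<Longrightarrow> B j \<in> sets borel" "\<And>j. j \<in> J \<Longrightarrow> E j = sphere 0 1 \<inter> B j" by metis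
    have "(\<integral>\<omega>. indicator A \<omega> * h \<omega> \<partial>torus_measure)
      = (\<integral>\<omega>. multi_powi \<omega> 0 * (\<Prod>j\<in>J. indicator (B j) (\<omega> j)) * h \<omega> \<partial>torus_measure)"
    proof (intro Bochner_Integration.integral_cong refl)
      fix \<omega> assume w: "\<omega> \<in> space torus_measure"
      then have "\<omega> \<in> A \<longleftrightarrow> (\<forall>j\<in>J. \<omega> j \<in> B j)"
        unfolding A by (auto simp: prod_emb_def space_circle space_torus B(2) PiE_iff)
      then have "indicator A \<omega> = (\<Prod>j\<in>J. indicator (B j) (\<omega> j) :: complex)"
        using J(1) by (auto simp: indicator_def intro: prod_zero)
      then show "indicator A \<omega> * h \<omega> = multi_powi \<omega> 0 * (\<Prod>j\<in>J. indicator (B j) (\<omega> j)) * h \<omega>"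
        by (simp add: multi_powi_def)
    qed
    also have "\<dots> = 0"
      by (rule annihilates_characters_products[OF h zero J(1)]) (use B trigonometric_closure_indicator in auto)
    finally show ?case .
  next
    case empty
    then show ?case by simp
  next
    case (compl A)
    then have A: "A \<in> sets torus_measure" by (simp add: sets)
    have "(\<integral>\<omega>. indicator (space torus_measure - A) \<omega> * h \<omega> \<partial>torus_measure)
      = (\<integral>\<omega>. indicator (space torus_measure) \<omega> * h \<omega> - indicator A \<omega> * h \<omega> \<partial>torus_measure)"
      by (intro Bochner_Integration.integral_cong refl) (auto simp: indicator_def)
    also have "\<dots> = (\<integral>\<omega>. indicator (space torus_measure) \<omega> * h \<omega> \<partial>torus_measure) - (\<integral>\<omega>. indicator A \<omega> * h \<omega> \<partial>torus_measure)"
      by (intro Bochner_Integration.integral_diff int A) auto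
    also have "(\<integral>\<omega>. indicator (space torus_measure) \<omega> * h \<omega> \<partial>torus_measure) = (\<integral>\<omega>. multi_powi \<omega> 0 * h \<omega> \<partial>torus_measure)"
      by (intro Bochner_Integration.integral_cong refl) (auto simp: multi_powi_def)
    finally show ?case using compl zero by simp
  next
    case (union A)
    have A: "A i \<in> sets torus_measure" for i using union(2) by (auto simp: sets)
    have e: "(\<Sum>i<k. indicator (A i) \<omega>) = (indicator (\<Union>i<k. A i) \<omega> :: complex)" for k \<omega>
      using union(1) by (intro indicator_UN_disjoint[symmetric]) (auto simp: disjoint_family_on_def)
    have "(\<integral>\<omega>. indicator (\<Union>i<k. A i) \<omega> * h \<omega> \<partial>torus_measure) = 0" for k
    proof -
      have "(\<integral>\<omega>. indicator (\<Union>i<k. A i) \<omega> * h \<omega> \<partial>torus_measure) = (\<integral>\<omega>. (\<Sum>i<k. indicator (A i) \<omega> * h \<omega>) \<partial>torus_measure)"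
        by (simp add: e[symmetric] sum_distrib_right)
      also have "\<dots> = (\<Sum>i<k. \<integral>\<omega>. indicator (A i) \<omega> * h \<omega> \<partial>torus_measure)"
        by (intro Bochner_Integration.integral_sum int A)
      finally show ?thesis using union(3) by simp
    qed
    moreover have "(\<lambda>k. \<integral>\<omega>. indicator (\<Union>i<k. A i) \<omega> * h \<omega> \<partial>torus_measure)
        \<longlonglongrightarrow> (\<integral>\<omega>. indicator (\<Union>i. A i) \<omega> * h \<omega> \<partial>torus_measure)"
    proof (rule integral_dominated_convergence[where w = "\<lambda>_. C"])
      show "AE \<omega> in torus_measure. (\<lambda>k. indicator (\<Union>i<k. A i) \<omega> * h \<omega>) \<longlonglongrightarrow> indicator (\<Union>i. A i) \<omega> * h \<omega>"
        by (intro AE_I2 tendsto_mult tendsto_const LIMSEQ_indicator_UN)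
      show "AE \<omega> in torus_measure. norm (indicator (\<Union>i<k. A i) \<omega> * h \<omega>) \<le> C" for k
        using h(2) by (rule AE_mp) (auto intro!: AE_I2 simp: norm_mult indicator_def intro: order_trans[OF norm_ge_zero])
    qed (use A in \<open>auto intro!: borel_measurable_integrable int sets.countable_UN sets.finite_UN\<close>)
    ultimately show ?case using LIMSEQ_unique[OF _ tendsto_const] by fastforce
  qed
qed

text \<open>
  For \<open>u = f - g\<close> and every functional, the integral of \<open>\<phi> u\<close> over every measurable set vanishes. The space
  may be nonseparable, so the exceptional null sets of the functionals cannot simply be united. Instead,
  approximate \<open>u\<close> in mean by a simple function \<open>s\<close>. If \<open>s\<close> equals \<open>x\<close> on the set \<open>A\<close> and \<open>\<phi>\<close> is norming
  for \<open>x\<close>, then \<open>norm x\<close> times the measure of \<open>A\<close> is the modulus of the integral of \<open>\<phi> (s - u)\<close> over \<open>A\<close>. Summing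
  over the values of \<open>s\<close> gives \<open>\<integral> \<parallel>s\<parallel> \<le> \<integral> \<parallel>u - s\<parallel>\<close> and hence \<open>\<integral> \<parallel>u\<parallel> \<le> 2 \<integral> \<parallel>u - s\<parallel>\<close>, which is
  arbitrarily small.
\<close>

lemma Linf_torus_eq_if_fourier_eq:
  fixes f g :: "(nat \<Rightarrow> complex) \<Rightarrow> 'x::complex_banach"
  assumes f: "f \<in> Linf_torus" and g: "g \<in> Linf_torus" and eq: "\<And>\<alpha>. fourier_coeff f \<alpha> = fourier_coeff g \<alpha>"
  shows "AE \<omega> in torus_measure. f \<omega> = g \<omega>"
proof -
  define u where "u \<omega> = f \<omega> - g \<omega>" for \<omega>
  define C where "C = norm_Linf_torus f + norm_Linf_torus g"
  have u: "strongly_measurable torus_measure u"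
    unfolding u_def by (rule strongly_measurable_diff[OF Linf_torusD(1)[OF f] Linf_torusD(1)[OF g]])
  have uC: "AE \<omega> in torus_measure. norm (u \<omega>) \<le> C"
    using Linf_torusD(2)[OF f] Linf_torusD(2)[OF g]
    by (elim AE_mp, intro AE_I2 impI) (auto simp: u_def C_def intro: order_trans[OF norm_triangle_ineq4])
  have set0: "(\<integral>\<omega>. indicator A \<omega> * \<phi> (u \<omega>) \<partial>torus_measure) = 0"
    if \<phi>: "contractive_functional \<phi>" and A: "A \<in> sets torus_measure" for \<phi> A
  proof (rule annihilates_characters_set_integral[OF _ _ _ A])
    show "(\<lambda>\<omega>. \<phi> (u \<omega>)) \<in> borel_measurable torus_measure" by (rule strongly_measurable_functional[OF u \<phi>])
    show "AE \<omega> in torus_measure. cmod (\<phi> (u \<omega>)) \<le> C"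
      using uC by (rule AE_mp) (use functional_contractive[OF \<phi>] order_trans in \<open>auto intro!: AE_I2\<close>)
    fix \<alpha>
    have int: "integrable torus_measure (\<lambda>\<omega>. multi_powi \<omega> \<alpha> * \<phi> (f \<omega>))" if "f \<in> Linf_torus" for f
      by (rule Linf_functional_integrable[OF that \<phi>, where C = 1]) (auto simp: norm_multi_powi)
    have "(\<integral>\<omega>. multi_powi \<omega> \<alpha> * \<phi> (u \<omega>) \<partial>torus_measure)
      = (\<integral>\<omega>. multi_powi \<omega> \<alpha> * \<phi> (f \<omega>) - multi_powi \<omega> \<alpha> * \<phi> (g \<omega>) \<partial>torus_measure)"
      by (simp add: u_def functional_diff[OF \<phi>] right_diff_distrib)
    also have "\<dots> = \<phi> (fourier_coeff f (- \<alpha>)) - \<phi> (fourier_coeff g (- \<alpha>))"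
      by (simp add: Bochner_Integration.integral_diff[OF int[OF f] int[OF g]] fourier_coeff_functional[OF f \<phi>] fourier_coeff_functional[OF g \<phi>])
    finally show "(\<integral>\<omega>. multi_powi \<omega> \<alpha> * \<phi> (u \<omega>) \<partial>torus_measure) = 0" using eq by simp
  qed
  obtain s where s: "\<And>i. Bochner_Integration.simple_bochner_integrable torus_measure (s i)"
    "(\<lambda>i. \<integral>\<^sup>+\<omega>. ennreal (norm (u \<omega> - s i \<omega>)) \<partial>torus_measure) \<longlonglongrightarrow> 0"
    using T.simple_approximation_in_mean[OF u uC] by metis
  have key: "(\<integral>\<^sup>+\<omega>. ennreal (norm (u \<omega>)) \<partial>torus_measure) \<le> 2 * (\<integral>\<^sup>+\<omega>. ennreal (norm (u \<omega> - s i \<omega>)) \<partial>torus_measure)" for i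
  proof -
    let ?s = "s i"
    have sf: "simple_function torus_measure ?s" using s(1)[of i] by (auto elim: Bochner_Integration.simple_bochner_integrable.cases)
    let ?R = "?s ` space torus_measure"
    have R: "finite ?R" using sf by (simp add: simple_function_def)
    define A where "A x = ?s -` {x} \<inter> space torus_measure" for x
    have A: "A x \<in> sets torus_measure" for x using sf unfolding A_def by (rule simple_functionD(2))
    obtain D where D: "\<And>x. x \<in> ?R \<Longrightarrow> norm x \<le> D" using finite_imp_bounded[OF R] by (auto simp: bounded_iff)
    have nsm: "(\<lambda>\<omega>. norm (?s \<omega>)) \<in> borel_measurable torus_measure"
      by (rule strongly_measurable_norm[OF strongly_measurable_simple[OF sf]])
    have dsm: "(\<lambda>\<omega>. norm (u \<omega> - ?s \<omega>)) \<in> borel_measurable torus_measure"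
      by (rule strongly_measurable_norm[OF strongly_measurable_diff[OF u strongly_measurable_simple[OF sf]]])
    have dint: "integrable torus_measure (\<lambda>\<omega>. norm (u \<omega> - ?s \<omega>))"
    proof (rule T.integrable_const_bound[OF _ dsm])
      show "AE \<omega> in torus_measure. norm (norm (u \<omega> - ?s \<omega>)) \<le> C + D"
        using uC
      proof (rule AE_mp, intro AE_I2 impI)
        fix \<omega> assume "\<omega> \<in> space torus_measure" "norm (u \<omega>) \<le> C"
        then show "norm (norm (u \<omega> - ?s \<omega>)) \<le> C + D"
          using norm_triangle_ineq4[of "u \<omega>" "?s \<omega>"] D[of "?s \<omega>"] by simp
      qed
    qed
    have piece: "norm x * measure torus_measure (A x) \<le> (\<integral>\<omega>. indicator (A x) \<omega> * norm (u \<omega> - ?s \<omega>) \<partial>torus_measure)" for x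
    proof -
      obtain \<phi> where \<phi>: "contractive_functional \<phi>" "\<phi> x = of_real (norm x)" using norming_functional by blast
      have mu: "(\<lambda>\<omega>. \<phi> (u \<omega>)) \<in> borel_measurable torus_measure" by (rule strongly_measurable_functional[OF u \<phi>(1)])
      have iu: "integrable torus_measure (\<lambda>\<omega>. indicator (A x) \<omega> * \<phi> (u \<omega>))"
      proof (rule T.integrable_const_bound[where B = C])
        show "AE \<omega> in torus_measure. cmod (indicator (A x) \<omega> * \<phi> (u \<omega>)) \<le> C"
          using uC
        proof (rule AE_mp, intro AE_I2 impI)
          fix \<omega> assume "norm (u \<omega>) \<le> C"
          then show "cmod (indicator (A x) \<omega> * \<phi> (u \<omega>)) \<le> C"
            using functional_contractive[OF \<phi>(1), of "u \<omega>"] order_trans[OF norm_ge_zero, of "u \<omega>" C]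
            by (auto simp: norm_mult indicator_def)
        qed
        show "(\<lambda>\<omega>. indicator (A x) \<omega> * \<phi> (u \<omega>)) \<in> borel_measurable torus_measure" using mu A by measurable
      qed
      have ix: "integrable torus_measure (\<lambda>\<omega>. indicator (A x) \<omega> * complex_of_real (norm x))"
      proof (rule T.integrable_const_bound[where B = "norm x"])
        show "(\<lambda>\<omega>. indicator (A x) \<omega> * complex_of_real (norm x)) \<in> borel_measurable torus_measure"
          using A by measurable
      qed (auto intro!: AE_I2 simp: indicator_def)
      have "(\<integral>\<omega>. indicator (A x) \<omega> * complex_of_real (norm x) \<partial>torus_measure)
          = complex_of_real (\<integral>\<omega>. indicator (A x) \<omega> * norm x \<partial>torus_measure)"
        unfolding integral_complex_of_real[symmetric]
        by (intro Bochner_Integration.integral_cong refl) (simp add: indicator_def)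
      also have "(\<integral>\<omega>. indicator (A x) \<omega> * norm x \<partial>torus_measure) = norm x * measure torus_measure (A x)"
        using A by (simp add: mult.commute)
      finally have e: "(\<integral>\<omega>. indicator (A x) \<omega> * complex_of_real (norm x) \<partial>torus_measure)
          = complex_of_real (norm x * measure torus_measure (A x))" .
      have "norm x * measure torus_measure (A x) = cmod (\<integral>\<omega>. indicator (A x) \<omega> * complex_of_real (norm x) \<partial>torus_measure)"
        unfolding e norm_of_real by simp
      also have "\<dots> = cmod ((\<integral>\<omega>. indicator (A x) \<omega> * \<phi> (u \<omega>) \<partial>torus_measure) - (\<integral>\<omega>. indicator (A x) \<omega> * complex_of_real (norm x) \<partial>torus_measure))"
        by (simp only: set0[OF \<phi>(1) A] diff_0 norm_minus_cancel)
      also have "\<dots> = cmod (\<integral>\<omega>. indicator (A x) \<omega> * \<phi> (u \<omega>) - indicator (A x) \<omega> * complex_of_real (norm x) \<partial>torus_measure)"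
        by (simp only: Bochner_Integration.integral_diff[OF iu ix])
      also have "\<dots> \<le> (\<integral>\<omega>. cmod (indicator (A x) \<omega> * \<phi> (u \<omega>) - indicator (A x) \<omega> * complex_of_real (norm x)) \<partial>torus_measure)"
        by (rule integral_norm_bound)
      also have "\<dots> \<le> (\<integral>\<omega>. indicator (A x) \<omega> * norm (u \<omega> - ?s \<omega>) \<partial>torus_measure)"
      proof (rule integral_mono)
        show "integrable torus_measure (\<lambda>\<omega>. cmod (indicator (A x) \<omega> * \<phi> (u \<omega>) - indicator (A x) \<omega> * complex_of_real (norm x)))"
          by (intro integrable_norm Bochner_Integration.integrable_diff iu ix)
        show "integrable torus_measure (\<lambda>\<omega>. indicator (A x) \<omega> * norm (u \<omega> - ?s \<omega>))"
          using integrable_mult_indicator[OF A dint] by simp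
        fix \<omega>
        show "cmod (indicator (A x) \<omega> * \<phi> (u \<omega>) - indicator (A x) \<omega> * complex_of_real (norm x))
            \<le> indicator (A x) \<omega> * norm (u \<omega> - ?s \<omega>)"
        proof (cases "\<omega> \<in> A x")
          case True
          then have "?s \<omega> = x" by (simp add: A_def)
          then have "\<phi> (u \<omega>) - complex_of_real (norm x) = \<phi> (u \<omega> - ?s \<omega>)"
            by (simp add: functional_diff[OF \<phi>(1)] \<phi>(2))
          then show ?thesis using True functional_contractive[OF \<phi>(1)] by simp
        qed simp
      qed
      finally show ?thesis .
    qed
    have sum_ind: "(\<Sum>x\<in>?R. indicator (A x) \<omega> * v x) = v (?s \<omega>)" if "\<omega> \<in> space torus_measure" for \<omega> and v :: "'x \<Rightarrow> real"
    proof -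
      have "(\<Sum>x\<in>?R. indicator (A x) \<omega> * v x) = (\<Sum>x\<in>?R. if x = ?s \<omega> then v x else 0)"
        using that by (intro sum.cong) (auto simp: A_def indicator_def)
      also have "\<dots> = v (?s \<omega>)" using R that by simp
      finally show ?thesis .
    qed
    have "(\<integral>\<omega>. norm (?s \<omega>) \<partial>torus_measure) = (\<integral>\<omega>. (\<Sum>x\<in>?R. indicator (A x) \<omega> * norm x) \<partial>torus_measure)"
      by (intro Bochner_Integration.integral_cong refl) (simp add: sum_ind)
    also have "\<dots> = (\<Sum>x\<in>?R. \<integral>\<omega>. indicator (A x) \<omega> * norm x \<partial>torus_measure)"
      by (intro Bochner_Integration.integral_sum integrable_mult_left) (use A in \<open>auto simp: T.emeasure_eq_measure\<close>)
    also have "\<dots> = (\<Sum>x\<in>?R. norm x * measure torus_measure (A x))"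
      using A by (simp add: mult.commute)
    also have "\<dots> \<le> (\<Sum>x\<in>?R. \<integral>\<omega>. indicator (A x) \<omega> * norm (u \<omega> - ?s \<omega>) \<partial>torus_measure)"
      by (intro sum_mono piece)
    also have "\<dots> = (\<integral>\<omega>. (\<Sum>x\<in>?R. indicator (A x) \<omega> * norm (u \<omega> - ?s \<omega>)) \<partial>torus_measure)"
      by (intro Bochner_Integration.integral_sum[symmetric]) (use integrable_mult_indicator[OF A dint] in simp)
    also have "\<dots> = (\<integral>\<omega>. norm (u \<omega> - ?s \<omega>) \<partial>torus_measure)"
    proof (intro Bochner_Integration.integral_cong refl)
      fix \<omega> assume "\<omega> \<in> space torus_measure"
      then show "(\<Sum>x\<in>?R. indicator (A x) \<omega> * norm (u \<omega> - ?s \<omega>)) = norm (u \<omega> - ?s \<omega>)"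
        using sum_ind[of \<omega> "\<lambda>_. norm (u \<omega> - ?s \<omega>)"] by simp
    qed
    finally have le: "(\<integral>\<omega>. norm (?s \<omega>) \<partial>torus_measure) \<le> (\<integral>\<omega>. norm (u \<omega> - ?s \<omega>) \<partial>torus_measure)" .
    have sint: "integrable torus_measure (\<lambda>\<omega>. norm (?s \<omega>))"
      by (rule T.integrable_const_bound[OF _ nsm, of D]) (use D in \<open>auto intro!: AE_I2\<close>)
    have "(\<integral>\<^sup>+\<omega>. ennreal (norm (u \<omega>)) \<partial>torus_measure) \<le> (\<integral>\<^sup>+\<omega>. ennreal (norm (u \<omega> - ?s \<omega>)) + ennreal (norm (?s \<omega>)) \<partial>torus_measure)"
    proof (rule nn_integral_mono)
      fix \<omega>
      have "norm (u \<omega>) \<le> norm (u \<omega> - ?s \<omega>) + norm (?s \<omega>)"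
        using norm_triangle_ineq[of "u \<omega> - ?s \<omega>" "?s \<omega>"] by simp
      then show "ennreal (norm (u \<omega>)) \<le> ennreal (norm (u \<omega> - ?s \<omega>)) + ennreal (norm (?s \<omega>))"
        by (simp flip: ennreal_plus add: ennreal_leI)
    qed
    also have "\<dots> = (\<integral>\<^sup>+\<omega>. ennreal (norm (u \<omega> - ?s \<omega>)) \<partial>torus_measure) + (\<integral>\<^sup>+\<omega>. ennreal (norm (?s \<omega>)) \<partial>torus_measure)"
      by (rule nn_integral_add[OF measurable_compose[OF dsm measurable_ennreal] measurable_compose[OF nsm measurable_ennreal]])
    also have "(\<integral>\<^sup>+\<omega>. ennreal (norm (?s \<omega>)) \<partial>torus_measure) \<le> (\<integral>\<^sup>+\<omega>. ennreal (norm (u \<omega> - ?s \<omega>)) \<partial>torus_measure)"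
      using le by (subst (1 2) nn_integral_eq_integral) (auto simp: sint dint intro: ennreal_leI)
    finally show ?thesis by (simp add: mult_2)
  qed
  have "(\<integral>\<^sup>+\<omega>. ennreal (norm (u \<omega>)) \<partial>torus_measure) \<le> 2 * 0"
  proof (rule LIMSEQ_le_const)
    show "(\<lambda>i. 2 * (\<integral>\<^sup>+\<omega>. ennreal (norm (u \<omega> - s i \<omega>)) \<partial>torus_measure)) \<longlonglongrightarrow> 2 * 0"
      by (intro ennreal_tendsto_cmult s(2)) simp
  qed (use key in blast)
  then have "(\<integral>\<^sup>+\<omega>. ennreal (norm (u \<omega>)) \<partial>torus_measure) = 0" by simp
  then have "AE \<omega> in torus_measure. ennreal (norm (u \<omega>)) = 0"
    by (subst (asm) nn_integral_0_iff_AE[OF measurable_compose[OF strongly_measurable_norm[OF u] measurable_ennreal]])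
  then show ?thesis by (rule AE_mp) (auto intro!: AE_I2 simp: u_def)
qed

lemma norm_Linf_torus_eq_if_fourier_eq:
  fixes f g :: "(nat \<Rightarrow> complex) \<Rightarrow> 'x::complex_banach"
  assumes f: "f \<in> Linf_torus" and g: "g \<in> Linf_torus" and eq: "\<And>\<alpha>. fourier_coeff f \<alpha> = fourier_coeff g \<alpha>"
  shows "norm_Linf_torus f = norm_Linf_torus g"
proof (rule antisym)
  have ae: "AE \<omega> in torus_measure. f \<omega> = g \<omega>" by (rule Linf_torus_eq_if_fourier_eq[OF f g eq])
  show "norm_Linf_torus f \<le> norm_Linf_torus g"
    by (rule Linf_torusI(2)[OF Linf_torusD(1)[OF f]]) (use ae Linf_torusD(2)[OF g] in eventually_elim, simp)
  show "norm_Linf_torus g \<le> norm_Linf_torus f"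
    by (rule Linf_torusI(2)[OF Linf_torusD(1)[OF g]]) (use ae Linf_torusD(2)[OF f] in eventually_elim, simp)
qed

section \<open>Poisson averages\<close>

text \<open>
  With \<open>q = z / w\<close> this is the sum of all \<open>q\<^sup>n\<close> for \<open>n \<ge> 0\<close> and of the conjugates of \<open>q\<^sup>n\<close> for \<open>n \<ge> 1\<close>. On the
  circle it equals \<open>(1 - \<bar>q\<bar>\<^sup>2) / \<bar>1 - q\<bar>\<^sup>2\<close>, the Poisson kernel of the disk.
\<close>

definition poisson_kernel :: "complex \<Rightarrow> complex \<Rightarrow> complex"
  where "poisson_kernel z w = 1 / (1 - z / w) + cnj (z / w) / (1 - cnj (z / w))"

text \<open>
  The term pairs the frequencies \<open>- n\<close> and \<open>n + 1\<close>, so that every frequency occurs for exactly one \<open>n\<close>.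
\<close>

definition poisson_term :: "complex \<Rightarrow> nat \<Rightarrow> complex \<Rightarrow> complex"
  where "poisson_term z n w = z ^ n * w powi (- int n) + cnj z ^ Suc n * w powi int (Suc n)"

lemma poisson_kernel_sums:
  assumes z: "cmod z < 1" and w: "cmod w = 1"
  shows "(\<lambda>n. poisson_term z n w) sums poisson_kernel z w"
proof -
  define q where "q = z / w"
  have q: "cmod q < 1" using z w by (simp add: q_def norm_divide)
  have "(\<lambda>n. q ^ n) sums (1 / (1 - q))" using q by (rule geometric_sums)
  moreover have "(\<lambda>n. cnj q * cnj q ^ n) sums (cnj q * (1 / (1 - cnj q)))"
    by (intro sums_mult geometric_sums) (use q in simp)
  ultimately have "(\<lambda>n. q ^ n + cnj q * cnj q ^ n) sums (1 / (1 - q) + cnj q * (1 / (1 - cnj q)))"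
    by (rule sums_add)
  moreover have "q ^ n + cnj q * cnj q ^ n = poisson_term z n w" for n
  proof -
    have w0: "w \<noteq> 0" using w by auto
    have "cnj q = cnj z * w" using unimodular_cnj[OF w] by (simp add: q_def divide_inverse)
    then have a: "cnj q * cnj q ^ n = cnj z ^ Suc n * w ^ Suc n" by (simp add: power_mult_distrib mult_ac)
    have b: "q ^ n = z ^ n * inverse (w ^ n)"
      by (simp add: q_def divide_inverse power_mult_distrib power_inverse)
    have c: "w powi int (Suc n) = w ^ Suc n" by (rule power_int_of_nat)
    have d: "w powi (- int n) = inverse (w ^ n)" by (simp add: power_int_minus)
    show ?thesis by (simp only: poisson_term_def a b c d)
  qed
  ultimately show ?thesis by (simp add: poisson_kernel_def q_def)
qed

lemma norm_poisson_term_le: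
  assumes z: "cmod z < 1" and w: "cmod w = 1"
  shows "cmod (poisson_term z n w) \<le> 2 * cmod z ^ n"
proof -
  have "cmod (poisson_term z n w) \<le> cmod (z ^ n * w powi (- int n)) + cmod (cnj z ^ Suc n * w powi int (Suc n))"
    unfolding poisson_term_def by (rule norm_triangle_ineq)
  also have "\<dots> = cmod z ^ n + cmod z ^ Suc n"
    using w by (simp only: norm_mult norm_power norm_power_int complex_mod_cnj power_int_1_left mult_1_right)
  also have "cmod z ^ Suc n \<le> cmod z ^ n" using z by (intro power_decreasing) auto
  finally show ?thesis by simp
qed

lemma norm_poisson_kernel_le:
  assumes z: "cmod z < 1" and w: "cmod w = 1"
  shows "cmod (poisson_kernel z w) \<le> 2 / (1 - cmod z)"
proof -
  have geo: "(\<lambda>n. 2 * cmod z ^ n) sums (2 * (1 / (1 - cmod z)))"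
    by (intro sums_mult geometric_sums) (use z in simp)
  have "cmod (suminf (\<lambda>n. poisson_term z n w)) \<le> suminf (\<lambda>n. 2 * cmod z ^ n)"
    by (rule norm_suminf_le) (use norm_poisson_term_le[OF z w] sums_summable[OF geo] in auto)
  then show ?thesis using sums_unique[OF poisson_kernel_sums[OF z w]] sums_unique[OF geo] by simp
qed

lemma poisson_kernel_nonneg:
  assumes z: "cmod z < 1" and w: "cmod w = 1"
  obtains p where "p \<ge> 0" "poisson_kernel z w = of_real p"
proof
  define q where "q = z / w"
  have q: "cmod q < 1" using z w by (simp add: q_def norm_divide)
  then have nz: "1 - q \<noteq> 0" "1 - cnj q \<noteq> 0" by auto
  show "(1 - (cmod q)\<^sup>2) / (cmod (1 - q))\<^sup>2 \<ge> 0"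
    using q by (intro divide_nonneg_nonneg) (auto simp: power_le_one)
  have "1 / (1 - q) + cnj q / (1 - cnj q) = (1 - q * cnj q) / ((1 - q) * (1 - cnj q))"
    using nz by (simp add: field_simps)
  also have "q * cnj q = of_real ((cmod q)\<^sup>2)" by (rule complex_norm_square[symmetric])
  also have "(1 - q) * (1 - cnj q) = of_real ((cmod (1 - q))\<^sup>2)"
    using complex_norm_square[of "1 - q"] by simp
  finally show "poisson_kernel z w = of_real ((1 - (cmod q)\<^sup>2) / (cmod (1 - q))\<^sup>2)"
    by (simp add: poisson_kernel_def q_def)
qed

lemma measurable_cnj: "cnj \<in> borel_measurable borel"
  by (intro borel_measurable_continuous_onI continuous_intros)

lemma measurable_poisson_kernel: "(\<lambda>\<omega>. poisson_kernel z (\<omega> j)) \<in> borel_measurable torus_measure"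
proof -
  note [measurable] = measurable_cnj
  show ?thesis unfolding poisson_kernel_def by measurable
qed

lemma measurable_poisson_product:
  "(\<lambda>\<omega>. \<Prod>j<m. poisson_kernel (z j) (\<omega> j)) \<in> borel_measurable torus_measure"
  by (intro borel_measurable_prod measurable_poisson_kernel)

lemma norm_poisson_product_le:
  assumes z: "\<And>j. j < m \<Longrightarrow> cmod (z j) < 1" and \<omega>: "\<omega> \<in> space torus_measure"
  shows "cmod (\<Prod>j<m. poisson_kernel (z j) (\<omega> j)) \<le> (\<Prod>j<m. 2 / (1 - cmod (z j)))"
  unfolding prod_norm[symmetric]
  using norm_poisson_kernel_le[OF z] \<omega> by (intro prod_mono) (auto simp: space_torus)

definition scalar_coeff :: "((nat \<Rightarrow> complex) \<Rightarrow> complex) \<Rightarrow> (nat \<Rightarrow>\<^sub>0 int) \<Rightarrow> complex"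
  where "scalar_coeff h \<alpha> = (\<integral>\<omega>. multi_powi \<omega> (- \<alpha>) * h \<omega> \<partial>torus_measure)"

lemma bounded_product_integrable:
  fixes h g :: "(nat \<Rightarrow> complex) \<Rightarrow> complex"
  assumes h: "h \<in> borel_measurable torus_measure" "AE \<omega> in torus_measure. cmod (h \<omega>) \<le> C"
    and g: "g \<in> borel_measurable torus_measure" "\<And>\<omega>. \<omega> \<in> space torus_measure \<Longrightarrow> cmod (g \<omega>) \<le> B"
  shows "integrable torus_measure (\<lambda>\<omega>. g \<omega> * h \<omega>)"
    "(\<integral>\<omega>. cmod (g \<omega> * h \<omega>) \<partial>torus_measure) \<le> B * C"
proof -
  have ae: "AE \<omega> in torus_measure. cmod (g \<omega> * h \<omega>) \<le> B * C"
    using h(2)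
  proof (rule AE_mp, intro AE_I2 impI)
    fix \<omega> assume "\<omega> \<in> space torus_measure" "cmod (h \<omega>) \<le> C"
    then show "cmod (g \<omega> * h \<omega>) \<le> B * C"
      unfolding norm_mult using g(2)[of \<omega>] by (intro mult_mono) (auto intro: order_trans[OF norm_ge_zero])
  qed
  show int: "integrable torus_measure (\<lambda>\<omega>. g \<omega> * h \<omega>)"
    using ae by (rule T.integrable_const_bound) (intro borel_measurable_times g h)
  have "(\<integral>\<omega>. cmod (g \<omega> * h \<omega>) \<partial>torus_measure) \<le> (\<integral>\<omega>. B * C \<partial>torus_measure)"
    by (rule integral_mono_AE[OF integrable_norm[OF int] _ ae]) simp
  then show "(\<integral>\<omega>. cmod (g \<omega> * h \<omega>) \<partial>torus_measure) \<le> B * C" by (simp add: T.prob_space)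
qed

lemma norm_scalar_coeff_le:
  assumes h: "h \<in> borel_measurable torus_measure" "AE \<omega> in torus_measure. cmod (h \<omega>) \<le> C"
  shows "cmod (scalar_coeff h \<alpha>) \<le> C"
  unfolding scalar_coeff_def
  using order_trans[OF integral_norm_bound bounded_product_integrable(2)[OF h measurable_multi_powi, of "- \<alpha>" 1]]
  by (simp add: norm_multi_powi)

lemma map_int_add: "Poly_Mapping.map int (\<alpha> + \<beta>) = Poly_Mapping.map int \<alpha> + Poly_Mapping.map int \<beta>"
  by (rule poly_mapping_eqI) (simp add: lookup_map_int lookup_add)

lemma map_int_single: "Poly_Mapping.map int (Poly_Mapping.single j n) = Poly_Mapping.single j (int n)"
  by (rule poly_mapping_eqI) (simp add: lookup_map_int lookup_single when_def)

text \<open>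
  Induction on the number of kernels, expanding the last kernel into characters of its coordinate. The
  characters of positive frequency meet coefficients of \<open>h\<close> at indices with a negative entry and drop out. The
  others shift \<open>\<alpha>\<close> by \<open>n\<close> in the last coordinate, and the induction hypothesis for the shifted index
  supplies the sum over the remaining exponents. This is why the statement carries an index \<open>\<alpha>\<close> that vanishes
  in the coordinates still to be summed.
\<close>

lemma poisson_product_integral:
  fixes h :: "(nat \<Rightarrow> complex) \<Rightarrow> complex"
  assumes h: "h \<in> borel_measurable torus_measure" "AE \<omega> in torus_measure. cmod (h \<omega>) \<le> C"
    and spec: "\<And>\<alpha> j. Poly_Mapping.lookup \<alpha> j < 0 \<Longrightarrow> scalar_coeff h \<alpha> = 0"
    and z: "\<And>j. j < m \<Longrightarrow> cmod (z j) < 1" and \<alpha>: "\<And>j. j < m \<Longrightarrow> Poly_Mapping.lookup \<alpha> j = 0"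
  shows "((\<lambda>\<beta>. multi_power z \<beta> * scalar_coeff h (\<alpha> + Poly_Mapping.map int \<beta>)) has_sum
    (\<integral>\<omega>. multi_powi \<omega> (- \<alpha>) * (\<Prod>j<m. poisson_kernel (z j) (\<omega> j)) * h \<omega> \<partial>torus_measure)) (multi_indices m)"
  using z \<alpha>
proof (induction m arbitrary: \<alpha>)
  case 0
  have "Poly_Mapping.map int 0 = (0 :: nat \<Rightarrow>\<^sub>0 int)" by (rule poly_mapping_eqI) (simp add: lookup_map_int)
  then show ?case
    using has_sum_finite[of "{0}" "\<lambda>\<beta>. multi_power z \<beta> * scalar_coeff h (\<alpha> + Poly_Mapping.map int \<beta>)"]
    by (simp add: multi_indices_0 scalar_coeff_def)
next
  case (Suc m)
  define Q where "Q \<omega> = (\<Prod>j<m. poisson_kernel (z j) (\<omega> j))" for \<omega>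
  define QB where "QB = (\<Prod>j<m. 2 / (1 - cmod (z j)))"
  define I where "I \<gamma> = (\<integral>\<omega>. multi_powi \<omega> (- \<gamma>) * Q \<omega> * h \<omega> \<partial>torus_measure)" for \<gamma>
  have IH: "((\<lambda>\<beta>. multi_power z \<beta> * scalar_coeff h (\<gamma> + Poly_Mapping.map int \<beta>)) has_sum I \<gamma>) (multi_indices m)"
    if "\<And>j. j < m \<Longrightarrow> Poly_Mapping.lookup \<gamma> j = 0" for \<gamma>
    unfolding I_def Q_def by (rule Suc.IH) (use Suc.prems that in auto)
  have zm: "cmod (z m) < 1" using Suc.prems by simp
  have Qm: "Q \<in> borel_measurable torus_measure" unfolding Q_def by (rule measurable_poisson_product)
  have QB: "cmod (Q \<omega>) \<le> QB" if "\<omega> \<in> space torus_measure" for \<omega>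
    unfolding Q_def QB_def by (rule norm_poisson_product_le) (use Suc.prems that in auto)
  have gm: "(\<lambda>\<omega>. multi_powi \<omega> (- \<gamma>) * Q \<omega>) \<in> borel_measurable torus_measure" for \<gamma>
    by (intro borel_measurable_times measurable_multi_powi Qm)
  have gB: "cmod (multi_powi \<omega> (- \<gamma>) * Q \<omega>) \<le> QB" if "\<omega> \<in> space torus_measure" for \<omega> \<gamma>
    using QB[OF that] by (simp add: norm_mult norm_multi_powi[OF that])
  have gI: "integrable torus_measure (\<lambda>\<omega>. multi_powi \<omega> (- \<gamma>) * Q \<omega> * h \<omega>)" for \<gamma>
    by (rule bounded_product_integrable(1)[OF h gm gB])
  define f where "f n \<omega> = multi_powi \<omega> (- \<alpha>) * Q \<omega> * poisson_term (z m) n (\<omega> m) * h \<omega>" for n \<omega>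
  have shift: "multi_powi \<omega> (- \<alpha>) * \<omega> m powi (- k) = multi_powi \<omega> (- (\<alpha> + Poly_Mapping.single m k))"
    if "\<omega> \<in> space torus_measure" for \<omega> k
  proof -
    have e: "- (\<alpha> + Poly_Mapping.single m k) = - \<alpha> + Poly_Mapping.single m (- k)"
      by (rule poly_mapping_eqI) (simp add: lookup_add lookup_minus lookup_single when_def)
    show ?thesis unfolding e multi_powi_add[of \<omega>, OF torus_nonzero[OF that]] multi_powi_single ..
  qed
  have f_eq: "f n \<omega> = z m ^ n * (multi_powi \<omega> (- (\<alpha> + Poly_Mapping.single m (int n))) * Q \<omega> * h \<omega>)
      + cnj (z m) ^ Suc n * (multi_powi \<omega> (- (\<alpha> + Poly_Mapping.single m (- int (Suc n)))) * Q \<omega> * h \<omega>)"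
    if "\<omega> \<in> space torus_measure" for n \<omega>
    unfolding f_def poisson_term_def shift[OF that, symmetric] minus_minus
    by (simp only: distrib_left distrib_right mult_ac)
  have I_neg: "I (\<alpha> + Poly_Mapping.single m (- int (Suc n))) = 0" for n
  proof (rule has_sum_unique[OF IH])
    show "Poly_Mapping.lookup (\<alpha> + Poly_Mapping.single m (- int (Suc n))) j = 0" if "j < m" for j
      using Suc.prems(2)[of j] that by (simp add: lookup_add lookup_single when_def)
    have "scalar_coeff h (\<alpha> + Poly_Mapping.single m (- int (Suc n)) + Poly_Mapping.map int \<beta>) = 0"
      if "\<beta> \<in> multi_indices m" for \<beta>
    proof (rule spec[of _ m])
      have "Poly_Mapping.lookup \<beta> m = 0" using that by (auto simp: multi_indices_def in_keys_iff)
      then show "Poly_Mapping.lookup (\<alpha> + Poly_Mapping.single m (- int (Suc n)) + Poly_Mapping.map int \<beta>) m < 0"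
        using Suc.prems(2)[of m] by (simp add: lookup_add lookup_map_int)
    qed
    then show "((\<lambda>\<beta>. multi_power z \<beta> * scalar_coeff h (\<alpha> + Poly_Mapping.single m (- int (Suc n)) + Poly_Mapping.map int \<beta>))
        has_sum 0) (multi_indices m)"
      by (intro has_sum_0) simp
  qed
  have f_int: "(\<integral>\<omega>. f n \<omega> \<partial>torus_measure) = z m ^ n * I (\<alpha> + Poly_Mapping.single m (int n))" for n
  proof -
    have "(\<integral>\<omega>. f n \<omega> \<partial>torus_measure)
      = (\<integral>\<omega>. z m ^ n * (multi_powi \<omega> (- (\<alpha> + Poly_Mapping.single m (int n))) * Q \<omega> * h \<omega>)
      + cnj (z m) ^ Suc n * (multi_powi \<omega> (- (\<alpha> + Poly_Mapping.single m (- int (Suc n)))) * Q \<omega> * h \<omega>) \<partial>torus_measure)"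
      by (intro Bochner_Integration.integral_cong refl f_eq)
    also have "\<dots> = z m ^ n * I (\<alpha> + Poly_Mapping.single m (int n))
        + cnj (z m) ^ Suc n * I (\<alpha> + Poly_Mapping.single m (- int (Suc n)))"
      unfolding I_def
      by (subst Bochner_Integration.integral_add) (intro integrable_mult_right gI, intro integrable_mult_right gI, simp only: integral_mult_right_zero)
    finally show ?thesis using I_neg[of n] by (simp del: of_nat_Suc)
  qed
  have fm: "(\<lambda>\<omega>. multi_powi \<omega> (- \<alpha>) * Q \<omega> * poisson_term (z m) n (\<omega> m)) \<in> borel_measurable torus_measure" for n
    unfolding poisson_term_def power_int_def
    by (intro borel_measurable_times measurable_multi_powi Qm) measurable
  have fB: "cmod (multi_powi \<omega> (- \<alpha>) * Q \<omega> * poisson_term (z m) n (\<omega> m)) \<le> QB * (2 * cmod (z m) ^ n)"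
    if "\<omega> \<in> space torus_measure" for n \<omega>
    unfolding norm_mult[of _ "poisson_term (z m) n (\<omega> m)"]
    using gB[OF that, of \<alpha>] norm_poisson_term_le[OF zm, of "\<omega> m" n] that
    by (intro mult_mono) (auto simp: space_torus intro: order_trans[OF norm_ge_zero])
  have f_intble: "integrable torus_measure (f n)" for n
    unfolding f_def by (rule bounded_product_integrable(1)[OF h fm fB])
  have pk: "(\<lambda>n. f n \<omega>) sums (multi_powi \<omega> (- \<alpha>) * (\<Prod>j<Suc m. poisson_kernel (z j) (\<omega> j)) * h \<omega>)"
    and pn: "summable (\<lambda>n. cmod (f n \<omega>))"
    if "\<omega> \<in> space torus_measure" for \<omega>
  proof -
    have w: "cmod (\<omega> m) = 1" using that by (simp add: space_torus)
    have "(\<lambda>n. multi_powi \<omega> (- \<alpha>) * Q \<omega> * poisson_term (z m) n (\<omega> m) * h \<omega>) sums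
        (multi_powi \<omega> (- \<alpha>) * Q \<omega> * poisson_kernel (z m) (\<omega> m) * h \<omega>)"
      by (intro sums_mult sums_mult2 poisson_kernel_sums zm w)
    then show "(\<lambda>n. f n \<omega>) sums (multi_powi \<omega> (- \<alpha>) * (\<Prod>j<Suc m. poisson_kernel (z j) (\<omega> j)) * h \<omega>)"
      by (simp add: f_def Q_def mult_ac)
    show "summable (\<lambda>n. cmod (f n \<omega>))"
    proof (rule summable_comparison_test')
      show "summable (\<lambda>n. QB * (2 * cmod (z m) ^ n) * cmod (h \<omega>))"
        by (intro summable_mult summable_mult2 summable_geometric) (use zm in simp)
      show "norm (cmod (f n \<omega>)) \<le> QB * (2 * cmod (z m) ^ n) * cmod (h \<omega>)" if "n \<ge> 0" for n
        unfolding f_def using fB[OF \<open>\<omega> \<in> space torus_measure\<close>, of n]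
        by (simp add: norm_mult[of _ "h \<omega>"] mult_right_mono)
    qed
  qed
  have "(\<lambda>n. \<integral>\<omega>. f n \<omega> \<partial>torus_measure) sums (\<integral>\<omega>. suminf (\<lambda>n. f n \<omega>) \<partial>torus_measure)"
  proof (rule sums_integral)
    show "integrable torus_measure (f n)" for n by (rule f_intble)
    show "AE \<omega> in torus_measure. summable (\<lambda>n. norm (f n \<omega>))" using pn by (rule AE_I2)
    show "summable (\<lambda>n. \<integral>\<omega>. norm (f n \<omega>) \<partial>torus_measure)"
    proof (rule summable_comparison_test')
      show "summable (\<lambda>n. QB * (2 * cmod (z m) ^ n) * C)"
        by (intro summable_mult summable_mult2 summable_geometric) (use zm in simp)
      show "norm (\<integral>\<omega>. norm (f n \<omega>) \<partial>torus_measure) \<le> QB * (2 * cmod (z m) ^ n) * C" if "n \<ge> 0" for n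
        using bounded_product_integrable(2)[OF h fm[of n] fB[of _ n]] by (simp add: f_def)
    qed
  qed
  moreover have "(\<integral>\<omega>. suminf (\<lambda>n. f n \<omega>) \<partial>torus_measure)
      = (\<integral>\<omega>. multi_powi \<omega> (- \<alpha>) * (\<Prod>j<Suc m. poisson_kernel (z j) (\<omega> j)) * h \<omega> \<partial>torus_measure)"
    by (intro Bochner_Integration.integral_cong refl sums_unique[symmetric] pk)
  ultimately have total: "(\<lambda>n. z m ^ n * I (\<alpha> + Poly_Mapping.single m (int n))) sums
      (\<integral>\<omega>. multi_powi \<omega> (- \<alpha>) * (\<Prod>j<Suc m. poisson_kernel (z j) (\<omega> j)) * h \<omega> \<partial>torus_measure)"
    by (simp only: f_int)
  let ?F = "\<lambda>\<beta>. multi_power z \<beta> * scalar_coeff h (\<alpha> + Poly_Mapping.map int \<beta>)"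
  have "(\<lambda>\<beta>. norm (multi_power z \<beta> *\<^sub>C scalar_coeff h (\<alpha> + Poly_Mapping.map int \<beta>))) summable_on multi_indices (Suc m)"
    by (rule multi_power_series_abs_summable[where M = C]) (use norm_scalar_coeff_le[OF h] Suc.prems(1) in auto)
  then have "?F summable_on multi_indices (Suc m)"
    unfolding scaleC_complex_def by (rule Infinite_Sum.abs_summable_summable)
  then obtain S where S: "(?F has_sum S) (multi_indices (Suc m))" by (auto simp: summable_on_def)
  have S': "((\<lambda>p. ?F ((\<lambda>(n, \<alpha>). \<alpha> + Poly_Mapping.single m n) p)) has_sum S) (UNIV \<times> multi_indices m)"
    by (rule has_sum_reindex_bij_betw[OF multi_indices_Suc_bij, where f = ?F and S = S, THEN iffD2, OF S])
  have "((\<lambda>n. z m ^ n * I (\<alpha> + Poly_Mapping.single m (int n))) has_sum S) UNIV"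
  proof (rule has_sum_SigmaD[OF S'])
    fix n
    have "((\<lambda>\<beta>. z m ^ n * (multi_power z \<beta> * scalar_coeff h (\<alpha> + Poly_Mapping.single m (int n) + Poly_Mapping.map int \<beta>)))
        has_sum z m ^ n * I (\<alpha> + Poly_Mapping.single m (int n))) (multi_indices m)"
      by (intro has_sum_cmult_right IH) (use Suc.prems(2) in \<open>simp add: lookup_add lookup_single when_def\<close>)
    then show "((\<lambda>\<beta>. ?F ((\<lambda>(n, \<alpha>). \<alpha> + Poly_Mapping.single m n) (n, \<beta>))) has_sum
        z m ^ n * I (\<alpha> + Poly_Mapping.single m (int n))) (multi_indices m)"
      by (rule has_sum_cong[THEN iffD1, rotated])
        (simp add: multi_power_add multi_power_single map_int_add map_int_single add_ac mult_ac)
  qed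
  then have "(\<lambda>n. z m ^ n * I (\<alpha> + Poly_Mapping.single m (int n))) sums S" by (rule has_sum_imp_sums)
  from sums_unique2[OF this total] show ?case using S by simp
qed

text \<open>
  The preceding lemma for the constant \<open>1\<close>, whose only nonzero coefficient is the one at \<open>0\<close>.
\<close>

lemma poisson_product_integral_one:
  assumes z: "\<And>j. j < m \<Longrightarrow> cmod (z j) < 1"
  shows "(\<integral>\<omega>. (\<Prod>j<m. poisson_kernel (z j) (\<omega> j)) \<partial>torus_measure) = 1"
proof -
  have coeff: "scalar_coeff (\<lambda>_. 1) \<alpha> = (if \<alpha> = 0 then 1 else 0)" for \<alpha>
    by (simp add: scalar_coeff_def torus_character_integral)
  have "((\<lambda>\<beta>. multi_power z \<beta> * scalar_coeff (\<lambda>_. 1) (0 + Poly_Mapping.map int \<beta>)) has_sum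
    (\<integral>\<omega>. multi_powi \<omega> (- 0) * (\<Prod>j<m. poisson_kernel (z j) (\<omega> j)) * 1 \<partial>torus_measure)) (multi_indices m)"
    by (rule poisson_product_integral[where C = 1]) (use z in \<open>auto simp: coeff\<close>)
  moreover have "((\<lambda>\<beta>. multi_power z \<beta> * scalar_coeff (\<lambda>_. 1) (0 + Poly_Mapping.map int \<beta>)) has_sum 1) (multi_indices m)"
  proof -
    have m0: "Poly_Mapping.map int 0 = (0 :: nat \<Rightarrow>\<^sub>0 int)" by (rule poly_mapping_eqI) (simp add: lookup_map_int)
    have "((\<lambda>\<beta>. if \<beta> = 0 then 1 else 0) has_sum (1::complex)) {0 :: nat \<Rightarrow>\<^sub>0 nat}"
      using has_sum_finite[of "{0 :: nat \<Rightarrow>\<^sub>0 nat}" "\<lambda>\<beta>. if \<beta> = 0 then 1 else (0::complex)"] by simp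
    then show ?thesis
    proof (rule has_sum_cong_neutral[THEN iffD1, rotated -1])
      fix \<beta> :: "nat \<Rightarrow>\<^sub>0 nat"
      have e: "Poly_Mapping.map int \<beta> = 0 \<longleftrightarrow> \<beta> = 0" using map_int_inject[of \<beta> 0] m0 by simp
      show "\<beta> \<in> multi_indices m - {0} \<Longrightarrow> multi_power z \<beta> * scalar_coeff (\<lambda>_. 1) (0 + Poly_Mapping.map int \<beta>) = 0"
        using e by (simp add: coeff)
      show "\<beta> \<in> {0} \<inter> multi_indices m \<Longrightarrow>
          (if \<beta> = 0 then 1 else 0) = multi_power z \<beta> * scalar_coeff (\<lambda>_. 1) (0 + Poly_Mapping.map int \<beta>)"
        using e by (simp add: coeff)
    qed (simp add: multi_indices_def)
  qed
  ultimately have "(\<integral>\<omega>. multi_powi \<omega> (- 0) * (\<Prod>j<m. poisson_kernel (z j) (\<omega> j)) * 1 \<partial>torus_measure) = 1"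
    by (rule has_sum_unique)
  then show ?thesis by (simp add: multi_powi_def)
qed

text \<open>
  A product of Poisson kernels is nonnegative and has integral \<open>1\<close>.
\<close>

lemma poisson_average_bound:
  fixes h :: "(nat \<Rightarrow> complex) \<Rightarrow> complex"
  assumes h: "h \<in> borel_measurable torus_measure" "AE \<omega> in torus_measure. cmod (h \<omega>) \<le> C"
    and z: "\<And>j. j < m \<Longrightarrow> cmod (z j) < 1"
  shows "cmod (\<integral>\<omega>. (\<Prod>j<m. poisson_kernel (z j) (\<omega> j)) * h \<omega> \<partial>torus_measure) \<le> C"
proof -
  define Q where "Q \<omega> = (\<Prod>j<m. poisson_kernel (z j) (\<omega> j))" for \<omega>
  define QB where "QB = (\<Prod>j<m. 2 / (1 - cmod (z j)))"
  have Qm: "Q \<in> borel_measurable torus_measure" unfolding Q_def by (rule measurable_poisson_product)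
  have QB: "cmod (Q \<omega>) \<le> QB" if "\<omega> \<in> space torus_measure" for \<omega>
    unfolding Q_def QB_def by (rule norm_poisson_product_le[OF z that])
  have int: "integrable torus_measure (\<lambda>\<omega>. Q \<omega> * h \<omega>)" by (rule bounded_product_integrable(1)[OF h Qm QB])
  have intQ: "integrable torus_measure Q"
    using bounded_product_integrable(1)[of "\<lambda>_. 1" 1, OF _ _ Qm QB] by simp
  have Q_real: "Q \<omega> = of_real (cmod (Q \<omega>))" if w: "\<omega> \<in> space torus_measure" for \<omega>
  proof -
    have "\<exists>p. p \<ge> 0 \<and> poisson_kernel (z j) (\<omega> j) = of_real p" if "j < m" for j
      using poisson_kernel_nonneg[OF z[OF that], of "\<omega> j"] w by (metis space_torus)
    then obtain p where p: "\<And>j. j < m \<Longrightarrow> p j \<ge> 0" "\<And>j. j < m \<Longrightarrow> poisson_kernel (z j) (\<omega> j) = of_real (p j)" by metis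
    have "Q \<omega> = of_real (\<Prod>j<m. p j)" unfolding Q_def of_real_prod by (intro prod.cong refl p) simp
    moreover have "(\<Prod>j<m. p j) \<ge> 0" by (intro prod_nonneg) (use p in auto)
    ultimately show ?thesis by (metis norm_of_real abs_of_nonneg)
  qed
  have "of_real (\<integral>\<omega>. cmod (Q \<omega>) \<partial>torus_measure) = (\<integral>\<omega>. Q \<omega> \<partial>torus_measure)"
    unfolding integral_complex_of_real[symmetric]
    by (intro Bochner_Integration.integral_cong refl Q_real[symmetric])
  also have "\<dots> = 1" unfolding Q_def by (rule poisson_product_integral_one[OF z])
  finally have one: "(\<integral>\<omega>. cmod (Q \<omega>) \<partial>torus_measure) = 1" by (metis of_real_eq_1_iff)
  have "cmod (\<integral>\<omega>. Q \<omega> * h \<omega> \<partial>torus_measure) \<le> (\<integral>\<omega>. cmod (Q \<omega> * h \<omega>) \<partial>torus_measure)"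
    by (rule integral_norm_bound)
  also have "\<dots> \<le> (\<integral>\<omega>. cmod (Q \<omega>) * C \<partial>torus_measure)"
  proof (rule integral_mono_AE)
    show "AE \<omega> in torus_measure. cmod (Q \<omega> * h \<omega>) \<le> cmod (Q \<omega>) * C"
      using h(2) by eventually_elim (simp add: norm_mult mult_left_mono)
  qed (intro integrable_norm int integrable_mult_left intQ)+
  also have "\<dots> = C" using one by simp
  finally show ?thesis unfolding Q_def .
qed

text \<open>
  After applying a functional, the left-hand side is a Poisson average of \<open>f\<close>.
\<close>

lemma polydisc_sum_le_norm_Linf:
  fixes f :: "(nat \<Rightarrow> complex) \<Rightarrow> 'x::complex_banach"
  assumes f: "f \<in> Hinf_torus" and z: "\<And>j. j < m \<Longrightarrow> cmod (z j) < 1"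
  shows "norm (polydisc_sum (\<lambda>\<beta>. fourier_coeff f (Poly_Mapping.map int \<beta>)) m z) \<le> norm_Linf_torus f"
proof (rule functional_norm_leI)
  fix \<phi> :: "'x \<Rightarrow> complex" assume \<phi>: "contractive_functional \<phi>"
  have fL: "f \<in> Linf_torus" using f by (simp add: Hinf_torus_def)
  define h where "h \<omega> = \<phi> (f \<omega>)" for \<omega>
  have hm: "h \<in> borel_measurable torus_measure"
    unfolding h_def by (rule strongly_measurable_functional[OF Linf_torusD(1)[OF fL] \<phi>])
  have hC: "AE \<omega> in torus_measure. cmod (h \<omega>) \<le> norm_Linf_torus f"
    using Linf_torusD(2)[OF fL] unfolding h_def
    by eventually_elim (rule order_trans[OF functional_contractive[OF \<phi>]])
  have coeff: "scalar_coeff h \<alpha> = \<phi> (fourier_coeff f \<alpha>)" for \<alpha>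
    by (simp add: scalar_coeff_def h_def fourier_coeff_functional[OF fL \<phi>])
  have spec: "scalar_coeff h \<alpha> = 0" if "Poly_Mapping.lookup \<alpha> j < 0" for \<alpha> j
  proof -
    have "fourier_coeff f \<alpha> = 0" using f that by (auto simp: Hinf_torus_def)
    then show ?thesis by (simp add: coeff functional_zero[OF \<phi>])
  qed
  have "((\<lambda>\<beta>. multi_power z \<beta> * scalar_coeff h (0 + Poly_Mapping.map int \<beta>)) has_sum
    (\<integral>\<omega>. multi_powi \<omega> (- 0) * (\<Prod>j<m. poisson_kernel (z j) (\<omega> j)) * h \<omega> \<partial>torus_measure)) (multi_indices m)"
    by (rule poisson_product_integral[OF hm hC spec]) (use z in auto)
  moreover have "((\<lambda>\<beta>. multi_power z \<beta> *\<^sub>C fourier_coeff f (Poly_Mapping.map int \<beta>)) has_sum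
    polydisc_sum (\<lambda>\<beta>. fourier_coeff f (Poly_Mapping.map int \<beta>)) m z) (multi_indices m)"
    by (rule polydisc_sum_has_sum[where M = "norm_Linf_torus f"]) (use norm_fourier_coeff_le[OF fL] z in auto)
  then have "((\<lambda>\<beta>. \<phi> (multi_power z \<beta> *\<^sub>C fourier_coeff f (Poly_Mapping.map int \<beta>))) has_sum
    \<phi> (polydisc_sum (\<lambda>\<beta>. fourier_coeff f (Poly_Mapping.map int \<beta>)) m z)) (multi_indices m)"
    by (rule has_sum_bounded_linear[OF functional_bounded_linear[OF \<phi>]])
  ultimately have "\<phi> (polydisc_sum (\<lambda>\<beta>. fourier_coeff f (Poly_Mapping.map int \<beta>)) m z)
      = (\<integral>\<omega>. (\<Prod>j<m. poisson_kernel (z j) (\<omega> j)) * h \<omega> \<partial>torus_measure)"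
    by (simp add: functional_scaleC[OF \<phi>] coeff multi_powi_def has_sum_unique)
  then show "cmod (\<phi> (polydisc_sum (\<lambda>\<beta>. fourier_coeff f (Poly_Mapping.map int \<beta>)) m z)) \<le> norm_Linf_torus f"
    using poisson_average_bound[OF hm hC z] by simp
qed

section \<open>Monomial coefficients as Fourier coefficients\<close>

lemma multi_power_real_scale:
  "multi_power (\<lambda>j. of_real (r j) * \<omega> j) \<beta> = of_real (multi_power r \<beta>) * multi_power \<omega> \<beta>"
  unfolding multi_power_mult by (simp add: multi_power_def)

text \<open>
  The series converges absolutely and uniformly on the polytorus of radii \<open>r\<close>, so it may be integrated
  termwise against a character. The sum on the right has at most one term; it is empty if \<open>\<alpha>\<close> has a
  negative entry or involves further variables.
\<close>

lemma power_series_fourier: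
  fixes G :: "(nat \<Rightarrow> complex) \<Rightarrow> complex"
  assumes r: "\<And>j. r j \<ge> 0"
    and G: "\<And>z. (\<And>j. cmod (z j) \<le> r j) \<Longrightarrow> ((\<lambda>\<beta>. multi_power z \<beta> * d \<beta>) has_sum G z) (multi_indices m)"
  shows "(\<integral>\<omega>. multi_powi \<omega> (- \<alpha>) * G (\<lambda>j. of_real (r j) * \<omega> j) \<partial>torus_measure)
    = (\<Sum>\<beta>\<in>{\<beta>\<in>multi_indices m. Poly_Mapping.map int \<beta> = \<alpha>}. of_real (multi_power r \<beta>) * d \<beta>)" (is "?L = ?R")
    and "(\<lambda>\<omega>. G (\<lambda>j. of_real (r j) * \<omega> j)) \<in> borel_measurable torus_measure"
proof -
  obtain E where E: "\<And>k. finite (E k)" "\<And>k. E k \<subseteq> multi_indices m"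
    "filterlim E (finite_subsets_at_top (multi_indices m)) sequentially"
    using finite_exhaustion[OF countable_multi_indices] by blast
  define b where "b \<beta> = of_real (multi_power r \<beta>) * d \<beta>" for \<beta>
  have "(\<lambda>\<beta>. multi_power (\<lambda>j. of_real (r j)) \<beta> * d \<beta>) summable_on multi_indices m"
    by (rule has_sum_imp_summable[OF G]) (use r in simp)
  then have "(\<lambda>\<beta>. norm (b \<beta>)) summable_on multi_indices m"
    unfolding b_def using multi_power_real_scale[of r "\<lambda>_. 1"]
    by (subst summable_on_iff_abs_summable_on_complex[symmetric]) (simp add: multi_power_def)
  note sb = this
  define B where "B = infsum (\<lambda>\<beta>. norm (b \<beta>)) (multi_indices m)"
  define g where "g k \<omega> = (\<Sum>\<beta>\<in>E k. b \<beta> * multi_power \<omega> \<beta>)" for k \<omega>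
  have lim: "(\<lambda>k. g k \<omega>) \<longlonglongrightarrow> G (\<lambda>j. of_real (r j) * \<omega> j)" if w: "\<omega> \<in> space torus_measure" for \<omega>
  proof -
    have "((\<lambda>\<beta>. multi_power (\<lambda>j. of_real (r j) * \<omega> j) \<beta> * d \<beta>) has_sum G (\<lambda>j. of_real (r j) * \<omega> j)) (multi_indices m)"
      by (rule G) (use w r in \<open>simp add: space_torus norm_mult\<close>)
    moreover have "multi_power (\<lambda>j. of_real (r j) * \<omega> j) \<beta> * d \<beta> = b \<beta> * multi_power \<omega> \<beta>" for \<beta>
      unfolding multi_power_real_scale b_def by (simp add: mult_ac)
    ultimately have "((\<lambda>\<beta>. b \<beta> * multi_power \<omega> \<beta>) has_sum G (\<lambda>j. of_real (r j) * \<omega> j)) (multi_indices m)"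
      by (simp only:)
    from has_sum_along[OF this E(3)] show ?thesis by (simp only: g_def)
  qed
  have gm: "g k \<in> borel_measurable torus_measure" for k
    unfolding g_def multi_power_def by measurable
  show "(\<lambda>\<omega>. G (\<lambda>j. of_real (r j) * \<omega> j)) \<in> borel_measurable torus_measure"
    by (rule borel_measurable_LIMSEQ_metric[OF gm lim])
  then have Gm: "(\<lambda>\<omega>. multi_powi \<omega> (- \<alpha>) * G (\<lambda>j. of_real (r j) * \<omega> j)) \<in> borel_measurable torus_measure"
    by (intro borel_measurable_times measurable_multi_powi)
  have mp: "cmod (multi_power \<omega> \<beta>) = 1" if "\<omega> \<in> space torus_measure" for \<omega> \<beta>
    using norm_multi_powi[OF that, of "Poly_Mapping.map int \<beta>"] by (simp add: multi_powi_map_int)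
  have g_le: "cmod (multi_powi \<omega> (- \<alpha>) * g k \<omega>) \<le> B" if w: "\<omega> \<in> space torus_measure" for k \<omega>
  proof -
    have "cmod (g k \<omega>) \<le> (\<Sum>\<beta>\<in>E k. norm (b \<beta>))"
      unfolding g_def by (rule sum_norm_le) (simp add: norm_mult mp[OF w])
    also have "\<dots> \<le> B" unfolding B_def by (rule finite_sum_le_infsum[OF sb E(1,2)]) simp
    finally show ?thesis by (simp add: norm_mult norm_multi_powi[OF w])
  qed
  have conv: "(\<lambda>k. \<integral>\<omega>. multi_powi \<omega> (- \<alpha>) * g k \<omega> \<partial>torus_measure) \<longlonglongrightarrow> ?L"
  proof (rule integral_dominated_convergence[where w = "\<lambda>_. B"])
    show "AE \<omega> in torus_measure. (\<lambda>k. multi_powi \<omega> (- \<alpha>) * g k \<omega>)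
        \<longlonglongrightarrow> multi_powi \<omega> (- \<alpha>) * G (\<lambda>j. of_real (r j) * \<omega> j)"
      by (intro AE_I2 tendsto_mult tendsto_const lim)
    show "AE \<omega> in torus_measure. norm (multi_powi \<omega> (- \<alpha>) * g k \<omega>) \<le> B" for k
      by (intro AE_I2 g_le)
    show "(\<lambda>\<omega>. multi_powi \<omega> (- \<alpha>) * g k \<omega>) \<in> borel_measurable torus_measure" for k
      by (intro borel_measurable_times measurable_multi_powi gm)
  qed (simp_all add: Gm)
  have val: "(\<integral>\<omega>. multi_powi \<omega> (- \<alpha>) * g k \<omega> \<partial>torus_measure)
      = (\<Sum>\<beta>\<in>E k. b \<beta> * (if Poly_Mapping.map int \<beta> = \<alpha> then 1 else 0))" for k
  proof -
    have "(\<integral>\<omega>. multi_powi \<omega> (- \<alpha>) * g k \<omega> \<partial>torus_measure)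
      = (\<integral>\<omega>. (\<Sum>\<beta>\<in>E k. b \<beta> * multi_powi \<omega> (- \<alpha> + Poly_Mapping.map int \<beta>)) \<partial>torus_measure)"
    proof (intro Bochner_Integration.integral_cong refl)
      fix \<omega> assume w: "\<omega> \<in> space torus_measure"
      show "multi_powi \<omega> (- \<alpha>) * g k \<omega> = (\<Sum>\<beta>\<in>E k. b \<beta> * multi_powi \<omega> (- \<alpha> + Poly_Mapping.map int \<beta>))"
        unfolding g_def sum_distrib_left
        by (intro sum.cong refl)
          (simp only: multi_powi_add[of \<omega>, OF torus_nonzero[OF w]] multi_powi_map_int mult_ac)
    qed
    also have "\<dots> = (\<Sum>\<beta>\<in>E k. \<integral>\<omega>. b \<beta> * multi_powi \<omega> (- \<alpha> + Poly_Mapping.map int \<beta>) \<partial>torus_measure)"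
    proof (rule Bochner_Integration.integral_sum)
      fix \<beta>
      have "integrable torus_measure (\<lambda>\<omega>. multi_powi \<omega> (- \<alpha> + Poly_Mapping.map int \<beta>))"
        by (rule T.integrable_const_bound[where B = 1]) (auto intro!: AE_I2 simp: norm_multi_powi)
      then show "integrable torus_measure (\<lambda>\<omega>. b \<beta> * multi_powi \<omega> (- \<alpha> + Poly_Mapping.map int \<beta>))"
        by (intro integrable_mult_right)
    qed
    also have "\<dots> = (\<Sum>\<beta>\<in>E k. b \<beta> * (if - \<alpha> + Poly_Mapping.map int \<beta> = 0 then 1 else 0))"
      by (simp only: integral_mult_right_zero torus_character_integral)
    also have "\<dots> = (\<Sum>\<beta>\<in>E k. b \<beta> * (if Poly_Mapping.map int \<beta> = \<alpha> then 1 else 0))"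
      by (intro sum.cong refl) (auto simp: add_eq_0_iff)
    finally show ?thesis .
  qed
  let ?S = "{\<beta>\<in>multi_indices m. Poly_Mapping.map int \<beta> = \<alpha>}"
  have finS: "finite ?S"
  proof (rule finite_subset)
    show "?S \<subseteq> {THE \<beta>. Poly_Mapping.map int \<beta> = \<alpha>}"
      by (auto simp: map_int_inject intro!: the_equality[symmetric])
  qed simp
  have "\<forall>\<^sub>F k in sequentially. ?S \<subseteq> E k"
  proof -
    have "\<forall>\<^sub>F X in finite_subsets_at_top (multi_indices m). ?S \<subseteq> X"
      using finS by (auto simp: eventually_finite_subsets_at_top intro!: exI[of _ ?S])
    then show ?thesis by (rule eventually_compose_filterlim[OF _ E(3)])
  qed
  then have "\<forall>\<^sub>F k in sequentially. (\<integral>\<omega>. multi_powi \<omega> (- \<alpha>) * g k \<omega> \<partial>torus_measure) = (\<Sum>\<beta>\<in>?S. b \<beta>)"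
  proof (rule eventually_mono)
    fix k assume k: "?S \<subseteq> E k"
    have "(\<Sum>\<beta>\<in>E k. b \<beta> * (if Poly_Mapping.map int \<beta> = \<alpha> then 1 else 0))
        = (\<Sum>\<beta>\<in>?S. b \<beta> * (if Poly_Mapping.map int \<beta> = \<alpha> then 1 else 0))"
      using E(1)[of k] E(2)[of k] k by (intro sum.mono_neutral_right) auto
    also have "\<dots> = (\<Sum>\<beta>\<in>?S. b \<beta>)" by (intro sum.cong) auto
    finally show "(\<integral>\<omega>. multi_powi \<omega> (- \<alpha>) * g k \<omega> \<partial>torus_measure) = (\<Sum>\<beta>\<in>?S. b \<beta>)"
      unfolding val .
  qed
  then have "(\<lambda>k. \<integral>\<omega>. multi_powi \<omega> (- \<alpha>) * g k \<omega> \<partial>torus_measure) \<longlonglongrightarrow> (\<Sum>\<beta>\<in>?S. b \<beta>)"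
    by (rule tendsto_eventually)
  from LIMSEQ_unique[OF conv this] show "?L = ?R" by (simp add: b_def)
qed

lemma multi_power_pos: "(\<And>j. r j > (0::real)) \<Longrightarrow> multi_power r \<beta> > 0"
  by (simp add: multi_power_def prod_pos)

lemma functional_has_sum:
  assumes "contractive_functional \<phi>" "((\<lambda>\<beta>. multi_power z \<beta> *\<^sub>C c \<beta>) has_sum S) A"
  shows "((\<lambda>\<beta>. multi_power z \<beta> * \<phi> (c \<beta>)) has_sum \<phi> S) A"
  using has_sum_bounded_linear[OF functional_bounded_linear[OF assms(1)] assms(2)]
  by (simp add: functional_scaleC[OF assms(1)])

text \<open>
  Up to a nonzero factor the coefficients are Fourier coefficients on the polytorus of radius \<open>1/2\<close>.
\<close>

lemma polydisc_coefficients_unique: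
  fixes c c' :: "(nat \<Rightarrow>\<^sub>0 nat) \<Rightarrow> 'x::complex_banach"
  assumes c: "\<And>z. (\<And>j. j < m \<Longrightarrow> cmod (z j) < 1) \<Longrightarrow>
      ((\<lambda>\<beta>. multi_power z \<beta> *\<^sub>C c \<beta>) has_sum G z) (multi_indices m)"
    and c': "\<And>z. (\<And>j. j < m \<Longrightarrow> cmod (z j) < 1) \<Longrightarrow>
      ((\<lambda>\<beta>. multi_power z \<beta> *\<^sub>C c' \<beta>) has_sum G z) (multi_indices m)"
    and \<alpha>: "\<alpha> \<in> multi_indices m"
  shows "c \<alpha> = c' \<alpha>"
proof (rule functional_eqI)
  fix \<phi> :: "'x \<Rightarrow> complex" assume \<phi>: "contractive_functional \<phi>"
  have S: "{\<beta>\<in>multi_indices m. Poly_Mapping.map int \<beta> = Poly_Mapping.map int \<alpha>} = {\<alpha>}"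
    using \<alpha> by (auto simp: map_int_inject)
  have F: "(\<integral>\<omega>. multi_powi \<omega> (- Poly_Mapping.map int \<alpha>) * \<phi> (G (\<lambda>j. of_real (1/2) * \<omega> j)) \<partial>torus_measure)
      = of_real (multi_power (\<lambda>_. 1/2) \<alpha>) * \<phi> (d \<alpha>)"
    if d: "\<And>z. (\<And>j. j < m \<Longrightarrow> cmod (z j) < 1) \<Longrightarrow>
      ((\<lambda>\<beta>. multi_power z \<beta> *\<^sub>C d \<beta>) has_sum G z) (multi_indices m)" for d
  proof -
    have "(\<integral>\<omega>. multi_powi \<omega> (- Poly_Mapping.map int \<alpha>) * \<phi> (G (\<lambda>j. of_real (1/2) * \<omega> j)) \<partial>torus_measure)
      = (\<Sum>\<beta>\<in>{\<beta>\<in>multi_indices m. Poly_Mapping.map int \<beta> = Poly_Mapping.map int \<alpha>}. of_real (multi_power (\<lambda>_. 1/2) \<beta>) * \<phi> (d \<beta>))"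
    proof (rule power_series_fourier(1))
      fix z :: "nat \<Rightarrow> complex" assume z: "\<And>j. cmod (z j) \<le> 1 / 2"
      show "((\<lambda>\<beta>. multi_power z \<beta> * \<phi> (d \<beta>)) has_sum \<phi> (G z)) (multi_indices m)"
        by (rule functional_has_sum[OF \<phi> d]) (rule le_less_trans[OF z], simp)
    qed simp
    then show ?thesis unfolding S by simp
  qed
  have "multi_power (\<lambda>_. 1/2 :: real) \<alpha> > 0" by (rule multi_power_pos) simp
  then show "\<phi> (c \<alpha>) = \<phi> (c' \<alpha>)" using F[OF c] F[OF c'] by simp
qed

definition is_monomial_expansion :: "(c0 \<Rightarrow> 'x::complex_banach) \<Rightarrow> ((nat \<Rightarrow>\<^sub>0 nat) \<Rightarrow> 'x) \<Rightarrow> bool"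
  where "is_monomial_expansion F c \<longleftrightarrow> (\<forall>m z. (\<forall>j<m. cmod (z j) < 1) \<longrightarrow>
    ((\<lambda>\<alpha>. multi_power z \<alpha> *\<^sub>C c \<alpha>) has_sum section_at F m z) (multi_indices m))"

lemma is_monomial_expansion_unique:
  assumes "is_monomial_expansion F c" "is_monomial_expansion F c'"
  shows "c = c'"
proof
  fix \<alpha>
  obtain m where "\<alpha> \<in> multi_indices m" using ex_multi_indices by blast
  then show "c \<alpha> = c' \<alpha>"
    using assms unfolding is_monomial_expansion_def
    by (intro polydisc_coefficients_unique[of m c "section_at F m" c' \<alpha>]) auto
qed

lemma monomial_coeff_eqI: "is_monomial_expansion F c \<Longrightarrow> monomial_coeff F = c"
  unfolding monomial_coeff_def multi_indices_def[symmetric] is_monomial_expansion_def[symmetric]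
  by (rule the_equality) (auto intro: is_monomial_expansion_unique)

text \<open>
  Each section has an expansion of its own. Setting the additional variables to \<open>0\<close> shows, by
  uniqueness, that the coefficients for more variables extend those for fewer variables, so that they form a
  single family.
\<close>

lemma Hinf_ball_expansion:
  assumes F: "F \<in> Hinf_ball" and M: "\<And>z. norm z < 1 \<Longrightarrow> norm (F z) \<le> M"
  shows "is_monomial_expansion F (monomial_coeff F)" "norm (monomial_coeff F \<alpha>) \<le> M"
proof -
  have "\<exists>c. (\<forall>\<alpha>\<in>multi_indices m. norm (c \<alpha>) \<le> M) \<and>
    (\<forall>z. (\<forall>i<m. cmod (z i) < 1) \<longrightarrow>
      ((\<lambda>\<alpha>. multi_power z \<alpha> *\<^sub>C c \<alpha>) has_sum section_at F m z) (multi_indices m))" for m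
    by (rule Hinf_ball_section_expansion[OF F M])
  then obtain C where C: "\<And>m \<alpha>. \<alpha> \<in> multi_indices m \<Longrightarrow> norm (C m \<alpha>) \<le> M"
    "\<And>m z. (\<And>i. i < m \<Longrightarrow> cmod (z i) < 1) \<Longrightarrow>
      ((\<lambda>\<alpha>. multi_power z \<alpha> *\<^sub>C C m \<alpha>) has_sum section_at F m z) (multi_indices m)" by metis
  have consistent: "C m' \<alpha> = C m \<alpha>" if m: "m \<le> m'" and \<alpha>: "\<alpha> \<in> multi_indices m" for m m' \<alpha>
  proof (rule polydisc_coefficients_unique[of m "C m'" "section_at F m" "C m"])
    fix z :: "nat \<Rightarrow> complex" assume z: "\<And>j. j < m \<Longrightarrow> cmod (z j) < 1"
    define z' where "z' j = (if j < m then z j else 0)" for j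
    have "section_at F m' z' = section_at F m z"
    proof -
      have "truncate_c0 m' z' = truncate_c0 m z"
        by (rule c0_eqI) (use m in \<open>simp add: c0_nth_truncate z'_def\<close>)
      then show ?thesis by (simp add: section_at_truncate)
    qed
    moreover have "((\<lambda>\<alpha>. multi_power z' \<alpha> *\<^sub>C C m' \<alpha>) has_sum section_at F m' z') (multi_indices m')"
      by (rule C(2)) (use z in \<open>simp add: z'_def\<close>)
    ultimately have s: "((\<lambda>\<alpha>. multi_power z' \<alpha> *\<^sub>C C m' \<alpha>) has_sum section_at F m z) (multi_indices m')"
      by simp
    show "((\<lambda>\<alpha>. multi_power z \<alpha> *\<^sub>C C m' \<alpha>) has_sum section_at F m z) (multi_indices m)"
    proof (rule has_sum_cong_neutral[THEN iffD1, OF _ _ _ s])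
      fix \<alpha> assume "\<alpha> \<in> multi_indices m' - multi_indices m"
      then obtain j where j: "j \<in> Poly_Mapping.keys \<alpha>" "\<not> j < m" by (auto simp: multi_indices_def)
      then have "z' j ^ Poly_Mapping.lookup \<alpha> j = 0" by (simp add: in_keys_iff z'_def)
      then have "multi_power z' \<alpha> = 0" using j unfolding multi_power_def by (intro prod_zero) auto
      then show "multi_power z' \<alpha> *\<^sub>C C m' \<alpha> = 0" by simp
    next
      fix \<alpha> assume "\<alpha> \<in> multi_indices m' \<inter> multi_indices m"
      then have "multi_power z' \<alpha> = multi_power z \<alpha>"
        by (intro multi_power_cong[of \<alpha> m]) (auto simp: z'_def)
      then show "multi_power z' \<alpha> *\<^sub>C C m' \<alpha> = multi_power z \<alpha> *\<^sub>C C m' \<alpha>" by simp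
    qed (use multi_indices_mono[OF m] in auto)
  qed (use C(2) \<alpha> in auto)
  define idx where "idx \<alpha> = (LEAST m. \<alpha> \<in> multi_indices m)" for \<alpha>
  have idx: "\<alpha> \<in> multi_indices (idx \<alpha>)" "\<alpha> \<in> multi_indices m \<Longrightarrow> idx \<alpha> \<le> m" for \<alpha> m
    using ex_multi_indices unfolding idx_def by (auto intro: LeastI_ex Least_le)
  define c where "c \<alpha> = C (idx \<alpha>) \<alpha>" for \<alpha>
  have c_eq: "C m \<alpha> = c \<alpha>" if "\<alpha> \<in> multi_indices m" for m \<alpha>
    unfolding c_def using consistent[OF idx(2)[OF that] idx(1)] .
  have "is_monomial_expansion F c"
    unfolding is_monomial_expansion_def
  proof (intro allI impI)
    fix m and z :: "nat \<Rightarrow> complex" assume z: "\<forall>j<m. cmod (z j) < 1"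
    have "((\<lambda>\<alpha>. multi_power z \<alpha> *\<^sub>C C m \<alpha>) has_sum section_at F m z) (multi_indices m)"
      by (rule C(2)) (use z in blast)
    then show "((\<lambda>\<alpha>. multi_power z \<alpha> *\<^sub>C c \<alpha>) has_sum section_at F m z) (multi_indices m)"
      by (rule has_sum_cong[THEN iffD1, rotated]) (simp add: c_eq)
  qed
  moreover from monomial_coeff_eqI[OF this] have "monomial_coeff F = c" .
  moreover have "norm (c \<alpha>) \<le> M" for \<alpha>
    unfolding c_def by (rule C(1)[OF idx(1)])
  ultimately show "is_monomial_expansion F (monomial_coeff F)" "norm (monomial_coeff F \<alpha>) \<le> M" by simp_all
qed

lemma polydisc_sum_monomial_coeff:
  assumes "is_monomial_expansion F c" "\<And>j. j < m \<Longrightarrow> cmod (z j) < 1"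
  shows "polydisc_sum c m z = section_at F m z"
  unfolding polydisc_sum_def using assms by (intro infsumI) (auto simp: is_monomial_expansion_def)

section \<open>From the ball to the torus\<close>

lemma Hinf_ball_bounded:
  assumes "F \<in> Hinf_ball"
  obtains M where "\<And>z. norm z < 1 \<Longrightarrow> norm (F z) \<le> M"
proof -
  obtain M where "\<forall>x\<in>F ` ball 0 1. norm x \<le> M"
    using assms unfolding Hinf_ball_def bounded_iff by blast
  then show ?thesis by (intro that[of M]) auto
qed

lemma Hinf_ball_continuous:
  assumes "F \<in> Hinf_ball" "norm z < 1"
  shows "isCont F z"
proof -
  have "holomorphic_at F z" using assms by (auto simp: Hinf_ball_def)
  then show ?thesis by (auto simp: holomorphic_at_def intro: has_derivative_continuous)
qed

definition torus_lift :: "(c0 \<Rightarrow> 'x) \<Rightarrow> (nat \<Rightarrow> real) \<Rightarrow> (nat \<Rightarrow> complex) \<Rightarrow> 'x"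
  where "torus_lift F r \<omega> = F (Abs_c0 (\<lambda>j. of_real (r j) * \<omega> j))"

text \<open>
  The radii form a null sequence, so that the points \<open>r j * \<omega> j\<close> belong to \<open>c0\<close>, and they are bounded by \<open>q < 1\<close>, so
  that these points stay in the unit ball.
\<close>

context
  fixes r :: "nat \<Rightarrow> real" and q :: real
  assumes r: "r \<longlonglongrightarrow> 0" "\<And>j. 0 < r j" "\<And>j. r j \<le> q" "q < 1"
begin

lemma c0_nth_scaled:
  assumes "\<And>j. cmod (\<omega> j) \<le> 1"
  shows "c0_nth (Abs_c0 (\<lambda>j. of_real (r j) * \<omega> j)) j = of_real (r j) * \<omega> j"
proof -
  have "(\<lambda>j. of_real (r j) * \<omega> j) \<longlonglongrightarrow> 0"
  proof (rule Lim_null_comparison[OF _ r(1)])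
    show "\<forall>\<^sub>F j in sequentially. norm (of_real (r j) * \<omega> j) \<le> r j"
      using assms r(2) by (intro always_eventually allI) (simp add: norm_mult mult_left_le less_imp_le)
  qed
  then show ?thesis by (simp add: c0_nth_Abs)
qed

lemma norm_scaled_less:
  assumes "\<And>j. cmod (\<omega> j) \<le> 1"
  shows "norm (Abs_c0 (\<lambda>j. of_real (r j) * \<omega> j)) < 1"
proof -
  have "norm (Abs_c0 (\<lambda>j. of_real (r j) * \<omega> j)) \<le> q"
  proof (rule norm_c0_le)
    fix j
    have "cmod (c0_nth (Abs_c0 (\<lambda>j. of_real (r j) * \<omega> j)) j) = r j * cmod (\<omega> j)"
      unfolding c0_nth_scaled[of \<omega>, OF assms] using r(2)[of j] by (simp add: norm_mult)
    also have "\<dots> \<le> r j * 1" using assms r(2)[of j] by (intro mult_left_mono) auto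
    also have "\<dots> \<le> q" using r(3)[of j] by simp
    finally show "cmod (c0_nth (Abs_c0 (\<lambda>j. of_real (r j) * \<omega> j)) j) \<le> q" .
  qed
  then show ?thesis using r(4) by simp
qed

text \<open>
  Far out, the coordinates are small because \<open>r\<close> is a null sequence; the finitely many others
  converge.
\<close>

lemma truncations_tendsto_scaled:
  assumes \<omega>: "\<And>j. cmod (\<omega> j) \<le> 1" and \<rho>1: "\<And>i j. cmod (\<rho> i j) \<le> 1" and \<rho>: "\<And>j. (\<lambda>i. \<rho> i j) \<longlonglongrightarrow> \<omega> j"
  shows "(\<lambda>i. truncate_c0 i (\<lambda>j. of_real (r j) * \<rho> i j)) \<longlonglongrightarrow> Abs_c0 (\<lambda>j. of_real (r j) * \<omega> j)"
proof (rule LIMSEQ_I)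
  fix e :: real assume e: "e > 0"
  obtain N where "\<forall>j\<ge>N. norm (r j - 0) < e / 4"
    using LIMSEQ_D[OF r(1), of "e / 4"] e by auto
  then have N: "r j < e / 4" if "j \<ge> N" for j using that by fastforce
  have "\<forall>\<^sub>F i in sequentially. \<forall>j\<in>{..<N}. cmod (\<rho> i j - \<omega> j) < e / 2"
    using tendstoD[OF \<rho>, of "e / 2"] e by (intro eventually_ball_finite) (auto simp: dist_norm)
  then obtain I where I: "\<And>i j. i \<ge> I \<Longrightarrow> j < N \<Longrightarrow> cmod (\<rho> i j - \<omega> j) < e / 2"
    by (auto simp: eventually_sequentially)
  have "norm (truncate_c0 i (\<lambda>j. of_real (r j) * \<rho> i j) - Abs_c0 (\<lambda>j. of_real (r j) * \<omega> j)) < e" if i: "i \<ge> max I N" for i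
  proof -
    have "norm (truncate_c0 i (\<lambda>j. of_real (r j) * \<rho> i j) - Abs_c0 (\<lambda>j. of_real (r j) * \<omega> j)) \<le> e / 2"
    proof (rule norm_c0_le)
      fix j
      have r1: "r j \<le> 1" using r(3)[of j] r(4) by simp
      consider "j < N" | "j \<ge> N" by linarith
      then show "cmod (c0_nth (truncate_c0 i (\<lambda>j. of_real (r j) * \<rho> i j) - Abs_c0 (\<lambda>j. of_real (r j) * \<omega> j)) j) \<le> e / 2"
      proof cases
        case 1
        then have "c0_nth (truncate_c0 i (\<lambda>j. of_real (r j) * \<rho> i j) - Abs_c0 (\<lambda>j. of_real (r j) * \<omega> j)) j
            = of_real (r j) * (\<rho> i j - \<omega> j)"
          unfolding minus_c0.rep_eq c0_nth_truncate c0_nth_scaled[of \<omega>, OF \<omega>]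
          using i by (simp add: algebra_simps)
        moreover have "r j * cmod (\<rho> i j - \<omega> j) \<le> 1 * (e / 2)"
          using I[of i j] 1 i r1 r(2)[of j] by (intro mult_mono) auto
        ultimately show ?thesis using r(2)[of j] by (simp add: norm_mult)
      next
        case 2
        have "cmod (c0_nth (truncate_c0 i (\<lambda>j. of_real (r j) * \<rho> i j) - Abs_c0 (\<lambda>j. of_real (r j) * \<omega> j)) j)
            \<le> cmod (if j < i then of_real (r j) * \<rho> i j else 0) + cmod (of_real (r j) * \<omega> j)"
          unfolding minus_c0.rep_eq c0_nth_truncate c0_nth_scaled[of \<omega>, OF \<omega>] by (rule norm_triangle_ineq4)
        also have "\<dots> \<le> r j + r j"
          using r(2)[of j] \<omega>[of j] \<rho>1[of i j] by (intro add_mono) (auto simp: norm_mult mult_left_le)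
        also have "\<dots> \<le> e / 2" using N[OF 2] by simp
        finally show ?thesis .
      qed
    qed
    then show ?thesis using e by simp
  qed
  then show "\<exists>no. \<forall>i\<ge>no. norm (truncate_c0 i (\<lambda>j. of_real (r j) * \<rho> i j) - Abs_c0 (\<lambda>j. of_real (r j) * \<omega> j)) < e"
    by blast
qed

lemma norm_truncate_scaled_less:
  assumes "\<And>j. cmod (\<rho> j) \<le> 1"
  shows "norm (truncate_c0 i (\<lambda>j. of_real (r j) * \<rho> j)) < 1"
proof (rule norm_truncate_less)
  fix j
  have "cmod (of_real (r j) * \<rho> j) = r j * cmod (\<rho> j)" using r(2)[of j] by (simp add: norm_mult)
  also have "\<dots> \<le> r j * 1" using assms r(2)[of j] by (intro mult_left_mono) auto
  also have "\<dots> < 1" using r(3)[of j] r(4) by simp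
  finally show "cmod (of_real (r j) * \<rho> j) < 1" .
qed

lemma sections_tendsto_torus_lift:
  assumes F: "F \<in> Hinf_ball" and \<omega>: "\<And>j. cmod (\<omega> j) \<le> 1"
  shows "(\<lambda>m. section_at F m (\<lambda>j. of_real (r j) * \<omega> j)) \<longlonglongrightarrow> torus_lift F r \<omega>"
  unfolding section_at_truncate torus_lift_def
  by (rule isCont_tendsto_compose[OF Hinf_ball_continuous[OF F norm_scaled_less]])
    (use \<omega> truncations_tendsto_scaled[of \<omega> "\<lambda>i. \<omega>"] in auto)

text \<open>
  The approximating simple functions round the first \<open>i\<close> coordinates to finitely many values and drop
  the others. They converge because \<open>F\<close> is continuous.
\<close>

lemma torus_lift_strongly_measurable:
  assumes F: "F \<in> Hinf_ball"
  shows "strongly_measurable torus_measure (torus_lift F r)"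
proof -
  have "\<exists>\<rho>. (\<forall>i. simple_function torus_measure (\<rho> i)) \<and>
      (\<forall>\<omega>\<in>space torus_measure. (\<lambda>i. \<rho> i \<omega>) \<longlonglongrightarrow> \<omega> j) \<and> (\<forall>i \<omega>. cmod (\<rho> i \<omega>) \<le> 1)" for j
  proof -
    obtain s where s: "\<And>i. simple_function torus_measure (s i)"
      "\<And>\<omega>. \<omega> \<in> space torus_measure \<Longrightarrow> (\<lambda>i. s i \<omega>) \<longlonglongrightarrow> \<omega> j"
      using borel_measurable_implies_sequence_metric[OF measurable_coordinate[of j], of 0] by metis
    \<comment> \<open>the retraction onto the closed disk keeps the rounded points inside the unit ball\<close>
    define u where "u w = w / of_real (max 1 (cmod w))" for w :: complex
    have u1: "cmod (u w) \<le> 1" for w by (simp add: u_def norm_divide divide_le_eq)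
    have "(\<lambda>i. u (s i \<omega>)) \<longlonglongrightarrow> \<omega> j" if w: "\<omega> \<in> space torus_measure" for \<omega>
    proof -
      have "(\<lambda>i. u (s i \<omega>)) \<longlonglongrightarrow> \<omega> j / of_real (max 1 (cmod (\<omega> j)))"
        unfolding u_def by (intro tendsto_intros s(2)[OF w]) auto
      then show ?thesis using w by (simp add: space_torus)
    qed
    then show ?thesis using simple_function_compose1[OF s(1), where g = u] u1
      by (intro exI[of _ "\<lambda>i \<omega>. u (s i \<omega>)"]) auto
  qed
  then obtain \<rho> where \<rho>: "\<And>j i. simple_function torus_measure (\<rho> j i)"
    "\<And>j \<omega>. \<omega> \<in> space torus_measure \<Longrightarrow> (\<lambda>i. \<rho> j i \<omega>) \<longlonglongrightarrow> \<omega> j" "\<And>j i \<omega>. cmod (\<rho> j i \<omega>) \<le> 1" by metis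
  \<comment> \<open>the list of rounded coordinates takes finitely many values, and the approximating function depends on it alone\<close>
  define L where "L i n \<omega> = map (\<lambda>j. \<rho> j i \<omega>) [0..<n]" for i n \<omega>
  have L: "simple_function torus_measure (L i n)" for i n
  proof (induction n)
    case 0
    then show ?case by (simp add: L_def)
  next
    case (Suc n)
    have "simple_function torus_measure (\<lambda>\<omega>. L i n \<omega> @ [\<rho> n i \<omega>])"
      by (rule simple_function_compose2[OF Suc \<rho>(1)])
    then show ?case by (simp add: L_def)
  qed
  define S where "S i \<omega> = F (truncate_c0 i (\<lambda>j. of_real (r j) * \<rho> j i \<omega>))" for i \<omega>
  show ?thesis
    unfolding strongly_measurable_def
  proof (intro exI[of _ S] conjI allI ballI)
    fix i
    have "S i \<omega> = F (truncate_c0 i (\<lambda>j. of_real (r j) * (L i i \<omega> ! j)))" for \<omega>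
    proof -
      have "truncate_c0 i (\<lambda>j. of_real (r j) * \<rho> j i \<omega>) = truncate_c0 i (\<lambda>j. of_real (r j) * (L i i \<omega> ! j))"
        by (rule c0_eqI) (simp add: c0_nth_truncate L_def)
      then show ?thesis by (simp add: S_def)
    qed
    then have "S i = (\<lambda>\<omega>. F (truncate_c0 i (\<lambda>j. of_real (r j) * (L i i \<omega> ! j))))" by blast
    then show "simple_function torus_measure (S i)"
      using simple_function_compose1[OF L, where g = "\<lambda>l. F (truncate_c0 i (\<lambda>j. of_real (r j) * (l ! j)))"] by simp
  next
    fix \<omega> assume w: "\<omega> \<in> space torus_measure"
    then have w1: "cmod (\<omega> j) \<le> 1" for j by (simp add: space_torus)
    have "(\<lambda>i. truncate_c0 i (\<lambda>j. of_real (r j) * \<rho> j i \<omega>)) \<longlonglongrightarrow> Abs_c0 (\<lambda>j. of_real (r j) * \<omega> j)"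
      by (rule truncations_tendsto_scaled[where \<rho> = "\<lambda>i j. \<rho> j i \<omega>"]) (use w1 \<rho> w in auto)
    then show "(\<lambda>i. S i \<omega>) \<longlonglongrightarrow> torus_lift F r \<omega>"
      unfolding S_def torus_lift_def
      by (rule isCont_tendsto_compose[OF Hinf_ball_continuous[OF F norm_scaled_less[of \<omega>, OF w1]]])
  qed
qed

lemma torus_lift_Linf:
  assumes F: "F \<in> Hinf_ball" and M: "\<And>z. norm z < 1 \<Longrightarrow> norm (F z) \<le> M"
  shows "torus_lift F r \<in> Linf_torus" "norm_Linf_torus (torus_lift F r) \<le> M"
proof -
  have "AE \<omega> in torus_measure. norm (torus_lift F r \<omega>) \<le> M"
    unfolding torus_lift_def
    by (intro AE_I2 M norm_scaled_less) (simp add: space_torus)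
  then show "torus_lift F r \<in> Linf_torus" "norm_Linf_torus (torus_lift F r) \<le> M"
    by (rule Linf_torusI[OF torus_lift_strongly_measurable[OF F]])+
qed

text \<open>
  The coefficients of the sections of \<open>F\<close> are known from \<open>power_series_fourier\<close>, and the sections converge
  to the lift boundedly, so the coefficients converge as well.
\<close>

lemma fourier_coeff_torus_lift:
  fixes F :: "c0 \<Rightarrow> 'x::complex_banach"
  assumes F: "F \<in> Hinf_ball"
  shows "fourier_coeff (torus_lift F r) (Poly_Mapping.map int \<alpha>) = complex_of_real (multi_power r \<alpha>) *\<^sub>C monomial_coeff F \<alpha>"
    and "Poly_Mapping.lookup \<gamma> j < 0 \<Longrightarrow> fourier_coeff (torus_lift F r) \<gamma> = 0"
proof -
  obtain M where M: "\<And>z. norm z < 1 \<Longrightarrow> norm (F z) \<le> M"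
    using Hinf_ball_bounded[OF F] by blast
  note exp = Hinf_ball_expansion[OF F M]
  have main: "(\<lambda>m. \<Sum>\<beta>\<in>{\<beta>\<in>multi_indices m. Poly_Mapping.map int \<beta> = \<gamma>}. complex_of_real (multi_power r \<beta>) * \<phi> (monomial_coeff F \<beta>))
      \<longlonglongrightarrow> \<phi> (fourier_coeff (torus_lift F r) \<gamma>)" if \<phi>: "contractive_functional \<phi>" for \<phi> \<gamma>
  proof -
    have hs: "((\<lambda>\<beta>. multi_power z \<beta> * \<phi> (monomial_coeff F \<beta>)) has_sum \<phi> (section_at F m z)) (multi_indices m)"
      if "\<And>j. cmod (z j) \<le> r j" for z m
    proof (rule functional_has_sum[OF \<phi>])
      have "cmod (z j) < 1" for j using that[of j] r(3)[of j] r(4) by simp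
      then show "((\<lambda>\<beta>. multi_power z \<beta> *\<^sub>C monomial_coeff F \<beta>) has_sum section_at F m z) (multi_indices m)"
        using exp(1) unfolding is_monomial_expansion_def by blast
    qed
    note FC = power_series_fourier[where r = r and d = "\<lambda>\<beta>. \<phi> (monomial_coeff F \<beta>)"
        and G = "\<lambda>z. \<phi> (section_at F m z)" and m = m for m, OF less_imp_le[OF r(2)] hs]
    have "(\<lambda>m. \<integral>\<omega>. multi_powi \<omega> (- \<gamma>) * \<phi> (section_at F m (\<lambda>j. of_real (r j) * \<omega> j)) \<partial>torus_measure)
        \<longlonglongrightarrow> (\<integral>\<omega>. multi_powi \<omega> (- \<gamma>) * \<phi> (torus_lift F r \<omega>) \<partial>torus_measure)"
    proof (rule integral_dominated_convergence[where w = "\<lambda>_. M"])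
      show "(\<lambda>\<omega>. multi_powi \<omega> (- \<gamma>) * \<phi> (torus_lift F r \<omega>)) \<in> borel_measurable torus_measure"
        by (intro borel_measurable_times measurable_multi_powi
            strongly_measurable_functional[OF torus_lift_strongly_measurable[OF F] \<phi>])
      show "(\<lambda>\<omega>. multi_powi \<omega> (- \<gamma>) * \<phi> (section_at F m (\<lambda>j. of_real (r j) * \<omega> j))) \<in> borel_measurable torus_measure" for m
        by (intro borel_measurable_times measurable_multi_powi FC(2))
      show "AE \<omega> in torus_measure. (\<lambda>m. multi_powi \<omega> (- \<gamma>) * \<phi> (section_at F m (\<lambda>j. of_real (r j) * \<omega> j)))
          \<longlonglongrightarrow> multi_powi \<omega> (- \<gamma>) * \<phi> (torus_lift F r \<omega>)"
        by (intro AE_I2 tendsto_mult tendsto_const functional_continuous[OF \<phi>] sections_tendsto_torus_lift[OF F])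
          (simp add: space_torus)
      show "AE \<omega> in torus_measure. norm (multi_powi \<omega> (- \<gamma>) * \<phi> (section_at F m (\<lambda>j. of_real (r j) * \<omega> j))) \<le> M" for m
      proof (rule AE_I2)
        fix \<omega> assume w: "\<omega> \<in> space torus_measure"
        have "norm (section_at F m (\<lambda>j. of_real (r j) * \<omega> j)) \<le> M"
          unfolding section_at_truncate
          by (rule M, rule norm_truncate_scaled_less) (use w in \<open>simp add: space_torus\<close>)
        then show "norm (multi_powi \<omega> (- \<gamma>) * \<phi> (section_at F m (\<lambda>j. of_real (r j) * \<omega> j))) \<le> M"
          using functional_contractive[OF \<phi>] order_trans by (simp add: norm_mult norm_multi_powi[OF w]) blast
      qed
    qed simp
    then show ?thesis
      by (simp only: FC(1) fourier_coeff_functional[OF torus_lift_Linf(1)[OF F M] \<phi>])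
  qed
  show "fourier_coeff (torus_lift F r) (Poly_Mapping.map int \<alpha>) = complex_of_real (multi_power r \<alpha>) *\<^sub>C monomial_coeff F \<alpha>"
  proof (rule functional_eqI)
    fix \<phi> :: "'x \<Rightarrow> complex" assume \<phi>: "contractive_functional \<phi>"
    obtain m0 where m0: "\<alpha> \<in> multi_indices m0" using ex_multi_indices by blast
    have "{\<beta>\<in>multi_indices m. Poly_Mapping.map int \<beta> = Poly_Mapping.map int \<alpha>} = {\<alpha>}" if "m \<ge> m0" for m
      using m0 multi_indices_mono[OF that] by (auto simp: map_int_inject)
    then have "(\<lambda>m. \<Sum>\<beta>\<in>{\<beta>\<in>multi_indices m. Poly_Mapping.map int \<beta> = Poly_Mapping.map int \<alpha>}. complex_of_real (multi_power r \<beta>) * \<phi> (monomial_coeff F \<beta>))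
      \<longlonglongrightarrow> complex_of_real (multi_power r \<alpha>) * \<phi> (monomial_coeff F \<alpha>)"
      by (intro tendsto_eventually eventually_sequentiallyI[of m0]) simp
    from LIMSEQ_unique[OF main[OF \<phi>] this]
    show "\<phi> (fourier_coeff (torus_lift F r) (Poly_Mapping.map int \<alpha>)) = \<phi> (complex_of_real (multi_power r \<alpha>) *\<^sub>C monomial_coeff F \<alpha>)"
      by (simp add: functional_scaleC[OF \<phi>])
  qed
  show "fourier_coeff (torus_lift F r) \<gamma> = 0" if neg: "Poly_Mapping.lookup \<gamma> j < 0"
  proof (rule functional_eqI)
    fix \<phi> :: "'x \<Rightarrow> complex" assume \<phi>: "contractive_functional \<phi>"
    have e: "{\<beta>\<in>multi_indices m. Poly_Mapping.map int \<beta> = \<gamma>} = {}" for m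
      using neg by (auto simp: lookup_map_int)
    have "(\<lambda>m::nat. 0) \<longlonglongrightarrow> \<phi> (fourier_coeff (torus_lift F r) \<gamma>)"
      using main[OF \<phi>, of \<gamma>] by (simp only: e sum.empty)
    then show "\<phi> (fourier_coeff (torus_lift F r) \<gamma>) = \<phi> 0"
      by (simp add: LIMSEQ_const_iff functional_zero[OF \<phi>])
  qed
qed

lemma torus_lift_Hinf: "F \<in> Hinf_ball \<Longrightarrow> torus_lift F r \<in> Hinf_torus"
proof -
  assume F: "F \<in> Hinf_ball"
  obtain M where M: "\<And>z. norm z < 1 \<Longrightarrow> norm (F z) \<le> M"
    using Hinf_ball_bounded[OF F] by blast
  show ?thesis
    unfolding Hinf_torus_def using torus_lift_Linf(1)[OF F M] fourier_coeff_torus_lift(2)[OF F] by auto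
qed

end

section \<open>Cutting off high frequencies\<close>

text \<open>
  Integration by parts; the boundary term vanishes at \<open>0\<close>.
\<close>

lemma one_minus_cos_integral:
  assumes "T \<ge> 0" "\<beta> \<ge> 0"
  shows "((\<lambda>t. (1 - cos (\<beta> * t)) / t ^ 2) has_integral (\<beta> * Si (\<beta> * T) - (1 - cos (\<beta> * T)) / T)) {0..T}"
proof -
  define \<Phi> where "\<Phi> t = \<beta> * Si (\<beta> * t) - (1 - cos (\<beta> * t)) / t" for t
  have der: "(\<Phi> has_real_derivative (1 - cos (\<beta> * t)) / t ^ 2) (at t)" if t: "t > 0" for t
  proof -
    have "((\<lambda>t. Si (\<beta> * t)) has_real_derivative sinc (\<beta> * t) * \<beta>) (at t)"
      by (rule DERIV_chain2[OF DERIV_Si]) (auto intro!: derivative_eq_intros)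
    then have "(\<Phi> has_real_derivative
        \<beta> * (sinc (\<beta> * t) * \<beta>) - (sin (\<beta> * t) * \<beta> * t - (1 - cos (\<beta> * t)) * 1) / (t * t)) (at t)"
      unfolding \<Phi>_def using t by (auto intro!: derivative_eq_intros)
    moreover have "\<beta> * (sinc (\<beta> * t) * \<beta>) = \<beta> * sin (\<beta> * t) / t"
    proof (cases "\<beta> = 0")
      case False
      then have "\<beta> * t \<noteq> 0" using t by simp
      then show ?thesis by (simp only: if_False) (simp add: field_simps)
    qed simp
    then have "\<beta> * (sinc (\<beta> * t) * \<beta>) - (sin (\<beta> * t) * \<beta> * t - (1 - cos (\<beta> * t)) * 1) / (t * t)
        = (1 - cos (\<beta> * t)) / t ^ 2"
      using t by (simp add: field_simps power2_eq_square)
    ultimately show ?thesis by simp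
  qed
  have cont: "isCont \<Phi> t" if "t \<ge> 0" for t
  proof (cases "t = 0")
    case False
    then show ?thesis using der[of t] that DERIV_isCont by fastforce
  next
    case True
    have "((\<lambda>t. 1 - cos (\<beta> * t)) has_real_derivative 0) (at 0)"
      by (auto intro!: derivative_eq_intros)
    then have "((\<lambda>t. (1 - cos (\<beta> * t)) / t) \<longlongrightarrow> 0) (at 0)"
      by (simp add: has_field_derivative_iff)
    moreover have "((\<lambda>t. \<beta> * Si (\<beta> * t)) \<longlongrightarrow> \<beta> * Si (\<beta> * 0)) (at 0)"
      by (intro tendsto_intros isCont_tendsto_compose[OF isCont_Si])
    ultimately have "(\<Phi> \<longlongrightarrow> \<beta> * Si (\<beta> * 0) - 0) (at 0)"
      unfolding \<Phi>_def by (rule tendsto_diff[rotated])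
    then show ?thesis using True by (simp add: isCont_def \<Phi>_def)
  qed
  have "((\<lambda>t. (1 - cos (\<beta> * t)) / t ^ 2) has_integral (\<Phi> T - \<Phi> 0)) {0..T}"
  proof (rule fundamental_theorem_of_calculus_interior[OF assms(1)])
    show "continuous_on {0..T} \<Phi>" using cont by (intro continuous_at_imp_continuous_on) auto
    show "(\<Phi> has_vector_derivative (1 - cos (\<beta> * t)) / t ^ 2) (at t)" if "t \<in> {0<..<T}" for t
      using der[of t] that by (simp add: has_real_derivative_iff_has_vector_derivative)
  qed
  moreover have "Si 0 = 0" by (simp add: Si_alt_def interval_integral_endpoints_same zero_ereal_def)
  then have "\<Phi> 0 = 0" by (simp add: \<Phi>_def)
  ultimately show ?thesis unfolding \<Phi>_def[of T] by simp
qed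

lemma one_minus_cos_integral_limit:
  "((\<lambda>T. \<bar>\<beta>\<bar> * Si (\<bar>\<beta>\<bar> * T) - (1 - cos (\<bar>\<beta>\<bar> * T)) / T) \<longlongrightarrow> pi / 2 * \<bar>\<beta>\<bar>) at_top"
proof (cases "\<beta> = 0")
  case False
  then have b: "\<bar>\<beta>\<bar> > 0" by simp
  have "filterlim (\<lambda>T. \<bar>\<beta>\<bar> * T) at_top at_top"
    using b by (intro filterlim_tendsto_pos_mult_at_top[OF tendsto_const]) (auto simp: filterlim_ident)
  then have 1: "((\<lambda>T. Si (\<bar>\<beta>\<bar> * T)) \<longlongrightarrow> pi / 2) at_top"
    by (rule filterlim_compose[OF Si_at_top])
  have 2: "((\<lambda>T. (1 - cos (\<bar>\<beta>\<bar> * T)) / T) \<longlongrightarrow> 0) at_top"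
  proof (rule Lim_null_comparison)
    show "((\<lambda>T::real. 2 / T) \<longlongrightarrow> 0) at_top"
      by (intro tendsto_divide_0[OF tendsto_const] filterlim_at_top_imp_at_infinity filterlim_ident)
    show "\<forall>\<^sub>F T in at_top. norm ((1 - cos (\<bar>\<beta>\<bar> * T)) / T) \<le> 2 / T"
    proof (rule eventually_mono[OF eventually_gt_at_top[of 0]])
      fix T :: real assume "T > 0"
      moreover have "\<bar>1 - cos (\<bar>\<beta>\<bar> * T)\<bar> \<le> 2" using cos_le_one[of "\<bar>\<beta>\<bar> * T"] cos_ge_minus_one[of "\<bar>\<beta>\<bar> * T"] by linarith
      ultimately show "norm ((1 - cos (\<bar>\<beta>\<bar> * T)) / T) \<le> 2 / T" by (simp add: divide_right_mono)
    qed
  qed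
  have "((\<lambda>T. \<bar>\<beta>\<bar> * Si (\<bar>\<beta>\<bar> * T) - (1 - cos (\<bar>\<beta>\<bar> * T)) / T) \<longlongrightarrow> \<bar>\<beta>\<bar> * (pi / 2) - 0) at_top"
    by (intro tendsto_diff tendsto_mult tendsto_const 1 2)
  then show ?thesis by (simp add: mult.commute)
qed simp

text \<open>
  Twice its cosine transform over the half-line is the trapezoid that equals \<open>1\<close> up to \<open>a\<close> and falls linearly
  to \<open>0\<close> at \<open>b\<close>. At \<open>t = 0\<close> the value is \<open>0\<close> instead of the limit, which integrals do not notice.
\<close>

definition trapezoid_kernel :: "real \<Rightarrow> real \<Rightarrow> real \<Rightarrow> real"
  where "trapezoid_kernel a b t = (cos (a * t) - cos (b * t)) / (pi * (b - a) * t ^ 2)"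

text \<open>
  The products of cosines are sums of cosines, and the integral of \<open>(1 - cos (\<beta> t)) / t\<^sup>2\<close> over the half-line
  is \<open>\<pi> \<bar>\<beta>\<bar> / 2\<close>. The transform at \<open>x\<close> is thus a combination of the absolute values of \<open>b + x\<close>, \<open>b - x\<close>, \<open>a + x\<close> and
  \<open>a - x\<close>.
\<close>

lemma trapezoid_kernel_cosine_transform:
  assumes ab: "0 \<le> a" "a < b" and x: "0 \<le> x" "x \<le> a \<or> b \<le> x"
  obtains I where "\<And>T. T \<ge> 0 \<Longrightarrow> ((\<lambda>t. trapezoid_kernel a b t * cos (x * t)) has_integral I T) {0..T}"
    "(I \<longlongrightarrow> (if x \<le> a then 1/2 else 0)) at_top"
proof -
  define J where "J \<beta> T = \<bar>\<beta>\<bar> * Si (\<bar>\<beta>\<bar> * T) - (1 - cos (\<bar>\<beta>\<bar> * T)) / T" for \<beta> T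
  have J: "((\<lambda>t. (1 - cos (\<beta> * t)) / t ^ 2) has_integral J \<beta> T) {0..T}" if "T \<ge> 0" for \<beta> T
  proof -
    have "cos (\<bar>\<beta>\<bar> * t) = cos (\<beta> * t)" for t by (cases "\<beta> \<ge> 0") auto
    then show ?thesis using one_minus_cos_integral[OF that, of "\<bar>\<beta>\<bar>"] by (simp add: J_def)
  qed
  define I where "I T = 1 / (2 * pi * (b - a)) * (J (b + x) T + J (b - x) T - (J (a + x) T + J (a - x) T))" for T
  show ?thesis
  proof (rule that[of I])
    fix T :: real assume T: "T \<ge> 0"
    have "((\<lambda>t. 1 / (2 * pi * (b - a)) * ((1 - cos ((b + x) * t)) / t ^ 2 + (1 - cos ((b - x) * t)) / t ^ 2
        - ((1 - cos ((a + x) * t)) / t ^ 2 + (1 - cos ((a - x) * t)) / t ^ 2))) has_integral I T) {0..T}"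
      unfolding I_def by (intro has_integral_mult_right has_integral_diff has_integral_add J T)
    moreover have "1 / (2 * pi * (b - a)) * ((1 - cos ((b + x) * t)) / t ^ 2 + (1 - cos ((b - x) * t)) / t ^ 2
        - ((1 - cos ((a + x) * t)) / t ^ 2 + (1 - cos ((a - x) * t)) / t ^ 2))
      = trapezoid_kernel a b t * cos (x * t)" for t
    proof -
      have "cos ((b + x) * t) + cos ((b - x) * t) = 2 * (cos (b * t) * cos (x * t))"
        "cos ((a + x) * t) + cos ((a - x) * t) = 2 * (cos (a * t) * cos (x * t))"
        by (simp_all add: cos_add cos_diff algebra_simps)
      then have "(1 - cos ((b + x) * t)) + (1 - cos ((b - x) * t)) - ((1 - cos ((a + x) * t)) + (1 - cos ((a - x) * t)))
        = 2 * ((cos (a * t) - cos (b * t)) * cos (x * t))"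
        by (simp add: algebra_simps)
      then have "1 / (2 * pi * (b - a)) * (((1 - cos ((b + x) * t)) + (1 - cos ((b - x) * t)) - ((1 - cos ((a + x) * t)) + (1 - cos ((a - x) * t)))) / t ^ 2)
        = trapezoid_kernel a b t * cos (x * t)"
        by (simp add: trapezoid_kernel_def)
      then show ?thesis by (simp add: add_divide_distrib diff_divide_distrib)
    qed
    ultimately show "((\<lambda>t. trapezoid_kernel a b t * cos (x * t)) has_integral I T) {0..T}" by simp
  next
    have "(I \<longlongrightarrow> 1 / (2 * pi * (b - a)) * (pi / 2 * \<bar>b + x\<bar> + pi / 2 * \<bar>b - x\<bar>
        - (pi / 2 * \<bar>a + x\<bar> + pi / 2 * \<bar>a - x\<bar>))) at_top"
      unfolding I_def J_def by (intro tendsto_intros one_minus_cos_integral_limit)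
    moreover have "1 / (2 * pi * (b - a)) * (pi / 2 * \<bar>b + x\<bar> + pi / 2 * \<bar>b - x\<bar>
        - (pi / 2 * \<bar>a + x\<bar> + pi / 2 * \<bar>a - x\<bar>)) = (if x \<le> a then 1/2 else 0)"
    proof (cases "x \<le> a")
      case True
      then have "\<bar>b + x\<bar> = b + x" "\<bar>b - x\<bar> = b - x" "\<bar>a + x\<bar> = a + x" "\<bar>a - x\<bar> = a - x"
        using ab x by auto
      then show ?thesis using True ab by (simp add: field_simps)
    next
      case False
      then have "\<bar>b + x\<bar> = b + x" "\<bar>b - x\<bar> = x - b" "\<bar>a + x\<bar> = a + x" "\<bar>a - x\<bar> = x - a"
        using ab x by auto
      then show ?thesis using False ab by (simp add: field_simps)
    qed
    ultimately show "(I \<longlongrightarrow> (if x \<le> a then 1/2 else 0)) at_top" by simp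
  qed
qed

lemma abs_cos_diff_le:
  fixes x y :: real
  shows "\<bar>cos x - cos y\<bar> \<le> \<bar>x - y\<bar>" "\<bar>cos x - cos y\<bar> \<le> \<bar>x - y\<bar> * \<bar>x + y\<bar> / 2"
proof -
  have e: "\<bar>cos x - cos y\<bar> = 2 * (\<bar>sin ((x + y) / 2)\<bar> * \<bar>sin ((y - x) / 2)\<bar>)"
    by (simp add: cos_diff_cos abs_mult)
  have s: "\<bar>sin ((y - x) / 2)\<bar> \<le> \<bar>x - y\<bar> / 2"
    using abs_sin_x_le_abs_x[of "(y - x) / 2"] by simp
  have "2 * (\<bar>sin ((x + y) / 2)\<bar> * \<bar>sin ((y - x) / 2)\<bar>) \<le> 2 * (1 * (\<bar>x - y\<bar> / 2))"
    using s by (intro mult_left_mono mult_mono) auto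
  then show "\<bar>cos x - cos y\<bar> \<le> \<bar>x - y\<bar>" unfolding e by simp
  have "2 * (\<bar>sin ((x + y) / 2)\<bar> * \<bar>sin ((y - x) / 2)\<bar>) \<le> 2 * (\<bar>(x + y) / 2\<bar> * (\<bar>x - y\<bar> / 2))"
    using s abs_sin_x_le_abs_x[of "(x + y) / 2"] by (intro mult_left_mono mult_mono) auto
  then show "\<bar>cos x - cos y\<bar> \<le> \<bar>x - y\<bar> * \<bar>x + y\<bar> / 2" unfolding e by (simp add: mult_ac)
qed

text \<open>
  The three bounds are used up to \<open>1 / (a + b)\<close>, from there to \<open>1 / (b - a)\<close>, and beyond. They contribute
  \<open>1 / (2 \<pi>)\<close>, \<open>ln ((a + b) / (b - a)) / \<pi>\<close> and \<open>2 / \<pi>\<close> to the \<open>L\<^sub>1\<close>-norm.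
\<close>

lemma trapezoid_kernel_bounds:
  assumes ab: "0 \<le> a" "a < b" and t: "t > 0"
  shows "\<bar>trapezoid_kernel a b t\<bar> \<le> (a + b) / (2 * pi)"
    "\<bar>trapezoid_kernel a b t\<bar> \<le> 1 / pi * (1 / t)"
    "\<bar>trapezoid_kernel a b t\<bar> \<le> 2 / (pi * (b - a)) * (1 / t ^ 2)"
proof -
  have k: "\<bar>trapezoid_kernel a b t\<bar> = \<bar>cos (a * t) - cos (b * t)\<bar> / (pi * (b - a) * t ^ 2)"
    using ab by (simp add: trapezoid_kernel_def abs_mult)
  have p: "pi * (b - a) * t ^ 2 > 0" using ab t by simp
  have d: "\<bar>a * t - b * t\<bar> = (b - a) * t" "\<bar>a * t + b * t\<bar> = (a + b) * t"
    using ab t by (auto simp: abs_mult simp flip: left_diff_distrib distrib_right)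
  have "\<bar>trapezoid_kernel a b t\<bar> \<le> ((b - a) * t * ((a + b) * t) / 2) / (pi * (b - a) * t ^ 2)"
    unfolding k using abs_cos_diff_le(2)[of "a * t" "b * t"] p unfolding d
    by (intro divide_right_mono) auto
  moreover have "((b - a) * t * ((a + b) * t) / 2) / (pi * (b - a) * t ^ 2) = (a + b) / (2 * pi)"
    using ab t by (simp add: divide_simps power2_eq_square)
  ultimately show "\<bar>trapezoid_kernel a b t\<bar> \<le> (a + b) / (2 * pi)" by simp
  have "\<bar>trapezoid_kernel a b t\<bar> \<le> ((b - a) * t) / (pi * (b - a) * t ^ 2)"
    unfolding k using abs_cos_diff_le(1)[of "a * t" "b * t"] p unfolding d
    by (intro divide_right_mono) auto
  moreover have "((b - a) * t) / (pi * (b - a) * t ^ 2) = 1 / pi * (1 / t)"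
    using ab t by (simp add: divide_simps power2_eq_square)
  ultimately show "\<bar>trapezoid_kernel a b t\<bar> \<le> 1 / pi * (1 / t)" by simp
  have "\<bar>trapezoid_kernel a b t\<bar> \<le> 2 / (pi * (b - a) * t ^ 2)"
    unfolding k using p cos_le_one[of "a * t"] cos_ge_minus_one[of "a * t"] cos_le_one[of "b * t"] cos_ge_minus_one[of "b * t"]
    by (intro divide_right_mono) linarith+
  then show "\<bar>trapezoid_kernel a b t\<bar> \<le> 2 / (pi * (b - a)) * (1 / t ^ 2)"
    by simp
qed

lemma norm_integral_le_has_integral:
  fixes f :: "real \<Rightarrow> 'a::banach"
  assumes "f integrable_on S" "(g has_integral I) S" "\<And>t. t \<in> S \<Longrightarrow> norm (f t) \<le> g t"
  shows "norm (integral S f) \<le> I"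
  using integral_norm_bound_integral[OF assms(1) has_integral_integrable[OF assms(2)] assms(3)]
    integral_unique[OF assms(2)] by simp

text \<open>
  Twice the resulting bound for the \<open>L\<^sub>1\<close>-norm of the kernel on the half-line.
\<close>

definition cutoff_constant :: "real \<Rightarrow> real \<Rightarrow> real"
  where "cutoff_constant a b = 2 / pi * (5 / 2 + ln ((a + b) / (b - a)))"

text \<open>
  The mean of the exponential sum at \<open>t\<close> and at \<open>- t\<close> is a cosine sum that is still bounded by \<open>B\<close>. Integrated
  against the kernel it retains half of the terms with frequency up to \<open>a\<close> and loses the others, because
  no frequency lies strictly between \<open>a\<close> and \<open>b\<close>.
\<close>

lemma frequency_cutoff_scalar:
  fixes \<beta> :: "'i \<Rightarrow> complex"
  assumes S: "finite S" and ab: "0 \<le> a" "a < b"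
    and \<nu>: "\<And>i. i \<in> S \<Longrightarrow> 0 \<le> \<nu> i" "\<And>i. i \<in> S \<Longrightarrow> \<nu> i \<le> a \<or> b \<le> \<nu> i"
    and B: "\<And>t. cmod (\<Sum>i\<in>S. cis (- t * \<nu> i) * \<beta> i) \<le> B"
  shows "cmod (\<Sum>i\<in>{i\<in>S. \<nu> i \<le> a}. \<beta> i) \<le> cutoff_constant a b * B"
proof -
  have B0: "B \<ge> 0" using B[of 0] norm_ge_zero order_trans by blast
  define g where "g t = (\<Sum>i\<in>S. of_real (cos (\<nu> i * t)) * \<beta> i)" for t
  have g_le: "cmod (g t) \<le> B" for t
  proof -
    have c: "complex_of_real (cos (\<nu> i * t)) = (cis (- t * \<nu> i) + cis (- (- t) * \<nu> i)) / 2" for i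
      by (simp add: complex_eq_iff mult.commute)
    have "g t = ((\<Sum>i\<in>S. cis (- t * \<nu> i) * \<beta> i) + (\<Sum>i\<in>S. cis (- (- t) * \<nu> i) * \<beta> i)) / 2"
      unfolding g_def c by (simp add: sum.distrib[symmetric] sum_divide_distrib algebra_simps)
    also have "cmod \<dots> \<le> (B + B) / 2"
      unfolding norm_divide using norm_triangle_le[OF add_mono[OF B[of t] B[of "- t"]]]
      by (simp add: divide_right_mono)
    finally show ?thesis by simp
  qed
  have "\<forall>i\<in>S. \<exists>I. (\<forall>T\<ge>0. ((\<lambda>t. trapezoid_kernel a b t * cos (\<nu> i * t)) has_integral I T) {0..T}) \<and>
    (I \<longlongrightarrow> (if \<nu> i \<le> a then 1/2 else 0)) at_top"
    using trapezoid_kernel_cosine_transform[OF ab \<nu>] by metis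
  then obtain I where I: "\<And>i T. i \<in> S \<Longrightarrow> T \<ge> 0 \<Longrightarrow>
      ((\<lambda>t. trapezoid_kernel a b t * cos (\<nu> i * t)) has_integral I i T) {0..T}"
    "\<And>i. i \<in> S \<Longrightarrow> (I i \<longlongrightarrow> (if \<nu> i \<le> a then 1/2 else 0)) at_top" by metis
  define k where "k t = trapezoid_kernel a b t *\<^sub>R g t" for t
  have k_int: "(k has_integral (\<Sum>i\<in>S. of_real (I i T) * \<beta> i)) {0..T}" if T: "T \<ge> 0" for T
  proof -
    have "((\<lambda>t. \<Sum>i\<in>S. of_real (trapezoid_kernel a b t * cos (\<nu> i * t)) * \<beta> i) has_integral
        (\<Sum>i\<in>S. of_real (I i T) * \<beta> i)) {0..T}"
      by (intro has_integral_sum S has_integral_mult_left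
          has_integral_linear[OF I(1) bounded_linear_of_real, unfolded o_def] T)
    then show ?thesis
      by (simp add: k_def[abs_def] g_def scaleR_conv_of_real sum_distrib_left mult.assoc)
  qed
  have lim: "((\<lambda>T. \<Sum>i\<in>S. of_real (I i T) * \<beta> i) \<longlongrightarrow> (\<Sum>i\<in>S. of_real (if \<nu> i \<le> a then 1/2 else 0) * \<beta> i)) at_top"
    by (intro tendsto_intros I(2))
  have lim_val: "(\<Sum>i\<in>S. of_real (if \<nu> i \<le> a then 1/2 else 0) * \<beta> i) = (\<Sum>i\<in>{i\<in>S. \<nu> i \<le> a}. \<beta> i) / 2"
  proof -
    have "(\<Sum>i\<in>S. of_real (if \<nu> i \<le> a then 1/2 else 0) * \<beta> i) = (\<Sum>i\<in>S. if \<nu> i \<le> a then \<beta> i / 2 else 0)"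
      by (intro sum.cong) auto
    also have "\<dots> = (\<Sum>i\<in>{i\<in>S. \<nu> i \<le> a}. \<beta> i / 2)"
      using S by (simp add: sum.inter_filter)
    finally show ?thesis by (simp add: sum_divide_distrib)
  qed
  define u where "u = 1 / (a + b)"
  define v where "v = 1 / (b - a)"
  have uv: "0 < u" "u \<le> v" using ab by (auto simp: u_def v_def field_simps)
  have k_le: "norm (k t) \<le> \<bar>trapezoid_kernel a b t\<bar> * B" for t
    unfolding k_def norm_scaleR by (intro mult_left_mono g_le) auto
  have bound: "cmod (\<Sum>i\<in>S. of_real (I i T) * \<beta> i) \<le> B / pi * (5/2 + ln (v / u))" if T: "T \<ge> v" for T
  proof -
    have T0: "T \<ge> 0" using T uv by simp
    have int: "k integrable_on {x..y}" if "0 \<le> x" "y \<le> T" for x y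
      using that by (intro integrable_on_subinterval[OF has_integral_integrable[OF k_int[OF T0]]]) auto
    have "(\<Sum>i\<in>S. of_real (I i T) * \<beta> i) = integral {0..T} k"
      using k_int[OF T0] by (simp add: integral_unique)
    also have "\<dots> = integral {0..u} k + (integral {u..v} k + integral {v..T} k)"
    proof -
      have "integral {0..T} k = integral {0..u} k + integral {u..T} k"
        by (rule Henstock_Kurzweil_Integration.integral_combine[symmetric]) (use int[of 0 T] uv T in auto)
      moreover have "integral {u..T} k = integral {u..v} k + integral {v..T} k"
        by (rule Henstock_Kurzweil_Integration.integral_combine[symmetric]) (use int[of u T] uv T in auto)
      ultimately show ?thesis by simp
    qed
    also have "norm \<dots> \<le> norm (integral {0..u} k) + (norm (integral {u..v} k) + norm (integral {v..T} k))"
      by (intro order_trans[OF norm_triangle_ineq] add_left_mono norm_triangle_ineq)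
    also have "\<dots> \<le> B / (2 * pi) + (B / pi * ln (v / u) + 2 * B / pi)"
    proof (intro add_mono)
      have "norm (integral (cbox 0 u) k) \<le> ((a + b) / (2 * pi) * B) * measure lborel (cbox 0 u)"
      proof (rule has_integral_bound)
        show "(k has_integral integral (cbox 0 u) k) (cbox 0 u)"
          using int[of 0 u] uv T by (simp add: has_integral_integral)
        fix t assume t: "t \<in> cbox 0 u"
        show "norm (k t) \<le> (a + b) / (2 * pi) * B"
        proof (cases "t = 0")
          case True
          then show ?thesis using ab B0 by (simp add: k_def trapezoid_kernel_def)
        next
          case False
          then have "t > 0" using t by simp
          then show ?thesis
            using order_trans[OF k_le mult_right_mono[OF trapezoid_kernel_bounds(1)[OF ab, of t] B0]] by simp
        qed
      qed (use ab B0 in simp)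
      then have "norm (integral {0..u} k) \<le> ((a + b) / (2 * pi) * B) * u" using uv by simp
      also have "\<dots> = ((a + b) * u) * (B / (2 * pi))" by simp
      also have "(a + b) * u = 1" using ab by (simp add: u_def)
      finally show "norm (integral {0..u} k) \<le> B / (2 * pi)" by simp
    next
      have "((\<lambda>t. B / pi * (1 / t)) has_integral B / pi * (ln v - ln u)) {u..v}"
      proof (intro has_integral_mult_right fundamental_theorem_of_calculus uv)
        show "(ln has_vector_derivative 1 / t) (at t within {u..v})" if "t \<in> {u..v}" for t
          using that uv by (auto intro!: derivative_eq_intros simp flip: has_real_derivative_iff_has_vector_derivative)
      qed
      moreover have "norm (k t) \<le> B / pi * (1 / t)" if "t \<in> {u..v}" for t
        using order_trans[OF k_le mult_right_mono[OF trapezoid_kernel_bounds(2)[OF ab, of t] B0]] that uv by simp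
      ultimately have "norm (integral {u..v} k) \<le> B / pi * (ln v - ln u)"
        by (rule norm_integral_le_has_integral[OF int[of u v], rotated 2]) (use uv T in auto)
      then show "norm (integral {u..v} k) \<le> B / pi * ln (v / u)" using uv by (simp add: ln_div)
    next
      have "((\<lambda>t. 2 * B / (pi * (b - a)) * (1 / t ^ 2)) has_integral 2 * B / (pi * (b - a)) * (- 1 / T - - 1 / v)) {v..T}"
      proof (intro has_integral_mult_right fundamental_theorem_of_calculus T)
        show "((\<lambda>t. - 1 / t) has_vector_derivative 1 / t ^ 2) (at t within {v..T})" if "t \<in> {v..T}" for t
          using that uv by (auto intro!: derivative_eq_intros simp: power2_eq_square simp flip: has_real_derivative_iff_has_vector_derivative)
      qed
      moreover have "norm (k t) \<le> 2 * B / (pi * (b - a)) * (1 / t ^ 2)" if "t \<in> {v..T}" for t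
        using order_trans[OF k_le mult_right_mono[OF trapezoid_kernel_bounds(3)[OF ab, of t] B0]] that uv by (simp add: mult_ac)
      ultimately have "norm (integral {v..T} k) \<le> 2 * B / (pi * (b - a)) * (- 1 / T - - 1 / v)"
        by (rule norm_integral_le_has_integral[OF int[of v T], rotated 2]) (use uv T in auto)
      also have "\<dots> \<le> 2 * B / (pi * (b - a)) * (1 / v)"
        using B0 ab uv T by (intro mult_left_mono) auto
      also have "\<dots> = 2 * B / pi" using ab by (simp add: v_def)
      finally show "norm (integral {v..T} k) \<le> 2 * B / pi" .
    qed
    also have "\<dots> = B / pi * (5/2 + ln (v / u))" by (simp add: field_simps)
    finally show ?thesis .
  qed
  have "cmod ((\<Sum>i\<in>{i\<in>S. \<nu> i \<le> a}. \<beta> i) / 2) \<le> B / pi * (5/2 + ln (v / u))"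
  proof (rule tendsto_upperbound)
    show "((\<lambda>T. cmod (\<Sum>i\<in>S. of_real (I i T) * \<beta> i)) \<longlongrightarrow> cmod ((\<Sum>i\<in>{i\<in>S. \<nu> i \<le> a}. \<beta> i) / 2)) at_top"
      using tendsto_norm[OF lim] unfolding lim_val .
    show "\<forall>\<^sub>F T in at_top. cmod (\<Sum>i\<in>S. of_real (I i T) * \<beta> i) \<le> B / pi * (5/2 + ln (v / u))"
      using eventually_ge_at_top bound by (rule eventually_mono)
  qed simp
  then show ?thesis by (simp add: cutoff_constant_def u_def v_def norm_divide field_simps)
qed

lemma summable_on_finite_tail:
  fixes f :: "'i \<Rightarrow> real"
  assumes f: "f summable_on A" and nn: "\<And>x. x \<in> A \<Longrightarrow> f x \<ge> 0" and e: "e > 0" and L: "finite L" "L \<subseteq> A"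
  obtains S where "finite S" "L \<subseteq> S" "S \<subseteq> A" "infsum f (A - S) < e"
proof -
  have "(sum f \<longlongrightarrow> infsum f A) (finite_subsets_at_top A)"
    using has_sum_infsum[OF f] by (simp add: has_sum_def)
  then have "\<forall>\<^sub>F S in finite_subsets_at_top A. dist (sum f S) (infsum f A) < e"
    using e by (rule tendstoD)
  then obtain X where X: "finite X" "X \<subseteq> A" "\<And>S. finite S \<Longrightarrow> X \<subseteq> S \<Longrightarrow> S \<subseteq> A \<Longrightarrow> dist (sum f S) (infsum f A) < e"
    unfolding eventually_finite_subsets_at_top by metis
  let ?S = "X \<union> L"
  have fin: "finite ?S" "?S \<subseteq> A" using X L by auto
  have "infsum f (A - ?S) = infsum f A - sum f ?S"
    using infsum_Diff[OF f, of ?S] fin by (simp add: summable_on_finite)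
  also have "\<dots> < e" using X(3)[of ?S] fin by (simp add: dist_real_def)
  finally show ?thesis using that[of ?S] fin by auto
qed

text \<open>
  A finite subfamily that contains all low frequencies and misses less than \<open>e\<close> of the total mass
  satisfies the hypothesis of the finite case with \<open>B + e\<close> in place of \<open>B\<close>.
\<close>

lemma frequency_cutoff:
  fixes \<beta> :: "'i \<Rightarrow> 'x::complex_banach"
  assumes ab: "0 \<le> a" "a < b" and sm: "(\<lambda>i. norm (\<beta> i)) summable_on A"
    and \<nu>: "\<And>i. i \<in> A \<Longrightarrow> 0 \<le> \<nu> i" "\<And>i. i \<in> A \<Longrightarrow> \<nu> i \<le> a \<or> b \<le> \<nu> i"
    and fin: "finite {i\<in>A. \<nu> i \<le> a}"
    and B: "\<And>t. norm (infsum (\<lambda>i. cis (- t * \<nu> i) *\<^sub>C \<beta> i) A) \<le> B"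
  shows "norm (\<Sum>i\<in>{i\<in>A. \<nu> i \<le> a}. \<beta> i) \<le> cutoff_constant a b * B"
proof -
  let ?L = "{i\<in>A. \<nu> i \<le> a}"
  have *: "norm (\<Sum>i\<in>?L. \<beta> i) \<le> cutoff_constant a b * (B + e)" if e: "e > 0" for e
  proof (rule functional_norm_leI)
    fix \<phi> :: "'x \<Rightarrow> complex" assume \<phi>: "contractive_functional \<phi>"
    obtain S where S: "finite S" "?L \<subseteq> S" "S \<subseteq> A" "infsum (\<lambda>i. norm (\<beta> i)) (A - S) < e"
      by (rule summable_on_finite_tail[OF sm _ e fin]) auto
    have bnd: "cmod (\<Sum>i\<in>S. cis (- t * \<nu> i) * \<phi> (\<beta> i)) \<le> B + e" for t
    proof -
      let ?f = "\<lambda>i. cis (- t * \<nu> i) *\<^sub>C \<beta> i"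
      have nf: "(\<lambda>i. norm (?f i)) = (\<lambda>i. norm (\<beta> i))" by (simp add: norm_scaleC)
      have sf: "?f summable_on A" by (rule Infinite_Sum.abs_summable_summable) (unfold nf, rule sm)
      have "norm (infsum ?f (A - S)) \<le> infsum (\<lambda>i. norm (?f i)) (A - S)"
        by (rule norm_infsum_bound) (unfold nf, rule summable_on_subset_banach[OF sm], simp)
      then have "norm (infsum ?f (A - S)) \<le> e" unfolding nf using S(4) by simp
      moreover have "infsum ?f (A - S) = infsum ?f A - sum ?f S"
        using infsum_Diff[OF sf, of S] S by (simp add: summable_on_finite)
      ultimately have "norm (sum ?f S) \<le> B + e"
        using norm_triangle_ineq4[of "infsum ?f A" "infsum ?f A - sum ?f S"] B[of t] by simp
      then have "cmod (\<phi> (sum ?f S)) \<le> B + e"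
        using functional_contractive[OF \<phi>] order_trans by blast
      then show ?thesis by (simp add: functional_sum[OF \<phi>] functional_scaleC[OF \<phi>])
    qed
    have "cmod (\<Sum>i\<in>{i\<in>S. \<nu> i \<le> a}. \<phi> (\<beta> i)) \<le> cutoff_constant a b * (B + e)"
    proof (rule frequency_cutoff_scalar[OF S(1) ab])
      show "0 \<le> \<nu> i" "\<nu> i \<le> a \<or> b \<le> \<nu> i" if "i \<in> S" for i
        using \<nu>[of i] that S(3) by auto
    qed (rule bnd)
    moreover have "{i\<in>S. \<nu> i \<le> a} = ?L" using S by auto
    ultimately show "cmod (\<phi> (\<Sum>i\<in>?L. \<beta> i)) \<le> cutoff_constant a b * (B + e)"
      by (simp add: functional_sum[OF \<phi>])
  qed
  have "((\<lambda>e. cutoff_constant a b * (B + e)) \<longlongrightarrow> cutoff_constant a b * (B + 0)) (at_right 0)"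
    by (intro tendsto_intros)
  moreover have "\<forall>\<^sub>F e in at_right 0. norm (\<Sum>i\<in>?L. \<beta> i) \<le> cutoff_constant a b * (B + e)"
    using * by (auto simp: eventually_at_right_field intro: exI[of _ 1])
  ultimately have "norm (\<Sum>i\<in>?L. \<beta> i) \<le> cutoff_constant a b * (B + 0)" by (rule tendsto_lowerbound) simp
  then show ?thesis by simp
qed

section \<open>Exponent sequences of natural numbers\<close>

lemma bij_nth_prime: "bij_betw nth_prime UNIV {p. prime p}"
  unfolding nth_prime_def by (rule bij_enumerate[OF primes_infinite])

lemma prime_nth_prime: "prime (nth_prime j)"
  using bij_betwE[OF bij_nth_prime] by auto

lemma inj_nth_prime: "inj nth_prime"
  using bij_nth_prime by (rule bij_betw_imp_inj_on)

lemma ex_nth_prime: "prime p \<Longrightarrow> \<exists>j. p = nth_prime j"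
  using bij_betw_imp_surj_on[OF bij_nth_prime] by blast

lemma le_nth_prime: "j \<le> nth_prime j"
  unfolding nth_prime_def by (rule le_enumerate[OF primes_infinite])

lemma nth_prime_ge_2: "nth_prime j \<ge> 2"
  by (rule prime_ge_2_nat[OF prime_nth_prime])

abbreviation prime_power :: "(nat \<Rightarrow>\<^sub>0 nat) \<Rightarrow> nat"
  where "prime_power \<equiv> multi_power nth_prime"

lemma prime_power_pos: "prime_power \<alpha> > 0"
  unfolding multi_power_def using nth_prime_ge_2 by (intro prod_pos) (metis gr0I not_numeral_le_zero zero_less_power)

lemma multiplicity_prime_power: "multiplicity (nth_prime j) (prime_power \<alpha>) = Poly_Mapping.lookup \<alpha> j"
proof -
  define f where "f p = Poly_Mapping.lookup \<alpha> (inv nth_prime p)" for p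
  have e: "prime_power \<alpha> = (\<Prod>p\<in>nth_prime ` Poly_Mapping.keys \<alpha>. p ^ f p)"
    unfolding multi_power_def
    by (subst prod.reindex) (auto simp: f_def inv_f_f[OF inj_nth_prime] intro: inj_on_subset[OF inj_nth_prime])
  have "multiplicity (nth_prime j) (prime_power \<alpha>)
      = (if nth_prime j \<in> nth_prime ` Poly_Mapping.keys \<alpha> then f (nth_prime j) else 0)"
    unfolding e by (rule multiplicity_prod_prime_powers) (auto simp: prime_nth_prime)
  then show ?thesis
    by (auto simp: f_def inv_f_f[OF inj_nth_prime] inj_image_mem_iff[OF inj_nth_prime] in_keys_iff)
qed

lemma inj_prime_power: "inj prime_power"
  by (intro injI poly_mapping_eqI) (metis multiplicity_prime_power)

lemma ex_prime_power:
  assumes "n > 0"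
  obtains \<alpha> where "prime_power \<alpha> = n"
proof -
  define l where "l j = multiplicity (nth_prime j) n" for j
  have sub: "{j. l j \<noteq> 0} \<subseteq> {..n}"
  proof
    fix j assume "j \<in> {j. l j \<noteq> 0}"
    then have "nth_prime j dvd n" by (metis (mono_tags) l_def mem_Collect_eq not_dvd_imp_multiplicity_0)
    then have "nth_prime j \<le> n" using assms by (rule dvd_imp_le)
    then show "j \<in> {..n}" using le_nth_prime[of j] by simp
  qed
  then have fin: "finite {j. l j \<noteq> 0}" by (rule finite_subset) simp
  define \<alpha> where "\<alpha> = Poly_Mapping.Abs_poly_mapping l"
  have lk: "Poly_Mapping.lookup \<alpha> = l" unfolding \<alpha>_def by (rule lookup_Abs_poly_mapping) (use fin in simp)
  have k: "Poly_Mapping.keys \<alpha> = {j. l j \<noteq> 0}" by (auto simp: in_keys_iff lk)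
  have "prime_factors n = nth_prime ` Poly_Mapping.keys \<alpha>"
  proof safe
    fix p assume p: "p \<in># prime_factorization n"
    then have "prime p" by auto
    then obtain j where j: "p = nth_prime j" using ex_nth_prime by blast
    have "l j \<noteq> 0" using p unfolding l_def j by (simp add: prime_factors_multiplicity)
    then show "p \<in> nth_prime ` Poly_Mapping.keys \<alpha>" using j k by blast
  next
    fix j assume "j \<in> Poly_Mapping.keys \<alpha>"
    then show "nth_prime j \<in># prime_factorization n"
      unfolding k using prime_nth_prime by (simp add: prime_factors_multiplicity l_def)
  qed
  then have "n = (\<Prod>p\<in>nth_prime ` Poly_Mapping.keys \<alpha>. p ^ multiplicity p n)"
    using prime_factorization_nat[OF assms] by simp
  also have "\<dots> = prime_power \<alpha>"
    unfolding multi_power_def by (subst prod.reindex) (auto simp: lk l_def intro: inj_on_subset[OF inj_nth_prime])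
  finally show ?thesis using that by metis
qed

lemma the_prime_power: "(THE \<alpha>. prime_power \<alpha> = prime_power \<beta>) = \<beta>"
  by (rule the_equality) (auto dest: injD[OF inj_prime_power])

text \<open>
  A prime factor of a number below \<open>m\<close> is itself below \<open>m\<close>, and so is its position in the sequence of
  primes.
\<close>

lemma prime_power_index_bound:
  assumes "prime_power \<alpha> < m"
  shows "\<alpha> \<in> multi_indices m"
  unfolding multi_indices_def
proof safe
  fix j assume "j \<in> Poly_Mapping.keys \<alpha>"
  then have "nth_prime j dvd prime_power \<alpha>"
    using multiplicity_prime_power[of j \<alpha>] by (metis in_keys_iff not_dvd_imp_multiplicity_0)
  then have "nth_prime j \<le> prime_power \<alpha>" using prime_power_pos by (rule dvd_imp_le)
  then show "j < m" using le_nth_prime[of j] assms by simp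
qed

text \<open>
  Powers with a fixed exponent are multiplicative. The exponential form covers real radii and complex
  exponents alike.
\<close>

lemma multi_power_exp_ln:
  fixes c :: "'a::{real_normed_field,banach}"
  shows "multi_power (\<lambda>j. exp (c * of_real (ln (real (nth_prime j))))) \<alpha> = exp (c * of_real (ln (real (prime_power \<alpha>))))"
proof -
  have "ln (real (prime_power \<alpha>)) = (\<Sum>j\<in>Poly_Mapping.keys \<alpha>. real (Poly_Mapping.lookup \<alpha> j) * ln (real (nth_prime j)))"
    unfolding multi_power_def of_nat_prod of_nat_power
    using nth_prime_ge_2 by (subst ln_prod) (auto simp: ln_realpow prime_gt_0_nat prime_nth_prime)
  then have "exp (c * of_real (ln (real (prime_power \<alpha>))))
      = exp (\<Sum>j\<in>Poly_Mapping.keys \<alpha>. of_nat (Poly_Mapping.lookup \<alpha> j) * (c * of_real (ln (real (nth_prime j)))))"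
    by (simp add: sum_distrib_left mult_ac)
  also have "\<dots> = multi_power (\<lambda>j. exp (c * of_real (ln (real (nth_prime j))))) \<alpha>"
    by (simp add: multi_power_def exp_sum exp_of_nat_mult)
  finally show ?thesis by simp
qed

lemma of_nat_powr_exp_ln:
  assumes "n > 0"
  shows "of_nat n powr s = exp (s * complex_of_real (ln (real n)))"
  using assms by (simp add: powr_def Ln_of_nat)

definition prime_radius :: "real \<Rightarrow> nat \<Rightarrow> real"
  where "prime_radius \<epsilon> j = real (nth_prime j) powr (- \<epsilon>)"

lemma prime_radius_exp: "prime_radius \<epsilon> j = exp (- \<epsilon> * ln (real (nth_prime j)))"
  using nth_prime_ge_2[of j] by (simp add: prime_radius_def powr_def)

lemma prime_radius_pos: "prime_radius \<epsilon> j > 0"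
  by (simp add: prime_radius_exp)

lemma multi_power_prime_radius: "multi_power (prime_radius \<epsilon>) \<alpha> = real (prime_power \<alpha>) powr (- \<epsilon>)"
  using multi_power_exp_ln[of "- \<epsilon>" \<alpha>] prime_power_pos[of \<alpha>]
  by (simp add: prime_radius_exp[abs_def] powr_def)

lemma prime_radius_le: "\<epsilon> > 0 \<Longrightarrow> prime_radius \<epsilon> j \<le> 2 powr (- \<epsilon>)"
  unfolding prime_radius_def using nth_prime_ge_2[of j] by (intro powr_mono2') auto

lemma prime_radius_tendsto: "\<epsilon> > 0 \<Longrightarrow> prime_radius \<epsilon> \<longlonglongrightarrow> 0"
proof -
  assume e: "\<epsilon> > 0"
  have "filterlim nth_prime at_top sequentially"
    by (rule filterlim_at_top_mono[OF filterlim_ident]) (simp add: le_nth_prime)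
  then have "filterlim (\<lambda>j. real (nth_prime j)) at_top sequentially"
    by (rule filterlim_compose[OF filterlim_real_sequentially])
  then show ?thesis
    unfolding prime_radius_def using e by (intro tendsto_neg_powr) auto
qed

lemma two_powr_less_one: "\<epsilon> > 0 \<Longrightarrow> (2::real) powr (- \<epsilon>) < 1"
  by (simp add: powr_less_one)

section \<open>The Bohr transform as an isometry\<close>

text \<open>
  Two representing functions share their Fourier coefficients: those at nonnegative indices are
  given by the series, the others vanish.
\<close>

lemma norm_Hinf_dirichlet_eq:
  assumes "represents_dirichlet f a"
  shows "norm_Hinf_dirichlet a = norm_Linf_torus f"
  unfolding norm_Hinf_dirichlet_def
proof (rule the_equality)
  show "\<exists>f'. represents_dirichlet f' a \<and> norm_Linf_torus f = norm_Linf_torus f'" using assms by blast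
  fix r assume "\<exists>f'. represents_dirichlet f' a \<and> r = norm_Linf_torus f'"
  then obtain g where g: "represents_dirichlet g a" "r = norm_Linf_torus g" by blast
  have "fourier_coeff f \<alpha> = fourier_coeff g \<alpha>" for \<alpha>
  proof (cases "\<exists>j. Poly_Mapping.lookup \<alpha> j < 0")
    case True
    then show ?thesis using assms g by (auto simp: represents_dirichlet_def Hinf_torus_def)
  next
    case False
    then have "\<alpha> = Poly_Mapping.map int (Poly_Mapping.map nat \<alpha>)"
      by (intro nonneg_index_is_map_int) (simp add: not_less)
    then show ?thesis using assms g by (metis represents_dirichlet_def)
  qed
  then show "r = norm_Linf_torus f"
    using norm_Linf_torus_eq_if_fourier_eq[of f g] assms g by (auto simp: represents_dirichlet_def Hinf_torus_def)
qed

lemma bohr_transform_prime_power: "bohr_transform F (prime_power \<alpha>) = monomial_coeff F \<alpha>"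
  using prime_power_pos[of \<alpha>] by (simp add: bohr_transform_def the_prime_power)

text \<open>
  With the prime radii, \<open>r\<^sup>\<alpha>\<close> is the factor by which the translation multiplies the coefficient with
  exponents \<open>\<alpha>\<close>.
\<close>

lemma torus_lift_represents:
  assumes F: "F \<in> Hinf_ball" and e: "\<epsilon> > 0"
  shows "represents_dirichlet (torus_lift F (prime_radius \<epsilon>)) (horizontal_translate \<epsilon> (bohr_transform F))"
proof -
  note r = prime_radius_tendsto[OF e] prime_radius_pos prime_radius_le[OF e] two_powr_less_one[OF e]
  show ?thesis
    unfolding represents_dirichlet_def
  proof (intro conjI allI)
    show "torus_lift F (prime_radius \<epsilon>) \<in> Hinf_torus" by (rule torus_lift_Hinf[OF r F])
    fix \<alpha>
    have "fourier_coeff (torus_lift F (prime_radius \<epsilon>)) (Poly_Mapping.map int \<alpha>)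
        = complex_of_real (multi_power (prime_radius \<epsilon>) \<alpha>) *\<^sub>C monomial_coeff F \<alpha>"
      by (rule fourier_coeff_torus_lift(1)[OF r F])
    then show "fourier_coeff (torus_lift F (prime_radius \<epsilon>)) (Poly_Mapping.map int \<alpha>)
        = horizontal_translate \<epsilon> (bohr_transform F) (prime_power \<alpha>)"
      by (simp add: horizontal_translate_def bohr_transform_prime_power multi_power_prime_radius
          scaleR_scaleC[where 'a = 'a] powr_minus divide_inverse)
  qed
qed

lemma Hinf_ball_norm_le: "F \<in> Hinf_ball \<Longrightarrow> norm z < 1 \<Longrightarrow> norm (F z) \<le> norm_Hinf_ball F"
  unfolding norm_Hinf_ball_def
proof (rule cSUP_upper)
  assume F: "F \<in> Hinf_ball"
  obtain M where "\<And>z. norm z < 1 \<Longrightarrow> norm (F z) \<le> M" using Hinf_ball_bounded[OF F] by blast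
  then show "bdd_above ((\<lambda>z. norm (F z)) ` ball 0 1)" by (intro bdd_aboveI2[of _ _ M]) simp
qed simp

lemma bohr_transform_Hinf_plus:
  assumes F: "F \<in> Hinf_ball"
  shows "bohr_transform F \<in> Hinf_plus" "norm_Hinf_plus (bohr_transform F) \<le> norm_Hinf_ball F"
proof -
  have le: "norm_Hinf_dirichlet (horizontal_translate \<epsilon> (bohr_transform F)) \<le> norm_Hinf_ball F" if e: "\<epsilon> > 0" for \<epsilon>
  proof -
    note r = prime_radius_tendsto[OF e] prime_radius_pos prime_radius_le[OF e] two_powr_less_one[OF e]
    show ?thesis
      unfolding norm_Hinf_dirichlet_eq[OF torus_lift_represents[OF F e]]
      by (rule torus_lift_Linf(2)[OF r F Hinf_ball_norm_le[OF F]])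
  qed
  show "bohr_transform F \<in> Hinf_plus"
    unfolding Hinf_plus_def
  proof (intro CollectI conjI allI impI)
    show "bohr_transform F \<in> dirichlet_series" by (simp add: dirichlet_series_def bohr_transform_def)
    show "horizontal_translate \<epsilon> (bohr_transform F) \<in> Hinf_dirichlet" if "\<epsilon> > 0" for \<epsilon>
      using torus_lift_represents[OF F that]
      by (auto simp: Hinf_dirichlet_def dirichlet_series_def horizontal_translate_def bohr_transform_def)
    show "bdd_above ((\<lambda>\<epsilon>. norm_Hinf_dirichlet (horizontal_translate \<epsilon> (bohr_transform F))) ` {0<..})"
      using le by (intro bdd_aboveI2[of _ _ "norm_Hinf_ball F"]) simp
  qed
  show "norm_Hinf_plus (bohr_transform F) \<le> norm_Hinf_ball F"
    unfolding norm_Hinf_plus_def by (rule cSUP_least) (use le in auto)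
qed

lemma prime_radius_tendsto_1: "((\<lambda>\<epsilon>. prime_radius \<epsilon> j) \<longlongrightarrow> 1) (at_right 0)"
proof -
  have "((\<lambda>\<epsilon>. exp (- \<epsilon> * ln (real (nth_prime j)))) \<longlongrightarrow> exp (- 0 * ln (real (nth_prime j)))) (at_right 0)"
    by (intro tendsto_intros)
  then show ?thesis by (simp add: prime_radius_exp)
qed

text \<open>
  Both bounds come from the functions that represent the translates. The first holds up to the factor
  \<open>n powr (- \<epsilon>)\<close>, which tends to \<open>1\<close>. For the second, \<open>\<epsilon>\<close> is chosen so small that the first \<open>m\<close> prime
  radii exceed the moduli of the \<open>z j\<close>; dividing \<open>z\<close> by the radii undoes the translation.
\<close>

lemma Hinf_plus_bounds:
  assumes a: "a \<in> Hinf_plus"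
  shows "norm (a (prime_power \<alpha>)) \<le> norm_Hinf_plus a"
    and "(\<And>j. j < m \<Longrightarrow> cmod (z j) < 1) \<Longrightarrow> norm (polydisc_sum (\<lambda>\<beta>. a (prime_power \<beta>)) m z) \<le> norm_Hinf_plus a"
proof -
  have ex: "\<exists>f. f \<in> Hinf_torus \<and> norm_Linf_torus f \<le> norm_Hinf_plus a \<and>
      (\<forall>\<beta>. fourier_coeff f (Poly_Mapping.map int \<beta>) = complex_of_real (multi_power (prime_radius \<epsilon>) \<beta>) *\<^sub>C a (prime_power \<beta>))"
    if e: "\<epsilon> > 0" for \<epsilon>
  proof -
    obtain f where f: "represents_dirichlet f (horizontal_translate \<epsilon> a)"
      using a e by (auto simp: Hinf_plus_def Hinf_dirichlet_def)
    have "norm_Hinf_dirichlet (horizontal_translate \<epsilon> a) \<le> norm_Hinf_plus a"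
      unfolding norm_Hinf_plus_def using a e by (intro cSUP_upper) (auto simp: Hinf_plus_def)
    then have "norm_Linf_torus f \<le> norm_Hinf_plus a" by (simp add: norm_Hinf_dirichlet_eq[OF f])
    moreover have "fourier_coeff f (Poly_Mapping.map int \<beta>) = complex_of_real (multi_power (prime_radius \<epsilon>) \<beta>) *\<^sub>C a (prime_power \<beta>)" for \<beta>
      using f by (simp add: represents_dirichlet_def horizontal_translate_def multi_power_prime_radius
          scaleR_scaleC[where 'a = 'a] powr_minus divide_inverse)
    ultimately show ?thesis using f by (auto simp: represents_dirichlet_def)
  qed
  show "norm (a (prime_power \<alpha>)) \<le> norm_Hinf_plus a"
  proof (rule tendsto_upperbound)
    have "((\<lambda>\<epsilon>. multi_power (prime_radius \<epsilon>) \<alpha>) \<longlongrightarrow> multi_power (\<lambda>_. 1) \<alpha>) (at_right 0)"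
      unfolding multi_power_def by (intro tendsto_intros prime_radius_tendsto_1)
    then have "((\<lambda>\<epsilon>. multi_power (prime_radius \<epsilon>) \<alpha>) \<longlongrightarrow> 1) (at_right 0)" by (simp add: multi_power_def)
    from tendsto_mult[OF this tendsto_const[of "norm (a (prime_power \<alpha>))"]]
    show "((\<lambda>\<epsilon>. multi_power (prime_radius \<epsilon>) \<alpha> * norm (a (prime_power \<alpha>))) \<longlongrightarrow> norm (a (prime_power \<alpha>))) (at_right 0)"
      by simp
    have "multi_power (prime_radius \<epsilon>) \<alpha> * norm (a (prime_power \<alpha>)) \<le> norm_Hinf_plus a" if e: "\<epsilon> > 0" for \<epsilon>
    proof -
      obtain f where f: "f \<in> Hinf_torus" "norm_Linf_torus f \<le> norm_Hinf_plus a"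
        "fourier_coeff f (Poly_Mapping.map int \<alpha>) = complex_of_real (multi_power (prime_radius \<epsilon>) \<alpha>) *\<^sub>C a (prime_power \<alpha>)"
        using ex[OF e] by blast
      have "norm (fourier_coeff f (Poly_Mapping.map int \<alpha>)) \<le> norm_Linf_torus f"
        by (rule norm_fourier_coeff_le) (use f in \<open>simp add: Hinf_torus_def\<close>)
      moreover have "multi_power (prime_radius \<epsilon>) \<alpha> > 0" by (rule multi_power_pos[OF prime_radius_pos])
      ultimately show ?thesis using f by (simp add: norm_scaleC)
    qed
    then show "\<forall>\<^sub>F \<epsilon> in at_right 0. multi_power (prime_radius \<epsilon>) \<alpha> * norm (a (prime_power \<alpha>)) \<le> norm_Hinf_plus a"
      by (auto simp: eventually_at_right_field intro: exI[of _ 1])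
  qed simp
  show "norm (polydisc_sum (\<lambda>\<beta>. a (prime_power \<beta>)) m z) \<le> norm_Hinf_plus a" if z: "\<And>j. j < m \<Longrightarrow> cmod (z j) < 1"
  proof -
    have "\<forall>\<^sub>F \<epsilon> in at_right 0. \<forall>j\<in>{..<m}. cmod (z j) < prime_radius \<epsilon> j"
      using order_tendstoD(1)[OF prime_radius_tendsto_1 z] by (intro eventually_ball_finite) auto
    then have "\<forall>\<^sub>F \<epsilon> in at_right (0::real). \<epsilon> > 0 \<and> (\<forall>j\<in>{..<m}. cmod (z j) < prime_radius \<epsilon> j)"
      by (rule eventually_conj[OF eventually_at_right_less])
    then obtain \<epsilon> where e: "\<epsilon> > 0" "\<And>j. j < m \<Longrightarrow> cmod (z j) < prime_radius \<epsilon> j"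
      using eventually_happens'[OF trivial_limit_at_right_real] by blast
    obtain f where f: "f \<in> Hinf_torus" "norm_Linf_torus f \<le> norm_Hinf_plus a"
      "\<And>\<beta>. fourier_coeff f (Poly_Mapping.map int \<beta>) = complex_of_real (multi_power (prime_radius \<epsilon>) \<beta>) *\<^sub>C a (prime_power \<beta>)"
      using ex[OF e(1)] by blast
    define z' where "z' j = z j / of_real (prime_radius \<epsilon> j)" for j
    have z_eq: "z j = z' j * of_real (prime_radius \<epsilon> j)" for j
      using prime_radius_pos[of \<epsilon> j] by (simp add: z'_def)
    have "multi_power z \<beta> = multi_power z' \<beta> * of_real (multi_power (prime_radius \<epsilon>) \<beta>)" for \<beta>
      unfolding z_eq[abs_def] multi_power_mult by (simp add: multi_power_def)
    then have "polydisc_sum (\<lambda>\<beta>. a (prime_power \<beta>)) m z = polydisc_sum (\<lambda>\<beta>. fourier_coeff f (Poly_Mapping.map int \<beta>)) m z'"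
      unfolding polydisc_sum_def f(3) by (simp add: scaleC_scaleC)
    moreover have "norm (polydisc_sum (\<lambda>\<beta>. fourier_coeff f (Poly_Mapping.map int \<beta>)) m z') \<le> norm_Linf_torus f"
    proof (rule polydisc_sum_le_norm_Linf[OF f(1)])
      show "cmod (z' j) < 1" if "j < m" for j
        using e(2)[OF that] prime_radius_pos[of \<epsilon> j] by (simp add: z'_def norm_divide)
    qed
    ultimately show ?thesis using f(2) by simp
  qed
qed

lemma truncate_tendsto: "(\<lambda>m. truncate_c0 m (c0_nth x)) \<longlonglongrightarrow> x"
proof (rule LIMSEQ_I)
  fix e :: real assume e: "e > 0"
  obtain N where N: "\<And>j. j \<ge> N \<Longrightarrow> cmod (c0_nth x j) < e / 2"
    using LIMSEQ_D[OF c0_nth_tendsto[of x], of "e / 2"] e by auto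
  have "norm (truncate_c0 m (c0_nth x) - x) \<le> e / 2" if "m \<ge> N" for m
    by (rule norm_c0_le) (use N that e in \<open>auto simp: minus_c0.rep_eq c0_nth_truncate less_imp_le\<close>)
  then show "\<exists>N. \<forall>m\<ge>N. norm (truncate_c0 m (c0_nth x) - x) < e"
    using e by (intro exI[of _ N]) force
qed

text \<open>
  At truncated points \<open>F\<close> is a sum in finitely many variables, which is bounded by the norm of the
  Dirichlet series. Truncations converge to the given point, and \<open>F\<close> is continuous.
\<close>

lemma bohr_transform_isometric:
  assumes F: "F \<in> Hinf_ball"
  shows "norm_Hinf_plus (bohr_transform F) = norm_Hinf_ball F"
proof (rule antisym[OF bohr_transform_Hinf_plus(2)[OF F]])
  have "norm (F x) \<le> norm_Hinf_plus (bohr_transform F)" if x: "norm x < 1" for x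
  proof (rule LIMSEQ_le_const2)
    show "(\<lambda>m. norm (F (truncate_c0 m (c0_nth x)))) \<longlonglongrightarrow> norm (F x)"
      by (intro tendsto_norm isCont_tendsto_compose[OF Hinf_ball_continuous[OF F x]] truncate_tendsto)
    have "norm (F (truncate_c0 m (c0_nth x))) \<le> norm_Hinf_plus (bohr_transform F)" for m
    proof -
      have xj: "cmod (c0_nth x j) < 1" for j using cmod_c0_nth_le[of x j] x by simp
      have "F (truncate_c0 m (c0_nth x)) = polydisc_sum (monomial_coeff F) m (c0_nth x)"
        using polydisc_sum_monomial_coeff[OF Hinf_ball_expansion(1)[OF F Hinf_ball_norm_le[OF F]] xj]
        by (simp add: section_at_truncate)
      then show ?thesis
        using Hinf_plus_bounds(2)[OF bohr_transform_Hinf_plus(1)[OF F] xj, of m] by (simp add: bohr_transform_prime_power)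
    qed
    then show "\<exists>N. \<forall>m\<ge>N. norm (F (truncate_c0 m (c0_nth x))) \<le> norm_Hinf_plus (bohr_transform F)" by blast
  qed
  then show "norm_Hinf_ball F \<le> norm_Hinf_plus (bohr_transform F)"
    unfolding norm_Hinf_ball_def by (intro cSUP_least) auto
qed

lemma bohr_transform_surj:
  assumes a: "a \<in> Hinf_plus"
  obtains F where "F \<in> Hinf_ball" "bohr_transform F = a"
proof -
  define c where "c \<beta> = a (prime_power \<beta>)" for \<beta>
  have c_le: "norm (c \<beta>) \<le> norm_Hinf_plus a" for \<beta> unfolding c_def by (rule Hinf_plus_bounds(1)[OF a])
  have sum_le: "norm (polydisc_sum c m z) \<le> norm_Hinf_plus a" if "\<And>j. j < m \<Longrightarrow> cmod (z j) < 1" for m z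
    unfolding c_def[abs_def] by (rule Hinf_plus_bounds(2)[OF a that])
  obtain F where F: "F \<in> Hinf_ball" "\<And>m z. section_at F m z = polydisc_sum c m z"
    using Hinf_ball_of_coefficients[of c "norm_Hinf_plus a", OF c_le sum_le] by blast
  have "is_monomial_expansion F c"
    unfolding is_monomial_expansion_def F(2)
  proof (intro allI impI)
    fix m and z :: "nat \<Rightarrow> complex" assume "\<forall>j<m. cmod (z j) < 1"
    then show "((\<lambda>\<alpha>. multi_power z \<alpha> *\<^sub>C c \<alpha>) has_sum polydisc_sum c m z) (multi_indices m)"
      by (intro polydisc_sum_has_sum[where M = "norm_Hinf_plus a"] c_le) auto
  qed
  then have mc: "monomial_coeff F = c" by (rule monomial_coeff_eqI)
  have "bohr_transform F n = a n" for n
  proof (cases "n = 0")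
    case True
    then show ?thesis using a by (simp add: bohr_transform_def Hinf_plus_def dirichlet_series_def)
  next
    case False
    then obtain \<alpha> where "n = prime_power \<alpha>" using ex_prime_power[of n] by auto
    then show ?thesis using bohr_transform_prime_power[of F \<alpha>] by (simp add: mc c_def)
  qed
  then show ?thesis using that F(1) by blast
qed

lemma bohr_transform_linear:
  assumes F: "F \<in> Hinf_ball" and G: "G \<in> Hinf_ball"
  shows "bohr_transform (\<lambda>z. F z + b *\<^sub>C G z) = (\<lambda>n. bohr_transform F n + b *\<^sub>C bohr_transform G n)"
proof -
  have "is_monomial_expansion (\<lambda>z. F z + b *\<^sub>C G z) (\<lambda>\<alpha>. monomial_coeff F \<alpha> + b *\<^sub>C monomial_coeff G \<alpha>)"
    unfolding is_monomial_expansion_def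
  proof (intro allI impI)
    fix m and z :: "nat \<Rightarrow> complex" assume z: "\<forall>j<m. cmod (z j) < 1"
    have f: "((\<lambda>\<alpha>. multi_power z \<alpha> *\<^sub>C monomial_coeff F \<alpha>) has_sum section_at F m z) (multi_indices m)"
      using Hinf_ball_expansion(1)[OF F Hinf_ball_norm_le[OF F]] z unfolding is_monomial_expansion_def by blast
    have g: "((\<lambda>\<alpha>. multi_power z \<alpha> *\<^sub>C monomial_coeff G \<alpha>) has_sum section_at G m z) (multi_indices m)"
      using Hinf_ball_expansion(1)[OF G Hinf_ball_norm_le[OF G]] z unfolding is_monomial_expansion_def by blast
    have "((\<lambda>\<alpha>. multi_power z \<alpha> *\<^sub>C monomial_coeff F \<alpha> + b *\<^sub>C multi_power z \<alpha> *\<^sub>C monomial_coeff G \<alpha>)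
        has_sum section_at F m z + b *\<^sub>C section_at G m z) (multi_indices m)"
      by (rule has_sum_add[OF f has_sum_bounded_linear[OF bounded_linear_scaleC_right g]])
    moreover have "multi_power z \<alpha> *\<^sub>C monomial_coeff F \<alpha> + b *\<^sub>C multi_power z \<alpha> *\<^sub>C monomial_coeff G \<alpha>
        = multi_power z \<alpha> *\<^sub>C (monomial_coeff F \<alpha> + b *\<^sub>C monomial_coeff G \<alpha>)" for \<alpha>
      by (simp add: scaleC_add_right scaleC_scaleC mult.commute)
    ultimately show "((\<lambda>\<alpha>. multi_power z \<alpha> *\<^sub>C (monomial_coeff F \<alpha> + b *\<^sub>C monomial_coeff G \<alpha>))
        has_sum section_at (\<lambda>z. F z + b *\<^sub>C G z) m z) (multi_indices m)"
      by (simp add: section_at_def)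
  qed
  then have "monomial_coeff (\<lambda>z. F z + b *\<^sub>C G z) = (\<lambda>\<alpha>. monomial_coeff F \<alpha> + b *\<^sub>C monomial_coeff G \<alpha>)"
    by (rule monomial_coeff_eqI)
  then show ?thesis by (auto simp: bohr_transform_def fun_eq_iff)
qed

section \<open>Convergence of the Dirichlet series\<close>

text \<open>
  Summation by parts for weights that are squares: one factor \<open>v n\<close> absorbs the growth \<open>K / v n\<close> of the
  partial sums, and the other one telescopes, since
  \<open>(v n)\<^sup>2 - (v (Suc n))\<^sup>2 \<le> 2 * v n * (v n - v (Suc n))\<close>.
\<close>

lemma abel_summation_tail:
  fixes u :: "nat \<Rightarrow> 'x::real_normed_vector" and v :: "nat \<Rightarrow> real"
  assumes v: "\<And>n. n \<ge> N \<Longrightarrow> v n > 0" "\<And>n. n \<ge> N \<Longrightarrow> v (Suc n) \<le> v n"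
    and K: "\<And>n. n \<ge> N \<Longrightarrow> norm (sum u {..n}) * v n \<le> K" and N': "N \<le> N'"
  shows "norm (\<Sum>n\<in>{N<..N'}. (v n)\<^sup>2 *\<^sub>R u n) \<le> 3 * K * v N"
proof -
  \<comment> \<open>the sum without the boundary term at its upper end; its increments are those of the squared weights\<close>
  define R where "R n = (\<Sum>k\<in>{N<..n}. (v k)\<^sup>2 *\<^sub>R u k) - (v n)\<^sup>2 *\<^sub>R sum u {..n}" for n
  have K0: "K \<ge> 0" using K[of N] v(1)[of N] by (smt (verit) mult_nonneg_nonneg norm_ge_zero order_refl)
  have vK: "(v n)\<^sup>2 * norm (sum u {..n}) \<le> K * v n" if "n \<ge> N" for n
  proof -
    have "(v n)\<^sup>2 * norm (sum u {..n}) = (norm (sum u {..n}) * v n) * v n" by (simp add: power2_eq_square)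
    also have "\<dots> \<le> K * v n" using K[OF that] v(1)[OF that] by (intro mult_right_mono) auto
    finally show ?thesis .
  qed
  have "norm (R N') \<le> K * v N + 2 * K * (v N - v N')"
    using N'
  proof (induction N' rule: dec_induct)
    case base
    then show ?case using vK[of N] by (simp add: R_def)
  next
    case (step n)
    have ins: "{N<..Suc n} = insert (Suc n) {N<..n}" using step by auto
    have "R (Suc n) = R n + ((v n)\<^sup>2 - (v (Suc n))\<^sup>2) *\<^sub>R sum u {..n}"
      unfolding R_def ins by (simp add: algebra_simps)
    then have "norm (R (Suc n)) \<le> norm (R n) + norm (((v n)\<^sup>2 - (v (Suc n))\<^sup>2) *\<^sub>R sum u {..n})"
      using norm_triangle_ineq by metis
    also have "norm (((v n)\<^sup>2 - (v (Suc n))\<^sup>2) *\<^sub>R sum u {..n}) \<le> 2 * K * (v n - v (Suc n))"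
    proof -
      have v1: "0 < v n" "0 < v (Suc n)" "v (Suc n) \<le> v n" using v step by auto
      have d: "(v n)\<^sup>2 - (v (Suc n))\<^sup>2 = (v n - v (Suc n)) * (v n + v (Suc n))"
        by (simp add: power2_eq_square algebra_simps)
      have "norm (((v n)\<^sup>2 - (v (Suc n))\<^sup>2) *\<^sub>R sum u {..n}) = ((v n - v (Suc n)) * (v n + v (Suc n))) * norm (sum u {..n})"
        unfolding d using v1 by (simp add: abs_mult)
      also have "\<dots> \<le> ((v n - v (Suc n)) * (2 * v n)) * norm (sum u {..n})"
        using v1 by (intro mult_right_mono mult_left_mono) auto
      also have "\<dots> = 2 * (v n - v (Suc n)) * (norm (sum u {..n}) * v n)" by simp
      also have "\<dots> \<le> 2 * (v n - v (Suc n)) * K" using K[of n] v1 step by (intro mult_left_mono) auto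
      finally show ?thesis by (simp add: mult_ac)
    qed
    finally show ?case using step by (simp add: algebra_simps)
  qed
  moreover have "(\<Sum>n\<in>{N<..N'}. (v n)\<^sup>2 *\<^sub>R u n) = R N' + (v N')\<^sup>2 *\<^sub>R sum u {..N'}" by (simp add: R_def)
  then have "norm (\<Sum>n\<in>{N<..N'}. (v n)\<^sup>2 *\<^sub>R u n) \<le> norm (R N') + norm ((v N')\<^sup>2 *\<^sub>R sum u {..N'})"
    using norm_triangle_ineq by metis
  moreover have "norm ((v N')\<^sup>2 *\<^sub>R sum u {..N'}) \<le> K * v N'" using vK[OF N'] by simp
  moreover have "0 \<le> K * v N'" using K0 v(1)[OF N'] by simp
  ultimately show ?thesis by (simp add: algebra_simps)
qed

text \<open>
  The gap between \<open>ln N\<close> and \<open>ln (N + 1)\<close> is at least \<open>1 / (N + 1)\<close>, so the constant is of order \<open>ln N\<close>, which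
  is absorbed by any positive power of \<open>N\<close>.
\<close>

lemma cutoff_constant_le:
  assumes "N > 0" "\<sigma> > 0"
  shows "cutoff_constant (ln (real N)) (ln (real (N + 1))) \<le> (9 / 2 + 4 / \<sigma>) * real N powr (\<sigma> / 2)"
proof -
  define a b where "a = ln (real N)" and "b = ln (real (N + 1))"
  have N1: "real N \<ge> 1" using assms by simp
  have a0: "a \<ge> 0" using N1 by (simp add: a_def)
  have ab: "a < b" using assms by (simp add: a_def b_def)
  have gap: "1 / (real N + 1) \<le> b - a"
  proof -
    have "ln (real N / (real N + 1)) \<le> real N / (real N + 1) - 1"
      using N1 by (intro ln_le_minus_one) simp
    also have "\<dots> = - (1 / (real N + 1))" using N1 by (simp add: field_simps)
    finally have "ln (real N) - ln (real N + 1) \<le> - (1 / (real N + 1))"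
      using N1 by (simp add: ln_div)
    then show ?thesis by (simp add: a_def b_def add.commute)
  qed
  have "b \<le> real N" using ln_le_minus_one[of "real (N + 1)"] N1 by (simp add: b_def)
  then have ab2: "a + b \<le> 2 * real N" using ab by simp
  have "(a + b) / (b - a) \<le> (2 * real N) / (1 / (real N + 1))"
    using a0 ab ab2 gap N1 by (intro frac_le) auto
  also have "\<dots> = 2 * real N * (real N + 1)" using N1 by simp
  also have "\<dots> \<le> 2 * real N * (real N + real N)" using N1 by (intro mult_left_mono) auto
  also have "\<dots> = (2 * real N) ^ 2" by (simp add: power2_eq_square)
  finally have "ln ((a + b) / (b - a)) \<le> ln ((2 * real N) ^ 2)"
    using a0 ab by (intro ln_mono) auto
  also have "\<dots> = 2 * ln (2 * real N)" using N1 by (subst ln_realpow) auto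
  also have "\<dots> = 2 * (ln 2 + ln (real N))" using N1 by (simp add: ln_mult)
  also have "\<dots> \<le> 2 * (1 + ln (real N))" using ln_2_less_1 by simp
  finally have l1: "ln ((a + b) / (b - a)) \<le> 2 + 2 * ln (real N)" by simp
  define y where "y = real N powr (\<sigma> / 2)"
  have y1: "y \<ge> 1" using N1 assms by (simp add: y_def ge_one_powr_ge_zero)
  have "ln (real N) = (2 / \<sigma>) * ln y" using N1 assms by (simp add: y_def ln_powr)
  moreover have "ln y \<le> y" using ln_le_minus_one[of y] y1 by simp
  ultimately have l2: "ln (real N) \<le> (2 / \<sigma>) * y"
    using mult_left_mono[of "ln y" y "2 / \<sigma>"] assms by simp
  have "cutoff_constant a b \<le> 1 * (5 / 2 + (2 + 2 * ln (real N)))"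
    unfolding cutoff_constant_def
  proof (rule mult_mono)
    show "2 / pi \<le> 1" using pi_gt3 by simp
    have "1 \<le> (a + b) / (b - a)" using a0 ab by simp
    then have "0 \<le> ln ((a + b) / (b - a))" by (rule ln_ge_zero)
    then show "0 \<le> 5 / 2 + ln ((a + b) / (b - a))" by simp
  qed (use l1 in auto)
  also have "\<dots> \<le> 9 / 2 * y + 2 * ((2 / \<sigma>) * y)" using y1 l2 by simp
  finally show ?thesis by (simp add: a_def b_def y_def algebra_simps)
qed

text \<open>
  The coefficients at the numbers composed of the first \<open>m\<close> primes: this is the Dirichlet series of the
  section in \<open>m\<close> variables.
\<close>

definition smooth_part :: "nat \<Rightarrow> (nat \<Rightarrow> 'x::zero) \<Rightarrow> nat \<Rightarrow> 'x"
  where "smooth_part m a n = (if n \<in> prime_power ` multi_indices m then a n else 0)"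

lemma cis_ln_prime_power: "multi_power (\<lambda>j. cis (- t * ln (real (nth_prime j)))) \<alpha> = cis (- t * ln (real (prime_power \<alpha>)))"
  using multi_power_exp_ln[of "\<i> * of_real (- t)" \<alpha>] by (simp add: cis_conv_exp mult_ac)

text \<open>
  At the points with coordinates \<open>\<rho> * p powr (- \<i> t)\<close>, for \<open>\<rho> < 1\<close> and real \<open>t\<close>, the section in \<open>m\<close> variables is an absolutely
  convergent series with the frequencies \<open>ln n\<close>, bounded by \<open>M\<close> in \<open>t\<close>. No frequency lies strictly between
  \<open>ln N\<close> and \<open>ln (N + 1)\<close>, so \<open>frequency_cutoff\<close> extracts the terms up to \<open>N\<close>. In this finite sum \<open>\<rho>\<close> may
  tend to \<open>1\<close>.
\<close>

lemma smooth_partial_sum_bound: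
  fixes F :: "c0 \<Rightarrow> 'x::complex_banach"
  assumes F: "F \<in> Hinf_ball" and M: "\<And>z. norm z < 1 \<Longrightarrow> norm (F z) \<le> M" and N: "N > 0"
  shows "norm (\<Sum>n\<le>N. cis (- \<tau> * ln (real n)) *\<^sub>C smooth_part m (bohr_transform F) n)
    \<le> cutoff_constant (ln (real N)) (ln (real (N + 1))) * M"
proof -
  define c where "c = monomial_coeff F"
  note exp = Hinf_ball_expansion[OF F M, folded c_def]
  define \<nu> where "\<nu> \<alpha> = ln (real (prime_power \<alpha>))" for \<alpha>
  define L where "L = {\<alpha>\<in>multi_indices m. prime_power \<alpha> \<le> N}"
  have \<nu>_le: "\<nu> \<alpha> \<le> ln (real N) \<longleftrightarrow> prime_power \<alpha> \<le> N" for \<alpha>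
    using N prime_power_pos[of \<alpha>] by (simp add: \<nu>_def)
  have L_eq: "{\<alpha>\<in>multi_indices m. \<nu> \<alpha> \<le> ln (real N)} = L" by (auto simp: L_def \<nu>_le)
  have finL: "finite L"
  proof (rule finite_imageD)
    show "finite (prime_power ` L)" by (rule finite_subset[of _ "{..N}"]) (auto simp: L_def)
  qed (rule inj_on_subset[OF inj_prime_power], simp)
  have bound_\<rho>: "norm (\<Sum>\<alpha>\<in>L. (of_real (\<rho> ^ (\<Sum>j\<in>Poly_Mapping.keys \<alpha>. Poly_Mapping.lookup \<alpha> j)) * cis (- \<tau> * \<nu> \<alpha>)) *\<^sub>C c \<alpha>)
      \<le> cutoff_constant (ln (real N)) (ln (real (N + 1))) * M" if \<rho>: "0 < \<rho>" "\<rho> < 1" for \<rho> :: real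
  proof -
    define z where "z t j = complex_of_real \<rho> * cis (- t * ln (real (nth_prime j)))" for t j
    have z1: "cmod (z t j) < 1" for t j using \<rho> by (simp add: z_def norm_mult)
    have mz: "multi_power (z t) \<alpha> = of_real (\<rho> ^ (\<Sum>j\<in>Poly_Mapping.keys \<alpha>. Poly_Mapping.lookup \<alpha> j)) * cis (- t * \<nu> \<alpha>)" for t \<alpha>
      unfolding z_def[abs_def] multi_power_mult cis_ln_prime_power \<nu>_def
      by (simp add: multi_power_def power_sum)
    define \<beta> where "\<beta> \<alpha> = multi_power (z \<tau>) \<alpha> *\<^sub>C c \<alpha>" for \<alpha>
    have shift: "cis (- t * \<nu> \<alpha>) *\<^sub>C \<beta> \<alpha> = multi_power (z (t + \<tau>)) \<alpha> *\<^sub>C c \<alpha>" for t \<alpha>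
    proof -
      have e: "cis (- t * \<nu> \<alpha>) * cis (- \<tau> * \<nu> \<alpha>) = cis (- (t + \<tau>) * \<nu> \<alpha>)"
        by (simp add: cis_mult algebra_simps)
      show ?thesis
        unfolding \<beta>_def mz scaleC_scaleC mult.left_commute[of "cis (- t * \<nu> \<alpha>)"] e ..
    qed
    have "norm (\<Sum>\<alpha>\<in>{\<alpha>\<in>multi_indices m. \<nu> \<alpha> \<le> ln (real N)}. \<beta> \<alpha>) \<le> cutoff_constant (ln (real N)) (ln (real (N + 1))) * M"
    proof (rule frequency_cutoff)
      show "0 \<le> ln (real N)" "ln (real N) < ln (real (N + 1))" using N by auto
      show "(\<lambda>\<alpha>. norm (\<beta> \<alpha>)) summable_on multi_indices m"
        unfolding \<beta>_def by (rule multi_power_series_abs_summable[where M = M]) (use exp(2) z1 in auto)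
      show "0 \<le> \<nu> \<alpha>" for \<alpha> using prime_power_pos[of \<alpha>] by (simp add: \<nu>_def)
      show "\<nu> \<alpha> \<le> ln (real N) \<or> ln (real (N + 1)) \<le> \<nu> \<alpha>" for \<alpha>
      proof (cases "prime_power \<alpha> \<le> N")
        case False
        then have "ln (real (N + 1)) \<le> \<nu> \<alpha>" unfolding \<nu>_def by (intro ln_mono) auto
        then show ?thesis ..
      qed (simp add: \<nu>_le)
      show "finite {\<alpha>\<in>multi_indices m. \<nu> \<alpha> \<le> ln (real N)}" unfolding L_eq by (rule finL)
      fix t
      have "((\<lambda>\<alpha>. multi_power (z (t + \<tau>)) \<alpha> *\<^sub>C c \<alpha>) has_sum section_at F m (z (t + \<tau>))) (multi_indices m)"
        using exp(1) z1 unfolding is_monomial_expansion_def by blast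
      then have "infsum (\<lambda>\<alpha>. cis (- t * \<nu> \<alpha>) *\<^sub>C \<beta> \<alpha>) (multi_indices m) = section_at F m (z (t + \<tau>))"
        unfolding shift by (rule infsumI)
      then show "norm (infsum (\<lambda>\<alpha>. cis (- t * \<nu> \<alpha>) *\<^sub>C \<beta> \<alpha>) (multi_indices m)) \<le> M"
        using M[OF norm_truncate_less[of m "z (t + \<tau>)", OF z1]] by (simp add: section_at_truncate)
    qed
    then show ?thesis unfolding L_eq \<beta>_def mz .
  qed
  have "norm (\<Sum>\<alpha>\<in>L. (of_real (1 ^ (\<Sum>j\<in>Poly_Mapping.keys \<alpha>. Poly_Mapping.lookup \<alpha> j)) * cis (- \<tau> * \<nu> \<alpha>)) *\<^sub>C c \<alpha>)
      \<le> cutoff_constant (ln (real N)) (ln (real (N + 1))) * M"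
  proof (rule tendsto_upperbound)
    show "((\<lambda>\<rho>. norm (\<Sum>\<alpha>\<in>L. (of_real (\<rho> ^ (\<Sum>j\<in>Poly_Mapping.keys \<alpha>. Poly_Mapping.lookup \<alpha> j)) * cis (- \<tau> * \<nu> \<alpha>)) *\<^sub>C c \<alpha>))
        \<longlongrightarrow> norm (\<Sum>\<alpha>\<in>L. (of_real (1 ^ (\<Sum>j\<in>Poly_Mapping.keys \<alpha>. Poly_Mapping.lookup \<alpha> j)) * cis (- \<tau> * \<nu> \<alpha>)) *\<^sub>C c \<alpha>)) (at_left (1::real))"
      by (intro tendsto_norm tendsto_sum bounded_linear.tendsto[OF bounded_linear_scaleC_left] tendsto_intros)
    show "\<forall>\<^sub>F \<rho> in at_left 1. norm (\<Sum>\<alpha>\<in>L. (of_real (\<rho> ^ (\<Sum>j\<in>Poly_Mapping.keys \<alpha>. Poly_Mapping.lookup \<alpha> j)) * cis (- \<tau> * \<nu> \<alpha>)) *\<^sub>C c \<alpha>)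
        \<le> cutoff_constant (ln (real N)) (ln (real (N + 1))) * M"
      using bound_\<rho> by (intro eventually_at_leftI[of 0]) auto
  qed simp
  moreover have "(\<Sum>\<alpha>\<in>L. (of_real (1 ^ (\<Sum>j\<in>Poly_Mapping.keys \<alpha>. Poly_Mapping.lookup \<alpha> j)) * cis (- \<tau> * \<nu> \<alpha>)) *\<^sub>C c \<alpha>)
      = (\<Sum>n\<le>N. cis (- \<tau> * ln (real n)) *\<^sub>C smooth_part m (bohr_transform F) n)"
  proof -
    have "(\<Sum>n\<le>N. cis (- \<tau> * ln (real n)) *\<^sub>C smooth_part m (bohr_transform F) n)
        = (\<Sum>n\<in>prime_power ` L. cis (- \<tau> * ln (real n)) *\<^sub>C smooth_part m (bohr_transform F) n)"
      by (rule sum.mono_neutral_right) (auto simp: L_def smooth_part_def)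
    also have "\<dots> = (\<Sum>\<alpha>\<in>L. cis (- \<tau> * \<nu> \<alpha>) *\<^sub>C smooth_part m (bohr_transform F) (prime_power \<alpha>))"
      by (subst sum.reindex) (auto simp: \<nu>_def intro: inj_on_subset[OF inj_prime_power])
    also have "\<dots> = (\<Sum>\<alpha>\<in>L. cis (- \<tau> * \<nu> \<alpha>) *\<^sub>C c \<alpha>)"
      by (intro sum.cong refl) (auto simp: smooth_part_def L_def bohr_transform_prime_power c_def)
    finally show ?thesis by simp
  qed
  ultimately show ?thesis by simp
qed

lemma of_nat_powr_scaleC:
  fixes x :: "'x::complex_normed_vector"
  assumes "n > 0"
  shows "of_nat n powr (- s) *\<^sub>C x = (real n powr (- Re s / 2))\<^sup>2 *\<^sub>R cis (- Im s * ln (real n)) *\<^sub>C x"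
proof -
  have "of_nat n powr (- s) = exp (- s * complex_of_real (ln (real n)))"
    using of_nat_powr_exp_ln[OF assms, of "- s"] by simp
  also have "- s * complex_of_real (ln (real n)) = of_real (- Re s * ln (real n)) + \<i> * of_real (- Im s * ln (real n))"
    by (simp add: complex_eq_iff)
  also have "exp \<dots> = of_real (exp (- Re s * ln (real n))) * cis (- Im s * ln (real n))"
    by (simp only: exp_add exp_of_real cis_conv_exp)
  also have "exp (- Re s * ln (real n)) = (real n powr (- Re s / 2))\<^sup>2"
    using assms by (simp add: powr_def power2_eq_square flip: exp_add)
  finally show ?thesis by (simp add: scaleR_scaleC[where 'a = 'x] scaleC_scaleC)
qed

text \<open>
  For \<open>m > N\<close> the section in \<open>m\<close> variables shares its first \<open>N\<close> terms with the full series. Summation by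
  parts with \<open>v n = n powr (- Re s / 2)\<close> bounds its remaining terms by a multiple of \<open>v N\<close> that does not depend on
  \<open>m\<close>. For \<open>m\<close> tending to infinity the section tends to the value of \<open>F\<close>, and the bound remains.
\<close>

lemma bohr_series_sums:
  fixes F :: "c0 \<Rightarrow> 'x::complex_banach"
  assumes F: "F \<in> Hinf_ball" and s: "Re s > 0"
  shows "(\<lambda>n. of_nat n powr (- s) *\<^sub>C bohr_transform F n) sums F (prime_point s)"
proof -
  obtain M where M: "\<And>z. norm z < 1 \<Longrightarrow> norm (F z) \<le> M" using Hinf_ball_bounded[OF F] by blast
  have M0: "M \<ge> 0" using order_trans[OF norm_ge_zero M[of 0]] by simp
  define a where "a = bohr_transform F"
  define c where "c = monomial_coeff F"
  note exp = Hinf_ball_expansion[OF F M, folded c_def]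
  define v where "v n = real n powr (- Re s / 2)" for n
  define D where "D = (9 / 2 + 4 / Re s) * M"
  define x where "x j = of_nat (nth_prime j) powr (- s)" for j
  define \<omega> where "\<omega> j = cis (- Im s * ln (real (nth_prime j)))" for j
  note r = prime_radius_tendsto[OF s] prime_radius_pos prime_radius_le[OF s] two_powr_less_one[OF s]
  have x_exp: "x j = exp (- s * of_real (ln (real (nth_prime j))))" for j
    unfolding x_def by (rule of_nat_powr_exp_ln) (use nth_prime_ge_2[of j] in simp)
  have x_polar: "of_real (prime_radius (Re s) j) * \<omega> j = x j" for j
  proof -
    have e: "- s * of_real (ln (real (nth_prime j))) = of_real (- Re s * ln (real (nth_prime j))) + \<i> * of_real (- Im s * ln (real (nth_prime j)))"
      by (simp add: complex_eq_iff)
    show ?thesis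
      unfolding x_exp e \<omega>_def prime_radius_exp by (simp only: exp_add exp_of_real cis_conv_exp)
  qed
  have x1: "cmod (x j) < 1" for j
    using prime_radius_pos[of "Re s" j] r(3)[of j] r(4) by (simp add: \<omega>_def norm_mult flip: x_polar)
  have lim_sections: "(\<lambda>m. section_at F m x) \<longlonglongrightarrow> F (prime_point s)"
  proof -
    have \<omega>1: "cmod (\<omega> j) \<le> 1" for j by (simp add: \<omega>_def)
    have "prime_point s = Abs_c0 x" by (simp add: prime_point_def x_def[abs_def])
    then show ?thesis
      using sections_tendsto_torus_lift[of "prime_radius (Re s)" _ F \<omega>, OF r F \<omega>1] by (simp only: torus_lift_def x_polar)
  qed
  have pv: "v n > 0" if "n \<ge> N" "N > 0" for n N using that by (simp add: v_def)
  have dv: "v (Suc n) \<le> v n" if "n \<ge> N" "N > 0" for n N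
    unfolding v_def using that s by (intro powr_mono2') auto
  have tail: "norm (section_at F m x - (\<Sum>n\<le>N. of_nat n powr (- s) *\<^sub>C a n)) \<le> 3 * D * v N"
    if N: "N > 0" and m: "m > N" for m N
  proof -
    define b where "b = smooth_part m a"
    have b0: "b 0 = 0" using prime_power_pos by (auto simp: b_def smooth_part_def a_def bohr_transform_def)
    define u where "u n = cis (- Im s * ln (real n)) *\<^sub>C b n" for n
    have term_eq: "of_nat n powr (- s) *\<^sub>C b n = (v n)\<^sup>2 *\<^sub>R u n" for n
    proof (cases "n = 0")
      case False
      then show ?thesis using of_nat_powr_scaleC[of n s "b n"] by (simp add: v_def u_def)
    qed (simp add: b0 u_def)
    have "((\<lambda>\<alpha>. multi_power x \<alpha> *\<^sub>C c \<alpha>) has_sum section_at F m x) (multi_indices m)"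
      using exp(1) x1 unfolding is_monomial_expansion_def by blast
    moreover have "multi_power x \<alpha> *\<^sub>C c \<alpha> = of_nat (prime_power \<alpha>) powr (- s) *\<^sub>C a (prime_power \<alpha>)" for \<alpha>
    proof -
      have "multi_power x \<alpha> = of_nat (prime_power \<alpha>) powr (- s)"
        unfolding x_exp[abs_def] multi_power_exp_ln using of_nat_powr_exp_ln[OF prime_power_pos, of \<alpha> "- s"] by simp
      then show ?thesis by (simp add: a_def c_def bohr_transform_prime_power)
    qed
    ultimately have "((\<lambda>n. of_nat n powr (- s) *\<^sub>C a n) has_sum section_at F m x) (prime_power ` multi_indices m)"
      by (subst has_sum_reindex) (auto simp: o_def intro: inj_on_subset[OF inj_prime_power])
    then have "((\<lambda>n. of_nat n powr (- s) *\<^sub>C b n) has_sum section_at F m x) UNIV"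
      by (rule has_sum_cong_neutral[THEN iffD1, rotated -1]) (auto simp: b_def smooth_part_def)
    then have sums: "(\<lambda>n. (v n)\<^sup>2 *\<^sub>R u n) sums section_at F m x" unfolding term_eq by (rule has_sum_imp_sums)
    have A: "norm (sum u {..n}) * v n \<le> D" if "n \<ge> N" for n
    proof -
      have n0: "n > 0" using that N by simp
      have "norm (sum u {..n}) \<le> cutoff_constant (ln (real n)) (ln (real (n + 1))) * M"
        unfolding u_def b_def a_def by (rule smooth_partial_sum_bound[OF F M n0])
      also have "\<dots> \<le> ((9 / 2 + 4 / Re s) * real n powr (Re s / 2)) * M"
        using cutoff_constant_le[OF n0 s] M0 by (rule mult_right_mono)
      finally have "norm (sum u {..n}) * v n \<le> (((9 / 2 + 4 / Re s) * real n powr (Re s / 2)) * M) * v n"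
        using n0 by (intro mult_right_mono) (auto simp: v_def)
      also have "\<dots> = D * (real n powr (Re s / 2) * v n)" by (simp add: D_def)
      also have "real n powr (Re s / 2) * v n = 1" using n0 by (simp add: v_def flip: powr_add)
      finally show ?thesis by simp
    qed
    have "(\<lambda>N'. \<Sum>n\<le>N'. (v n)\<^sup>2 *\<^sub>R u n) \<longlonglongrightarrow> section_at F m x"
      using sums by (simp add: sums_def_le)
    then have "(\<lambda>N'. norm ((\<Sum>n\<le>N'. (v n)\<^sup>2 *\<^sub>R u n) - (\<Sum>n\<le>N. (v n)\<^sup>2 *\<^sub>R u n))) \<longlonglongrightarrow>
        norm (section_at F m x - (\<Sum>n\<le>N. (v n)\<^sup>2 *\<^sub>R u n))"
      by (intro tendsto_intros)
    then have "norm (section_at F m x - (\<Sum>n\<le>N. (v n)\<^sup>2 *\<^sub>R u n)) \<le> 3 * D * v N"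
    proof (rule LIMSEQ_le_const2, intro exI[of _ N] allI impI)
      fix N' assume N': "N \<le> N'"
      have e: "{..N'} = {..N} \<union> {N<..N'}" using N' by auto
      have "(\<Sum>n\<le>N'. (v n)\<^sup>2 *\<^sub>R u n) = (\<Sum>n\<le>N. (v n)\<^sup>2 *\<^sub>R u n) + (\<Sum>n\<in>{N<..N'}. (v n)\<^sup>2 *\<^sub>R u n)"
        unfolding e by (rule sum.union_disjoint) auto
      moreover have "norm (\<Sum>n\<in>{N<..N'}. (v n)\<^sup>2 *\<^sub>R u n) \<le> 3 * D * v N"
        by (rule abel_summation_tail[OF _ _ A N']) (use pv dv N in auto)
      ultimately show "norm ((\<Sum>n\<le>N'. (v n)\<^sup>2 *\<^sub>R u n) - (\<Sum>n\<le>N. (v n)\<^sup>2 *\<^sub>R u n)) \<le> 3 * D * v N" by simp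
    qed
    moreover have "(\<Sum>n\<le>N. (v n)\<^sup>2 *\<^sub>R u n) = (\<Sum>n\<le>N. of_nat n powr (- s) *\<^sub>C a n)"
    proof (intro sum.cong refl)
      fix n assume n: "n \<in> {..N}"
      have "b n = a n"
      proof (cases "n = 0")
        case False
        then obtain \<alpha> where \<alpha>: "prime_power \<alpha> = n" using ex_prime_power[of n] by auto
        then have "\<alpha> \<in> multi_indices m" using n m by (intro prime_power_index_bound) auto
        then show ?thesis using \<alpha> by (auto simp: b_def smooth_part_def)
      qed (simp add: b0 a_def bohr_transform_def)
      then show "(v n)\<^sup>2 *\<^sub>R u n = of_nat n powr (- s) *\<^sub>C a n" unfolding term_eq[symmetric] by simp
    qed
    ultimately show ?thesis by simp
  qed
  have limit_bound: "norm (F (prime_point s) - (\<Sum>n\<le>N. of_nat n powr (- s) *\<^sub>C a n)) \<le> 3 * D * v N" if N: "N > 0" for N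
  proof (rule LIMSEQ_le_const2)
    show "(\<lambda>m. norm (section_at F m x - (\<Sum>n\<le>N. of_nat n powr (- s) *\<^sub>C a n)))
        \<longlonglongrightarrow> norm (F (prime_point s) - (\<Sum>n\<le>N. of_nat n powr (- s) *\<^sub>C a n))"
      by (intro tendsto_intros lim_sections)
    show "\<exists>m0. \<forall>m\<ge>m0. norm (section_at F m x - (\<Sum>n\<le>N. of_nat n powr (- s) *\<^sub>C a n)) \<le> 3 * D * v N"
      using tail[OF N] by (intro exI[of _ "Suc N"]) auto
  qed
  have "v \<longlonglongrightarrow> 0"
    unfolding v_def using s by (intro tendsto_neg_powr filterlim_real_sequentially) auto
  then have vlim: "(\<lambda>N. 3 * D * v N) \<longlonglongrightarrow> 0" by (rule tendsto_mult_right_zero)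
  have "(\<lambda>N. (\<Sum>n\<le>N. of_nat n powr (- s) *\<^sub>C a n) - F (prime_point s)) \<longlonglongrightarrow> 0"
  proof (rule Lim_null_comparison[OF _ vlim])
    show "\<forall>\<^sub>F N in sequentially. norm ((\<Sum>n\<le>N. of_nat n powr (- s) *\<^sub>C a n) - F (prime_point s)) \<le> 3 * D * v N"
      using limit_bound by (intro eventually_sequentiallyI[of 1]) (simp add: norm_minus_commute)
  qed
  then show ?thesis unfolding sums_def_le a_def by (rule LIM_zero_cancel)
qed

section \<open>The Bohr correspondence\<close>

theorem theorem6p2:
  shows "(\<forall>F \<in> (Hinf_ball :: (c0 \<Rightarrow> 'x::complex_banach) set). \<forall>G \<in> (Hinf_ball :: (c0 \<Rightarrow> 'x) set). \<forall>c.
      bohr_transform (\<lambda>z. F z + c *\<^sub>C G z) = (\<lambda>n. bohr_transform F n + c *\<^sub>C bohr_transform G n))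
    \<and> bohr_transform ` (Hinf_ball :: (c0 \<Rightarrow> 'x) set) = Hinf_plus
    \<and> (\<forall>F \<in> (Hinf_ball :: (c0 \<Rightarrow> 'x) set). norm_Hinf_plus (bohr_transform F) = norm_Hinf_ball F)
    \<and> (\<forall>F \<in> (Hinf_ball :: (c0 \<Rightarrow> 'x) set). \<forall>s. Re s > 0 \<longrightarrow>
        (\<lambda>n. of_nat n powr (- s) *\<^sub>C bohr_transform F n) sums F (prime_point s))"
proof (intro conjI ballI allI impI)
  show "bohr_transform ` (Hinf_ball :: (c0 \<Rightarrow> 'x) set) = Hinf_plus"
  proof
    show "bohr_transform ` (Hinf_ball :: (c0 \<Rightarrow> 'x) set) \<subseteq> Hinf_plus"
      using bohr_transform_Hinf_plus(1) by blast
    show "Hinf_plus \<subseteq> bohr_transform ` (Hinf_ball :: (c0 \<Rightarrow> 'x) set)"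
      using bohr_transform_surj by (metis image_eqI subsetI)
  qed
qed (simp_all add: bohr_transform_linear bohr_transform_isometric bohr_series_sums)

end
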